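(* The space $\mathcal S(\widehat\Gamma)$ is an equivalence bimodule between $\mathcal A^\circ$ and $\mathbb C$ with respect to the actions $$K\cdot\xi'=\int_G k(\gamma,t)\,\pi^\circ\iota(\gamma,t)\xi'\,d\mu_G,\qquad \xi'\cdot\lambda=\lambda\,\xi'$$ for $\xi'\in\mathcal S(\widehat\Gamma)$, $k\in\mathcal S(G)$, $K=\pi^\circ\iota(k)\in\mathcal A^\circ$, $\lambda\in\mathbb C$, and the $\mathcal A^\circ$-valued and $\mathbb C$-valued hermitian products $${}_{\mathcal A^\circ}\langle\xi',\eta'\rangle=\int_G V^\circ_{\eta'}\xi'(g)\,\pi^\circ\iota(g)\,d\mu_G,\qquad \langle\xi',\eta'\rangle_{\mathbb C}=\langle\eta',\xi'\rangle_{L^2(\widehat\Gamma)} .$$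
   Context: All abelian groups are written additively. $\Gamma$ is a second countable locally compact abelian group, elementary in the sense of Bruhat, so that the Schwartz(–Bruhat) spaces $\mathcal S(\Gamma),\mathcal S(\widehat\Gamma),\mathcal S(G)$ are defined; $\widehat\Gamma$ is its Pontryagin dual, with Haar measure chosen so that Plancherel's theorem holds for $\mathcal F(f)(\gamma)=\int_\Gamma f(s)\overline{\gamma(s)}\,ds$; $G=\widehat\Gamma\times\Gamma$ with product Haar measure $\mu_G$. Scalar products $\langle\cdot,\cdot\rangle$ on $L^2$ spaces are linear in the first variable. Let $\sigma((\gamma_1,t_1),(\gamma_2,t_2))=\overline{\gamma_2(t_1)}$. On $L^2(\widehat\Gamma)$ let $T_\gamma\xi(\delta)=\xi(\delta-\gamma)$, $M_t\xi(\delta)=\delta(t)\xi(\delta)$ and $\pi^\circ\iota(\gamma,t)=T_\gamma M_{-t}$ (a $\sigma$-projective unitary representation of $G$ on $L^2(\widehat\Gamma)$). Put $V^\circ_{\eta'}\xi'(g)=\langle\xi',\pi^\circ\iota(g)\eta'\rangle$, which lies in $\mathcal S(G)$ for $\xi',\eta'\in\mathcal S(\widehat\Gamma)$. For $a\in\mathcal S(G)$, $\pi^\circ\iota(a)=\int_G a(g)\,\pi^\circ\iota(g)\,d\mu_G$, and $\mathcal A^\circ=\{\pi^\circ\iota(a):a\in\mathcal S(G)\}\subset B(L^2(\widehat\Gamma))$, a $*$-algebra with the operator norm. For pre-$C^*$-algebras $A$ and $B$, a (pre-)equivalence bimodule between $A$ and $B$ is an $A$-$B$-bimodule $E$ with an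 $A$-valued hermitian product ${}_A\langle\cdot,\cdot\rangle$ ($A$-linear in the first variable, ${}_A\langle\xi,\eta\rangle^*={}_A\langle\eta,\xi\rangle$, positive definite) and a $B$-valued hermitian product $\langle\cdot,\cdot\rangle_B$ ($B$-linear in the second variable, $\langle\xi,\eta\rangle_B^*=\langle\eta,\xi\rangle_B$, positive definite), such that the linear spans of the values of each product are dense in $A$ and $B$ respectively, ${}_A\langle\xi,\eta\rangle\cdot\zeta=\xi\cdot\langle\eta,\zeta\rangle_B$ for all $\xi,\eta,\zeta\in E$, and the actions are bounded: $\langle a\xi,a\xi\rangle_B\le\|a\|^2\langle\xi,\xi\rangle_B$ and ${}_A\langle\xi b,\xi b\rangle\le\|b\|^2{}_A\langle\xi,\xi\rangle$. *)

theory Defs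
  imports "HOL-Analysis.Analysis" "HOL-Algebra.Module"
begin

section \<open>Pontryagin dual\<close>

typedef (overloaded) ('g :: topological_ab_group_add) pontryagin_dual =
  "{\<phi> :: 'g \<Rightarrow> complex. continuous_on UNIV \<phi> \<and> (\<forall>x. norm (\<phi> x) = 1) \<and>
     (\<forall>x y. \<phi> (x + y) = \<phi> x * \<phi> y)}"
  morphisms char_fun Abs_char
  by (rule exI[of _ "\<lambda>_. 1"]) auto

text \<open>The dual is written additively although it is multiplied pointwise.\<close>

instantiation pontryagin_dual :: (topological_ab_group_add) ab_group_add
begin

definition "0 = Abs_char (\<lambda>_. 1)"
definition "\<gamma> + \<delta> = Abs_char (\<lambda>x. char_fun \<gamma> x * char_fun \<delta> x)"
definition "- \<gamma> = Abs_char (\<lambda>x. cnj (char_fun \<gamma> x))"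
definition "\<gamma> - \<delta> = \<gamma> + - (\<delta> :: 'a pontryagin_dual)"

lemma char_fun_zero: "char_fun (0 :: 'a pontryagin_dual) x = 1"
  unfolding zero_pontryagin_dual_def by (subst Abs_char_inverse) auto

lemma char_fun_add: "char_fun (\<gamma> + \<delta> :: 'a pontryagin_dual) x = char_fun \<gamma> x * char_fun \<delta> x"
  unfolding plus_pontryagin_dual_def using char_fun[of \<gamma>] char_fun[of \<delta>]
  by (subst Abs_char_inverse) (auto intro!: continuous_intros simp: norm_mult)

lemma char_fun_uminus: "char_fun (- \<gamma> :: 'a pontryagin_dual) x = cnj (char_fun \<gamma> x)"
  unfolding uminus_pontryagin_dual_def using char_fun[of \<gamma>]
  by (subst Abs_char_inverse) (auto intro!: continuous_intros)

instance
proof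
  fix a b c :: "'a pontryagin_dual"
  show "a + b + c = a + (b + c)" "a + b = b + a" "0 + a = a"
    by (simp_all add: char_fun_inject[symmetric] fun_eq_iff char_fun_add char_fun_zero mult_ac)
  have "norm (char_fun a x) = 1" for x using char_fun[of a] by auto
  hence "cnj (char_fun a x) * char_fun a x = 1" for x
    by (metis complex_norm_square mult.commute of_real_1 one_power2)
  thus "- a + a = 0"
    by (simp add: char_fun_inject[symmetric] fun_eq_iff char_fun_add char_fun_zero char_fun_uminus)
  show "a - b = a + - b" by (rule minus_pontryagin_dual_def)
qed

end

text \<open>Compact-open topology.\<close>

instantiation pontryagin_dual :: (topological_ab_group_add) topological_space
begin

definition open_pontryagin_dual :: "'a pontryagin_dual set \<Rightarrow> bool" where
  "open_pontryagin_dual =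
     generate_topology {{\<gamma>. char_fun \<gamma> ` K \<subseteq> U} | K U. compact K \<and> open U}"

instance
proof
  show "open (UNIV :: 'a pontryagin_dual set)"
    unfolding open_pontryagin_dual_def by (rule generate_topology.UNIV)
  show "open (S \<inter> T)" if "open S" "open T" for S T :: "'a pontryagin_dual set"
    using that unfolding open_pontryagin_dual_def by (rule generate_topology.Int)
  show "open (\<Union>\<K>)" if "\<forall>S\<in>\<K>. open S" for \<K> :: "'a pontryagin_dual set set"
    using that unfolding open_pontryagin_dual_def by (intro generate_topology.UN) auto
qed

end


section \<open>Elementary groups\<close>

definition real_grp :: "nat \<Rightarrow> (nat \<Rightarrow> real) monoid" where
  "real_grp p = \<lparr>carrier = {x. \<forall>i\<ge>p. x i = 0}, mult = (\<lambda>x y i. x i + y i), one = (\<lambda>_. 0)\<rparr>"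

definition torus_grp :: "nat \<Rightarrow> (nat \<Rightarrow> complex) monoid" where
  "torus_grp q = \<lparr>carrier = {z. (\<forall>i<q. norm (z i) = 1) \<and> (\<forall>i\<ge>q. z i = 1)},
     mult = (\<lambda>x y i. x i * y i), one = (\<lambda>_. 1)\<rparr>"

definition int_grp :: "nat \<Rightarrow> (nat \<Rightarrow> int) monoid" where
  "int_grp r = \<lparr>carrier = {x. \<forall>i\<ge>r. x i = 0}, mult = (\<lambda>x y i. x i + y i), one = (\<lambda>_. 0)\<rparr>"

text \<open>
  Elementary in the sense of Bruhat: isomorphic, as a topological group, to
  \<open>\<real>\<^sup>p \<times> T\<^sup>q \<times> \<int>\<^sup>r \<times> F\<close> with \<open>T\<close> the circle and \<open>F\<close> a finite abelian group.  Every finite group has a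
  copy carried by natural numbers, and the topology of \<^typ>\<open>nat\<close> is discrete.
\<close>

definition elementary :: "'g :: {topological_space, ab_group_add} itself \<Rightarrow> bool" where
  "elementary _ \<longleftrightarrow>
     (\<exists>p q r (F :: nat monoid) \<Phi> \<Psi>.
        comm_group F \<and> finite (carrier F) \<and>
        (let M = real_grp p \<times>\<times> torus_grp q \<times>\<times> int_grp r \<times>\<times> F in
           homeomorphism (UNIV :: 'g set) (carrier M) \<Phi> \<Psi> \<and>
           (\<forall>x y. \<Phi> (x + y) = \<Phi> x \<otimes>\<^bsub>M\<^esub> \<Phi> y)))"


section \<open>Schwartz-Bruhat functions on an elementary group\<close>

text \<open>
  Coordinate-free form of the usual definition on \<open>\<real>\<^sup>p \<times> T\<^sup>q \<times> \<int>\<^sup>r \<times> F\<close>: all functions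
  \<open>P \<cdot> D f\<close>, with \<open>P\<close> a polynomial and \<open>D\<close> a translation-invariant differential operator,
  are bounded.  The invariant vector fields on an abelian Lie group are the derivatives along
  its one-parameter subgroups (here: the lines in the \<open>\<real>\<^sup>p \<times> T\<^sup>q\<close> directions), and the
  polynomials on the group are generated by the constants and the continuous homomorphisms
  into \<open>\<real>\<close> (here: the linear forms on \<open>\<real>\<^sup>p \<times> \<int>\<^sup>r\<close>).
\<close>

definition one_param :: "(real \<Rightarrow> 'h :: {topological_space, ab_group_add}) \<Rightarrow> bool" where
  "one_param X \<longleftrightarrow> continuous_on UNIV X \<and> (\<forall>s t. X (s + t) = X s + X t)"

definition real_hom :: "('h :: {topological_space, ab_group_add} \<Rightarrow> real) \<Rightarrow> bool" where
  "real_hom p \<longleftrightarrow> continuous_on UNIV p \<and> (\<forall>x y. p (x + y) = p x + p y)"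

definition dir_deriv ::
  "(real \<Rightarrow> 'h :: {topological_space, ab_group_add}) \<Rightarrow> ('h \<Rightarrow> complex) \<Rightarrow> 'h \<Rightarrow> complex" where
  "dir_deriv X f x = vector_derivative (\<lambda>t. f (x + X t)) (at 0)"

definition iter_deriv ::
  "(real \<Rightarrow> 'h :: {topological_space, ab_group_add}) list \<Rightarrow> ('h \<Rightarrow> complex) \<Rightarrow> 'h \<Rightarrow> complex" where
  "iter_deriv Xs f = foldr dir_deriv Xs f"

definition smooth_fun :: "('h :: {topological_space, ab_group_add} \<Rightarrow> complex) \<Rightarrow> bool" where
  "smooth_fun f \<longleftrightarrow>
     (\<forall>Xs. list_all one_param Xs \<longrightarrow>
        continuous_on UNIV (iter_deriv Xs f) \<and>
        (\<forall>X x. one_param X \<longrightarrow> (\<lambda>t. iter_deriv Xs f (x + X t)) differentiable (at 0)))"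

definition schwartz_space :: "('h :: {topological_space, ab_group_add} \<Rightarrow> complex) set" where
  "schwartz_space = {f. smooth_fun f \<and>
     (\<forall>Xs ps. list_all one_param Xs \<longrightarrow> list_all real_hom ps \<longrightarrow>
        bounded (range (\<lambda>x. of_real (\<Prod>p\<leftarrow>ps. p x) * iter_deriv Xs f x)))}"


section \<open>Haar measures and Plancherel's theorem\<close>

text \<open>Regularity is automatic on second countable locally compact groups.\<close>

definition haar_measure :: "'h :: {topological_space, ab_group_add} measure \<Rightarrow> bool" where
  "haar_measure \<mu> \<longleftrightarrow> sets \<mu> = sets borel \<and>
     (\<forall>A\<in>sets borel. \<forall>x. emeasure \<mu> ((\<lambda>y. x + y) ` A) = emeasure \<mu> A) \<and>
     (\<forall>K. compact K \<longrightarrow> emeasure \<mu> K < \<infinity>) \<and>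
     (\<forall>U. open U \<longrightarrow> U \<noteq> {} \<longrightarrow> emeasure \<mu> U > 0)"

definition sq_integrable :: "'x measure \<Rightarrow> ('x \<Rightarrow> complex) set" where
  "sq_integrable M = {f \<in> borel_measurable M. integrable M (\<lambda>x. (norm (f x))\<^sup>2)}"

definition fourier ::
  "'g :: topological_ab_group_add measure \<Rightarrow> ('g \<Rightarrow> complex) \<Rightarrow> 'g pontryagin_dual \<Rightarrow> complex" where
  "fourier \<mu> f \<gamma> = (\<integral>s. f s * cnj (char_fun \<gamma> s) \<partial>\<mu>)"

definition plancherel ::
  "'g :: topological_ab_group_add measure \<Rightarrow> 'g pontryagin_dual measure \<Rightarrow> bool" where
  "plancherel \<mu> \<nu> \<longleftrightarrow>
     (\<forall>f. integrable \<mu> f \<longrightarrow> f \<in> sq_integrable \<mu> \<longrightarrow>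
        fourier \<mu> f \<in> sq_integrable \<nu> \<and>
        (\<integral>\<gamma>. (norm (fourier \<mu> f \<gamma>))\<^sup>2 \<partial>\<nu>) = (\<integral>s. (norm (f s))\<^sup>2 \<partial>\<mu>))"


section \<open>Pre-C*-algebras and equivalence bimodules\<close>

text \<open>
  Complex vector spaces are modules over the following ring; as usual for the record
  \<^type>\<open>module\<close>, the fields \<open>mult\<close> and \<open>one\<close> of a mere vector space carry no meaning.
  Likewise the field \<open>one\<close> carries no meaning for a (possibly non-unital) *-algebra.
\<close>

definition complex_ring :: "complex ring" where
  "complex_ring = \<lparr>carrier = UNIV, mult = (*), one = 1, zero = 0, add = (+)\<rparr>"

record 'a star_algebra = "(complex, 'a) module" +
  star :: "'a \<Rightarrow> 'a"
  nrm :: "'a \<Rightarrow> real"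

locale pre_cstar_algebra =
  fixes A :: "('a, 'm) star_algebra_scheme" (structure)
  assumes vector_space: "Module.module complex_ring A"
    and mult_closed: "\<lbrakk>a \<in> carrier A; b \<in> carrier A\<rbrakk> \<Longrightarrow> a \<otimes> b \<in> carrier A"
    and mult_assoc: "\<lbrakk>a \<in> carrier A; b \<in> carrier A; c \<in> carrier A\<rbrakk> \<Longrightarrow> (a \<otimes> b) \<otimes> c = a \<otimes> (b \<otimes> c)"
    and distr_left: "\<lbrakk>a \<in> carrier A; b \<in> carrier A; c \<in> carrier A\<rbrakk> \<Longrightarrow> (a \<oplus> b) \<otimes> c = a \<otimes> c \<oplus> b \<otimes> c"
    and distr_right: "\<lbrakk>a \<in> carrier A; b \<in> carrier A; c \<in> carrier A\<rbrakk> \<Longrightarrow> a \<otimes> (b \<oplus> c) = a \<otimes> b \<oplus> a \<otimes> c"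
    and smult_mult_left: "\<lbrakk>a \<in> carrier A; b \<in> carrier A\<rbrakk> \<Longrightarrow> (z \<odot> a) \<otimes> b = z \<odot> (a \<otimes> b)"
    and smult_mult_right: "\<lbrakk>a \<in> carrier A; b \<in> carrier A\<rbrakk> \<Longrightarrow> a \<otimes> (z \<odot> b) = z \<odot> (a \<otimes> b)"
    and star_closed: "a \<in> carrier A \<Longrightarrow> star A a \<in> carrier A"
    and star_star: "a \<in> carrier A \<Longrightarrow> star A (star A a) = a"
    and star_add: "\<lbrakk>a \<in> carrier A; b \<in> carrier A\<rbrakk> \<Longrightarrow> star A (a \<oplus> b) = star A a \<oplus> star A b"
    and star_smult: "a \<in> carrier A \<Longrightarrow> star A (z \<odot> a) = cnj z \<odot> star A a"
    and star_mult: "\<lbrakk>a \<in> carrier A; b \<in> carrier A\<rbrakk> \<Longrightarrow> star A (a \<otimes> b) = star A b \<otimes> star A a"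
    and nrm_definite: "a \<in> carrier A \<Longrightarrow> nrm A a = 0 \<longleftrightarrow> a = \<zero>"
    and nrm_triangle: "\<lbrakk>a \<in> carrier A; b \<in> carrier A\<rbrakk> \<Longrightarrow> nrm A (a \<oplus> b) \<le> nrm A a + nrm A b"
    and nrm_smult: "a \<in> carrier A \<Longrightarrow> nrm A (z \<odot> a) = norm z * nrm A a"
    and nrm_mult: "\<lbrakk>a \<in> carrier A; b \<in> carrier A\<rbrakk> \<Longrightarrow> nrm A (a \<otimes> b) \<le> nrm A a * nrm A b"
    and cstar_identity: "a \<in> carrier A \<Longrightarrow> nrm A (star A a \<otimes> a) = (nrm A a)\<^sup>2"

text \<open>
  Positivity refers to the C*-completion.  The positive elements of a C*-algebra are the
  \<open>c\<^sup>* c\<close>; as \<open>A\<close> is dense in its completion and the positive cone is closed, \<open>a\<close> is positive in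
  the completion iff it is a norm limit of elements \<open>b\<^sup>* b\<close> with \<open>b\<close> in \<open>A\<close>.
\<close>

definition pos_elem :: "('a, 'm) star_algebra_scheme \<Rightarrow> 'a \<Rightarrow> bool" where
  "pos_elem A a \<longleftrightarrow> a \<in> carrier A \<and>
     (\<forall>\<epsilon>>0. \<exists>b\<in>carrier A. nrm A (a \<ominus>\<^bsub>A\<^esub> (star A b \<otimes>\<^bsub>A\<^esub> b)) < \<epsilon>)"

definition cstar_le :: "('a, 'm) star_algebra_scheme \<Rightarrow> 'a \<Rightarrow> 'a \<Rightarrow> bool" where
  "cstar_le A a b \<longleftrightarrow> pos_elem A (b \<ominus>\<^bsub>A\<^esub> a)"

definition lin_span :: "('a, 'm) star_algebra_scheme \<Rightarrow> 'a set \<Rightarrow> 'a set" where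
  "lin_span A S = \<Inter>{N. submodule N complex_ring A \<and> S \<subseteq> N}"

definition norm_dense :: "('a, 'm) star_algebra_scheme \<Rightarrow> 'a set \<Rightarrow> bool" where
  "norm_dense A S \<longleftrightarrow> (\<forall>a\<in>carrier A. \<forall>\<epsilon>>0. \<exists>s\<in>S. nrm A (a \<ominus>\<^bsub>A\<^esub> s) < \<epsilon>)"

locale equivalence_bimodule = A: pre_cstar_algebra A + B: pre_cstar_algebra B
  for A :: "('a, 'm) star_algebra_scheme" and B :: "('b, 'n) star_algebra_scheme" +
  fixes E :: "(complex, 'e, 'k) module_scheme"
    and lact :: "'a \<Rightarrow> 'e \<Rightarrow> 'e" and ract :: "'e \<Rightarrow> 'b \<Rightarrow> 'e"
    and lprod :: "'e \<Rightarrow> 'e \<Rightarrow> 'a" and rprod :: "'e \<Rightarrow> 'e \<Rightarrow> 'b"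
  assumes E_vector_space: "Module.module complex_ring E"
    \<comment> \<open>bimodule\<close>
    and lact_closed: "\<lbrakk>a \<in> carrier A; \<xi> \<in> carrier E\<rbrakk> \<Longrightarrow> lact a \<xi> \<in> carrier E"
    and lact_add_left: "\<lbrakk>a \<in> carrier A; a' \<in> carrier A; \<xi> \<in> carrier E\<rbrakk> \<Longrightarrow>
          lact (a \<oplus>\<^bsub>A\<^esub> a') \<xi> = lact a \<xi> \<oplus>\<^bsub>E\<^esub> lact a' \<xi>"
    and lact_add_right: "\<lbrakk>a \<in> carrier A; \<xi> \<in> carrier E; \<eta> \<in> carrier E\<rbrakk> \<Longrightarrow>
          lact a (\<xi> \<oplus>\<^bsub>E\<^esub> \<eta>) = lact a \<xi> \<oplus>\<^bsub>E\<^esub> lact a \<eta>"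
    and lact_smult_left: "\<lbrakk>a \<in> carrier A; \<xi> \<in> carrier E\<rbrakk> \<Longrightarrow>
          lact (z \<odot>\<^bsub>A\<^esub> a) \<xi> = z \<odot>\<^bsub>E\<^esub> lact a \<xi>"
    and lact_smult_right: "\<lbrakk>a \<in> carrier A; \<xi> \<in> carrier E\<rbrakk> \<Longrightarrow>
          lact a (z \<odot>\<^bsub>E\<^esub> \<xi>) = z \<odot>\<^bsub>E\<^esub> lact a \<xi>"
    and lact_mult: "\<lbrakk>a \<in> carrier A; a' \<in> carrier A; \<xi> \<in> carrier E\<rbrakk> \<Longrightarrow>
          lact (a \<otimes>\<^bsub>A\<^esub> a') \<xi> = lact a (lact a' \<xi>)"
    and ract_closed: "\<lbrakk>\<xi> \<in> carrier E; b \<in> carrier B\<rbrakk> \<Longrightarrow> ract \<xi> b \<in> carrier E"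
    and ract_add_left: "\<lbrakk>\<xi> \<in> carrier E; \<eta> \<in> carrier E; b \<in> carrier B\<rbrakk> \<Longrightarrow>
          ract (\<xi> \<oplus>\<^bsub>E\<^esub> \<eta>) b = ract \<xi> b \<oplus>\<^bsub>E\<^esub> ract \<eta> b"
    and ract_add_right: "\<lbrakk>\<xi> \<in> carrier E; b \<in> carrier B; b' \<in> carrier B\<rbrakk> \<Longrightarrow>
          ract \<xi> (b \<oplus>\<^bsub>B\<^esub> b') = ract \<xi> b \<oplus>\<^bsub>E\<^esub> ract \<xi> b'"
    and ract_smult_left: "\<lbrakk>\<xi> \<in> carrier E; b \<in> carrier B\<rbrakk> \<Longrightarrow>
          ract (z \<odot>\<^bsub>E\<^esub> \<xi>) b = z \<odot>\<^bsub>E\<^esub> ract \<xi> b"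
    and ract_smult_right: "\<lbrakk>\<xi> \<in> carrier E; b \<in> carrier B\<rbrakk> \<Longrightarrow>
          ract \<xi> (z \<odot>\<^bsub>B\<^esub> b) = z \<odot>\<^bsub>E\<^esub> ract \<xi> b"
    and ract_mult: "\<lbrakk>\<xi> \<in> carrier E; b \<in> carrier B; b' \<in> carrier B\<rbrakk> \<Longrightarrow>
          ract \<xi> (b \<otimes>\<^bsub>B\<^esub> b') = ract (ract \<xi> b) b'"
    and lact_ract: "\<lbrakk>a \<in> carrier A; \<xi> \<in> carrier E; b \<in> carrier B\<rbrakk> \<Longrightarrow>
          ract (lact a \<xi>) b = lact a (ract \<xi> b)"
    \<comment> \<open>\<open>A\<close>-valued hermitian product\<close>
    and lprod_closed: "\<lbrakk>\<xi> \<in> carrier E; \<eta> \<in> carrier E\<rbrakk> \<Longrightarrow> lprod \<xi> \<eta> \<in> carrier A"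
    and lprod_add: "\<lbrakk>\<xi> \<in> carrier E; \<xi>' \<in> carrier E; \<eta> \<in> carrier E\<rbrakk> \<Longrightarrow>
          lprod (\<xi> \<oplus>\<^bsub>E\<^esub> \<xi>') \<eta> = lprod \<xi> \<eta> \<oplus>\<^bsub>A\<^esub> lprod \<xi>' \<eta>"
    and lprod_smult: "\<lbrakk>\<xi> \<in> carrier E; \<eta> \<in> carrier E\<rbrakk> \<Longrightarrow>
          lprod (z \<odot>\<^bsub>E\<^esub> \<xi>) \<eta> = z \<odot>\<^bsub>A\<^esub> lprod \<xi> \<eta>"
    and lprod_lact: "\<lbrakk>a \<in> carrier A; \<xi> \<in> carrier E; \<eta> \<in> carrier E\<rbrakk> \<Longrightarrow>
          lprod (lact a \<xi>) \<eta> = a \<otimes>\<^bsub>A\<^esub> lprod \<xi> \<eta>"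
    and lprod_star: "\<lbrakk>\<xi> \<in> carrier E; \<eta> \<in> carrier E\<rbrakk> \<Longrightarrow> star A (lprod \<xi> \<eta>) = lprod \<eta> \<xi>"
    and lprod_pos: "\<xi> \<in> carrier E \<Longrightarrow> pos_elem A (lprod \<xi> \<xi>)"
    and lprod_definite: "\<lbrakk>\<xi> \<in> carrier E; lprod \<xi> \<xi> = \<zero>\<^bsub>A\<^esub>\<rbrakk> \<Longrightarrow> \<xi> = \<zero>\<^bsub>E\<^esub>"
    \<comment> \<open>\<open>B\<close>-valued hermitian product\<close>
    and rprod_closed: "\<lbrakk>\<xi> \<in> carrier E; \<eta> \<in> carrier E\<rbrakk> \<Longrightarrow> rprod \<xi> \<eta> \<in> carrier B"
    and rprod_add: "\<lbrakk>\<xi> \<in> carrier E; \<eta> \<in> carrier E; \<eta>' \<in> carrier E\<rbrakk> \<Longrightarrow>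
          rprod \<xi> (\<eta> \<oplus>\<^bsub>E\<^esub> \<eta>') = rprod \<xi> \<eta> \<oplus>\<^bsub>B\<^esub> rprod \<xi> \<eta>'"
    and rprod_smult: "\<lbrakk>\<xi> \<in> carrier E; \<eta> \<in> carrier E\<rbrakk> \<Longrightarrow>
          rprod \<xi> (z \<odot>\<^bsub>E\<^esub> \<eta>) = z \<odot>\<^bsub>B\<^esub> rprod \<xi> \<eta>"
    and rprod_ract: "\<lbrakk>\<xi> \<in> carrier E; \<eta> \<in> carrier E; b \<in> carrier B\<rbrakk> \<Longrightarrow>
          rprod \<xi> (ract \<eta> b) = rprod \<xi> \<eta> \<otimes>\<^bsub>B\<^esub> b"
    and rprod_star: "\<lbrakk>\<xi> \<in> carrier E; \<eta> \<in> carrier E\<rbrakk> \<Longrightarrow> star B (rprod \<xi> \<eta>) = rprod \<eta> \<xi>"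
    and rprod_pos: "\<xi> \<in> carrier E \<Longrightarrow> pos_elem B (rprod \<xi> \<xi>)"
    and rprod_definite: "\<lbrakk>\<xi> \<in> carrier E; rprod \<xi> \<xi> = \<zero>\<^bsub>B\<^esub>\<rbrakk> \<Longrightarrow> \<xi> = \<zero>\<^bsub>E\<^esub>"
    \<comment> \<open>fullness, compatibility of the products, boundedness of the actions\<close>
    and lprod_full: "norm_dense A (lin_span A {lprod \<xi> \<eta> | \<xi> \<eta>. \<xi> \<in> carrier E \<and> \<eta> \<in> carrier E})"
    and rprod_full: "norm_dense B (lin_span B {rprod \<xi> \<eta> | \<xi> \<eta>. \<xi> \<in> carrier E \<and> \<eta> \<in> carrier E})"
    and compatible: "\<lbrakk>\<xi> \<in> carrier E; \<eta> \<in> carrier E; \<zeta> \<in> carrier E\<rbrakk> \<Longrightarrow>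
          lact (lprod \<xi> \<eta>) \<zeta> = ract \<xi> (rprod \<eta> \<zeta>)"
    and lact_bounded: "\<lbrakk>a \<in> carrier A; \<xi> \<in> carrier E\<rbrakk> \<Longrightarrow>
          cstar_le B (rprod (lact a \<xi>) (lact a \<xi>)) (of_real ((nrm A a)\<^sup>2) \<odot>\<^bsub>B\<^esub> rprod \<xi> \<xi>)"
    and ract_bounded: "\<lbrakk>\<xi> \<in> carrier E; b \<in> carrier B\<rbrakk> \<Longrightarrow>
          cstar_le A (lprod (ract \<xi> b) (ract \<xi> b)) (of_real ((nrm B b)\<^sup>2) \<odot>\<^bsub>A\<^esub> lprod \<xi> \<xi>)"

definition complex_star_algebra :: "complex star_algebra" where
  "complex_star_algebra =
     \<lparr>carrier = UNIV, mult = (*), one = 1, zero = 0, add = (+), smult = (*), star = cnj, nrm = norm\<rparr>"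


section \<open>The Hilbert space $L^2$ and its bounded operators\<close>

record 'v inner_space = "(complex, 'v) module" +
  ip :: "'v \<Rightarrow> 'v \<Rightarrow> complex"

definition ae_eq :: "'x measure \<Rightarrow> (('x \<Rightarrow> complex) \<times> ('x \<Rightarrow> complex)) set" where
  "ae_eq M = {(f, g). f \<in> sq_integrable M \<and> g \<in> sq_integrable M \<and> (AE x in M. f x = g x)}"

definition L2_class :: "'x measure \<Rightarrow> ('x \<Rightarrow> complex) \<Rightarrow> ('x \<Rightarrow> complex) set" where
  "L2_class M f = ae_eq M `` {f}"

definition L2_rep :: "('x \<Rightarrow> complex) set \<Rightarrow> 'x \<Rightarrow> complex" where
  "L2_rep c = (SOME f. f \<in> c)"

definition L2 :: "'x measure \<Rightarrow> ('x \<Rightarrow> complex) set inner_space" where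
  "L2 M = \<lparr>carrier = sq_integrable M // ae_eq M, mult = undefined, one = undefined,
     zero = L2_class M (\<lambda>_. 0),
     add = (\<lambda>c d. L2_class M (\<lambda>x. L2_rep c x + L2_rep d x)),
     smult = (\<lambda>z c. L2_class M (\<lambda>x. z * L2_rep c x)),
     ip = (\<lambda>c d. \<integral>x. L2_rep c x * cnj (L2_rep d x) \<partial>M)\<rparr>"

definition vnorm :: "('v, 'm) inner_space_scheme \<Rightarrow> 'v \<Rightarrow> real" where
  "vnorm H x = sqrt (Re (ip H x x))"

definition bounded_op :: "('v, 'm) inner_space_scheme \<Rightarrow> ('v \<Rightarrow> 'v) \<Rightarrow> bool" where
  "bounded_op H T \<longleftrightarrow> T \<in> carrier H \<rightarrow>\<^sub>E carrier H \<and>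
     (\<forall>x\<in>carrier H. \<forall>y\<in>carrier H. T (x \<oplus>\<^bsub>H\<^esub> y) = T x \<oplus>\<^bsub>H\<^esub> T y) \<and>
     (\<forall>x\<in>carrier H. \<forall>z. T (z \<odot>\<^bsub>H\<^esub> x) = z \<odot>\<^bsub>H\<^esub> T x) \<and>
     (\<exists>C. \<forall>x\<in>carrier H. vnorm H (T x) \<le> C * vnorm H x)"

definition bounded_ops :: "('v, 'm) inner_space_scheme \<Rightarrow> ('v \<Rightarrow> 'v) star_algebra" where
  "bounded_ops H = \<lparr>carrier = {T. bounded_op H T},
     mult = compose (carrier H),
     one = (\<lambda>x\<in>carrier H. x),
     zero = (\<lambda>x\<in>carrier H. \<zero>\<^bsub>H\<^esub>),
     add = (\<lambda>S T. \<lambda>x\<in>carrier H. S x \<oplus>\<^bsub>H\<^esub> T x),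
     smult = (\<lambda>z T. \<lambda>x\<in>carrier H. z \<odot>\<^bsub>H\<^esub> T x),
     star = (\<lambda>T. THE S. bounded_op H S \<and>
               (\<forall>x\<in>carrier H. \<forall>y\<in>carrier H. ip H (T x) y = ip H x (S y))),
     nrm = (\<lambda>T. SUP x\<in>{x \<in> carrier H. vnorm H x \<le> 1}. vnorm H (T x))\<rparr>"

text \<open>Operator-valued integrals are understood in the weak sense.\<close>

definition op_integral ::
  "('v, 'm) inner_space_scheme \<Rightarrow> 'x measure \<Rightarrow> ('x \<Rightarrow> 'v \<Rightarrow> 'v) \<Rightarrow> 'v \<Rightarrow> 'v" where
  "op_integral H M F = (THE T. bounded_op H T \<and>
     (\<forall>x\<in>carrier H. \<forall>y\<in>carrier H. integrable M (\<lambda>g. ip H (F g x) y) \<and>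
        ip H (T x) y = (\<integral>g. ip H (F g x) y \<partial>M)))"


section \<open>The projective representation on $L^2$ of the dual group\<close>

definition translation ::
  "'g :: topological_ab_group_add pontryagin_dual \<Rightarrow> ('g pontryagin_dual \<Rightarrow> complex) \<Rightarrow>
     'g pontryagin_dual \<Rightarrow> complex" where
  "translation \<gamma> \<xi> \<delta> = \<xi> (\<delta> - \<gamma>)"

definition modulation ::
  "'g :: topological_ab_group_add \<Rightarrow> ('g pontryagin_dual \<Rightarrow> complex) \<Rightarrow>
     'g pontryagin_dual \<Rightarrow> complex" where
  "modulation t \<xi> \<delta> = char_fun \<delta> t * \<xi> \<delta>"

definition pi_fun ::
  "'g :: topological_ab_group_add pontryagin_dual \<times> 'g \<Rightarrow> ('g pontryagin_dual \<Rightarrow> complex) \<Rightarrow>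
     'g pontryagin_dual \<Rightarrow> complex" where
  "pi_fun = (\<lambda>(\<gamma>, t) \<xi>. translation \<gamma> (modulation (- t) \<xi>))"

definition pi_op ::
  "'g :: topological_ab_group_add pontryagin_dual measure \<Rightarrow> 'g pontryagin_dual \<times> 'g \<Rightarrow>
     ('g pontryagin_dual \<Rightarrow> complex) set \<Rightarrow> ('g pontryagin_dual \<Rightarrow> complex) set" where
  "pi_op \<nu> g = (\<lambda>c\<in>carrier (L2 \<nu>). L2_class \<nu> (pi_fun g (L2_rep c)))"

definition pi_int ::
  "'g :: topological_ab_group_add measure \<Rightarrow> 'g pontryagin_dual measure \<Rightarrow>
     ('g pontryagin_dual \<times> 'g \<Rightarrow> complex) \<Rightarrow>
     ('g pontryagin_dual \<Rightarrow> complex) set \<Rightarrow> ('g pontryagin_dual \<Rightarrow> complex) set" where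
  "pi_int \<mu> \<nu> a =
     op_integral (L2 \<nu>) (\<nu> \<Otimes>\<^sub>M \<mu>) (\<lambda>g. a g \<odot>\<^bsub>bounded_ops (L2 \<nu>)\<^esub> pi_op \<nu> g)"

text \<open>The operations, adjoint and norm of the following algebra are those of all bounded operators.\<close>

definition A_circ ::
  "'g :: topological_ab_group_add measure \<Rightarrow> 'g pontryagin_dual measure \<Rightarrow>
     (('g pontryagin_dual \<Rightarrow> complex) set \<Rightarrow> ('g pontryagin_dual \<Rightarrow> complex) set) star_algebra" where
  "A_circ \<mu> \<nu> = (bounded_ops (L2 \<nu>))\<lparr>carrier := pi_int \<mu> \<nu> ` schwartz_space\<rparr>"

definition coeff_fun ::
  "'g :: topological_ab_group_add pontryagin_dual measure \<Rightarrow> ('g pontryagin_dual \<Rightarrow> complex) \<Rightarrow>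
     ('g pontryagin_dual \<Rightarrow> complex) \<Rightarrow> 'g pontryagin_dual \<times> 'g \<Rightarrow> complex" where
  "coeff_fun \<nu> \<eta> \<xi> g = ip (L2 \<nu>) (L2_class \<nu> \<xi>) (pi_op \<nu> g (L2_class \<nu> \<eta>))"

definition schwartz_module ::
  "(complex, 'h :: {topological_space, ab_group_add} \<Rightarrow> complex) module" where
  "schwartz_module = \<lparr>carrier = schwartz_space, mult = undefined, one = undefined,
     zero = (\<lambda>_. 0), add = (\<lambda>\<xi> \<eta> \<delta>. \<xi> \<delta> + \<eta> \<delta>), smult = (\<lambda>z \<xi> \<delta>. z * \<xi> \<delta>)\<rparr>"

end

(*
  In the kernel picture an operator of the algebra is an integral operator on the dual group whose
  kernel is a partial Fourier transform of its symbol.  The coefficient functions of Schwartz vectors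
  are themselves Schwartz functions, and Fourier inversion identifies the operators they define with
  the rank-one operators.  Hence the compatibility relation is the associativity of rank-one
  operators, and fullness of the left product amounts to density of finite-rank operators, which
  follows from the density of trigonometric polynomials (Stone-Weierstrass) in a Gaussian-weighted
  L2 space of kernels.  Every element of the algebra is approximated in Hilbert-Schmidt norm.
  The Lie-theoretic input is only that an elementary group and its dual carry finitely many real
  homomorphisms that are proper and control all others.
*)
theory Submission
  imports Defs
begin

text \<open>The Plancherel hypothesis is an isometry on integrable, square-integrable functions; by
  itself it gives neither inversion nor a dense range. Inversion is derived from injectivity in the
  opposite direction: characters separate the points of the dual, so a bounded integrable continuous
  function whose inverse transform vanishes is zero. Membership in the Schwartz space refers to all
  one-parameter subgroups and all real homomorphisms at once. It is established by exhibiting a set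
  of functions that is stable under one derivative and one polynomial factor. Fourier transforms
  exchange these operations, because one-parameter subgroups of a group correspond to real
  homomorphisms of its dual and conversely. No structure theorem is applied to the dual: its proper
  homomorphisms are the frequencies of characters along coordinate subgroups, and its compact sets
  come from equicontinuity. The operator algebra is explicit as well: products and adjoints have
  written-out symbols, and positivity of the left product is attained by an exact square.\<close>

section \<open>The topology of the dual group\<close>

text \<open>These product instances make the phase space, and pairs of points in it, groups of the
  same kind as their factors, so that one theory of Schwartz functions covers all of them.\<close>

instance prod :: (topological_monoid_add, topological_monoid_add) topological_monoid_add
proof
 fix a b :: "'a \<times> 'b"
 have 1: "((\<lambda>x. fst (fst x) + fst (snd x)) \<longlongrightarrow> fst a + fst b) (nhds a \<times>\<^sub>F nhds b)"
  by (intro tendsto_add tendsto_fst filterlim_fst filterlim_snd)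
 have 2: "((\<lambda>x. snd (fst x) + snd (snd x)) \<longlongrightarrow> snd a + snd b) (nhds a \<times>\<^sub>F nhds b)"
  by (intro tendsto_add tendsto_snd filterlim_fst filterlim_snd)
 show "LIM x (nhds a \<times>\<^sub>F nhds b). fst x + snd x :> nhds (a + b)"
  using tendsto_Pair[OF 1 2] by (simp add: plus_prod_def)
qed

instance prod :: (topological_group_add, topological_group_add) topological_group_add
proof
 fix a :: "'a \<times> 'b"
 have "((\<lambda>x. (- fst x, - snd x)) \<longlongrightarrow> (- fst a, - snd a)) (nhds a)"
  by (intro tendsto_Pair tendsto_minus tendsto_fst tendsto_snd filterlim_ident)
 moreover have "uminus = (\<lambda>x :: 'a \<times> 'b. (- fst x, - snd x))" by (simp add: fun_eq_iff prod_eq_iff)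
 moreover have "- a = (- fst a, - snd a)" by (simp add: prod_eq_iff)
 ultimately show "(uminus \<longlongrightarrow> - a) (nhds a)" by simp
qed

instance prod :: (topological_ab_group_add, topological_ab_group_add) topological_ab_group_add ..

lemma continuous_on_UNIV_nhds: "continuous_on UNIV f \<longleftrightarrow> (\<forall>x. (f \<longlongrightarrow> f x) (nhds x))"
 by (simp add: continuous_on_def tendsto_at_iff_tendsto_nhds)

lemma norm_char_fun [simp]: "norm (char_fun \<gamma> x) = 1"
 using char_fun[of \<gamma>] by auto

lemma char_fun_add_arg: "char_fun \<gamma> (x + y) = char_fun \<gamma> x * char_fun \<gamma> y"
 using char_fun[of \<gamma>] by auto

lemma continuous_char_fun: "continuous_on UNIV (char_fun \<gamma>)"
 using char_fun[of \<gamma>] by auto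

lemma char_fun_nonzero [simp]: "char_fun \<gamma> x \<noteq> 0"
 using norm_char_fun[of \<gamma> x] by (metis norm_zero zero_neq_one)

lemma char_fun_cnj_mult [simp]: "cnj (char_fun \<gamma> x) * char_fun \<gamma> x = 1"
 "char_fun \<gamma> x * cnj (char_fun \<gamma> x) = 1"
 by (metis complex_norm_square mult.commute norm_char_fun of_real_1 one_power2)+

lemma char_fun_zero_arg [simp]: "char_fun \<gamma> 0 = 1"
 using char_fun_add_arg[of \<gamma> 0 0] by auto

lemma char_fun_minus_arg: "char_fun \<gamma> (- x) = cnj (char_fun \<gamma> x)"
proof -
 have "char_fun \<gamma> x * char_fun \<gamma> (- x) = char_fun \<gamma> x * cnj (char_fun \<gamma> x)"
  by (simp flip: char_fun_add_arg)
 then show ?thesis using mult_left_cancel[OF char_fun_nonzero] by blast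
qed

lemma char_fun_diff_arg: "char_fun \<gamma> (x - y) = char_fun \<gamma> x * cnj (char_fun \<gamma> y)"
 by (metis char_fun_add_arg char_fun_minus_arg diff_conv_add_uminus)

lemma char_fun_diff: "char_fun (\<gamma> - \<delta>) x = char_fun \<gamma> x * cnj (char_fun \<delta> x)"
 by (metis char_fun_add char_fun_uminus diff_conv_add_uminus)

declare char_fun_zero [simp]

lemma ex_char_fun:
 assumes "continuous_on UNIV \<phi>" "\<And>x. norm (\<phi> x) = 1" "\<And>x y. \<phi> (x + y) = \<phi> x * \<phi> y"
 shows "\<exists>\<gamma>. char_fun \<gamma> = \<phi>"
 using assms by (intro exI[of _ "Abs_char \<phi>"] Abs_char_inverse) auto

lemma open_dual_subbasic:
 "compact K \<Longrightarrow> open U \<Longrightarrow> open {\<gamma>. char_fun \<gamma> ` K \<subseteq> U}"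
 unfolding open_pontryagin_dual_def by (rule generate_topology.Basis) auto

text \<open>A subbasic set of the compact-open topology confines the image of a whole compact set to
  one open set. Uniform closeness on K therefore needs K to be cut into finitely many compact pieces
  on which \<gamma>0 varies by at most e/3; confining the images to balls of radius e/2 then leaves
  a total below e.\<close>

lemma dual_nhd_uniform:
 fixes \<gamma>0 :: "'g::topological_ab_group_add pontryagin_dual"
 assumes K: "compact K" and e: "e > 0"
 shows "\<exists>N. open N \<and> \<gamma>0 \<in> N \<and> (\<forall>\<gamma>\<in>N. \<forall>x\<in>K. norm (char_fun \<gamma> x - char_fun \<gamma>0 x) < e)"
proof -
 define V where "V x = {y. norm (char_fun \<gamma>0 y - char_fun \<gamma>0 x) < e/3}" for x
 define C where "C x = K \<inter> {y. norm (char_fun \<gamma>0 y - char_fun \<gamma>0 x) \<le> e/3}" for x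
 have "open (V x)" for x
  unfolding V_def by (intro open_Collect_less continuous_intros continuous_char_fun)
 moreover have "K \<subseteq> (\<Union>x\<in>K. V x)" using e by (auto simp: V_def)
 ultimately obtain F where F: "F \<subseteq> K" "finite F" "K \<subseteq> (\<Union>x\<in>F. V x)"
  using K compactE_image[of K K V] by metis
 have C: "compact (C x)" for x
  unfolding C_def using K
  by (intro compact_Int_closed closed_Collect_le continuous_intros continuous_char_fun)
 define N where "N = (\<Inter>x\<in>F. {\<gamma>. char_fun \<gamma> ` C x \<subseteq> ball (char_fun \<gamma>0 x) (e/2)})"
 have "open N" unfolding N_def using F C by (intro open_INT open_dual_subbasic ballI) auto
 moreover have "\<gamma>0 \<in> N" using e by (auto simp: N_def C_def dist_norm norm_minus_commute)
 moreover have "norm (char_fun \<gamma> x - char_fun \<gamma>0 x) < e" if "\<gamma> \<in> N" "x \<in> K" for \<gamma> x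
 proof -
  obtain z where z: "z \<in> F" "x \<in> V z" using F(3) \<open>x \<in> K\<close> by blast
  then have x: "x \<in> C z" using that by (auto simp: V_def C_def)
  then have "char_fun \<gamma> x \<in> ball (char_fun \<gamma>0 z) (e/2)" using that(1) z(1) x unfolding N_def by blast
  then have 1: "norm (char_fun \<gamma> x - char_fun \<gamma>0 z) < e/2"
   by (simp add: dist_norm norm_minus_commute)
  have 2: "norm (char_fun \<gamma>0 x - char_fun \<gamma>0 z) < e/3" using z by (simp add: V_def)
  have "norm (char_fun \<gamma> x - char_fun \<gamma>0 x) \<le>
    norm (char_fun \<gamma> x - char_fun \<gamma>0 z) + norm (char_fun \<gamma>0 x - char_fun \<gamma>0 z)"
   using norm_triangle_ineq4[of "char_fun \<gamma> x - char_fun \<gamma>0 z" "char_fun \<gamma>0 x - char_fun \<gamma>0 z"]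
   by simp
  then show ?thesis using 1 2 e by linarith
 qed
 ultimately show ?thesis by blast
qed

text \<open>For a subbasic set the image of K under \<gamma>0 is compact inside U, so a single
  radius e fits around all of its points. Finite intersections take the union of the compact sets
  and the smaller radius.\<close>

lemma open_dual_uniform:
 fixes \<gamma>0 :: "'g::topological_ab_group_add pontryagin_dual"
 assumes "open S" "\<gamma>0 \<in> S"
 shows "\<exists>K e. compact K \<and> e > 0 \<and>
  (\<forall>\<gamma>. (\<forall>x\<in>K. norm (char_fun \<gamma> x - char_fun \<gamma>0 x) < e) \<longrightarrow> \<gamma> \<in> S)"
 using assms unfolding open_pontryagin_dual_def
proof (induction rule: generate_topology.induct)
 case UNIV
 show ?case by (intro exI[of _ "{}"] exI[of _ "1::real"]) auto
next
 case (Int a b)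
 from Int.IH(1) Int.prems obtain K e where 1:
  "compact K" "e > 0" "\<And>\<gamma>. (\<forall>x\<in>K. norm (char_fun \<gamma> x - char_fun \<gamma>0 x) < e) \<Longrightarrow> \<gamma> \<in> a" by blast
 from Int.IH(2) Int.prems obtain K' e' where 2:
  "compact K'" "e' > 0" "\<And>\<gamma>. (\<forall>x\<in>K'. norm (char_fun \<gamma> x - char_fun \<gamma>0 x) < e') \<Longrightarrow> \<gamma> \<in> b" by blast
 show ?case
 proof (intro exI[of _ "K \<union> K'"] exI[of _ "min e e'"] conjI allI impI)
  fix \<gamma> assume "\<forall>x\<in>K \<union> K'. norm (char_fun \<gamma> x - char_fun \<gamma>0 x) < min e e'"
  then show "\<gamma> \<in> a \<inter> b" using 1(3)[of \<gamma>] 2(3)[of \<gamma>] by simp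
 qed (use 1 2 in \<open>auto intro: compact_Un\<close>)
next
 case (UN \<K>)
 then obtain S where S: "S \<in> \<K>" "\<gamma>0 \<in> S" by blast
 from UN.IH[OF this] obtain K e where
  "compact K" "e > 0" "\<And>\<gamma>. (\<forall>x\<in>K. norm (char_fun \<gamma> x - char_fun \<gamma>0 x) < e) \<Longrightarrow> \<gamma> \<in> S" by blast
 with S(1) show ?case by blast
next
 case (Basis s)
 then obtain K U where KU: "s = {\<gamma>. char_fun \<gamma> ` K \<subseteq> U}" "compact K" "open U" by auto
 have "compact (char_fun \<gamma>0 ` K)"
  using KU by (intro compact_continuous_image) (auto intro: continuous_on_subset[OF continuous_char_fun])
 then obtain e where e: "e > 0" "(\<Union>x\<in>char_fun \<gamma>0 ` K. ball x e) \<subseteq> U"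
  using compact_subset_open_imp_ball_epsilon_subset[of "char_fun \<gamma>0 ` K" U] KU Basis by auto
 show ?case
 proof (intro exI[of _ K] exI[of _ e] conjI allI impI)
  fix \<gamma> assume *: "\<forall>x\<in>K. norm (char_fun \<gamma> x - char_fun \<gamma>0 x) < e"
  have "char_fun \<gamma> x \<in> U" if "x \<in> K" for x
  proof -
   have "char_fun \<gamma> x \<in> ball (char_fun \<gamma>0 x) e" using * that by (simp add: dist_norm norm_minus_commute)
   then show ?thesis using e(2) that by blast
  qed
  then show "\<gamma> \<in> s" unfolding KU by auto
 qed (use KU e in auto)
qed

lemma eventually_nhds_dual:
 fixes \<gamma>0 :: "'g::topological_ab_group_add pontryagin_dual"
 shows "eventually P (nhds \<gamma>0) \<longleftrightarrow> (\<exists>K e. compact K \<and> e > 0 \<and>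
  (\<forall>\<gamma>. (\<forall>x\<in>K. norm (char_fun \<gamma> x - char_fun \<gamma>0 x) < e) \<longrightarrow> P \<gamma>))" (is "?L \<longleftrightarrow> ?R")
proof
 assume ?L
 then obtain S where "open S" "\<gamma>0 \<in> S" "\<forall>x\<in>S. P x" unfolding eventually_nhds by blast
 then show ?R using open_dual_uniform[of S \<gamma>0] by meson
next
 assume ?R
 then obtain K e where "compact K" "e > 0"
  "\<forall>\<gamma>. (\<forall>x\<in>K. norm (char_fun \<gamma> x - char_fun \<gamma>0 x) < e) \<longrightarrow> P \<gamma>" by blast
 then show ?L using dual_nhd_uniform[of K e \<gamma>0] unfolding eventually_nhds by meson
qed

lemma tendsto_dual_iff:
 fixes \<gamma>0 :: "'g::topological_ab_group_add pontryagin_dual"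
 shows "(f \<longlongrightarrow> \<gamma>0) F \<longleftrightarrow> (\<forall>K e. compact K \<longrightarrow> e > 0 \<longrightarrow>
  (\<forall>\<^sub>F a in F. \<forall>x\<in>K. norm (char_fun (f a) x - char_fun \<gamma>0 x) < e))"
proof (intro iffI allI impI)
 fix K :: "'g set" and e :: real assume "(f \<longlongrightarrow> \<gamma>0) F" "compact K" "e > 0"
 then have "\<forall>\<^sub>F \<gamma> in nhds \<gamma>0. \<forall>x\<in>K. norm (char_fun \<gamma> x - char_fun \<gamma>0 x) < e"
  unfolding eventually_nhds_dual by blast
 then show "\<forall>\<^sub>F a in F. \<forall>x\<in>K. norm (char_fun (f a) x - char_fun \<gamma>0 x) < e"
  using \<open>(f \<longlongrightarrow> \<gamma>0) F\<close> unfolding filterlim_iff by auto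
next
 assume *: "\<forall>K e. compact K \<longrightarrow> e > 0 \<longrightarrow>
  (\<forall>\<^sub>F a in F. \<forall>x\<in>K. norm (char_fun (f a) x - char_fun \<gamma>0 x) < e)"
 show "(f \<longlongrightarrow> \<gamma>0) F" unfolding filterlim_iff eventually_nhds_dual
 proof (intro allI impI, elim exE conjE)
  fix P and K :: "'g set" and e :: real assume "compact K" "e > 0"
   and P: "\<forall>\<gamma>. (\<forall>x\<in>K. norm (char_fun \<gamma> x - char_fun \<gamma>0 x) < e) \<longrightarrow> P \<gamma>"
  then have "\<forall>\<^sub>F a in F. \<forall>x\<in>K. norm (char_fun (f a) x - char_fun \<gamma>0 x) < e" using * by blast
  then show "\<forall>\<^sub>F a in F. P (f a)" by eventually_elim (use P in blast)
 qed
qed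

lemma tendsto_eval_dual:
 fixes x :: "'g :: topological_ab_group_add"
 shows "((\<lambda>\<gamma>. char_fun \<gamma> x) \<longlongrightarrow> char_fun \<gamma>0 x) (nhds \<gamma>0)"
proof (rule tendstoI)
 fix e :: real assume "e > 0"
 then show "\<forall>\<^sub>F \<gamma> in nhds \<gamma>0. dist (char_fun \<gamma> x) (char_fun \<gamma>0 x) < e"
  unfolding eventually_nhds_dual
  by (intro exI[of _ "{x}"] exI[of _ e]) (auto simp: dist_norm)
qed

lemma continuous_eval_dual:
 fixes x :: "'g :: topological_ab_group_add"
 shows "continuous_on UNIV (\<lambda>\<gamma>. char_fun \<gamma> x)"
 by (simp add: continuous_on_UNIV_nhds tendsto_eval_dual)

instance pontryagin_dual :: (topological_ab_group_add) topological_monoid_add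
proof
 fix a b :: "'a pontryagin_dual"
 show "LIM x (nhds a \<times>\<^sub>F nhds b). fst x + snd x :> nhds (a + b)"
  unfolding tendsto_dual_iff
 proof (intro allI impI)
  fix K :: "'a set" and e :: real assume K: "compact K" "e > 0"
  have "((\<lambda>x. fst x) \<longlongrightarrow> a) (nhds a \<times>\<^sub>F nhds b)" "((\<lambda>x. snd x) \<longlongrightarrow> b) (nhds a \<times>\<^sub>F nhds b)"
   by (auto intro: filterlim_fst filterlim_snd)
  then have "\<forall>\<^sub>F z in nhds a \<times>\<^sub>F nhds b. \<forall>x\<in>K. norm (char_fun (fst z) x - char_fun a x) < e/2"
    "\<forall>\<^sub>F z in nhds a \<times>\<^sub>F nhds b. \<forall>x\<in>K. norm (char_fun (snd z) x - char_fun b x) < e/2"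
   unfolding tendsto_dual_iff using K(1) half_gt_zero[OF K(2)] by blast+
  then show "\<forall>\<^sub>F z in nhds a \<times>\<^sub>F nhds b. \<forall>x\<in>K. norm (char_fun (fst z + snd z) x - char_fun (a + b) x) < e"
  proof eventually_elim
   case (elim z)
   show ?case
   proof
    fix x assume "x \<in> K"
    have "char_fun (fst z + snd z) x - char_fun (a + b) x =
     char_fun (fst z) x * (char_fun (snd z) x - char_fun b x) + (char_fun (fst z) x - char_fun a x) * char_fun b x"
     by (simp add: char_fun_add algebra_simps)
    then have "norm (char_fun (fst z + snd z) x - char_fun (a + b) x) \<le>
     norm (char_fun (snd z) x - char_fun b x) + norm (char_fun (fst z) x - char_fun a x)"
     by (metis (no_types, lifting) mult_1 mult.right_neutral norm_char_fun norm_mult norm_triangle_ineq)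
    also have "\<dots> < e/2 + e/2" using elim \<open>x \<in> K\<close> by (intro add_strict_mono) auto
    finally show "norm (char_fun (fst z + snd z) x - char_fun (a + b) x) < e" by simp
   qed
  qed
 qed
qed

instance pontryagin_dual :: (topological_ab_group_add) topological_group_add
proof
 fix a :: "'a pontryagin_dual"
 have eq: "norm (char_fun (- \<gamma>) x - char_fun (- a) x) = norm (char_fun \<gamma> x - char_fun a x)"
  for x and \<gamma> :: "'a pontryagin_dual"
  by (metis char_fun_uminus complex_cnj_diff complex_mod_cnj)
 show "(uminus \<longlongrightarrow> - a) (nhds a)"
  unfolding tendsto_dual_iff eq eventually_nhds_dual by blast
qed

instance pontryagin_dual :: (topological_ab_group_add) topological_ab_group_add ..

instance pontryagin_dual :: (topological_ab_group_add) t2_space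
proof
 fix a b :: "'a pontryagin_dual" assume "a \<noteq> b"
 then obtain x where "char_fun a x \<noteq> char_fun b x" by (metis char_fun_inject ext)
 then obtain U V where UV: "open U" "open V" "char_fun a x \<in> U" "char_fun b x \<in> V" "U \<inter> V = {}"
  by (metis hausdorff)
 have "open {\<gamma>. char_fun \<gamma> ` {x} \<subseteq> U}" "open {\<gamma>. char_fun \<gamma> ` {x} \<subseteq> V}"
  using UV by (intro open_dual_subbasic; simp)+
 with UV show "\<exists>U V. open U \<and> open V \<and> a \<in> U \<and> b \<in> V \<and> U \<inter> V = {}"
  by (intro exI[of _ "{\<gamma>. char_fun \<gamma> ` {x} \<subseteq> U}"] exI[of _ "{\<gamma>. char_fun \<gamma> ` {x} \<subseteq> V}"]) auto
qed

text \<open>The currying half of the exponential law: joint continuity is uniform along a compact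
  set of second arguments, and that is convergence in the dual.\<close>

lemma continuous_into_dual:
 fixes f :: "'a::topological_space \<Rightarrow> 'g::topological_ab_group_add pontryagin_dual"
 assumes "continuous_on UNIV (\<lambda>(a, x). char_fun (f a) x)"
 shows "continuous_on UNIV f"
proof -
 have "(f \<longlongrightarrow> f a) (nhds a)" for a
  unfolding tendsto_dual_iff
 proof (intro allI impI)
  fix K :: "'g set" and e :: real assume K: "compact K" "e > 0"
  have "continuous_on (UNIV \<times> K) (\<lambda>(a, x). char_fun (f a) x)"
   using assms continuous_on_subset by blast
  then obtain X where X: "a \<in> X" "open X"
   "\<forall>y\<in>X \<inter> UNIV. \<forall>t\<in>K. dist ((\<lambda>(a, x). char_fun (f a) x) (y, t)) ((\<lambda>(a, x). char_fun (f a) x) (a, t)) \<le> e/2"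
   by (rule continuous_on_prod_compactE[OF _ K(1) UNIV_I half_gt_zero[OF K(2)]])
  then show "\<forall>\<^sub>F y in nhds a. \<forall>x\<in>K. norm (char_fun (f y) x - char_fun (f a) x) < e"
   unfolding eventually_nhds using K(2) by (intro exI[of _ X]) (fastforce simp: dist_norm)
 qed
 then show ?thesis by (simp add: continuous_on_UNIV_nhds)
qed

lemma locally_compact_nhd:
 assumes "locally compact (UNIV :: 'a::topological_space set)" "open W" "x \<in> W"
 obtains U V where "open U" "compact V" "x \<in> U" "U \<subseteq> V" "V \<subseteq> (W :: 'a set)"
proof -
 have "\<exists>U V. open U \<and> compact V \<and> x \<in> U \<and> U \<subseteq> V \<and> V \<subseteq> W"
  using assms unfolding locally_def by (simp add: openin_open)
 with that show ?thesis by blast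
qed

text \<open>The evaluation half of the exponential law. A compact neighbourhood V of x0 is needed
  because closeness of \<gamma> to \<gamma>0 must hold at all nearby points x
  simultaneously.\<close>

lemma continuous_eval_dual_joint:
 assumes lc: "locally compact (UNIV :: 'g::topological_ab_group_add set)"
 shows "continuous_on UNIV (\<lambda>(\<gamma>, x :: 'g). char_fun \<gamma> x)"
proof -
 have "((\<lambda>(\<gamma>, x). char_fun \<gamma> x) \<longlongrightarrow> char_fun \<gamma>0 x0) (nhds \<gamma>0 \<times>\<^sub>F nhds x0)" for \<gamma>0 and x0 :: 'g
 proof (rule tendstoI)
  fix e :: real assume e: "e > 0"
  obtain U V where UV: "open U" "compact V" "x0 \<in> U" "U \<subseteq> V" "V \<subseteq> UNIV"
   by (rule locally_compact_nhd[OF lc open_UNIV UNIV_I])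
  have 1: "\<forall>\<^sub>F \<gamma> in nhds \<gamma>0. \<forall>x\<in>V. norm (char_fun \<gamma> x - char_fun \<gamma>0 x) < e/2"
   unfolding eventually_nhds_dual using UV(2) half_gt_zero[OF e] by blast
  have "(char_fun \<gamma>0 \<longlongrightarrow> char_fun \<gamma>0 x0) (nhds x0)"
   using continuous_char_fun[of \<gamma>0] by (simp add: continuous_on_UNIV_nhds)
  from tendstoD[OF this half_gt_zero[OF e]]
  have "\<forall>\<^sub>F x in nhds x0. norm (char_fun \<gamma>0 x - char_fun \<gamma>0 x0) < e/2"
   unfolding dist_norm .
  moreover have "\<forall>\<^sub>F x in nhds x0. x \<in> V" using UV by (auto simp: eventually_nhds)
  ultimately have 2: "\<forall>\<^sub>F x in nhds x0. x \<in> V \<and> norm (char_fun \<gamma>0 x - char_fun \<gamma>0 x0) < e/2"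
   by eventually_elim auto
  have tri: "norm (char_fun \<gamma> x - char_fun \<gamma>0 x0) < e"
   if "\<forall>x\<in>V. norm (char_fun \<gamma> x - char_fun \<gamma>0 x) < e/2" "x \<in> V \<and> norm (char_fun \<gamma>0 x - char_fun \<gamma>0 x0) < e/2" for \<gamma> x
   using that norm_triangle_lt[of "char_fun \<gamma> x - char_fun \<gamma>0 x" "char_fun \<gamma>0 x - char_fun \<gamma>0 x0" e]
   by force
  show "\<forall>\<^sub>F x in nhds \<gamma>0 \<times>\<^sub>F nhds x0. dist (case x of (\<gamma>, x) \<Rightarrow> char_fun \<gamma> x) (char_fun \<gamma>0 x0) < e"
   unfolding eventually_prod_filter
   using 1 2 tri by (intro exI conjI) (assumption, assumption, auto simp: dist_norm)
 qed
 then show ?thesis by (simp add: continuous_on_UNIV_nhds nhds_prod split_paired_all)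
qed

section \<open>Countable bases, sequential continuity and Borel sets of products\<close>

text \<open>A predicate instead of the class of second countable spaces: the dual acquires a
  countable basis only from the local compactness of the group, which is a hypothesis and not part
  of its type.\<close>

definition countably_based :: "'a::topological_space itself \<Rightarrow> bool" where
 "countably_based _ \<longleftrightarrow> (\<exists>B :: 'a set set. countable B \<and> topological_basis B)"

lemma countably_based_class: "countably_based TYPE('a::second_countable_topology)"
 unfolding countably_based_def using ex_countable_basis by auto

lemma countably_based_prod:
 "countably_based TYPE('a::topological_space) \<Longrightarrow> countably_based TYPE('b::topological_space) \<Longrightarrow>
  countably_based TYPE('a \<times> 'b)"
 unfolding countably_based_def by (metis topological_basis_prod countable_SIGMA countable_image)

text \<open>Parameter integrals are handled by dominated convergence, which speaks of sequences; a
  countable basis makes sequential continuity enough.\<close>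

lemma countably_based_continuousI:
 fixes f :: "'a::topological_space \<Rightarrow> 'b::topological_space"
 assumes cb: "countably_based TYPE('a)"
  and seq: "\<And>X x. X \<longlonglongrightarrow> x \<Longrightarrow> (\<lambda>n. f (X n)) \<longlonglongrightarrow> f x"
 shows "continuous_on UNIV f"
proof -
 have "(f \<longlongrightarrow> f x) (nhds x)" for x
 proof (rule ccontr)
  obtain B :: "'a set set" where B: "countable B" "topological_basis B"
   using cb unfolding countably_based_def by blast
  define C where "C = {b \<in> B. x \<in> b}"
  have "C \<noteq> {}" using topological_basisE[OF B(2) open_UNIV, of x] by (auto simp: C_def)
  moreover have "countable C" using B by (auto simp: C_def)
  ultimately have rC: "range (from_nat_into C) = C" by simp
  \<comment> \<open>A decreasing base of neighbourhoods of x, so that choosing one bad point from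
    each member gives a sequence converging to x.\<close>
  define A where "A n = (\<Inter>i\<le>n. from_nat_into C i)" for n
  have opC: "open (from_nat_into C i)" "x \<in> from_nat_into C i" for i
   using rC topological_basis_open[OF B(2)] by (auto simp: C_def)
  have xA: "x \<in> A n" for n using opC by (auto simp: A_def)
  assume "\<not> (f \<longlongrightarrow> f x) (nhds x)"
  then obtain S where S: "open S" "f x \<in> S" "\<not> (\<forall>\<^sub>F y in nhds x. f y \<in> S)"
   unfolding tendsto_def by blast
  have "open (A n)" for n unfolding A_def using opC by (intro open_INT) auto
  then have "\<exists>y\<in>A n. f y \<notin> S" for n using S(3) xA unfolding eventually_nhds by blast
  then obtain X where X: "\<And>n. X n \<in> A n" "\<And>n. f (X n) \<notin> S" by metis
  have "X \<longlonglongrightarrow> x"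
  proof (rule topological_tendstoI)
   fix W assume "open W" "x \<in> W"
   then obtain b where "b \<in> C" "b \<subseteq> W" using topological_basisE[OF B(2)] unfolding C_def by blast
   then obtain i where "from_nat_into C i \<subseteq> W" using rC by (metis rangeE)
   then show "\<forall>\<^sub>F n in sequentially. X n \<in> W"
    using X(1) unfolding eventually_sequentially A_def by (intro exI[of _ i]) blast
  qed
  from seq[OF this] S(1,2) have "\<forall>\<^sub>F n in sequentially. f (X n) \<in> S" by (rule topological_tendstoD)
  then show False using X(2) by auto
 qed
 then show ?thesis by (simp add: continuous_on_UNIV_nhds)
qed

text \<open>Local compactness yields basic sets b with compact closure, so small that \<gamma>0 maps
  this closure into a prescribed basic set u of the plane. There are countably many conditions of
  this kind, and finitely many of them already force uniform closeness to \<gamma>0 on a given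
  compact set.\<close>

lemma countably_based_dual:
 assumes lc: "locally compact (UNIV :: 'g::{topological_ab_group_add, t2_space, second_countable_topology} set)"
 shows "countably_based TYPE('g pontryagin_dual)"
proof -
 obtain B :: "'g set set" where B: "countable B" "topological_basis B" using ex_countable_basis by auto
 obtain D :: "complex set set" where D: "countable D" "topological_basis D" using ex_countable_basis by auto
 define \<S> where "\<S> = (\<lambda>(b, u). {\<gamma>. char_fun \<gamma> ` closure b \<subseteq> u}) ` ({b\<in>B. compact (closure b)} \<times> D)"
 have cS: "countable \<S>" unfolding \<S>_def using B D by auto
 have oS: "open s" if "s \<in> \<S>" for s
  using that topological_basis_open[OF D(2)] by (auto simp: \<S>_def intro!: open_dual_subbasic)
 define \<B> where "\<B> = Inter ` {F. F \<subseteq> \<S> \<and> finite F}"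
 have "countable \<B>" unfolding \<B>_def using cS countable_Collect_finite_subset[of \<S>]
  by (simp add: conj_commute)
 moreover have "topological_basis \<B>"
 proof (rule topological_basisI)
  show "open s" if "s \<in> \<B>" for s using that oS by (auto simp: \<B>_def intro!: open_Inter)
  fix O' and \<gamma>0 :: "'g pontryagin_dual" assume "open O'" "\<gamma>0 \<in> O'"
  from open_dual_uniform[OF this] obtain K e where K: "compact K" "e > 0"
   and Ke: "\<And>\<gamma>. (\<forall>x\<in>K. norm (char_fun \<gamma> x - char_fun \<gamma>0 x) < e) \<Longrightarrow> \<gamma> \<in> O'" by blast
  have "\<exists>b u. b \<in> B \<and> compact (closure b) \<and> u \<in> D \<and> x \<in> b \<and> char_fun \<gamma>0 ` closure b \<subseteq> u \<and>
    u \<subseteq> ball (char_fun \<gamma>0 x) (e/2)" for x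
  proof -
   obtain u where u: "u \<in> D" "char_fun \<gamma>0 x \<in> u" "u \<subseteq> ball (char_fun \<gamma>0 x) (e/2)"
    using topological_basisE[OF D(2) open_ball, of "char_fun \<gamma>0 x" "char_fun \<gamma>0 x" "e/2"] K by auto
   have "open (char_fun \<gamma>0 -` u)"
    using continuous_char_fun u topological_basis_open[OF D(2)] by (metis open_vimage)
   then obtain U V where UV: "open U" "compact V" "x \<in> U" "U \<subseteq> V" "V \<subseteq> char_fun \<gamma>0 -` u"
    using locally_compact_nhd[OF lc] u by (metis vimageI2)
   obtain b where b: "b \<in> B" "x \<in> b" "b \<subseteq> U" using topological_basisE[OF B(2)] UV by metis
   have "closure b \<subseteq> V" using UV b by (intro closure_minimal compact_imp_closed) auto
   moreover from this have "compact (closure b)"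
    using UV compact_Int_closed[of V "closure b"] by (simp add: inf_absorb2)
   ultimately show ?thesis using u b UV by blast
  qed
  then obtain b u where bu: "\<And>x. b x \<in> B" "\<And>x. compact (closure (b x))" "\<And>x. u x \<in> D" "\<And>x. x \<in> b x"
   "\<And>x. char_fun \<gamma>0 ` closure (b x) \<subseteq> u x" "\<And>x. u x \<subseteq> ball (char_fun \<gamma>0 x) (e/2)" by metis
  have "\<And>x. open (b x)" using bu topological_basis_open[OF B(2)] by auto
  then obtain F where F: "F \<subseteq> K" "finite F" "K \<subseteq> (\<Union>x\<in>F. b x)"
   using K compactE_image[of K K b] bu(4) by (metis UN_I subsetI)
  define s where "s = (\<Inter>x\<in>F. {\<gamma>. char_fun \<gamma> ` closure (b x) \<subseteq> u x})"
  have "s \<in> \<B>" unfolding \<B>_def s_def using F bu by (intro imageI) (auto simp: \<S>_def)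
  moreover have "\<gamma>0 \<in> s" using bu by (auto simp: s_def)
  moreover have "s \<subseteq> O'"
  proof
   fix \<gamma> assume g: "\<gamma> \<in> s"
   show "\<gamma> \<in> O'"
   proof (rule Ke, intro ballI)
    fix x assume "x \<in> K"
    then obtain z where z: "z \<in> F" "x \<in> b z" using F by auto
    then have xc: "x \<in> closure (b z)" using closure_subset by blast
    then have "char_fun \<gamma> x \<in> ball (char_fun \<gamma>0 z) (e/2)" "char_fun \<gamma>0 x \<in> ball (char_fun \<gamma>0 z) (e/2)"
     using g z bu(5,6)[of z] unfolding s_def by blast+
    then show "norm (char_fun \<gamma> x - char_fun \<gamma>0 x) < e"
     using dist_triangle_half_r[of "char_fun \<gamma>0 z" "char_fun \<gamma> x" e "char_fun \<gamma>0 x"] by (simp add: dist_norm)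
   qed
  qed
  ultimately show "\<exists>s\<in>\<B>. \<gamma>0 \<in> s \<and> s \<subseteq> O'" by blast
 qed
 ultimately show ?thesis unfolding countably_based_def by blast
qed

text \<open>An open S is the union of the boxes \<open>b \<times> W b\<close> over the countable
  basis of the first factor, where \<open>W b\<close> is the largest open set for which the box
  stays inside S.\<close>

lemma sets_borel_prod:
 assumes "countably_based TYPE('a::topological_space)"
 shows "sets (borel \<Otimes>\<^sub>M borel :: ('a \<times> 'b::topological_space) measure) = sets borel"
proof (rule antisym)
 obtain B :: "'a set set" where B: "countable B" "topological_basis B"
  using assms unfolding countably_based_def by blast
 have "S \<in> sets (borel \<Otimes>\<^sub>M borel)" if S: "open S" for S :: "('a \<times> 'b) set"
 proof -
  define W where "W b = \<Union>{w. open w \<and> b \<times> w \<subseteq> S}" for b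
  have "S = (\<Union>b\<in>B. b \<times> W b)"
  proof (intro equalityI subsetI)
   fix z assume "z \<in> S"
   then obtain U V where UV: "open U" "open V" "z \<in> U \<times> V" "U \<times> V \<subseteq> S"
    using S open_prod_elim by blast
   moreover from UV(3) have "fst z \<in> U" by auto
   then obtain b where "b \<in> B" "fst z \<in> b" "b \<subseteq> U"
    by (rule topological_basisE[OF B(2) UV(1)])
   ultimately show "z \<in> (\<Union>b\<in>B. b \<times> W b)" unfolding W_def
    by (intro UN_I[of b]) (auto simp: mem_Times_iff intro!: exI[of _ V])
  qed (auto simp: W_def)
  moreover have "open (W b)" for b unfolding W_def by auto
  then have "(\<Union>b\<in>B. b \<times> W b) \<in> sets (borel \<Otimes>\<^sub>M borel)"
   using B(1) topological_basis_open[OF B(2)]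
   by (intro sets.countable_UN' subsetI) (auto intro!: pair_measureI borel_open)
  ultimately show ?thesis by simp
 qed
 then have "sigma_sets UNIV {S. open S} \<subseteq> sets (borel \<Otimes>\<^sub>M borel :: ('a \<times> 'b) measure)"
  by (intro sets.sigma_sets_subset') (auto simp: space_pair_measure)
 then show "sets borel \<subseteq> sets (borel \<Otimes>\<^sub>M borel :: ('a \<times> 'b) measure)"
  by (simp add: borel_def sets_measure_of_conv)
next
 have "sets (borel \<Otimes>\<^sub>M borel :: ('a \<times> 'b) measure) = sigma_sets UNIV {a \<times> b | a b. a \<in> sets borel \<and> b \<in> sets borel}"
  by (simp add: sets_pair_measure)
 also have "\<dots> \<subseteq> sets borel"
 proof (rule sets.sigma_sets_subset'[where M = borel, unfolded space_borel])
  show "{a \<times> b |a b. a \<in> sets borel \<and> b \<in> sets borel} \<subseteq> sets (borel :: ('a \<times> 'b) measure)"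
  proof safe
   fix a :: "'a set" and b :: "'b set" assume ab: "a \<in> sets borel" "b \<in> sets borel"
   have "fst -` a \<inter> space borel \<in> sets (borel :: ('a \<times> 'b) measure)" "snd -` b \<inter> space borel \<in> sets (borel :: ('a \<times> 'b) measure)"
    by (rule measurable_sets[OF borel_measurable_continuous_onI[OF continuous_on_fst[OF continuous_on_id]] ab(1)]
      measurable_sets[OF borel_measurable_continuous_onI[OF continuous_on_snd[OF continuous_on_id]] ab(2)])+
   moreover have "a \<times> b = (fst -` a \<inter> space borel) \<inter> (snd -` b \<inter> space borel)" by auto
   ultimately show "a \<times> b \<in> sets borel" by auto
  qed
 qed auto
 finally show "sets (borel \<Otimes>\<^sub>M borel :: ('a \<times> 'b) measure) \<subseteq> sets borel" .
qed

section \<open>One-parameter subgroups and real characters\<close>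

lemma ex_antiderivative:
 fixes f :: "real \<Rightarrow> 'a::euclidean_space"
 assumes "continuous_on UNIV f"
 shows "\<exists>F. \<forall>x. (F has_vector_derivative f x) (at x)"
 using einterval_antiderivative[of "-\<infinity>" "\<infinity>" f] assms
 by (auto simp: continuous_on_eq_continuous_at)

lemma has_vector_derivative_zero_const:
 fixes f :: "real \<Rightarrow> 'a::real_normed_vector"
 assumes "\<And>x. (f has_vector_derivative 0) (at x)"
 shows "f x = f y"
proof -
 have "\<exists>c. \<forall>x\<in>UNIV. f x = c"
  using assms by (intro has_derivative_zero_constant) (auto simp: has_vector_derivative_def)
 then show ?thesis by auto
qed

lemma has_vector_derivative_shift:
 assumes "\<And>x. (F has_vector_derivative f x) (at x)"
 shows "((\<lambda>s. F (s + t)) has_vector_derivative f (s + t)) (at (s::real))"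
proof -
 have "((\<lambda>s. s + t) has_vector_derivative 1) (at s)" by (auto intro!: derivative_eq_intros)
 then show ?thesis using vector_diff_chain_at[of "\<lambda>s. s + t" 1 s F "f (s + t)"] assms by (simp add: o_def)
qed

text \<open>Integrating the functional equation over the first argument from 0 to 1 expresses f t as
  a difference of antiderivatives. Hence f is differentiable, and its derivative f (1 + t) - f t is
  the constant f 1.\<close>

lemma additive_real_linear:
 fixes f :: "real \<Rightarrow> real"
 assumes cont: "continuous_on UNIV f" and add: "\<And>s t. f (s + t) = f s + f t"
 shows "f s = s * f 1"
proof -
 obtain G where G: "\<And>x. (G has_vector_derivative f x) (at x)" using ex_antiderivative[OF cont] by blast
 define H where "H t = G (1 + t) - G t" for t
 have key: "f t = H t - H 0" for t
 proof -
  have "((\<lambda>s. G (s + t) - G s - s * f t) has_vector_derivative (f (s + t) - f s - f t)) (at s)" for s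
   by (rule derivative_eq_intros has_vector_derivative_shift G refl | simp)+
  then have "((\<lambda>s. G (s + t) - G s - s * f t) has_vector_derivative 0) (at s)" for s
   by (simp add: add)
  from has_vector_derivative_zero_const[OF this, of 1 0] show ?thesis by (simp add: H_def)
 qed
 have "(H has_vector_derivative (f (1 + t) - f t)) (at t)" for t
  using has_vector_derivative_shift[of G f 1 t, OF G] unfolding H_def
  by (auto intro!: derivative_eq_intros G simp: add.commute)
 then have H: "(H has_vector_derivative f 1) (at t)" for t by (simp add: add)
 have "((\<lambda>t. H t - t * f 1) has_vector_derivative 0) (at t)" for t
  by (rule derivative_eq_intros H refl | simp)+
 from has_vector_derivative_zero_const[OF this, of s 0] show ?thesis using key[of s] by simp
qed

text \<open>The same regularisation in multiplicative form: an integrated functional equation makes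
  \<phi> differentiable with \<phi>' = k \<phi>, so \<phi> is exponential, and modulus 1 forces k to
  be imaginary.\<close>

lemma unit_character_cis:
 fixes \<phi> :: "real \<Rightarrow> complex"
 assumes cont: "continuous_on UNIV \<phi>" and hom: "\<And>s t. \<phi> (s + t) = \<phi> s * \<phi> t"
  and nrm: "\<And>s. norm (\<phi> s) = 1"
 shows "\<exists>c. \<forall>s. \<phi> s = cis (s * c)"
proof -
 obtain G where G: "\<And>x. (G has_vector_derivative \<phi> x) (at x)" using ex_antiderivative[OF cont] by blast
 define H where "H a t = G (a + t) - G t" for a t
 have key: "\<phi> t * H a 0 = H a t" for a t
 proof -
  have "((\<lambda>s. G (s + t) - \<phi> t * G s) has_vector_derivative (\<phi> (s + t) - \<phi> t * \<phi> s)) (at s)" for s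
   by (rule derivative_eq_intros has_vector_derivative_shift G refl | simp)+
  then have "((\<lambda>s. G (s + t) - \<phi> t * G s) has_vector_derivative 0) (at s)" for s
   by (simp add: hom)
  from has_vector_derivative_zero_const[OF this, of a 0] show ?thesis by (simp add: H_def algebra_simps)
 qed
 \<comment> \<open>Otherwise G would be constant, and its derivative at 0, a number of modulus 1,
   would vanish.\<close>
 have "\<exists>a. H a 0 \<noteq> 0"
 proof (rule ccontr)
  assume "\<not> ?thesis"
  then have "G = (\<lambda>_. G 0)" by (auto simp: H_def fun_eq_iff)
  then have "(G has_vector_derivative 0) (at 0)" by (metis has_vector_derivative_const)
  then have "\<phi> 0 = 0" using G vector_derivative_unique_at by blast
  then show False using nrm[of 0] by simp
 qed
 then obtain a where a: "H a 0 \<noteq> 0" by blast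
 define k where "k = (\<phi> a - 1) / H a 0"
 have "(H a has_vector_derivative (\<phi> (a + t) - \<phi> t)) (at t)" for t
  using has_vector_derivative_shift[of G \<phi> a t, OF G] unfolding H_def
  by (auto intro!: derivative_eq_intros G simp: add.commute)
 then have "((\<lambda>t. H a t / H a 0) has_vector_derivative ((\<phi> (a + t) - \<phi> t) / H a 0)) (at t)" for t
  by (intro has_vector_derivative_divide)
 moreover have "(\<lambda>t. H a t / H a 0) = \<phi>" using key a by (auto simp: fun_eq_iff field_simps)
 moreover have "(\<phi> (a + t) - \<phi> t) / H a 0 = k * \<phi> t" for t by (simp add: k_def hom field_simps)
 ultimately have D: "(\<phi> has_vector_derivative (k * \<phi> t)) (at t)" for t by simp
 have E: "((\<lambda>t. exp (of_real t * (-k))) has_vector_derivative (- k * exp (of_real t * (-k)))) (at t)" for t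
  using exp_scaleR_has_vector_derivative_right[of "-k" t UNIV] by (simp add: scaleR_conv_of_real mult.commute)
 have "((\<lambda>t. \<phi> t * exp (of_real t * (-k))) has_vector_derivative 0) (at t)" for t
  using has_vector_derivative_mult[OF D E, of t] by (simp add: algebra_simps)
 from has_vector_derivative_zero_const[OF this, of _ 0]
 have "\<phi> t * exp (of_real t * (-k)) = \<phi> 0" for t by simp
 moreover have "\<phi> 0 = 1" using hom[of 0 0] nrm[of 0] by auto
 ultimately have ex: "\<phi> t = exp (of_real t * k)" for t
  by (metis (no_types) exp_minus mult_minus_right divide_inverse inverse_inverse_eq nonzero_eq_divide_eq exp_not_eq_zero mult_1)
 have "Re k = 0" using nrm[of 1] ex[of 1] by simp
 then have k: "k = \<i> * of_real (Im k)" by (simp add: complex_eq_iff)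
 have "of_real s * k = \<i> * of_real (s * Im k)" for s by (subst k) (simp only: of_real_mult mult_ac)
 then have "\<phi> s = cis (s * Im k)" for s
  unfolding ex cis_conv_exp by (simp only:)
 then show ?thesis by blast
qed

text \<open>The margin by which \<open>cis 1\<close> and \<open>cis (- 1)\<close> stay away from 1;
  the threshold 1/2 below is chosen to match it.\<close>

lemma sin_1_gt_half: "sin (1::real) > 1/2"
proof -
 have "sin (pi/6) < sin 1" using pi_less_4 pi_ge_two
  by (intro sin_monotone_2pi) (auto)
 then show ?thesis by (simp add: sin_30)
qed

lemma cis_scaled_inject:
 assumes "\<And>s. cis (s * c) = cis (s * d)"
 shows "c = d"
proof (rule ccontr)
 assume "c \<noteq> d"
 have "cis (s * (c - d)) = 1" for s
  using assms[of s] by (simp add: right_diff_distrib flip: cis_divide)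
 from this[of "1 / (c - d)"] \<open>c \<noteq> d\<close> have "cis 1 = 1" by simp
 then show False using sin_1_gt_half by (simp add: complex_eq_iff)
qed

lemma one_param_0: "one_param X \<Longrightarrow> X 0 = 0"
 unfolding one_param_def by (metis add.right_neutral add_left_cancel)

lemma one_param_add: "one_param X \<Longrightarrow> X (s + t) = X s + X t"
 by (simp add: one_param_def)

lemma real_hom_add: "real_hom p \<Longrightarrow> p (x + y) = p x + p y"
 by (simp add: real_hom_def)

lemma real_hom_continuous: "real_hom p \<Longrightarrow> continuous_on UNIV p"
 by (simp add: real_hom_def)

lemma real_hom_0: "real_hom p \<Longrightarrow> p 0 = 0"
 using real_hom_add[of p 0 0] by simp

lemma real_hom_minus: "real_hom p \<Longrightarrow> p (- x) = - p x"
 using real_hom_add[of p x "-x"] real_hom_0[of p] by simp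

lemma real_hom_diff: "real_hom p \<Longrightarrow> p (x - y) = p x - p y"
 using real_hom_add[of p x "-y"] real_hom_minus[of p y] by simp

lemma real_hom_one_param:
 assumes X: "one_param X" and p: "real_hom p"
 shows "p (X s) = s * p (X 1)"
proof -
 have "continuous_on UNIV (\<lambda>s. p (X s))"
  using X p unfolding one_param_def real_hom_def
  by (metis continuous_on_compose2 subset_UNIV)
 then show ?thesis
  using additive_real_linear[of "\<lambda>s. p (X s)" s] X p by (simp add: one_param_def real_hom_def)
qed

text \<open>Additivity moves continuity at any point to 0. Smallness is asked in the form 1/n
  because that is what control of a character on the time interval from 0 to n provides.\<close>

lemma real_homI:
 fixes p :: "'h::topological_ab_group_add \<Rightarrow> real"
 assumes add: "\<And>x y. p (x + y) = p x + p y"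
  and small: "\<And>n::nat. n > 0 \<Longrightarrow> \<forall>\<^sub>F x in nhds 0. \<bar>p x\<bar> < 1 / real n"
 shows "real_hom p"
proof -
 have "(p \<longlongrightarrow> p a) (nhds a)" for a
 proof (rule tendstoI)
  fix e :: real assume "e > 0"
  from reals_Archimedean[OF this] obtain m where m: "inverse (real (Suc m)) < e" by blast
  define n where "n = Suc m"
  have n: "n > 0" "1 / real n < e" using m by (auto simp: n_def inverse_eq_divide)
  have "((\<lambda>x. x - a) \<longlongrightarrow> a - a) (nhds a)"
   by (rule tendsto_diff[OF filterlim_ident tendsto_const])
  then have "filterlim (\<lambda>x. x - a) (nhds 0) (nhds a)" by simp
  from this[unfolded filterlim_iff, rule_format, OF small[OF n(1)]]
  have "\<forall>\<^sub>F x in nhds a. \<bar>p (x - a)\<bar> < 1 / real n" .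
  then show "\<forall>\<^sub>F x in nhds a. dist (p x) (p a) < e"
  proof eventually_elim
   case (elim x)
   have "p x = p (x - a) + p a" using add[of "x - a" a] by simp
   then show ?case using elim n by (simp add: dist_real_def)
  qed
 qed
 then show ?thesis using add by (simp add: real_hom_def continuous_on_UNIV_nhds)
qed

text \<open>Common core of both directions of the duality between one-parameter subgroups and real
  homomorphisms. The frequencies are additive because a character of the line determines its
  frequency; their continuity comes from watching the character long enough to see it leave
  1.\<close>

lemma character_family_real_hom:
 fixes \<phi> :: "'h::topological_ab_group_add \<Rightarrow> real \<Rightarrow> complex"
 assumes cont: "\<And>x. continuous_on UNIV (\<phi> x)" and hom: "\<And>x s t. \<phi> x (s + t) = \<phi> x s * \<phi> x t"
  and nrm: "\<And>x s. norm (\<phi> x s) = 1" and add: "\<And>x y s. \<phi> (x + y) s = \<phi> x s * \<phi> y s"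
  and unif: "\<And>n::nat. \<forall>\<^sub>F x in nhds 0. \<forall>s\<in>{0..real n}. norm (\<phi> x s - 1) < 1/2"
 shows "\<exists>P. real_hom P \<and> (\<forall>x s. \<phi> x s = cis (s * P x))"
proof -
 obtain P where P: "\<And>x s. \<phi> x s = cis (s * P x)"
  using unit_character_cis[OF cont hom nrm] by metis
 have "P (x + y) = P x + P y" for x y
  using add[of x y] by (intro cis_scaled_inject) (simp add: P cis_mult distrib_left)
 moreover have "\<forall>\<^sub>F x in nhds 0. \<bar>P x\<bar> < 1 / real n" if "n > 0" for n :: nat
  using unif[of n]
 proof eventually_elim
  case (elim x)
  show ?case
  proof (rule ccontr)
   assume "\<not> \<bar>P x\<bar> < 1 / n"
   then have P1: "\<bar>P x\<bar> \<ge> 1 / n" "\<bar>P x\<bar> > 0" using that by (auto simp: not_less intro: less_le_trans[of 0 "1 / n"])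
   \<comment> \<open>At the time 1/|P x| the character equals \<open>cis 1\<close> or
     \<open>cis (- 1)\<close>, whose imaginary part has modulus above 1/2.\<close>
   then have "1 / \<bar>P x\<bar> \<in> {0..real n}" using that by (simp add: field_simps)
   then have "norm (cis (1 / \<bar>P x\<bar> * P x) - 1) < 1/2" using elim P by metis
   moreover have "1 / \<bar>P x\<bar> * P x = 1 \<or> 1 / \<bar>P x\<bar> * P x = -1" using P1(2) by (auto simp: abs_if)
   moreover have "\<bar>Im (cis c - 1)\<bar> \<le> norm (cis c - 1)" for c by (rule abs_Im_le_cmod)
   ultimately show False using sin_1_gt_half
    by (smt (verit, best) Im_complex_of_real cis.simps(2) minus_complex.simps(2) one_complex.simps(2) sin_minus)
  qed
 qed
 ultimately have "real_hom P" by (intro real_homI) auto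
 then show ?thesis using P by blast
qed

lemma one_param_frequency:
 fixes X :: "real \<Rightarrow> 'g::topological_ab_group_add"
 assumes X: "one_param X"
 shows "\<exists>P. real_hom P \<and> (\<forall>\<gamma> s. char_fun \<gamma> (X s) = cis (s * P \<gamma>))"
proof (rule character_family_real_hom)
 fix n :: nat
 have "compact (X ` {0..real n})"
  using X by (intro compact_continuous_image) (auto simp: one_param_def intro: continuous_on_subset)
 then show "\<forall>\<^sub>F \<gamma> in nhds 0. \<forall>s\<in>{0..real n}. norm (char_fun \<gamma> (X s) - 1) < 1/2"
  unfolding eventually_nhds_dual by (intro exI[of _ "X ` {0..real n}"] exI[of _ "1/2"]) simp
 show "continuous_on UNIV (\<lambda>s. char_fun \<gamma> (X s))" for \<gamma>
  using X continuous_char_fun[of \<gamma>] unfolding one_param_def by (metis continuous_on_compose2 subset_UNIV)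
qed (auto simp: char_fun_add char_fun_add_arg one_param_add[OF X])

text \<open>Point and character exchange roles, so the uniform control near t = 0 comes from joint
  continuity of evaluation and no longer from the compact-open topology.\<close>

lemma one_param_dual_frequency:
 fixes X :: "real \<Rightarrow> 'g::topological_ab_group_add pontryagin_dual"
 assumes lc: "locally compact (UNIV :: 'g set)" and X: "one_param X"
 shows "\<exists>p. real_hom p \<and> (\<forall>t s. char_fun (X s) t = cis (s * p t))"
proof (rule character_family_real_hom)
 have X': "continuous_on UNIV X" using X by (simp add: one_param_def)
 have j: "continuous_on UNIV (\<lambda>(t, s). char_fun (X s) t)"
 proof -
  have "continuous_on UNIV ((\<lambda>(\<gamma>, x). char_fun \<gamma> x) \<circ> (\<lambda>(t, s). (X s, t)))"
   by (intro continuous_on_compose continuous_on_subset[OF continuous_eval_dual_joint[OF lc]])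
    (auto simp: case_prod_beta intro!: continuous_intros continuous_on_compose2[OF X'])
  then show ?thesis by (simp add: o_def case_prod_beta)
 qed
 fix n :: nat
 have c: "continuous_on (UNIV \<times> {0..real n}) (\<lambda>(t, s). char_fun (X s) t)"
  using j continuous_on_subset by blast
 obtain V where V: "(0::'g) \<in> V" "open V" "\<forall>t\<in>V \<inter> UNIV. \<forall>s\<in>{0..real n}.
  dist ((\<lambda>(t, s). char_fun (X s) t) (t, s)) ((\<lambda>(t, s). char_fun (X s) t) (0, s)) \<le> 1/4"
  by (rule continuous_on_prod_compactE[OF c _ UNIV_I, of "1/4" 0]) auto
 then show "\<forall>\<^sub>F t in nhds 0. \<forall>s\<in>{0..real n}. norm (char_fun (X s) t - 1) < 1/2"
 proof -
  have "norm (char_fun (X s) t - 1) < 1/2" if "t \<in> V" "s \<in> {0..real n}" for t s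
  proof -
   have "dist (char_fun (X s) t) (char_fun (X s) 0) \<le> 1/4" using V(3) that by simp
   then show ?thesis by (simp add: dist_norm)
  qed
  then show ?thesis unfolding eventually_nhds using V(1,2) by (intro exI[of _ V]) simp
 qed
 show "continuous_on UNIV (\<lambda>s. char_fun (X s) t)" for t
  using continuous_on_compose2[OF continuous_eval_dual X', of t] by simp
qed (auto simp: char_fun_add char_fun_add_arg one_param_add[OF X])

text \<open>Exponentiating s * p t gives a character for each s. Differentiating along this subgroup
  of the dual multiplies by \<i> p t, which is how polynomials in the group variable become
  derivatives in the dual variable.\<close>

lemma real_hom_frequency:
 fixes p :: "'g::topological_ab_group_add \<Rightarrow> real"
 assumes p: "real_hom p"
 shows "\<exists>X. one_param X \<and> (\<forall>s t. char_fun (X s) t = cis (s * p t))"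
proof -
 have "\<exists>\<gamma>. char_fun \<gamma> = (\<lambda>t. cis (s * p t))" for s
  by (intro ex_char_fun) (auto simp: cis_mult real_hom_add[OF p] distrib_left
    intro!: continuous_intros real_hom_continuous[OF p])
 then obtain X where X: "\<And>s. char_fun (X s) = (\<lambda>t. cis (s * p t))" by metis
 have "continuous_on UNIV (\<lambda>(s, t). char_fun (X s) t)"
  unfolding X case_prod_beta
  by (intro continuous_intros continuous_on_compose2[OF real_hom_continuous[OF p]]) auto
 then have "continuous_on UNIV X" by (rule continuous_into_dual)
 moreover have "X (s + t) = X s + X t" for s t
  by (simp add: char_fun_inject[symmetric] fun_eq_iff char_fun_add X cis_mult distrib_right)
 ultimately show ?thesis using X unfolding one_param_def by metis
qed

section \<open>Closure properties of the Schwartz space\<close>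

lemma dir_derivI:
 "((\<lambda>t. f (x + X t)) has_vector_derivative d) (at 0) \<Longrightarrow> dir_deriv X f x = d"
 unfolding dir_deriv_def by (rule vector_derivative_at)

text \<open>The definition asks about every list of derivatives followed by every monomial. A set of
  bounded continuous functions that is stable under single derivatives and single linear factors
  contains all of these functions, so only such a set has to be found.\<close>

lemma schwartz_coinduct:
 assumes f: "f \<in> W"
  and cont: "\<And>g. g \<in> W \<Longrightarrow> continuous_on UNIV g"
  and bdd: "\<And>g. g \<in> W \<Longrightarrow> bounded (range g)"
  and deriv: "\<And>g X. g \<in> W \<Longrightarrow> one_param X \<Longrightarrow>
   \<exists>g'\<in>W. \<forall>x. ((\<lambda>t. g (x + X t)) has_vector_derivative g' x) (at 0)"
  and mult: "\<And>g p. g \<in> W \<Longrightarrow> real_hom p \<Longrightarrow> (\<lambda>x. of_real (p x) * g x) \<in> W"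
 shows "f \<in> schwartz_space"
proof -
 have D: "dir_deriv X g \<in> W" if "g \<in> W" "one_param X" for g X
 proof -
  obtain g' where g': "g' \<in> W" "\<And>x. ((\<lambda>t. g (x + X t)) has_vector_derivative g' x) (at 0)"
   using deriv[OF \<open>g \<in> W\<close> \<open>one_param X\<close>] by blast
  have "dir_deriv X g = g'" using dir_derivI[OF g'(2)] by (simp add: fun_eq_iff)
  then show ?thesis using g' by simp
 qed
 have I: "iter_deriv Xs f \<in> W" if "list_all one_param Xs" for Xs
  using that by (induction Xs) (auto simp: iter_deriv_def f intro: D)
 have M: "(\<lambda>x. of_real (\<Prod>p\<leftarrow>ps. p x) * g x) \<in> W" if "list_all real_hom ps" "g \<in> W" for ps g
  using that
 proof (induction ps)
  case (Cons p ps)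
  then show ?case using mult[of "\<lambda>x. of_real (\<Prod>p\<leftarrow>ps. p x) * g x" p] by (simp add: mult.assoc)
 qed simp
 have diff: "(\<lambda>t. g (x + X t)) differentiable at 0" if "g \<in> W" "one_param X" for g X x
  using deriv[OF that] vector_derivative_works differentiableI_vector by blast
 show ?thesis
  unfolding schwartz_space_def smooth_fun_def
  by (auto intro!: cont I diff bdd M)
qed

text \<open>The complex linear span. Product rules produce sums, so the stable sets that occur are
  spans of more manageable generating families.\<close>

inductive_set fspan :: "('h \<Rightarrow> complex) set \<Rightarrow> ('h \<Rightarrow> complex) set" for W where
 zero: "(\<lambda>_. 0) \<in> fspan W"
| base: "f \<in> W \<Longrightarrow> f \<in> fspan W"
| add: "f \<in> fspan W \<Longrightarrow> g \<in> fspan W \<Longrightarrow> (\<lambda>x. f x + g x) \<in> fspan W"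
| scale: "f \<in> fspan W \<Longrightarrow> (\<lambda>x. z * f x) \<in> fspan W"

lemma fspan_diff: "f \<in> fspan W \<Longrightarrow> g \<in> fspan W \<Longrightarrow> (\<lambda>x. f x - g x) \<in> fspan W"
 using fspan.add[OF _ fspan.scale[of g W "-1"], of f] by simp

lemma bounded_range_add:
 fixes f g :: "'a \<Rightarrow> 'b::real_normed_vector"
 assumes "bounded (range f)" "bounded (range g)"
 shows "bounded (range (\<lambda>x. f x + g x))"
proof -
 obtain a b where "\<And>x. norm (f x) \<le> a" "\<And>x. norm (g x) \<le> b"
  using assms by (auto simp: bounded_iff)
 then have "norm (f x + g x) \<le> a + b" for x by (meson add_mono norm_triangle_le)
 then show ?thesis by (auto simp: bounded_iff)
qed

lemma bounded_range_mult:
 fixes f g :: "'a \<Rightarrow> 'b::real_normed_algebra"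
 assumes "bounded (range f)" "bounded (range g)"
 shows "bounded (range (\<lambda>x. f x * g x))"
proof -
 obtain a b where ab: "\<And>x. norm (f x) \<le> a" "\<And>x. norm (g x) \<le> b"
  using assms by (auto simp: bounded_iff)
 have "norm (f x * g x) \<le> a * b" for x
 proof -
  have "norm (f x * g x) \<le> norm (f x) * norm (g x)" by (rule norm_mult_ineq)
  also have "\<dots> \<le> a * b" using ab[of x] by (intro mult_mono) (auto intro: order_trans[OF norm_ge_zero])
  finally show ?thesis .
 qed
 then show ?thesis by (auto simp: bounded_iff)
qed

text \<open>All four closure conditions are linear in the function and hence pass from the
  generators to their span.\<close>

lemma schwartz_coinduct_span:
 assumes f: "f \<in> fspan W"
  and cont: "\<And>g. g \<in> W \<Longrightarrow> continuous_on UNIV g"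
  and bdd: "\<And>g. g \<in> W \<Longrightarrow> bounded (range g)"
  and deriv: "\<And>g X. g \<in> W \<Longrightarrow> one_param X \<Longrightarrow>
   \<exists>g'\<in>fspan W. \<forall>x. ((\<lambda>t. g (x + X t)) has_vector_derivative g' x) (at 0)"
  and mult: "\<And>g p. g \<in> W \<Longrightarrow> real_hom p \<Longrightarrow> (\<lambda>x. of_real (p x) * g x) \<in> fspan W"
 shows "f \<in> schwartz_space"
 using f
proof (rule schwartz_coinduct[of f "fspan W"])
 fix g assume g: "g \<in> fspan W"
 show "continuous_on UNIV g"
  using g by induction (simp_all add: cont continuous_on_add continuous_on_mult_left)
 show "bounded (range g)"
  using g by induction (simp_all add: bdd bounded_range_add bounded_range_mult)
 show "(\<lambda>x. of_real (p x) * g x) \<in> fspan W" if "real_hom p" for p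
  using g
 proof induction
  case (add f g)
  then show ?case using fspan.add by (fastforce simp: distrib_left)
 next
  case (scale f z)
  then show ?case using fspan.scale[of _ W z] by (fastforce simp: mult.left_commute)
 qed (use mult that in \<open>auto intro: fspan.zero\<close>)
 show "\<exists>g'\<in>fspan W. \<forall>x. ((\<lambda>t. g (x + X t)) has_vector_derivative g' x) (at 0)" if X: "one_param X" for X
  using g
 proof induction
  case zero
  show ?case by (intro bexI[of _ "\<lambda>_. 0"] fspan.zero) auto
 next
  case (add f g)
  then obtain f' g' where "f' \<in> fspan W" "g' \<in> fspan W"
   "\<And>x. ((\<lambda>t. f (x + X t)) has_vector_derivative f' x) (at 0)"
   "\<And>x. ((\<lambda>t. g (x + X t)) has_vector_derivative g' x) (at 0)" by blast
  then show ?case by (intro bexI[of _ "\<lambda>x. f' x + g' x"] fspan.add)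
    (auto intro!: has_vector_derivative_add)
 next
  case (scale f z)
  then obtain f' where "f' \<in> fspan W"
   "\<And>x. ((\<lambda>t. f (x + X t)) has_vector_derivative f' x) (at 0)" by blast
  then show ?case by (intro bexI[of _ "\<lambda>x. z * f' x"] fspan.scale)
    (auto intro!: has_vector_derivative_mult_right)
 qed (use deriv X in auto)
qed

lemma schwartz_continuous: "f \<in> schwartz_space \<Longrightarrow> continuous_on UNIV f"
proof -
 assume "f \<in> schwartz_space"
 then have "continuous_on UNIV (iter_deriv [] f)"
  unfolding schwartz_space_def smooth_fun_def by (auto dest: spec[of _ "[]"])
 then show ?thesis by (simp add: iter_deriv_def)
qed

lemma schwartz_bounded_weighted:
 "f \<in> schwartz_space \<Longrightarrow> list_all real_hom ps \<Longrightarrow> bounded (range (\<lambda>x. of_real (\<Prod>p\<leftarrow>ps. p x) * f x))"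
proof -
 assume "f \<in> schwartz_space" "list_all real_hom ps"
 then have "bounded (range (\<lambda>x. of_real (\<Prod>p\<leftarrow>ps. p x) * iter_deriv [] f x))"
  unfolding schwartz_space_def by (auto dest: spec[of _ "[]"])
 then show ?thesis by (simp add: iter_deriv_def)
qed

lemma schwartz_bounded: "f \<in> schwartz_space \<Longrightarrow> bounded (range f)"
 using schwartz_bounded_weighted[of f "[]"] by simp

lemma schwartz_has_deriv:
 assumes "f \<in> schwartz_space" "one_param X"
 shows "((\<lambda>t. f (x + X t)) has_vector_derivative dir_deriv X f x) (at 0)"
proof -
 have "(\<lambda>t. iter_deriv [] f (x + X t)) differentiable (at 0)"
  using assms unfolding schwartz_space_def smooth_fun_def by (auto dest: spec[of _ "[]"])
 then show ?thesis unfolding dir_deriv_def iter_deriv_def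
  by (simp add: vector_derivative_works)
qed

text \<open>\<open>foldr\<close> applies the last entry of the list first, so an initial derivative
  along X is the same as appending X.\<close>

lemma schwartz_dir_deriv:
 assumes f: "f \<in> schwartz_space" and X: "one_param X"
 shows "dir_deriv X f \<in> schwartz_space"
proof -
 have "iter_deriv Xs (dir_deriv X f) = iter_deriv (Xs @ [X]) f" for Xs
  by (simp add: iter_deriv_def)
 moreover have "list_all one_param (Xs @ [X])" if "list_all one_param Xs" for Xs using that X by simp
 ultimately show ?thesis
  using f unfolding schwartz_space_def smooth_fun_def by (simp del: list_all_append)
qed

lemma schwartz_has_deriv_at:
 assumes "f \<in> schwartz_space" "one_param X"
 shows "((\<lambda>t. f (x + X t)) has_vector_derivative dir_deriv X f (x + X s)) (at s)"
proof -
 have "((\<lambda>t. f ((x + X s) + X t)) has_vector_derivative dir_deriv X f (x + X s)) (at (s - s))"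
  using schwartz_has_deriv[OF assms, of "x + X s"] by simp
 moreover have "((\<lambda>t. t - s) has_vector_derivative 1) (at s)"
  by (auto intro!: derivative_eq_intros)
 ultimately have "(((\<lambda>t. f ((x + X s) + X t)) \<circ> (\<lambda>t. t - s)) has_vector_derivative 1 *\<^sub>R dir_deriv X f (x + X s)) (at s)"
  by (intro vector_diff_chain_at)
 moreover have "x + X s + X (t - s) = x + X t" for t
  using one_param_add[OF assms(2), of s "t - s"] by (simp add: add.assoc)
 ultimately show ?thesis by (simp add: o_def)
qed

lemma real_hom_has_deriv:
 assumes "real_hom p" "one_param X"
 shows "((\<lambda>t. complex_of_real (p (x + X t))) has_vector_derivative of_real (p (X 1))) (at 0)"
proof -
 have "p (x + X t) = p x + t * p (X 1)" for t
  using real_hom_one_param[OF assms(2,1), of t] by (simp add: real_hom_add[OF assms(1)])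
 then show ?thesis
  by (auto intro!: derivative_eq_intros simp: has_vector_derivative_of_real)
qed

text \<open>In \<open>schwartz_space\<close> the monomial multiplies after all derivatives; here it
  comes before them. Moving a derivative past p costs only the constant \<open>p (X 1)\<close>, so
  monomials times Schwartz functions span a stable set.\<close>

lemma schwartz_mult_real_hom:
 assumes f: "f \<in> schwartz_space" and p: "real_hom p"
 shows "(\<lambda>x. of_real (p x) * f x) \<in> schwartz_space"
proof -
 define W where "W = {\<lambda>x. of_real (\<Prod>p\<leftarrow>ps. p x) * f x | (ps :: ('a \<Rightarrow> real) list) f. list_all real_hom ps \<and> f \<in> schwartz_space}"
 have WI: "(\<lambda>x. of_real (\<Prod>p\<leftarrow>ps. p x) * f x) \<in> W" if "list_all real_hom ps" "f \<in> schwartz_space" for ps f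
  using that unfolding W_def by blast
 have mult: "(\<lambda>x. of_real (p x) * g x) \<in> W" if g: "g \<in> W" and p: "real_hom p" for g p
 proof -
  obtain ps f where "list_all real_hom ps" "f \<in> schwartz_space" "g = (\<lambda>x. of_real (\<Prod>p\<leftarrow>ps. p x) * f x)"
   using g unfolding W_def by blast
  then show ?thesis using WI[of "p # ps" f] p by (simp add: mult.assoc)
 qed
 have mults: "(\<lambda>x. of_real (p x) * g x) \<in> fspan W" if "g \<in> fspan W" and p: "real_hom p" for g p
  using that(1)
 proof induction
  case (add f g)
  then show ?case using fspan.add by (fastforce simp: distrib_left)
 next
  case (scale f z)
  then show ?case using fspan.scale[of _ W z] by (fastforce simp: mult.left_commute)
 qed (use mult p in \<open>auto intro: fspan.intros\<close>)
 have deriv: "\<exists>g'\<in>fspan W. \<forall>x. ((\<lambda>t. of_real (\<Prod>p\<leftarrow>ps. p (x + X t)) * f (x + X t)) has_vector_derivative g' x) (at 0)"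
  if "list_all real_hom ps" "f \<in> schwartz_space" and X: "one_param X" for ps :: "('a \<Rightarrow> real) list" and f X
  using that(1,2)
 proof (induction ps)
  case Nil
  then show ?case using WI[of "[]" "dir_deriv X f"] schwartz_dir_deriv[OF _ X] schwartz_has_deriv[OF _ X]
   by (intro bexI[of _ "dir_deriv X f"]) (auto intro: fspan.base)
 next
  case (Cons p ps)
  let ?h = "\<lambda>x. of_real (\<Prod>p\<leftarrow>ps. p x) * f x"
  have ps: "list_all real_hom ps" and p: "real_hom p" using Cons.prems by auto
  have h: "?h \<in> fspan W" using WI[OF ps Cons.prems(2)] by (rule fspan.base)
  obtain g' where g': "g' \<in> fspan W" "\<And>x. ((\<lambda>t. ?h (x + X t)) has_vector_derivative g' x) (at 0)"
   using Cons.IH[OF ps Cons.prems(2)] by blast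
  have "(\<lambda>x. of_real (p x) * g' x + of_real (p (X 1)) * ?h x) \<in> fspan W"
   by (rule fspan.add[OF mults[OF g'(1) p] fspan.scale[OF h]])
  moreover have "((\<lambda>t. of_real (p (x + X t)) * ?h (x + X t)) has_vector_derivative
    of_real (p (x + X 0)) * g' x + of_real (p (X 1)) * ?h (x + X 0)) (at 0)" for x
   by (rule has_vector_derivative_mult[OF real_hom_has_deriv[OF p X] g'(2)])
  ultimately show ?case
   by (intro bexI[of _ "\<lambda>x. of_real (p x) * g' x + of_real (p (X 1)) * ?h x"])
    (auto simp: mult.assoc one_param_0[OF X])
 qed
 show ?thesis
 proof (rule schwartz_coinduct_span[of _ W])
  show "(\<lambda>x. of_real (p x) * f x) \<in> fspan W" using WI[of "[p]" f] f p by (auto intro: fspan.base)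
 next
  fix g assume "g \<in> W"
  then obtain ps f where g: "list_all real_hom ps" "f \<in> schwartz_space" "g = (\<lambda>x. of_real (\<Prod>p\<leftarrow>ps. p x) * f x)"
   unfolding W_def by blast
  have "continuous_on UNIV (\<lambda>x. (\<Prod>p\<leftarrow>ps. p x))"
   using g(1) by (induction ps) (simp_all add: continuous_on_mult real_hom_continuous)
  then show "continuous_on UNIV g" unfolding g(3) by (intro continuous_intros schwartz_continuous g)
  show "bounded (range g)" unfolding g(3) by (rule schwartz_bounded_weighted[OF g(2,1)])
  show "\<exists>g'\<in>fspan W. \<forall>x. ((\<lambda>t. g (x + X t)) has_vector_derivative g' x) (at 0)" if "one_param X" for X
   using deriv[OF g(1,2) that] unfolding g(3) .
 qed (auto intro: fspan.base mult)
qed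

lemma schwartz_zero: "(\<lambda>_. 0) \<in> schwartz_space"
 by (rule schwartz_coinduct[of _ "{\<lambda>_. 0}"]) auto

lemma schwartz_add:
 fixes f g :: "'a::{topological_space, ab_group_add} \<Rightarrow> complex"
 assumes "f \<in> schwartz_space" "g \<in> schwartz_space"
 shows "(\<lambda>x. f x + g x) \<in> schwartz_space"
proof (rule schwartz_coinduct[of _ "{\<lambda>x. f x + g x | f g. f \<in> schwartz_space \<and> g \<in> schwartz_space}"])
 fix h :: "'a \<Rightarrow> complex" and X :: "real \<Rightarrow> 'a" assume "h \<in> {\<lambda>x. f x + g x | f g. f \<in> schwartz_space \<and> g \<in> schwartz_space}" and X: "one_param X"
 then obtain f g where fg: "f \<in> schwartz_space" "g \<in> schwartz_space" "h = (\<lambda>x. f x + g x)" by blast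
 show "\<exists>g'\<in>{\<lambda>x. f x + g x | f g. f \<in> schwartz_space \<and> g \<in> schwartz_space}.
   \<forall>x. ((\<lambda>t. h (x + X t)) has_vector_derivative g' x) (at 0)"
  using fg X by (intro bexI[of _ "\<lambda>x. dir_deriv X f x + dir_deriv X g x"])
   (auto intro!: has_vector_derivative_add schwartz_has_deriv schwartz_dir_deriv)
next
 fix h :: "'a \<Rightarrow> complex" and p :: "'a \<Rightarrow> real" assume "h \<in> {\<lambda>x. f x + g x | f g. f \<in> schwartz_space \<and> g \<in> schwartz_space}" and p: "real_hom p"
 then obtain f g where fg: "f \<in> schwartz_space" "g \<in> schwartz_space" "h = (\<lambda>x. f x + g x)" by blast
 have "(\<lambda>x. of_real (p x) * h x) = (\<lambda>x. of_real (p x) * f x + of_real (p x) * g x)"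
  by (simp add: fg distrib_left)
 then show "(\<lambda>x. of_real (p x) * h x) \<in> {\<lambda>x. f x + g x | f g. f \<in> schwartz_space \<and> g \<in> schwartz_space}"
  using schwartz_mult_real_hom[OF fg(1) p] schwartz_mult_real_hom[OF fg(2) p]
  by (intro CollectI exI[of _ "\<lambda>x. of_real (p x) * f x"] exI[of _ "\<lambda>x. of_real (p x) * g x"]) simp
qed (use assms in \<open>auto simp: continuous_on_add schwartz_continuous bounded_range_add schwartz_bounded\<close>)

text \<open>
 Multiplication by a bounded function whose logarithmic derivatives are purely imaginary affine
 functions: characters, and the pairing \<open>\<gamma>(t)\<close> on the phase space.
\<close>

lemma schwartz_phase:
 fixes f c :: "'a::{topological_space, ab_group_add} \<Rightarrow> complex"
 assumes f: "f \<in> schwartz_space" and c: "continuous_on UNIV c" "bounded (range c)"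
  and deriv: "\<And>X :: real \<Rightarrow> 'a. one_param X \<Longrightarrow> \<exists>q r. real_hom q \<and>
   (\<forall>x. ((\<lambda>t. c (x + X t)) has_vector_derivative \<i> * of_real (q x + r) * c x) (at 0))"
 shows "(\<lambda>x. c x * f x) \<in> schwartz_space"
proof (rule schwartz_coinduct_span[of _ "{\<lambda>x. c x * f x | f. f \<in> schwartz_space}"])
 fix h :: "'a \<Rightarrow> complex" and X :: "real \<Rightarrow> 'a" assume "h \<in> {\<lambda>x. c x * f x | f. f \<in> schwartz_space}" and X: "one_param X"
 then obtain f where f: "f \<in> schwartz_space" "h = (\<lambda>x. c x * f x)" by blast
 obtain q r where q: "real_hom q" and d: "\<And>x. ((\<lambda>t. c (x + X t)) has_vector_derivative \<i> * of_real (q x + r) * c x) (at 0)"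
  using deriv[OF X] by blast
 let ?W = "{\<lambda>x. c x * f x | f. f \<in> schwartz_space}"
 have W: "(\<lambda>x. c x * f x) \<in> fspan ?W" if "f \<in> schwartz_space" for f using that by (auto intro: fspan.base)
 have "(\<lambda>x. c x * dir_deriv X f x + (\<i> * (c x * (of_real (q x) * f x)) + \<i> * of_real r * (c x * f x))) \<in> fspan ?W"
  by (intro fspan.add fspan.scale W schwartz_mult_real_hom f q schwartz_dir_deriv X)
 moreover have "((\<lambda>t. c (x + X t) * f (x + X t)) has_vector_derivative
   (c (x + X 0) * dir_deriv X f x + \<i> * of_real (q x + r) * c x * f (x + X 0))) (at 0)" for x
  by (rule has_vector_derivative_mult[OF d schwartz_has_deriv[OF f(1) X]])
 ultimately show "\<exists>g'\<in>fspan ?W. \<forall>x. ((\<lambda>t. h (x + X t)) has_vector_derivative g' x) (at 0)"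
  unfolding f(2) by (intro bexI[of _ "\<lambda>x. c x * dir_deriv X f x + (\<i> * (c x * (of_real (q x) * f x)) + \<i> * of_real r * (c x * f x))"])
   (simp_all add: one_param_0[OF X] algebra_simps)
next
 fix h :: "'a \<Rightarrow> complex" and p :: "'a \<Rightarrow> real" assume "h \<in> {\<lambda>x. c x * f x | f. f \<in> schwartz_space}" and p: "real_hom p"
 then obtain f where f: "f \<in> schwartz_space" "h = (\<lambda>x. c x * f x)" by blast
 have "(\<lambda>x. of_real (p x) * h x) = (\<lambda>x. c x * (of_real (p x) * f x))" by (simp add: f mult_ac)
 then show "(\<lambda>x. of_real (p x) * h x) \<in> fspan {\<lambda>x. c x * f x | f. f \<in> schwartz_space}"
  using schwartz_mult_real_hom[OF f(1) p] by (auto intro!: fspan.base)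
next
 show "(\<lambda>x. c x * f x) \<in> fspan {\<lambda>x. c x * f x | f. f \<in> schwartz_space}"
  using f by (auto intro: fspan.base)
qed (use c in \<open>auto simp: continuous_on_mult schwartz_continuous bounded_range_mult schwartz_bounded\<close>)

lemma real_hom_const_0: "real_hom (\<lambda>_. 0)"
 by (simp add: real_hom_def)

text \<open>A constant is a phase with vanishing derivative.\<close>

lemma schwartz_scale:
 fixes f :: "'a::{topological_space, ab_group_add} \<Rightarrow> complex"
 assumes "f \<in> schwartz_space"
 shows "(\<lambda>x. z * f x) \<in> schwartz_space"
 using assms by (rule schwartz_phase)
  (auto intro!: exI[of _ "\<lambda>_. 0"] exI[of _ 0] simp: real_hom_const_0)

lemma schwartz_cnj:
 fixes f :: "'a::{topological_space, ab_group_add} \<Rightarrow> complex"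
 assumes "f \<in> schwartz_space"
 shows "(\<lambda>x. cnj (f x)) \<in> schwartz_space"
proof (rule schwartz_coinduct[of _ "{\<lambda>x. cnj (f x) | f. f \<in> schwartz_space}"])
 fix h :: "'a \<Rightarrow> complex" and X :: "real \<Rightarrow> 'a" assume "h \<in> {\<lambda>x. cnj (f x) | f. f \<in> schwartz_space}" and X: "one_param X"
 then obtain f where f: "f \<in> schwartz_space" "h = (\<lambda>x. cnj (f x))" by blast
 then show "\<exists>g'\<in>{\<lambda>x. cnj (f x) | f. f \<in> schwartz_space}. \<forall>x. ((\<lambda>t. h (x + X t)) has_vector_derivative g' x) (at 0)"
  using X by (intro bexI[of _ "\<lambda>x. cnj (dir_deriv X f x)"])
   (auto intro!: has_vector_derivative_cnj schwartz_has_deriv schwartz_dir_deriv)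
next
 fix h :: "'a \<Rightarrow> complex" and p :: "'a \<Rightarrow> real" assume "h \<in> {\<lambda>x. cnj (f x) | f. f \<in> schwartz_space}" and p: "real_hom p"
 then obtain f where f: "f \<in> schwartz_space" "h = (\<lambda>x. cnj (f x))" by blast
 have "(\<lambda>x. of_real (p x) * h x) = (\<lambda>x. cnj (of_real (p x) * f x))" by (simp add: f)
 then show "(\<lambda>x. of_real (p x) * h x) \<in> {\<lambda>x. cnj (f x) | f. f \<in> schwartz_space}"
  using schwartz_mult_real_hom[OF f(1) p]
  by (intro CollectI exI[of _ "\<lambda>x. of_real (p x) * f x"]) simp
next
 fix h :: "'a \<Rightarrow> complex" assume "h \<in> {\<lambda>x. cnj (f x) | f. f \<in> schwartz_space}"
 then obtain f where f: "f \<in> schwartz_space" "h = (\<lambda>x. cnj (f x))" by blast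
 show "continuous_on UNIV h" unfolding f by (intro continuous_intros schwartz_continuous f)
 show "bounded (range h)" unfolding f using schwartz_bounded[OF f(1)] by (auto simp: bounded_iff)
qed (use assms in auto)

lemma schwartz_mult:
 fixes f g :: "'a::{topological_space, ab_group_add} \<Rightarrow> complex"
 assumes "f \<in> schwartz_space" "g \<in> schwartz_space"
 shows "(\<lambda>x. f x * g x) \<in> schwartz_space"
proof (rule schwartz_coinduct_span[of _ "{\<lambda>x. f x * g x | f g. f \<in> schwartz_space \<and> g \<in> schwartz_space}"])
 let ?W = "{\<lambda>x. f x * g x | f g. f \<in> schwartz_space \<and> g \<in> schwartz_space}"
 have W: "(\<lambda>x. f x * g x) \<in> fspan ?W" if "f \<in> schwartz_space" "g \<in> schwartz_space" for f g
  using that by (auto intro: fspan.base)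
 {
  fix h :: "'a \<Rightarrow> complex" and X :: "real \<Rightarrow> 'a" assume "h \<in> ?W" and X: "one_param X"
  then obtain f g where fg: "f \<in> schwartz_space" "g \<in> schwartz_space" "h = (\<lambda>x. f x * g x)" by blast
  have "(\<lambda>x. f x * dir_deriv X g x + dir_deriv X f x * g x) \<in> fspan ?W"
   by (intro fspan.add W fg schwartz_dir_deriv X)
  moreover have "((\<lambda>t. f (x + X t) * g (x + X t)) has_vector_derivative
    (f (x + X 0) * dir_deriv X g x + dir_deriv X f x * g (x + X 0))) (at 0)" for x
   by (rule has_vector_derivative_mult[OF schwartz_has_deriv[OF fg(1) X] schwartz_has_deriv[OF fg(2) X]])
  ultimately show "\<exists>g'\<in>fspan ?W. \<forall>x. ((\<lambda>t. h (x + X t)) has_vector_derivative g' x) (at 0)"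
   unfolding fg(3) by (intro bexI[of _ "\<lambda>x. f x * dir_deriv X g x + dir_deriv X f x * g x"])
    (simp_all add: one_param_0[OF X])
 next
  fix h :: "'a \<Rightarrow> complex" and p :: "'a \<Rightarrow> real" assume "h \<in> ?W" and p: "real_hom p"
  then obtain f g where fg: "f \<in> schwartz_space" "g \<in> schwartz_space" "h = (\<lambda>x. f x * g x)" by blast
  then have "(\<lambda>x. of_real (p x) * h x) = (\<lambda>x. (of_real (p x) * f x) * g x)" by (simp add: mult_ac)
  then show "(\<lambda>x. of_real (p x) * h x) \<in> fspan ?W"
   using W[OF schwartz_mult_real_hom[OF fg(1) p] fg(2)] by simp
 next
  fix h :: "'a \<Rightarrow> complex" assume "h \<in> ?W"
  then obtain f g where fg: "f \<in> schwartz_space" "g \<in> schwartz_space" "h = (\<lambda>x. f x * g x)" by blast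
  show "continuous_on UNIV h" "bounded (range h)" unfolding fg
   by (intro continuous_intros schwartz_continuous fg bounded_range_mult schwartz_bounded)+
 }
 show "(\<lambda>x. f x * g x) \<in> fspan ?W" using assms by (rule W)
qed

text \<open>The map \<phi> carries one-parameter subgroups to one-parameter subgroups, and every
  real homomorphism on its domain is pulled back from the target up to a constant. Pullbacks of
  Schwartz functions therefore span a stable set. Translations, reflections and slices are of this
  kind.\<close>

lemma schwartz_pullback:
 fixes f :: "'k::{topological_space, ab_group_add} \<Rightarrow> complex"
  and \<phi> :: "'h::{topological_space, ab_group_add} \<Rightarrow> 'k"
 assumes f: "f \<in> schwartz_space" and cont: "continuous_on UNIV \<phi>"
  and X: "\<And>X. one_param X \<Longrightarrow> \<exists>Y. one_param Y \<and> (\<forall>x t. \<phi> (x + X t) = \<phi> x + Y t)"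
  and p: "\<And>p. real_hom p \<Longrightarrow> \<exists>p' c. real_hom p' \<and> (\<forall>x. p x = p' (\<phi> x) + c)"
 shows "(\<lambda>x. f (\<phi> x)) \<in> schwartz_space"
proof (rule schwartz_coinduct_span[of _ "{\<lambda>x. f (\<phi> x) | f. f \<in> schwartz_space}"])
 let ?W = "{\<lambda>x. f (\<phi> x) | f. f \<in> schwartz_space}"
 have W: "(\<lambda>x. f (\<phi> x)) \<in> fspan ?W" if "f \<in> schwartz_space" for f
  using that by (auto intro: fspan.base)
 {
  fix h and X :: "real \<Rightarrow> 'h" assume "h \<in> ?W" "one_param X"
  then obtain f where f: "f \<in> schwartz_space" "h = (\<lambda>x. f (\<phi> x))" by blast
  obtain Y where Y: "one_param Y" "\<And>x t. \<phi> (x + X t) = \<phi> x + Y t" using X \<open>one_param X\<close> by blast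
  have "\<forall>x. ((\<lambda>t. h (x + X t)) has_vector_derivative dir_deriv Y f (\<phi> x)) (at 0)"
   unfolding f(2) Y(2) using schwartz_has_deriv[OF f(1) Y(1)] by blast
  then show "\<exists>g'\<in>fspan ?W. \<forall>x. ((\<lambda>t. h (x + X t)) has_vector_derivative g' x) (at 0)"
   using W[OF schwartz_dir_deriv[OF f(1) Y(1)]] by (intro bexI)
 next
  fix h and q :: "'h \<Rightarrow> real" assume "h \<in> ?W" and q: "real_hom q"
  then obtain f where f: "f \<in> schwartz_space" "h = (\<lambda>x. f (\<phi> x))" by blast
  obtain q' c where "real_hom q'" and c: "\<forall>x. q x = q' (\<phi> x) + c" using p[OF q] by blast
  then have "(\<lambda>x. of_real (q' (\<phi> x)) * f (\<phi> x) + of_real c * f (\<phi> x)) \<in> fspan ?W"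
   by (intro fspan.add fspan.scale W f schwartz_mult_real_hom)
  then show "(\<lambda>x. of_real (q x) * h x) \<in> fspan ?W" by (simp add: f(2) c distrib_right)
 next
  fix h :: "'h \<Rightarrow> complex" assume "h \<in> ?W"
  then obtain f where f: "f \<in> schwartz_space" "h = (\<lambda>x. f (\<phi> x))" by blast
  show "continuous_on UNIV h" unfolding f
   by (rule continuous_on_compose2[OF schwartz_continuous[OF f(1)] cont]) simp
  show "bounded (range h)" unfolding f using schwartz_bounded[OF f(1)] by (rule bounded_subset) auto
 }
 show "(\<lambda>x. f (\<phi> x)) \<in> fspan ?W" using f by (rule W)
qed

lemma schwartz_translate:
 fixes f :: "'h::topological_ab_group_add \<Rightarrow> complex"
 assumes f: "f \<in> schwartz_space"
 shows "(\<lambda>x. f (x + a)) \<in> schwartz_space"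
proof (rule schwartz_pullback[OF f])
 show "continuous_on UNIV (\<lambda>x. x + a)" by (intro continuous_intros)
 show "\<exists>Y. one_param Y \<and> (\<forall>x t. x + X t + a = x + a + Y t)" if "one_param X" for X
  using that by (intro exI[of _ X]) (simp add: ac_simps)
 show "\<exists>p' c. real_hom p' \<and> (\<forall>x. p x = p' (x + a) + c)" if "real_hom p" for p
  using that by (intro exI[of _ p] exI[of _ "- p a"]) (simp add: real_hom_add)
qed

lemma one_param_minus:
 fixes X :: "real \<Rightarrow> 'h::topological_ab_group_add"
 shows "one_param X \<Longrightarrow> one_param (\<lambda>t. - X t)"
 by (auto simp: one_param_def intro!: continuous_intros)

lemma schwartz_reflect:
 fixes f :: "'h::topological_ab_group_add \<Rightarrow> complex"
 assumes f: "f \<in> schwartz_space"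
 shows "(\<lambda>x. f (- x)) \<in> schwartz_space"
proof (rule schwartz_pullback[OF f])
 show "continuous_on UNIV (uminus :: 'h \<Rightarrow> 'h)" by (intro continuous_intros)
 show "\<exists>Y. one_param Y \<and> (\<forall>x t. - (x + X t) = - x + Y t)" if "one_param X" for X :: "real \<Rightarrow> 'h"
  using one_param_minus[OF that] by (intro exI[of _ "\<lambda>t. - X t"]) simp
 show "\<exists>p' c. real_hom p' \<and> (\<forall>x. p x = p' (- x) + c)" if "real_hom p" for p :: "'h \<Rightarrow> real"
  using that by (intro exI[of _ "\<lambda>x. - p x"] exI[of _ 0])
   (auto simp: real_hom_minus real_hom_def intro!: continuous_intros)
qed

lemma real_hom_compose_fst: "real_hom p \<Longrightarrow> real_hom (\<lambda>z. p (fst z))"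
 by (auto simp: real_hom_def intro!: continuous_on_compose2[of UNIV p] continuous_intros)

lemma real_hom_compose_snd: "real_hom p \<Longrightarrow> real_hom (\<lambda>z. p (snd z))"
 by (auto simp: real_hom_def intro!: continuous_on_compose2[of UNIV p] continuous_intros)

lemma real_hom_slice_fst: "real_hom p \<Longrightarrow> real_hom (\<lambda>x. p (x, 0 :: 'b::{topological_space, ab_group_add}))"
 unfolding real_hom_def
 by (auto intro!: continuous_on_compose2[of UNIV p] continuous_intros) (metis add_Pair add_0)

lemma real_hom_slice_snd: "real_hom p \<Longrightarrow> real_hom (\<lambda>x. p (0 :: 'b::{topological_space, ab_group_add}, x))"
 unfolding real_hom_def
 by (auto intro!: continuous_on_compose2[of UNIV p] continuous_intros) (metis add_Pair add_0)

lemma real_hom_Pair: "real_hom p \<Longrightarrow> p z = p (fst z, 0) + p (0, snd z)"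
 using real_hom_add[of p "(fst z, 0)" "(0, snd z)"] by simp

lemma one_param_fst: "one_param X \<Longrightarrow> one_param (\<lambda>t. fst (X t))"
 by (auto simp: one_param_def intro!: continuous_intros)

lemma one_param_snd: "one_param X \<Longrightarrow> one_param (\<lambda>t. snd (X t))"
 by (auto simp: one_param_def intro!: continuous_intros)

lemma schwartz_slice_snd:
 fixes f :: "'a::{topological_space, ab_group_add} \<times> 'b::{topological_space, ab_group_add} \<Rightarrow> complex"
 assumes f: "f \<in> schwartz_space"
 shows "(\<lambda>x. f (a, x)) \<in> schwartz_space"
proof (rule schwartz_pullback[OF f])
 show "continuous_on UNIV (\<lambda>x. (a, x))" by (intro continuous_intros)
 show "\<exists>Y. one_param Y \<and> (\<forall>x t. (a, x + X t) = (a, x) + Y t)" if "one_param X" for X :: "real \<Rightarrow> 'b"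
  using that by (intro exI[of _ "\<lambda>t. (0, X t)"]) (auto simp: one_param_def intro!: continuous_intros)
 show "\<exists>p' c. real_hom p' \<and> (\<forall>x. p x = p' (a, x) + c)" if "real_hom p" for p :: "'b \<Rightarrow> real"
  using real_hom_compose_snd[OF that] by (intro exI[of _ "\<lambda>z. p (snd z)"] exI[of _ 0]) simp
qed

section \<open>Differentiation and continuity of parameter integrals\<close>

text \<open>Difference quotients along sequences are the form in which dominated convergence can be
  applied.\<close>

lemma has_vector_derivative_iff_quotient:
 fixes f :: "real \<Rightarrow> 'a::real_normed_vector"
 shows "(f has_vector_derivative D) (at 0) \<longleftrightarrow> ((\<lambda>s. (f s - f 0) /\<^sub>R s) \<longlongrightarrow> D) (at 0)"
proof -
 have "norm (f y - f 0 - y *\<^sub>R D) / norm y = norm ((f y - f 0) /\<^sub>R y - D)" if "y \<noteq> 0" for y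
 proof -
  have "(f y - f 0) /\<^sub>R y - D = (f y - f 0 - y *\<^sub>R D) /\<^sub>R y"
   using that by (simp add: scaleR_diff_right)
  then show ?thesis by (simp add: divide_inverse_commute)
 qed
 then have "((\<lambda>y. norm (f y - f 0 - y *\<^sub>R D) / norm y) \<longlongrightarrow> 0) (at 0) \<longleftrightarrow>
   ((\<lambda>y. norm ((f y - f 0) /\<^sub>R y - D)) \<longlongrightarrow> 0) (at 0)"
  by (intro Lim_cong_within) auto
 also have "\<dots> \<longleftrightarrow> ((\<lambda>s. (f s - f 0) /\<^sub>R s) \<longlongrightarrow> D) (at 0)"
  by (metis (no_types) Lim_null tendsto_norm_zero_iff)
 finally show ?thesis
  unfolding has_vector_derivative_def has_derivative_iff_norm
  by (simp add: bounded_linear_scaleR_left)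
qed

text \<open>The mean value inequality on [-1, 1] bounds every difference quotient by b, so dominated
  convergence gives the derivative of the integral.\<close>

lemma integral_has_vector_derivative_param:
 fixes \<phi> :: "'a \<Rightarrow> real \<Rightarrow> complex"
 assumes int: "\<And>s. integrable M (\<lambda>h. \<phi> h s)"
  and d: "\<And>h s. (\<phi> h has_vector_derivative \<phi>' h s) (at s)"
  and b: "integrable M b" "\<And>h s. \<bar>s\<bar> \<le> 1 \<Longrightarrow> norm (\<phi>' h s) \<le> b h"
  and meas: "(\<lambda>h. \<phi>' h 0) \<in> borel_measurable M"
 shows "((\<lambda>s. \<integral>h. \<phi> h s \<partial>M) has_vector_derivative (\<integral>h. \<phi>' h 0 \<partial>M)) (at 0)"
 unfolding has_vector_derivative_iff_quotient tendsto_at_iff_sequentially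
proof (intro allI impI)
 fix X :: "nat \<Rightarrow> real" assume X: "\<forall>i. X i \<in> UNIV - {0}" "X \<longlonglongrightarrow> 0"
 then have "eventually (\<lambda>n. \<bar>X n\<bar> < 1) sequentially"
  by (auto simp: tendsto_iff dist_real_def)
 \<comment> \<open>The sequence tends to 0 but may start outside [-1, 1], where b gives no bound; a
   shift by N does not affect the limit.\<close>
 then obtain N where N: "\<And>n. n \<ge> N \<Longrightarrow> \<bar>X n\<bar> \<le> 1" by (force simp: eventually_sequentially)
 have bound: "norm (\<phi> h s - \<phi> h 0) \<le> b h * \<bar>s\<bar>" if "\<bar>s\<bar> \<le> 1" for h s
 proof -
  have "norm (\<phi> h s - \<phi> h 0) \<le> b h * norm (s - 0)"
  proof (rule differentiable_bound[of "{-1..1}" _ "\<lambda>s x. x *\<^sub>R \<phi>' h s"])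
   show "(\<phi> h has_derivative (\<lambda>x. x *\<^sub>R \<phi>' h s)) (at s within {-1..1})" for s
    using d[of h s] has_vector_derivative_def has_derivative_at_withinI by blast
   show "onorm (\<lambda>x. x *\<^sub>R \<phi>' h s) \<le> b h" if "s \<in> {-1..1}" for s
    using b(2)[of s h] that onorm_scaleR_left[of "\<lambda>x::real. x" "\<phi>' h s"]
    by (simp add: onorm_id abs_le_iff bounded_linear_ident)
  qed (use that in auto)
  then show ?thesis by simp
 qed
 have "(\<lambda>n. \<integral>h. (\<phi> h (X (n + N)) - \<phi> h 0) /\<^sub>R X (n + N) \<partial>M) \<longlonglongrightarrow> (\<integral>h. \<phi>' h 0 \<partial>M)"
 proof (rule integral_dominated_convergence[where w = b])
  show "(\<lambda>h. (\<phi> h (X (n + N)) - \<phi> h 0) /\<^sub>R X (n + N)) \<in> borel_measurable M" for n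
   using borel_measurable_integrable[OF int] by measurable
  show "AE h in M. (\<lambda>n. (\<phi> h (X (n + N)) - \<phi> h 0) /\<^sub>R X (n + N)) \<longlonglongrightarrow> \<phi>' h 0"
  proof (rule AE_I2)
   fix h
   have "((\<lambda>s. (\<phi> h s - \<phi> h 0) /\<^sub>R s) \<longlongrightarrow> \<phi>' h 0) (at 0)"
    using d[of h 0] unfolding has_vector_derivative_iff_quotient .
   then have "((\<lambda>s. (\<phi> h s - \<phi> h 0) /\<^sub>R s) \<circ> X) \<longlonglongrightarrow> \<phi>' h 0"
    using X unfolding tendsto_at_iff_sequentially by blast
   from LIMSEQ_ignore_initial_segment[OF this, of N]
   show "(\<lambda>n. (\<phi> h (X (n + N)) - \<phi> h 0) /\<^sub>R X (n + N)) \<longlonglongrightarrow> \<phi>' h 0" by (simp add: o_def)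
  qed
  show "AE h in M. norm ((\<phi> h (X (n + N)) - \<phi> h 0) /\<^sub>R X (n + N)) \<le> b h" for n
  proof (rule AE_I2)
   fix h
   have "X (n + N) \<noteq> 0" using X by auto
   then show "norm ((\<phi> h (X (n + N)) - \<phi> h 0) /\<^sub>R X (n + N)) \<le> b h"
    using bound[of "X (n + N)" h] N[of "n + N"]
    by (simp add: divide_inverse_commute[symmetric] divide_le_eq)
  qed
 qed (use b meas in auto)
 then have "(\<lambda>n. ((\<integral>h. \<phi> h (X (n + N)) \<partial>M) - (\<integral>h. \<phi> h 0 \<partial>M)) /\<^sub>R X (n + N)) \<longlonglongrightarrow> (\<integral>h. \<phi>' h 0 \<partial>M)"
  by (simp add: int)
 then show "((\<lambda>s. ((\<integral>h. \<phi> h s \<partial>M) - (\<integral>h. \<phi> h 0 \<partial>M)) /\<^sub>R s) \<circ> X) \<longlonglongrightarrow> (\<integral>h. \<phi>' h 0 \<partial>M)"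
  unfolding o_def by (rule LIMSEQ_offset)
qed

lemma continuous_on_integral_param:
 fixes \<phi> :: "'b \<Rightarrow> 'a::topological_space \<Rightarrow> complex"
 assumes cb: "countably_based TYPE('a)"
  and cont: "\<And>h. continuous_on UNIV (\<phi> h)" and meas: "\<And>x. (\<lambda>h. \<phi> h x) \<in> borel_measurable M"
  and b: "integrable M b" "\<And>h x. norm (\<phi> h x) \<le> b h"
 shows "continuous_on UNIV (\<lambda>x. \<integral>h. \<phi> h x \<partial>M)"
proof (rule countably_based_continuousI[OF cb])
 fix X x assume X: "X \<longlonglongrightarrow> (x :: 'a)"
 show "(\<lambda>n. \<integral>h. \<phi> h (X n) \<partial>M) \<longlonglongrightarrow> (\<integral>h. \<phi> h x \<partial>M)"
 proof (rule integral_dominated_convergence[where w = b])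
  show "AE h in M. (\<lambda>n. \<phi> h (X n)) \<longlonglongrightarrow> \<phi> h x"
   using cont X by (auto simp: continuous_on_UNIV_nhds intro: filterlim_compose)
 qed (use meas b in auto)
qed

section \<open>Haar measures with an integrable polynomial weight\<close>

lemma sets_pair_borel:
 assumes "sets M1 = sets (borel :: 'a::topological_space measure)"
  "sets M2 = sets (borel :: 'b::topological_space measure)" "countably_based TYPE('a)"
 shows "sets (M1 \<Otimes>\<^sub>M M2) = sets borel"
 using sets_pair_measure_cong[OF assms(1,2)] sets_borel_prod[OF assms(3)] by simp

lemma measurable_pair_continuous:
 fixes f :: "'a::topological_space \<times> 'b::topological_space \<Rightarrow> 'c::topological_space"
 assumes "sets M1 = sets (borel :: 'a measure)" "sets M2 = sets (borel :: 'b measure)" "countably_based TYPE('a)"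
  and "continuous_on UNIV f"
 shows "f \<in> borel_measurable (M1 \<Otimes>\<^sub>M M2)"
 using borel_measurable_continuous_onI[OF assms(4)] measurable_cong_sets[OF sets_pair_borel[OF assms(1-3)] refl]
 by blast

text \<open>What the analysis uses of an elementary group, phrased so that it holds for the group,
  its dual and their products alike. \<open>weight\<close> makes Schwartz functions integrable,
  \<open>proper\<close> gives tightness of finite densities, \<open>growth\<close> lets the listed
  homomorphisms dominate all polynomials, and \<open>basis\<close> gives access to sequences and to
  Borel sets of products.\<close>

locale schwartz_group =
 fixes M :: "'h::topological_ab_group_add measure" and Ps :: "('h \<Rightarrow> real) list"
 assumes sets_M [simp, measurable_cong]: "sets M = sets borel"
  and invariant: "A \<in> sets borel \<Longrightarrow> emeasure M ((\<lambda>y. x + y) ` A) = emeasure M A"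
  and homs: "list_all real_hom Ps"
  and weight: "(\<integral>\<^sup>+x. ennreal (\<Prod>p\<leftarrow>Ps. 1 / (1 + (p x)\<^sup>2)) \<partial>M) < \<infinity>"
  and nonempty_open: "open U \<Longrightarrow> U \<noteq> {} \<Longrightarrow> emeasure M U > 0"
  and basis: "countably_based TYPE('h)"
  and proper: "compact {x. \<forall>p\<in>set Ps. \<bar>p x\<bar> \<le> c}"
  and growth: "real_hom p \<Longrightarrow> \<exists>C. \<forall>x. \<bar>p x\<bar> \<le> C * (1 + (\<Sum>q\<leftarrow>Ps. \<bar>q x\<bar>))"
begin

lemma space_M [simp]: "space M = UNIV"
 using sets_eq_imp_space_eq[OF sets_M] by simp

lemma cont_meas: "continuous_on UNIV f \<Longrightarrow> f \<in> borel_measurable M"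
 using borel_measurable_continuous_onI by (simp add: measurable_cong_sets[OF sets_M refl])

lemma cont_meas_M: "continuous_on UNIV f \<Longrightarrow> f \<in> M \<rightarrow>\<^sub>M M"
 using cont_meas by (simp add: measurable_cong_sets[OF refl sets_M])

lemma measurable_ops [measurable]:
 "(\<lambda>x. x + a) \<in> M \<rightarrow>\<^sub>M M" "(\<lambda>x. a + x) \<in> M \<rightarrow>\<^sub>M M" "(\<lambda>x. x - a) \<in> M \<rightarrow>\<^sub>M M" "(\<lambda>x. a - x) \<in> M \<rightarrow>\<^sub>M M" "uminus \<in> M \<rightarrow>\<^sub>M M"
 by (intro cont_meas_M continuous_intros)+

lemma measurable_pair_cont:
 assumes "sets N = sets (borel :: 'b::topological_space measure)" "continuous_on UNIV f"
 shows "f \<in> borel_measurable (M \<Otimes>\<^sub>M N)"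
 by (rule measurable_pair_continuous[OF sets_M assms(1) basis assms(2)])

lemma measurable_pair_ops [measurable]:
 "(\<lambda>z. fst z + snd z) \<in> M \<Otimes>\<^sub>M M \<rightarrow>\<^sub>M M" "(\<lambda>z. fst z - snd z) \<in> M \<Otimes>\<^sub>M M \<rightarrow>\<^sub>M M"
 "(\<lambda>z. snd z + fst z) \<in> M \<Otimes>\<^sub>M M \<rightarrow>\<^sub>M M" "(\<lambda>z. snd z - fst z) \<in> M \<Otimes>\<^sub>M M \<rightarrow>\<^sub>M M"
proof -
 have "(\<lambda>z. fst z + snd z) \<in> M \<Otimes>\<^sub>M M \<rightarrow>\<^sub>M (borel :: 'h measure)" "(\<lambda>z. fst z - snd z) \<in> M \<Otimes>\<^sub>M M \<rightarrow>\<^sub>M (borel :: 'h measure)"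
  "(\<lambda>z. snd z + fst z) \<in> M \<Otimes>\<^sub>M M \<rightarrow>\<^sub>M (borel :: 'h measure)" "(\<lambda>z. snd z - fst z) \<in> M \<Otimes>\<^sub>M M \<rightarrow>\<^sub>M (borel :: 'h measure)"
  by (intro measurable_pair_cont sets_M continuous_intros)+
 then show "(\<lambda>z. fst z + snd z) \<in> M \<Otimes>\<^sub>M M \<rightarrow>\<^sub>M M" "(\<lambda>z. fst z - snd z) \<in> M \<Otimes>\<^sub>M M \<rightarrow>\<^sub>M M"
  "(\<lambda>z. snd z + fst z) \<in> M \<Otimes>\<^sub>M M \<rightarrow>\<^sub>M M" "(\<lambda>z. snd z - fst z) \<in> M \<Otimes>\<^sub>M M \<rightarrow>\<^sub>M M"
  by (simp_all add: measurable_cong_sets[OF refl sets_M])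
qed

definition wt :: "'h \<Rightarrow> real" where "wt x = (\<Prod>p\<leftarrow>Ps. 1 / (1 + (p x)\<^sup>2))"

lemma wt_pos: "wt x > 0"
proof -
 have "(\<Prod>p\<leftarrow>ps. 1 / (1 + (p x)\<^sup>2)) > 0" for ps :: "('h \<Rightarrow> real) list"
  by (induction ps) (auto intro!: divide_pos_pos mult_pos_pos add_pos_nonneg)
 then show ?thesis by (simp add: wt_def)
qed

lemma wt_continuous: "continuous_on UNIV wt"
proof -
 have "continuous_on UNIV (\<lambda>x. \<Prod>p\<leftarrow>ps. 1 / (1 + (p x)\<^sup>2))" if "list_all real_hom ps" for ps :: "('h \<Rightarrow> real) list"
  using that
 proof (induction ps)
  case (Cons p ps)
  have "1 + (p x)\<^sup>2 \<noteq> 0" for x by (metis add_pos_nonneg less_irrefl zero_le_power2 zero_less_one)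
  with Cons show ?case by (auto intro!: continuous_on_mult continuous_on_divide continuous_on_add continuous_on_power simp: real_hom_continuous)
 qed simp
 then show ?thesis using homs by (simp add: wt_def[abs_def])
qed

lemma wt_meas [measurable]: "wt \<in> borel_measurable M"
 by (intro cont_meas wt_continuous)

lemma wt_integrable: "integrable M wt"
 using weight wt_pos by (intro integrableI_nonneg) (auto simp: wt_def[symmetric] less_imp_le)

text \<open>The superlevel sets of the weight have finite measure by Markov's inequality, and they
  exhaust the group because the weight is positive everywhere.\<close>

sublocale sigma_finite_measure M
proof
 define A where "A = range (\<lambda>n::nat. {x. wt x \<ge> 1 / real (Suc n)})"
 have "emeasure M {x. wt x \<ge> 1 / real (Suc n)} \<noteq> \<infinity>" for n
 proof -
  have "1 \<le> ennreal (real (Suc n)) * ennreal (wt x) \<longleftrightarrow> 1 / real (Suc n) \<le> wt x" for x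
  proof -
   have "1 \<le> ennreal (real (Suc n)) * ennreal (wt x) \<longleftrightarrow> 1 \<le> real (Suc n) * wt x"
    using wt_pos[of x] by (simp add: ennreal_mult[symmetric] less_imp_le ennreal_ge_1 del: of_nat_Suc)
   also have "\<dots> \<longleftrightarrow> 1 / real (Suc n) \<le> wt x" by (simp add: divide_le_eq mult.commute del: of_nat_Suc)
   finally show ?thesis .
  qed
  then have "emeasure M {x. wt x \<ge> 1 / real (Suc n)} \<le> ennreal (real (Suc n)) * (\<integral>\<^sup>+x. ennreal (wt x) * indicator UNIV x \<partial>M)"
   using nn_integral_Markov_inequality[of wt UNIV M "ennreal (real (Suc n))"] by simp
  also have "\<dots> < \<infinity>"
   using weight by (simp add: wt_def ennreal_mult_less_top)
  finally show ?thesis by simp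
 qed
 moreover have "\<Union>A = UNIV"
 proof -
  have "\<exists>n. wt x \<ge> 1 / real (Suc n)" for x
   using reals_Archimedean[OF wt_pos[of x]] unfolding inverse_eq_divide by (meson less_imp_le)
  then show ?thesis by (auto simp: A_def)
 qed
 ultimately show "\<exists>A. countable A \<and> A \<subseteq> sets M \<and> \<Union>A = space M \<and> (\<forall>a\<in>A. emeasure M a \<noteq> \<infinity>)"
  using wt_meas by (intro exI[of _ A]) (auto simp: A_def simp flip: space_M)
qed

lemma distr_translate: "distr M M (\<lambda>x. x + a) = M"
proof (rule measure_eqI)
 fix A assume "A \<in> sets (distr M M (\<lambda>x. x + a))"
 then have A: "A \<in> sets borel" "A \<in> sets M" by simp_all
 have "(\<lambda>x. x + a) -` A \<inter> space M = (\<lambda>y. - a + y) ` A"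
  by (auto intro!: image_eqI[of _ _ "_ + a"])
 then show "emeasure (distr M M (\<lambda>x. x + a)) A = emeasure M A"
  using invariant[OF A(1), of "-a"] A by (subst emeasure_distr) auto
qed simp

lemma nn_integral_translate: "f \<in> borel_measurable M \<Longrightarrow> (\<integral>\<^sup>+x. f (x + a) \<partial>M) = (\<integral>\<^sup>+x. f x \<partial>M)"
 using nn_integral_distr[of "\<lambda>x. x + a" M M f] by (simp add: distr_translate)

text \<open>The uniqueness argument for Haar measures in miniature: the double integral of f(x) g(x
  - y) is the integral of f times that of g(-y) in one order, and the integral of f times that of g
  in the other. The weight serves as f, since its integral is finite and nonzero and may be
  cancelled.\<close>

lemma distr_uminus: "distr M M uminus = M"
proof (rule measure_eqI)
 fix A assume "A \<in> sets (distr M M uminus)"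
 then have A [measurable]: "A \<in> sets M" by simp
 define f :: "'h \<Rightarrow> ennreal" where "f = (\<lambda>x. ennreal (wt x))"
 define g :: "'h \<Rightarrow> ennreal" where "g = indicator A"
 have fg [measurable]: "f \<in> borel_measurable M" "g \<in> borel_measurable M" by (simp_all add: f_def g_def)
 have f: "(\<integral>\<^sup>+x. f x \<partial>M) \<noteq> \<infinity>" "(\<integral>\<^sup>+x. f x \<partial>M) \<noteq> 0"
 proof -
  show "(\<integral>\<^sup>+x. f x \<partial>M) \<noteq> \<infinity>" using weight by (simp add: f_def wt_def)
  have "f x \<noteq> 0" for x using wt_pos[of x] by (simp add: f_def)
  then have "(\<integral>\<^sup>+x. f x \<partial>M) = 0 \<longleftrightarrow> (AE x in M. False)" by (subst nn_integral_0_iff_AE) auto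
  also have "\<dots> \<longleftrightarrow> emeasure M UNIV = 0" using AE_iff_null_sets[of UNIV M] by (auto simp: null_sets_def)
  finally show "(\<integral>\<^sup>+x. f x \<partial>M) \<noteq> 0" using nonempty_open[of UNIV] by auto
 qed
 interpret P: pair_sigma_finite M M ..
 have "(\<integral>\<^sup>+x. f x \<partial>M) * (\<integral>\<^sup>+y. g (- y) \<partial>M) = (\<integral>\<^sup>+x. (\<integral>\<^sup>+y. f x * g (x - y) \<partial>M) \<partial>M)"
 proof -
  have "(\<integral>\<^sup>+y. f x * g (x - y) \<partial>M) = f x * (\<integral>\<^sup>+y. g (- y) \<partial>M)" for x
   using nn_integral_translate[of "\<lambda>y. g (x - y)" x] by (simp add: nn_integral_cmult)
  then show ?thesis by (simp add: nn_integral_multc)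
 qed
 also have "\<dots> = (\<integral>\<^sup>+y. (\<integral>\<^sup>+x. f x * g (x - y) \<partial>M) \<partial>M)"
  by (rule P.Fubini') measurable
 also have "\<dots> = (\<integral>\<^sup>+y. (\<integral>\<^sup>+x. f (x + y) * g x \<partial>M) \<partial>M)"
  using nn_integral_translate[of "\<lambda>x. f x * g (x - y)" y for y] by simp
 also have "\<dots> = (\<integral>\<^sup>+x. (\<integral>\<^sup>+y. f (x + y) * g x \<partial>M) \<partial>M)"
  by (rule P.Fubini') measurable
 also have "\<dots> = (\<integral>\<^sup>+x. f x \<partial>M) * (\<integral>\<^sup>+x. g x \<partial>M)"
 proof -
  have "(\<integral>\<^sup>+y. f (x + y) * g x \<partial>M) = (\<integral>\<^sup>+x. f x \<partial>M) * g x" for x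
   using nn_integral_translate[of f x] by (simp add: nn_integral_multc add.commute)
  then show ?thesis by (simp add: nn_integral_cmult)
 qed
 finally have "(\<integral>\<^sup>+y. g (- y) \<partial>M) = (\<integral>\<^sup>+x. g x \<partial>M)"
  using f by (auto simp: ennreal_mult_cancel_left)
 moreover have "(\<integral>\<^sup>+y. g (- y) \<partial>M) = (\<integral>\<^sup>+x. g x \<partial>distr M M uminus)"
  by (subst nn_integral_distr) auto
 ultimately show "emeasure (distr M M uminus) A = emeasure M A"
  using A by (simp add: g_def)
qed simp

lemma integral_translate:
 fixes f :: "'h \<Rightarrow> complex"
 shows "f \<in> borel_measurable M \<Longrightarrow> (\<integral>x. f (x + a) \<partial>M) = (\<integral>x. f x \<partial>M)"
 using integral_distr[of "\<lambda>x. x + a" M M f] by (simp add: distr_translate)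

lemma integral_reflect:
 fixes f :: "'h \<Rightarrow> complex"
 shows "f \<in> borel_measurable M \<Longrightarrow> (\<integral>x. f (- x) \<partial>M) = (\<integral>x. f x \<partial>M)"
 using integral_distr[of uminus M M f] by (simp add: distr_uminus)

lemma integrable_translate:
 fixes f :: "'h \<Rightarrow> 'b::{banach, second_countable_topology}"
 shows "integrable M f \<Longrightarrow> integrable M (\<lambda>x. f (x + a))"
 using integrable_distr_eq[of "\<lambda>x. x + a" M M f] by (simp add: distr_translate)

lemma AE_translate: "AE x in M. P x \<Longrightarrow> AE x in M. P (x + a)"
proof -
 assume "AE x in M. P x"
 then have "AE x in distr M M (\<lambda>x. x + a). P x" unfolding distr_translate .
 then show "AE x in M. P (x + a)" by (rule AE_distrD[OF measurable_ops(1)])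
qed

lemma schwartz_meas: "f \<in> schwartz_space \<Longrightarrow> f \<in> borel_measurable M"
 by (intro cont_meas schwartz_continuous)

text \<open>Multiplying by the factors 1 + (p x)^2 one after another stays inside the Schwartz
  space, and the final product is bounded; dividing it back out leaves the weight.\<close>

lemma schwartz_wt_bound:
 assumes "f \<in> schwartz_space"
 shows "\<exists>C\<ge>0. \<forall>x. norm (f x) \<le> C * wt x"
proof -
 have "(\<lambda>x. of_real (\<Prod>p\<leftarrow>ps. 1 + (p x)\<^sup>2) * f x) \<in> schwartz_space"
  if "list_all real_hom ps" for ps :: "('h \<Rightarrow> real) list"
  using that
 proof (induction ps)
  case (Cons p ps)
  let ?g = "\<lambda>x. of_real (\<Prod>p\<leftarrow>ps. 1 + (p x)\<^sup>2) * f x"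
  have g: "?g \<in> schwartz_space" and p: "real_hom p" using Cons by auto
  have "(\<lambda>x. ?g x + of_real (p x) * (of_real (p x) * ?g x)) \<in> schwartz_space"
   by (rule schwartz_add[OF g schwartz_mult_real_hom[OF schwartz_mult_real_hom[OF g p] p]])
  moreover have "(\<lambda>x. ?g x + of_real (p x) * (of_real (p x) * ?g x)) =
    (\<lambda>x. of_real (\<Prod>p\<leftarrow>p # ps. 1 + (p x)\<^sup>2) * f x)" by (simp add: fun_eq_iff algebra_simps power2_eq_square)
  ultimately show ?case by simp
 qed (use assms in simp)
 from schwartz_bounded[OF this[OF homs]]
 obtain C where C: "\<And>x. norm (of_real (\<Prod>p\<leftarrow>Ps. 1 + (p x)\<^sup>2) * f x) \<le> C" by (auto simp: bounded_iff)
 have inv: "(\<Prod>p\<leftarrow>ps. 1 / (1 + (p x)\<^sup>2)) = inverse (\<Prod>p\<leftarrow>ps. 1 + (p x)\<^sup>2)" for x and ps :: "('h \<Rightarrow> real) list"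
  by (induction ps) (auto simp: inverse_eq_divide)
 have "norm (f x) \<le> C * wt x" for x
 proof -
  let ?w = "\<Prod>p\<leftarrow>Ps. 1 + (p x)\<^sup>2"
  have w: "wt x = inverse ?w" by (simp add: wt_def inv)
  then have "?w > 0" using wt_pos[of x] by simp
  then show ?thesis using C[of x] unfolding w norm_mult by (simp add: field_simps)
 qed
 moreover have "C \<ge> 0" using C[of 0] norm_ge_zero order_trans by blast
 ultimately show ?thesis by blast
qed

lemma schwartz_integrable: assumes f: "f \<in> schwartz_space" shows "integrable M f"
proof -
 obtain C where C: "C \<ge> 0" "\<And>x. norm (f x) \<le> C * wt x" using schwartz_wt_bound[OF f] by blast
 show ?thesis
  by (rule Bochner_Integration.integrable_bound[of M "\<lambda>x. C * wt x"])
   (use C f wt_pos in \<open>auto intro!: integrable_mult_right wt_integrable schwartz_meas simp: less_imp_le\<close>)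
qed

lemma schwartz_sq_integrable: assumes f: "f \<in> schwartz_space" shows "f \<in> sq_integrable M"
proof -
 have "integrable M (\<lambda>x. f x * cnj (f x))" by (intro schwartz_integrable schwartz_mult schwartz_cnj f)
 then have "integrable M (\<lambda>x. norm (f x * cnj (f x)))" by (rule integrable_norm)
 then show ?thesis using f by (simp add: schwartz_meas sq_integrable_def norm_mult power2_eq_square)
qed

text \<open>A shift along a bounded piece of a one-parameter subgroup changes each factor of the
  weight by a bounded ratio. One multiple of \<open>wt\<close> then dominates all f (x + X s) with
  |s| \<le> 1, as differentiation under the integral requires.\<close>

lemma wt_shift_bound:
 assumes X: "one_param X"
 shows "\<exists>C\<ge>0. \<forall>x s. \<bar>s\<bar> \<le> 1 \<longrightarrow> wt (x + X s) \<le> C * wt x"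
proof -
 have "\<exists>C\<ge>0. \<forall>x s. \<bar>s\<bar> \<le> 1 \<longrightarrow> (\<Prod>p\<leftarrow>ps. 1 / (1 + (p (x + X s))\<^sup>2)) \<le> C * (\<Prod>p\<leftarrow>ps. 1 / (1 + (p x)\<^sup>2))"
  if "list_all real_hom ps" for ps :: "('h \<Rightarrow> real) list"
  using that
 proof (induction ps)
  case Nil
  show ?case by (intro exI[of _ 1]) auto
 next
  case (Cons p ps)
  then have p: "real_hom p" by simp
  obtain C where C: "C \<ge> 0" "\<And>x s. \<bar>s\<bar> \<le> 1 \<Longrightarrow> (\<Prod>p\<leftarrow>ps. 1 / (1 + (p (x + X s))\<^sup>2)) \<le> C * (\<Prod>p\<leftarrow>ps. 1 / (1 + (p x)\<^sup>2))"
   using Cons by auto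
  define c where "c = p (X 1)"
  \<comment> \<open>From p x = q - s c and |s| \<le> 1 follows (p x)^2 \<le> 2 q^2 + 2 c^2, hence 1
    + (p x)^2 \<le> D (1 + q^2).\<close>
  define D where "D = 2 * (1 + c\<^sup>2)"
  have one: "1 / (1 + (p (x + X s))\<^sup>2) \<le> D * (1 / (1 + (p x)\<^sup>2))" if s: "\<bar>s\<bar> \<le> 1" for x s
  proof -
   define q where "q = p (x + X s)"
   have px: "p x = q - s * c"
    using real_hom_one_param[OF X p, of s] by (simp add: q_def c_def real_hom_add[OF p])
   have "(p x)\<^sup>2 \<le> 2 * q\<^sup>2 + 2 * (s * c)\<^sup>2"
    using zero_le_power2[of "q + s * c"] unfolding px by (simp add: power2_sum power2_diff)
   also have "(s * c)\<^sup>2 \<le> c\<^sup>2" using s by (simp add: power_mult_distrib mult_left_le_one_le abs_square_le_1)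
   finally have "(p x)\<^sup>2 \<le> 2 * q\<^sup>2 + 2 * c\<^sup>2" by simp
   moreover have "D * (1 + q\<^sup>2) = 2 + 2 * c\<^sup>2 + 2 * q\<^sup>2 + 2 * (c\<^sup>2 * q\<^sup>2)" by (simp add: D_def algebra_simps)
   moreover have "c\<^sup>2 * q\<^sup>2 \<ge> 0" by simp
   ultimately have "1 + (p x)\<^sup>2 \<le> D * (1 + q\<^sup>2)" by linarith
   moreover have "1 + (p x)\<^sup>2 > 0" "1 + q\<^sup>2 > 0" by (auto intro: add_pos_nonneg)
   ultimately show ?thesis by (simp add: q_def[symmetric] field_simps)
  qed
  have nn: "(\<Prod>p\<leftarrow>ps. 1 / (1 + (p y)\<^sup>2)) \<ge> 0" for y by (induction ps) auto
  have "(\<Prod>p\<leftarrow>p # ps. 1 / (1 + (p (x + X s))\<^sup>2)) \<le> (D * C) * (\<Prod>p\<leftarrow>p # ps. 1 / (1 + (p x)\<^sup>2))" if s: "\<bar>s\<bar> \<le> 1" for x s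
  proof -
   have "1 / (1 + (p (x + X s))\<^sup>2) * (\<Prod>p\<leftarrow>ps. 1 / (1 + (p (x + X s))\<^sup>2)) \<le>
     (D * (1 / (1 + (p x)\<^sup>2))) * (C * (\<Prod>p\<leftarrow>ps. 1 / (1 + (p x)\<^sup>2)))"
    using one[OF s] C(2)[OF s] nn by (intro mult_mono) (auto simp: D_def)
   then show ?thesis by (simp add: mult_ac)
  qed
  moreover have "D * C \<ge> 0" using C by (simp add: D_def)
  ultimately show ?case by blast
 qed
 from this[OF homs] show ?thesis by (simp add: wt_def)
qed

lemma schwartz_dominated:
 assumes f: "f \<in> schwartz_space" and X: "one_param X"
 shows "\<exists>b. integrable M b \<and> (\<forall>x s. \<bar>s\<bar> \<le> 1 \<longrightarrow> norm (f (x + X s)) \<le> b x)"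
proof -
 obtain C where C: "C \<ge> 0" "\<And>x. norm (f x) \<le> C * wt x" using schwartz_wt_bound[OF f] by blast
 obtain D where D: "\<And>x s. \<bar>s\<bar> \<le> 1 \<Longrightarrow> wt (x + X s) \<le> D * wt x" using wt_shift_bound[OF X] by blast
 have "norm (f (x + X s)) \<le> C * (D * wt x)" if "\<bar>s\<bar> \<le> 1" for x s
  using C(2)[of "x + X s"] mult_left_mono[OF D[OF that, of x] C(1)] by simp
 then show ?thesis by (intro exI[of _ "\<lambda>x. C * (D * wt x)"]) (auto intro!: integrable_mult_right wt_integrable)
qed

text \<open>Translation invariance makes the integral of f (x + X s) constant in s, so its
  derivative at 0 vanishes. Applied to products this is integration by parts.\<close>

lemma schwartz_integral_dir_deriv:
 assumes f: "f \<in> schwartz_space" and X: "one_param X"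
 shows "(\<integral>x. dir_deriv X f x \<partial>M) = 0"
proof -
 obtain b where b: "integrable M b" "\<And>x s. \<bar>s\<bar> \<le> 1 \<Longrightarrow> norm (dir_deriv X f (x + X s)) \<le> b x"
  using schwartz_dominated[OF schwartz_dir_deriv[OF f X] X] by blast
 have "((\<lambda>s. \<integral>x. f (x + X s) \<partial>M) has_vector_derivative (\<integral>x. dir_deriv X f (x + X 0) \<partial>M)) (at 0)"
  by (rule integral_has_vector_derivative_param[OF _ _ b])
   (auto intro!: integrable_translate schwartz_integrable f schwartz_has_deriv_at X
     schwartz_meas schwartz_dir_deriv schwartz_translate)
 moreover have "(\<lambda>s. \<integral>x. f (x + X s) \<partial>M) = (\<lambda>s. \<integral>x. f x \<partial>M)"
  using f by (simp add: schwartz_meas integral_translate)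
 ultimately have "((\<lambda>s::real. \<integral>x. f x \<partial>M) has_vector_derivative (\<integral>x. dir_deriv X f x \<partial>M)) (at 0)"
  by (simp add: one_param_0[OF X])
 then show ?thesis using vector_derivative_unique_at has_vector_derivative_const by blast
qed

text \<open>
 Covers both the action of the algebra on the module and the twisted convolution: a derivative
 in \<open>x\<close> of the phase \<open>c\<close> is a polynomial factor in \<open>h\<close>, and a polynomial in \<open>x\<close> splits as
 one in \<open>\<rho> h\<close> plus one in \<open>x - \<rho> h\<close>, so no integration by parts is needed.
\<close>

lemma schwartz_twisted_integral:
 fixes f :: "'k::topological_ab_group_add \<Rightarrow> complex" and c :: "'h \<Rightarrow> 'k \<Rightarrow> complex"
 assumes a: "a \<in> schwartz_space" and f: "f \<in> schwartz_space" and cb: "countably_based TYPE('k)"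
  and c: "continuous_on UNIV (\<lambda>(h, x). c h x)" "\<And>h x. norm (c h x) = 1"
  and dc: "\<And>X :: real \<Rightarrow> 'k. one_param X \<Longrightarrow> \<exists>q. real_hom q \<and>
   (\<forall>h x s. c h (x + X s) = cis (s * q h) * c h x)"
  and \<rho>: "continuous_on UNIV \<rho>" "\<And>g h. \<rho> (g + h) = \<rho> g + \<rho> h"
 shows "(\<lambda>x. \<integral>h. a h * c h x * f (x - \<rho> h) \<partial>M) \<in> schwartz_space"
proof -
 define F where "F a f x = (\<integral>h. a h * c h x * f (x - \<rho> h) \<partial>M)" for a and f :: "'k \<Rightarrow> complex" and x
 define W where "W = {F a f | a f. a \<in> schwartz_space \<and> f \<in> schwartz_space}"
 have FW: "F a f \<in> fspan W" if "a \<in> schwartz_space" "f \<in> schwartz_space" for a f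
  using that by (auto simp: W_def intro!: fspan.base)
 have cx: "continuous_on UNIV (\<lambda>x. c h x)" for h
  using continuous_on_compose2[OF c(1), of UNIV "\<lambda>x. (h, x)"] continuous_on_Pair[OF continuous_on_const continuous_on_id, of UNIV h] by simp
 have ch: "continuous_on UNIV (\<lambda>h. c h x)" for x
  using continuous_on_compose2[OF c(1), of UNIV "\<lambda>h. (h, x)"] continuous_on_Pair[OF continuous_on_id continuous_on_const, of UNIV x] by simp
 have meas: "(\<lambda>h. a h * c h x * f (x - \<rho> h)) \<in> borel_measurable M"
  if "a \<in> schwartz_space" "f \<in> schwartz_space" for a f x
  by (intro cont_meas continuous_intros schwartz_continuous that ch
    continuous_on_compose2[OF schwartz_continuous[OF that(2)]] \<rho>) auto
 obtain B where B: "\<And>(f :: 'k \<Rightarrow> complex) x. f \<in> schwartz_space \<Longrightarrow> norm (f x) \<le> B f"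
  using schwartz_bounded unfolding bounded_iff by (metis rangeI)
 have bound: "norm (a h * c h x * f y) \<le> B f * norm (a h)" if "f \<in> schwartz_space" for a h x f y
  using mult_left_mono[OF B[OF that, of y] norm_ge_zero[of "a h"]] by (simp add: norm_mult c mult.commute)
 have int: "integrable M (\<lambda>h. a h * c h x * f (x - \<rho> h))"
  if "a \<in> schwartz_space" "f \<in> schwartz_space" for a f x
 proof (rule Bochner_Integration.integrable_bound)
  show "integrable M (\<lambda>h. B f * norm (a h))"
   by (intro integrable_mult_right integrable_norm schwartz_integrable that)
  show "AE h in M. norm (a h * c h x * f (x - \<rho> h)) \<le> norm (B f * norm (a h))"
   using bound[OF that(2)] by (auto intro!: AE_I2 order_trans[OF _ abs_ge_self] simp del: abs_mult)
 qed (rule meas[OF that])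
 have "F a f \<in> schwartz_space"
 proof (rule schwartz_coinduct_span[of _ W])
  show "F a f \<in> fspan W" using a f by (rule FW)
 next
  fix g assume "g \<in> W"
  then obtain a f where af: "a \<in> schwartz_space" "f \<in> schwartz_space" and g: "g = F a f" by (auto simp: W_def)
  show "continuous_on UNIV g" unfolding g F_def
  proof (rule continuous_on_integral_param[OF cb])
   show "continuous_on UNIV (\<lambda>x. a h * c h x * f (x - \<rho> h))" for h
    by (intro continuous_intros cx continuous_on_compose2[OF schwartz_continuous[OF af(2)]]) auto
   show "integrable M (\<lambda>h. B f * norm (a h))"
    by (intro integrable_mult_right integrable_norm schwartz_integrable af)
  qed (use bound[OF af(2)] meas[OF af] in auto)
  show "bounded (range g)"
  proof -
   have "norm (F a f x) \<le> (\<integral>h. B f * norm (a h) \<partial>M)" for x unfolding F_def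
    by (rule order_trans[OF integral_norm_bound Bochner_Integration.integral_mono[OF integrable_norm[OF int[OF af]]]])
     (intro integrable_mult_right integrable_norm schwartz_integrable af bound)+
   then show ?thesis by (auto simp: bounded_iff g)
  qed
  show "\<exists>g'\<in>fspan W. \<forall>x. ((\<lambda>t. g (x + X t)) has_vector_derivative g' x) (at 0)" if X: "one_param X" for X
  proof -
   obtain q where q: "real_hom q" and cX: "\<And>h x s. c h (x + X s) = cis (s * q h) * c h x" using dc[OF X] by blast
   have cd: "((\<lambda>s. c h (x + X s)) has_vector_derivative (\<i> * of_real (q h) * c h (x + X s))) (at s)" for h x s
   proof -
    have "((\<lambda>s. cis (s * q h)) has_vector_derivative (\<i> * of_real (q h) * cis (s * q h))) (at s)"
     unfolding cis_conv_exp
     using exp_scaleR_has_vector_derivative_left[of "\<i> * of_real (q h)" s]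
     by (simp add: scaleR_conv_of_real mult_ac)
    from has_vector_derivative_mult_left[OF this, of "c h x"] show ?thesis
     unfolding cX by (simp only: mult.assoc)
   qed
   let ?a' = "\<lambda>h. \<i> * (of_real (q h) * a h)" and ?f' = "dir_deriv X f"
   have a': "?a' \<in> schwartz_space" and f': "?f' \<in> schwartz_space"
    by (intro schwartz_scale schwartz_mult_real_hom schwartz_dir_deriv af q X)+
   have "((\<lambda>s. F a f (x + X s)) has_vector_derivative (F ?a' f x + F a ?f' x)) (at 0)" for x
   proof -
    let ?D = "\<lambda>h s. ?a' h * c h (x + X s) * f (x + X s - \<rho> h) + a h * c h (x + X s) * ?f' (x + X s - \<rho> h)"
    have "((\<lambda>s. \<integral>h. a h * c h (x + X s) * f (x + X s - \<rho> h) \<partial>M) has_vector_derivative (\<integral>h. ?D h 0 \<partial>M)) (at 0)"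
    proof (rule integral_has_vector_derivative_param)
     show "integrable M (\<lambda>h. B f * norm (?a' h) + B ?f' * norm (a h))"
      by (intro Bochner_Integration.integrable_add integrable_mult_right integrable_norm schwartz_integrable a' af)
     show "norm (?D h s) \<le> B f * norm (?a' h) + B ?f' * norm (a h)" for h s
      using bound[OF af(2), of ?a' h "x + X s" "x + X s - \<rho> h"] bound[OF f', of a h "x + X s" "x + X s - \<rho> h"]
       norm_triangle_ineq[of "?a' h * c h (x + X s) * f (x + X s - \<rho> h)" "a h * c h (x + X s) * ?f' (x + X s - \<rho> h)"]
      by linarith
     show "((\<lambda>s. a h * c h (x + X s) * f (x + X s - \<rho> h)) has_vector_derivative ?D h s) (at s)" for h s
     proof -
      have "((\<lambda>s. f ((x - \<rho> h) + X s)) has_vector_derivative ?f' ((x - \<rho> h) + X s)) (at s)"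
       by (rule schwartz_has_deriv_at[OF af(2) X])
      then have f1: "((\<lambda>s. f (x + X s - \<rho> h)) has_vector_derivative ?f' (x + X s - \<rho> h)) (at s)"
       by (simp add: algebra_simps)
      have c1: "((\<lambda>s. a h * c h (x + X s)) has_vector_derivative a h * (\<i> * of_real (q h) * c h (x + X s))) (at s)"
       by (rule has_vector_derivative_mult_right[OF cd])
      show ?thesis using has_vector_derivative_mult[OF c1 f1] by (simp add: algebra_simps)
     qed
    qed (use int[OF af] meas[OF a' af(2)] meas[OF af(1) f'] in \<open>auto simp: one_param_0[OF X]\<close>)
    then show ?thesis unfolding F_def
     using int[OF a' af(2), of x] int[OF af(1) f', of x] by (simp add: one_param_0[OF X])
   qed
   moreover have "(\<lambda>x. F ?a' f x + F a ?f' x) \<in> fspan W" by (intro fspan.add FW a' f' af)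
   ultimately show ?thesis unfolding g by (intro bexI[of _ "\<lambda>x. F ?a' f x + F a ?f' x"] allI)
  qed
  show "(\<lambda>x. of_real (p x) * g x) \<in> fspan W" if p: "real_hom p" for p
  proof -
   have p\<rho>: "real_hom (\<lambda>h. p (\<rho> h))"
    using p \<rho> unfolding real_hom_def by (auto intro: continuous_on_compose2)
   let ?a' = "\<lambda>h. of_real (p (\<rho> h)) * a h" and ?f' = "\<lambda>x. of_real (p x) * f x"
   have a': "?a' \<in> schwartz_space" and f': "?f' \<in> schwartz_space"
    by (intro schwartz_mult_real_hom af p p\<rho>)+
   have "of_real (p x) * F a f x = F ?a' f x + F a ?f' x" for x
   proof -
    have "of_real (p x) * F a f x = (\<integral>h. of_real (p x) * (a h * c h x * f (x - \<rho> h)) \<partial>M)"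
     unfolding F_def by simp
    also have "\<dots> = (\<integral>h. ?a' h * c h x * f (x - \<rho> h) + a h * c h x * ?f' (x - \<rho> h) \<partial>M)"
     by (intro Bochner_Integration.integral_cong refl) (simp add: real_hom_diff[OF p] algebra_simps)
    also have "\<dots> = F ?a' f x + F a ?f' x"
     unfolding F_def using int[OF a' af(2), of x] int[OF af(1) f', of x] by simp
    finally show ?thesis .
   qed
   then show ?thesis unfolding g using fspan.add[OF FW[OF a' af(2)] FW[OF af(1) f']] by simp
  qed
 qed
 then show ?thesis by (simp add: F_def[abs_def])
qed

end

section \<open>Products\<close>

text \<open>The weight of the product is the product of the weights, integrable by Tonelli, and
  sublevel sets are products of sublevel sets. A real homomorphism splits as p(x, 0) + p(0, y), so
  the two growth bounds add.\<close>

lemma schwartz_group_prod: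
 fixes M :: "'a::topological_ab_group_add measure" and N :: "'b::topological_ab_group_add measure"
 assumes "schwartz_group M Ps" "schwartz_group N Qs"
 shows "schwartz_group (M \<Otimes>\<^sub>M N) (map (\<lambda>p z. p (fst z)) Ps @ map (\<lambda>q z. q (snd z)) Qs)"
proof -
 interpret M: schwartz_group M Ps by fact
 interpret N: schwartz_group N Qs by fact
 interpret P: pair_sigma_finite M N ..
 let ?Rs = "map (\<lambda>p z. p (fst z)) Ps @ map (\<lambda>q z. q (snd z)) Qs :: ('a \<times> 'b \<Rightarrow> real) list"
 have S: "sets (M \<Otimes>\<^sub>M N) = sets borel" by (rule sets_pair_borel[OF M.sets_M N.sets_M M.basis])
 then have sp: "space (M \<Otimes>\<^sub>M N) = UNIV" by (simp add: space_pair_measure)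
 show ?thesis
 proof
  show "sets (M \<Otimes>\<^sub>M N) = sets borel" by fact
  show "countably_based TYPE('a \<times> 'b)" by (rule countably_based_prod[OF M.basis N.basis])
  show "list_all real_hom ?Rs"
   using M.homs N.homs by (auto simp: list_all_iff real_hom_compose_fst real_hom_compose_snd)
  show "emeasure (M \<Otimes>\<^sub>M N) ((\<lambda>y. x + y) ` A) = emeasure (M \<Otimes>\<^sub>M N) A" if A: "A \<in> sets borel" for A x
  proof -
   obtain a b where x: "x = (a, b)" by (cases x)
   \<comment> \<open>Subtracting x, so that the preimage of A is the translate of A by x.\<close>
   let ?T = "\<lambda>(u, v). (u + - a, v + - b)"
   have "distr M M (\<lambda>x. x + - a) \<Otimes>\<^sub>M distr N N (\<lambda>x. x + - b) = distr (M \<Otimes>\<^sub>M N) (M \<Otimes>\<^sub>M N) ?T"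
    by (rule pair_measure_distr) (use M.measurable_ops N.measurable_ops in \<open>auto simp: N.distr_translate N.sigma_finite_measure_axioms simp del: add_uminus_conv_diff\<close>)
   then have T: "distr (M \<Otimes>\<^sub>M N) (M \<Otimes>\<^sub>M N) ?T = M \<Otimes>\<^sub>M N"
    by (simp only: M.distr_translate N.distr_translate)
   have Tm: "?T \<in> M \<Otimes>\<^sub>M N \<rightarrow>\<^sub>M M \<Otimes>\<^sub>M N"
    using M.measurable_ops(1)[of "-a"] N.measurable_ops(1)[of "-b"] by measurable
   have "?T -` A \<inter> space (M \<Otimes>\<^sub>M N) = (\<lambda>y. x + y) ` A"
   proof -
    have "z \<in> (\<lambda>y. x + y) ` A" if "?T z \<in> A" for z
     using that by (intro image_eqI[of _ _ "?T z"]) (auto simp: x split: prod.splits)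
    then show ?thesis by (auto simp: sp x split: prod.splits)
   qed
   then have "emeasure (distr (M \<Otimes>\<^sub>M N) (M \<Otimes>\<^sub>M N) ?T) A = emeasure (M \<Otimes>\<^sub>M N) ((\<lambda>y. x + y) ` A)"
    using A Tm S by (subst emeasure_distr) auto
   then show ?thesis by (simp only: T)
  qed
  show "(\<integral>\<^sup>+z. ennreal (\<Prod>p\<leftarrow>?Rs. 1 / (1 + (p z)\<^sup>2)) \<partial>(M \<Otimes>\<^sub>M N)) < \<infinity>"
  proof -
   have eq: "(\<Prod>p\<leftarrow>?Rs. 1 / (1 + (p z)\<^sup>2)) = M.wt (fst z) * N.wt (snd z)" for z
    by (simp add: M.wt_def N.wt_def o_def)
   have "(\<integral>\<^sup>+z. ennreal (M.wt (fst z)) * ennreal (N.wt (snd z)) \<partial>(M \<Otimes>\<^sub>M N)) =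
     (\<integral>\<^sup>+x. (\<integral>\<^sup>+y. ennreal (M.wt x) * ennreal (N.wt y) \<partial>N) \<partial>M)"
    by (subst N.nn_integral_fst[symmetric]) (use M.wt_meas N.wt_meas in \<open>auto simp del: M.sets_M N.sets_M\<close>)
   also have "\<dots> = (\<integral>\<^sup>+x. ennreal (M.wt x) \<partial>M) * (\<integral>\<^sup>+y. ennreal (N.wt y) \<partial>N)"
    using M.wt_meas N.wt_meas by (simp add: nn_integral_cmult nn_integral_multc)
   also have "\<dots> < \<infinity>" using M.weight N.weight by (simp add: M.wt_def N.wt_def ennreal_mult_less_top)
   finally show ?thesis unfolding eq
    by (simp add: ennreal_mult less_imp_le[OF M.wt_pos] less_imp_le[OF N.wt_pos])
  qed
  show "emeasure (M \<Otimes>\<^sub>M N) U > 0" if U: "open U" "U \<noteq> {}" for U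
  proof -
   obtain z where z: "z \<in> U" using U(2) by blast
   obtain A B where AB: "open A" "open B" "z \<in> A \<times> B" "A \<times> B \<subseteq> U"
    by (rule open_prod_elim[OF U(1) z])
   then have "emeasure M A > 0" "emeasure N B > 0"
    using M.nonempty_open[of A] N.nonempty_open[of B] by auto
   then have "0 < emeasure M A * emeasure N B" by (simp add: ennreal_zero_less_mult_iff)
   also have "\<dots> = emeasure (M \<Otimes>\<^sub>M N) (A \<times> B)"
    using AB by (intro N.emeasure_pair_measure_Times[symmetric]) auto
   also have "\<dots> \<le> emeasure (M \<Otimes>\<^sub>M N) U" using AB(4) S U(1) by (intro emeasure_mono) auto
   finally show ?thesis .
  qed
  show "compact {z. \<forall>p\<in>set ?Rs. \<bar>p z\<bar> \<le> c}" for c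
  proof -
   have "{z. \<forall>p\<in>set ?Rs. \<bar>p z\<bar> \<le> c} = {x. \<forall>p\<in>set Ps. \<bar>p x\<bar> \<le> c} \<times> {x. \<forall>p\<in>set Qs. \<bar>p x\<bar> \<le> c}"
    by (auto simp: ball_Un)
   then show ?thesis using compact_Times[OF M.proper N.proper] by simp
  qed
  show "\<exists>C. \<forall>z. \<bar>p z\<bar> \<le> C * (1 + (\<Sum>q\<leftarrow>?Rs. \<bar>q z\<bar>))" if p: "real_hom p" for p :: "'a \<times> 'b \<Rightarrow> real"
  proof -
   have "\<exists>C. \<forall>x. \<bar>p (x, 0)\<bar> \<le> C * (1 + (\<Sum>q\<leftarrow>Ps. \<bar>q x\<bar>))"
    by (rule M.growth[OF real_hom_slice_fst[OF p]])
   then obtain C where C: "\<And>x. \<bar>p (x, 0)\<bar> \<le> C * (1 + (\<Sum>q\<leftarrow>Ps. \<bar>q x\<bar>))" by blast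
   have "\<exists>D. \<forall>x. \<bar>p (0, x)\<bar> \<le> D * (1 + (\<Sum>q\<leftarrow>Qs. \<bar>q x\<bar>))"
    by (rule N.growth[OF real_hom_slice_snd[OF p]])
   then obtain D where D: "\<And>x. \<bar>p (0, x)\<bar> \<le> D * (1 + (\<Sum>q\<leftarrow>Qs. \<bar>q x\<bar>))" by blast
   have nnM: "0 \<le> (\<Sum>q\<leftarrow>Ps. \<bar>q x\<bar>)" and nnN: "0 \<le> (\<Sum>q\<leftarrow>Qs. \<bar>q y\<bar>)" for x y
    by (auto intro!: sum_list_nonneg)
   have "\<bar>p z\<bar> \<le> (\<bar>C\<bar> + \<bar>D\<bar>) * (1 + (\<Sum>q\<leftarrow>?Rs. \<bar>q z\<bar>))" for z
   proof -
    let ?a = "\<Sum>q\<leftarrow>Ps. \<bar>q (fst z)\<bar>" and ?b = "\<Sum>q\<leftarrow>Qs. \<bar>q (snd z)\<bar>"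
    have "\<bar>p z\<bar> \<le> \<bar>p (fst z, 0)\<bar> + \<bar>p (0, snd z)\<bar>" by (subst real_hom_Pair[OF p, of z]) (rule abs_triangle_ineq)
    also have "\<dots> \<le> C * (1 + ?a) + D * (1 + ?b)" by (rule add_mono[OF C D])
    also have "\<dots> \<le> \<bar>C\<bar> * (1 + ?a + ?b) + \<bar>D\<bar> * (1 + ?a + ?b)"
     using nnM[of "fst z"] nnN[of "snd z"]
     by (intro add_mono[OF mult_mono mult_mono]) linarith+
    also have "\<dots> = (\<bar>C\<bar> + \<bar>D\<bar>) * (1 + (\<Sum>q\<leftarrow>?Rs. \<bar>q z\<bar>))" by (simp add: o_def algebra_simps)
    finally show ?thesis .
   qed
   then show ?thesis by blast
  qed
 qed
qed

section \<open>Density of algebras of bounded functions\<close>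

text \<open>The only case beyond closure of R is a linear map of the line, which is multiplication
  by its value at 1.\<close>

lemma real_polynomial_function_compose_algebra:
 fixes R :: "('a \<Rightarrow> real) set"
 assumes add: "\<And>f g. f \<in> R \<Longrightarrow> g \<in> R \<Longrightarrow> (\<lambda>x. f x + g x) \<in> R"
  and mult: "\<And>f g. f \<in> R \<Longrightarrow> g \<in> R \<Longrightarrow> (\<lambda>x. f x * g x) \<in> R" and const: "\<And>c. (\<lambda>_. c) \<in> R"
  and q: "real_polynomial_function q" and r: "r \<in> R"
 shows "(\<lambda>x. q (r x)) \<in> R"
 using q
proof induction
 case (linear h)
 interpret bounded_linear h by fact
 have "h y = h 1 * y" for y :: real
  using scaleR[of y 1] by (simp add: mult.commute[of y "h 1"])
 then have "(\<lambda>x. h (r x)) = (\<lambda>x. h 1 * r x)" by (intro ext)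
 then show ?case using mult[OF const r, of "h 1"] by (simp only:)
qed (auto intro: add mult const)

text \<open>
 Stone-Weierstrass only controls the approximant on a compact set; composing it with a
 polynomial close to a truncation keeps it bounded everywhere, so the tails stay small.
\<close>

lemma bounded_algebra_dense_L2:
 fixes m :: "'a::t2_space measure" and R :: "('a \<Rightarrow> real) set"
 assumes sets: "sets m = sets borel" and fin: "finite_measure m"
  and tight: "\<And>e. e > 0 \<Longrightarrow> \<exists>C. compact C \<and> measure m (- C) < e"
  and cont: "\<And>r. r \<in> R \<Longrightarrow> continuous_on UNIV r" and bdd: "\<And>r. r \<in> R \<Longrightarrow> \<exists>B. \<forall>x. \<bar>r x\<bar> \<le> B"
  and add: "\<And>f g. f \<in> R \<Longrightarrow> g \<in> R \<Longrightarrow> (\<lambda>x. f x + g x) \<in> R"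
  and mult: "\<And>f g. f \<in> R \<Longrightarrow> g \<in> R \<Longrightarrow> (\<lambda>x. f x * g x) \<in> R" and const: "\<And>c. (\<lambda>_. c) \<in> R"
  and sep: "\<And>x y. x \<noteq> y \<Longrightarrow> \<exists>f\<in>R. f x \<noteq> f y"
  and f: "continuous_on UNIV f" "\<And>x. \<bar>f x\<bar> \<le> c" and \<epsilon>: "\<epsilon> > 0"
 shows "\<exists>r\<in>R. (\<integral>x. (f x - r x)\<^sup>2 \<partial>m) < \<epsilon>"
proof -
 interpret finite_measure m by fact
 have sp [simp]: "space m = UNIV" using sets_eq_imp_space_eq[OF sets] by simp
 have c0: "c \<ge> 0" using f(2)[of undefined] by linarith
 define T where "T = measure m UNIV"
 \<comment> \<open>The error on the compact set contributes \<delta>^2 T, which is at most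
   \<epsilon>/4 because \<delta> \<le> 1 and \<delta> (T + 1) \<le> \<epsilon>/4; adding 1 covers a
   measure of total mass 0.\<close>
 define \<delta> where "\<delta> = min 1 (\<epsilon> / (4 * (T + 1)))"
 have T0: "T \<ge> 0" by (simp add: T_def)
 have \<delta>: "\<delta> > 0" "\<delta> \<le> 1" using T0 \<epsilon> by (auto simp: \<delta>_def intro!: divide_pos_pos)
 have \<delta>T: "\<delta>\<^sup>2 * T < \<epsilon> / 2"
 proof -
  have "\<delta>\<^sup>2 * T \<le> \<delta> * (T + 1)" using \<delta> T0 by (intro mult_mono) (auto simp: power2_eq_square mult_left_le)
  also have "\<dots> \<le> \<epsilon> / (4 * (T + 1)) * (T + 1)" using T0 by (intro mult_right_mono) (auto simp: \<delta>_def)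
  also have "\<dots> = \<epsilon> / 4" using T0 by (simp add: field_simps)
  finally show ?thesis using \<epsilon> by simp
 qed
 \<comment> \<open>Off C the squared error is at most (2 c + 1)^2, so this bound on the tail mass
   costs less than \<epsilon>/2.\<close>
 obtain C where C: "compact C" "measure m (- C) < \<epsilon> / (2 * (2 * c + 1)\<^sup>2)"
  using tight[of "\<epsilon> / (2 * (2 * c + 1)\<^sup>2)"] \<epsilon> c0 by auto
 have "function_ring_on R C"
  by (unfold_locales) (use C cont add mult const sep in \<open>auto intro: continuous_on_subset\<close>)
 then obtain r0 where r0: "r0 \<in> R" "\<And>x. x \<in> C \<Longrightarrow> \<bar>f x - r0 x\<bar> < \<delta> / 2"
  using function_ring_on.Stone_Weierstrass_basic[of R C f "\<delta>/2"] continuous_on_subset[OF f(1)] \<delta> by auto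
 obtain B where B: "\<And>x. \<bar>r0 x\<bar> \<le> B" using bdd[OF r0(1)] by blast
 \<comment> \<open>Truncation to [-c, c] is 1-Lipschitz and fixes the values of f, so it does not
   increase the error on C. Since r0 takes values in [-B, B], a polynomial can imitate the
   truncation on everything that occurs.\<close>
 define cl where "cl x = max (- c) (min c x)" for x :: real
 have cl: "\<bar>cl x\<bar> \<le> c" "\<bar>cl x - cl y\<bar> \<le> \<bar>x - y\<bar>" "\<bar>z\<bar> \<le> c \<Longrightarrow> cl z = z" for x y z
  using c0 by (auto simp: cl_def max_def min_def)
 have "continuous_on {-B..B} cl" unfolding cl_def by (intro continuous_intros)
 then obtain q where q: "real_polynomial_function q" "\<And>x. x \<in> {-B..B} \<Longrightarrow> \<bar>cl x - q x\<bar> < \<delta> / 2"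
  using Stone_Weierstrass_real_polynomial_function[of "{-B..B}" cl "\<delta>/2"] \<delta> by auto
 define r where "r x = q (r0 x)" for x
 have rR: "r \<in> R" unfolding r_def[abs_def]
  by (rule real_polynomial_function_compose_algebra[OF add mult const q(1) r0(1)])
 have rcl: "\<bar>cl (r0 x) - r x\<bar> < \<delta> / 2" for x using q(2)[of "r0 x"] B[of x] by (auto simp: r_def abs_le_iff)
 have onC: "(f x - r x)\<^sup>2 \<le> \<delta>\<^sup>2" if "x \<in> C" for x
 proof -
  have "\<bar>f x - cl (r0 x)\<bar> < \<delta> / 2" using cl(2)[of "f x" "r0 x"] cl(3)[OF f(2)[of x]] r0(2)[OF that] by simp
  then have "\<bar>f x - r x\<bar> \<le> \<delta>" using rcl[of x] by linarith
  then show ?thesis using \<delta> by (simp add: abs_le_square_iff flip: abs_le_square_iff)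
 qed
 \<comment> \<open>f and the truncated value are each bounded by c, and the polynomial error is
   below 1/2, whatever r0 does outside C.\<close>
 have all: "(f x - r x)\<^sup>2 \<le> (2 * c + 1)\<^sup>2" for x
 proof -
  have "\<bar>f x - r x\<bar> \<le> 2 * c + 1" using cl(1)[of "r0 x"] f(2)[of x] rcl[of x] \<delta> by linarith
  then show ?thesis using c0 by (simp add: abs_le_square_iff[symmetric])
 qed
 have Cs: "C \<in> sets m" using compact_imp_closed[OF C(1)] by (simp add: sets)
 have fm: "f \<in> borel_measurable m" "r \<in> borel_measurable m"
  using borel_measurable_continuous_onI f(1) cont[OF rR] by (auto simp: measurable_cong_sets[OF sets refl])
 have "(\<integral>x. (f x - r x)\<^sup>2 \<partial>m) \<le> (\<integral>x. \<delta>\<^sup>2 + (2 * c + 1)\<^sup>2 * indicator (- C) x \<partial>m)"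
 proof (rule Bochner_Integration.integral_mono)
  show "integrable m (\<lambda>x. (f x - r x)\<^sup>2)"
   using fm all by (intro integrable_const_bound[of _ "(2 * c + 1)\<^sup>2"]) auto
  show "integrable m (\<lambda>x. \<delta>\<^sup>2 + (2 * c + 1)\<^sup>2 * indicator (- C) x)"
   using Cs by (intro Bochner_Integration.integrable_add integrable_mult_right integrable_const integrable_real_indicator)
    (auto simp: less_top[symmetric] Compl_eq_Diff_UNIV simp flip: sp)
  show "(f x - r x)\<^sup>2 \<le> \<delta>\<^sup>2 + (2 * c + 1)\<^sup>2 * indicator (- C) x" for x
   using onC[of x] all[of x] by (cases "x \<in> C") (auto intro: add_increasing)
 qed
 also have "\<dots> = \<delta>\<^sup>2 * T + (2 * c + 1)\<^sup>2 * measure m (- C)"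
  using Cs by (subst Bochner_Integration.integral_add)
   (auto simp: T_def less_top[symmetric] Compl_eq_Diff_UNIV mult.commute simp flip: sp)
 also have "\<dots> < \<epsilon> / 2 + (2 * c + 1)\<^sup>2 * (\<epsilon> / (2 * (2 * c + 1)\<^sup>2))"
  using \<delta>T C c0 by (intro add_less_le_mono mult_left_mono) auto
 also have "\<dots> = \<epsilon>" using c0 by simp
 finally show ?thesis using rR by blast
qed

lemma fspan_mult:
 assumes W: "\<And>f g. f \<in> W \<Longrightarrow> g \<in> W \<Longrightarrow> (\<lambda>x. f x * g x) \<in> W"
  and f: "f \<in> fspan W" and g: "g \<in> fspan W"
 shows "(\<lambda>x. f x * g x) \<in> fspan W"
 using f
proof induction
 case (base f)
 show ?case using g
 proof induction
  case (add g h)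
  from fspan.add[OF this(3,4)] show ?case by (simp add: distrib_left)
 next
  case (scale g z)
  from fspan.scale[OF this(2), of z] show ?case by (simp add: mult.left_commute)
 qed (auto intro: fspan.intros W base)
next
 case (add f h)
 from fspan.add[OF this(3,4)] show ?case by (simp add: distrib_right)
next
 case (scale f z)
 from fspan.scale[OF this(2), of z] show ?case by (simp add: mult.assoc)
qed (auto intro: fspan.zero)

text \<open>R collects the real functions whose complexification lies in the span. Closure under
  conjugation puts real and imaginary parts of generators into R, which preserves separation of
  points; the two parts of f are then approximated to \<epsilon>/2 each.\<close>

lemma bounded_complex_algebra_dense_L2:
 fixes m :: "'a::t2_space measure" and W :: "('a \<Rightarrow> complex) set"
 assumes sets: "sets m = sets borel" and fin: "finite_measure m"
  and tight: "\<And>e. e > 0 \<Longrightarrow> \<exists>C. compact C \<and> measure m (- C) < e"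
  and cont: "\<And>w. w \<in> W \<Longrightarrow> continuous_on UNIV w" and bdd: "\<And>w. w \<in> W \<Longrightarrow> bounded (range w)"
  and mult: "\<And>f g. f \<in> W \<Longrightarrow> g \<in> W \<Longrightarrow> (\<lambda>x. f x * g x) \<in> W" and one: "(\<lambda>_. 1) \<in> W"
  and cnj: "\<And>w. w \<in> W \<Longrightarrow> (\<lambda>x. cnj (w x)) \<in> W"
  and sep: "\<And>x y. x \<noteq> y \<Longrightarrow> \<exists>w\<in>W. w x \<noteq> w y"
  and f: "continuous_on UNIV f" "bounded (range f)" and \<epsilon>: "\<epsilon> > 0"
 shows "\<exists>r\<in>fspan W. (\<integral>x. (norm (f x - r x))\<^sup>2 \<partial>m) < \<epsilon>"
proof -
 interpret finite_measure m by fact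
 have sp [simp]: "space m = UNIV" using sets_eq_imp_space_eq[OF sets] by simp
 have fcont: "continuous_on UNIV w" if "w \<in> fspan W" for w
  using that by induction (simp_all add: cont continuous_on_add continuous_on_mult_left)
 have fbdd: "bounded (range w)" if "w \<in> fspan W" for w
  using that by induction (simp_all add: bdd bounded_range_add bounded_range_mult)
 define R where "R = {r :: 'a \<Rightarrow> real. (\<lambda>x. of_real (r x)) \<in> fspan W}"
 have ReIm: "(\<lambda>x. Re (w x)) \<in> R" "(\<lambda>x. Im (w x)) \<in> R" if w: "w \<in> W" for w
 proof -
  have "(\<lambda>x. (1/2) * (w x + cnj (w x))) \<in> fspan W" "(\<lambda>x. (- \<i> / 2) * (w x - cnj (w x))) \<in> fspan W"
   by (intro fspan.scale fspan.add fspan_diff fspan.base w cnj)+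
  moreover have "(\<lambda>x. (1/2) * (w x + cnj (w x))) = (\<lambda>x. of_real (Re (w x)))"
   "(\<lambda>x. (- \<i> / 2) * (w x - cnj (w x))) = (\<lambda>x. of_real (Im (w x)))"
   by (auto simp: fun_eq_iff complex_eq_iff)
  ultimately show "(\<lambda>x. Re (w x)) \<in> R" "(\<lambda>x. Im (w x)) \<in> R" by (simp_all add: R_def)
 qed
 have key: "\<exists>r\<in>R. (\<integral>x. (g x - r x)\<^sup>2 \<partial>m) < \<epsilon> / 2"
  if g: "continuous_on UNIV g" "\<And>x. \<bar>g x\<bar> \<le> c" for g c
 proof (rule bounded_algebra_dense_L2[OF sets fin tight _ _ _ _ _ _ g])
  show "continuous_on UNIV r" if "r \<in> R" for r
  proof -
   have "continuous_on UNIV (\<lambda>x. Re (of_real (r x)))"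
    using fcont[of "\<lambda>x. of_real (r x)"] that by (intro continuous_on_Re) (simp add: R_def)
   then show ?thesis by simp
  qed
  show "\<exists>B. \<forall>x. \<bar>r x\<bar> \<le> B" if "r \<in> R" for r
   using fbdd[of "\<lambda>x. of_real (r x)"] that by (auto simp: R_def bounded_iff)
  show "(\<lambda>x. f x + g x) \<in> R" "(\<lambda>x. f x * g x) \<in> R" if "f \<in> R" "g \<in> R" for f g
  proof -
   have fg: "(\<lambda>x. of_real (f x)) \<in> fspan W" "(\<lambda>x. of_real (g x)) \<in> fspan W"
    using that unfolding R_def by auto
   have "(\<lambda>x. of_real (f x) * of_real (g x)) \<in> fspan W"
    by (rule fspan_mult[OF _ fg]) (rule mult)
   with fspan.add[OF fg] show "(\<lambda>x. f x + g x) \<in> R" "(\<lambda>x. f x * g x) \<in> R"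
    unfolding R_def by auto
  qed
  show "(\<lambda>_. c) \<in> R" for c
   using fspan.scale[OF fspan.base[OF one], of "of_real c"] by (simp add: R_def)
  show "\<exists>f\<in>R. f x \<noteq> f y" if "x \<noteq> y" for x y
  proof -
   obtain w where w: "w \<in> W" "w x \<noteq> w y" using sep[OF \<open>x \<noteq> y\<close>] by blast
   then have "Re (w x) \<noteq> Re (w y) \<or> Im (w x) \<noteq> Im (w y)" by (simp add: complex_eq_iff)
   then show ?thesis using ReIm[OF w(1)] by (elim disjE) (rule bexI, assumption, assumption)+
  qed
 qed (use \<epsilon> in auto)
 obtain B where B: "\<And>x. norm (f x) \<le> B" using f(2) by (auto simp: bounded_iff)
 obtain r1 where r1: "r1 \<in> R" "(\<integral>x. (Re (f x) - r1 x)\<^sup>2 \<partial>m) < \<epsilon> / 2"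
  using key[of "\<lambda>x. Re (f x)" B] f(1) B by (auto intro!: continuous_intros order_trans[OF abs_Re_le_cmod])
 obtain r2 where r2: "r2 \<in> R" "(\<integral>x. (Im (f x) - r2 x)\<^sup>2 \<partial>m) < \<epsilon> / 2"
  using key[of "\<lambda>x. Im (f x)" B] f(1) B by (auto intro!: continuous_intros order_trans[OF abs_Im_le_cmod])
 let ?r = "\<lambda>x. of_real (r1 x) + \<i> * of_real (r2 x)"
 have rW: "?r \<in> fspan W" using r1(1) r2(1) by (intro fspan.add fspan.scale) (simp_all add: R_def)
 have int: "integrable m (\<lambda>x. (g x - r x)\<^sup>2)"
  if g: "continuous_on UNIV g" "\<And>x. \<bar>g x\<bar> \<le> B" and r: "r \<in> R" for g r
 proof -
  have rW: "(\<lambda>x. of_real (r x)) \<in> fspan W" using r by (simp add: R_def)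
  have "continuous_on UNIV (\<lambda>x. Re (of_real (r x)))"
   using fcont[OF rW] by (intro continuous_on_Re)
  then have rc: "continuous_on UNIV r" by simp
  have "\<exists>D. \<forall>x. \<bar>r x\<bar> \<le> D" using fbdd[OF rW] by (auto simp: bounded_iff)
  then obtain D where D: "\<And>x. \<bar>r x\<bar> \<le> D" by blast
  have "(\<lambda>x. (g x - r x)\<^sup>2) \<in> borel_measurable m"
   unfolding measurable_cong_sets[OF sets refl]
   by (intro borel_measurable_continuous_onI continuous_intros g(1) rc)
  moreover have "(g x - r x)\<^sup>2 \<le> (B + D)\<^sup>2" for x
  proof -
   have "\<bar>g x - r x\<bar> \<le> B + D" using g(2)[of x] D[of x] by linarith
   then show ?thesis using power_mono[of "\<bar>g x - r x\<bar>" "B + D" 2] by simp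
  qed
  ultimately show ?thesis by (intro integrable_const_bound[of _ "(B + D)\<^sup>2"]) auto
 qed
 have "(norm (f x - ?r x))\<^sup>2 = (Re (f x) - r1 x)\<^sup>2 + (Im (f x) - r2 x)\<^sup>2" for x
  by (simp add: cmod_power2)
 then have "(\<integral>x. (norm (f x - ?r x))\<^sup>2 \<partial>m) = (\<integral>x. (Re (f x) - r1 x)\<^sup>2 \<partial>m) + (\<integral>x. (Im (f x) - r2 x)\<^sup>2 \<partial>m)"
  using int[of "\<lambda>x. Re (f x)" r1] int[of "\<lambda>x. Im (f x)" r2] r1(1) r2(1) f(1) B
  by (simp add: continuous_on_Re continuous_on_Im order_trans[OF abs_Re_le_cmod] order_trans[OF abs_Im_le_cmod])
 then show ?thesis using rW r1(2) r2(2) by (intro bexI[of _ ?r]) auto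
qed

section \<open>Tightness of finite densities, and continuous functions vanishing almost
  everywhere\<close>

context schwartz_group
begin

text \<open>The compact sets on which all homomorphisms in \<open>Ps\<close> are bounded by n
  exhaust the group, so their complements decrease to the empty set and their mass under a finite
  measure tends to 0.\<close>

lemma tight_density:
 fixes g :: "'h \<Rightarrow> real"
 assumes g: "integrable M g" "\<And>x. g x \<ge> 0" and e: "e > 0"
 shows "\<exists>C. compact C \<and> measure (density M g) (- C) < e" "finite_measure (density M g)"
proof -
 let ?m = "density M (\<lambda>x. ennreal (g x))"
 show fin: "finite_measure ?m"
  using g by (intro finite_measureI) (simp add: emeasure_density nn_integral_eq_integral)
 interpret m: finite_measure ?m by fact
 define C where "C n = {x. \<forall>p\<in>set Ps. \<bar>p x\<bar> \<le> real n}" for n :: nat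
 have Cc: "compact (C n)" for n unfolding C_def by (rule proper)
 have Cm: "- C n \<in> sets ?m" for n
 proof -
  have "closed (C n)" unfolding C_def
   using homs unfolding Collect_ball_eq
   by (intro closed_INT ballI closed_Collect_le continuous_intros)
    (auto simp: list_all_iff real_hom_continuous)
  then show ?thesis by (simp add: open_Compl)
 qed
 have "(\<lambda>n. measure ?m (- C n)) \<longlonglongrightarrow> measure ?m (\<Inter>n. - C n)"
  using Cm by (intro m.finite_Lim_measure_decseq) (auto simp: decseq_def C_def intro: order_trans)
 moreover have "(\<Inter>n. - C n) = {}"
 proof -
  have "\<exists>n. x \<in> C n" for x
  proof -
   obtain n where n: "(\<Sum>p\<leftarrow>Ps. \<bar>p x\<bar>) \<le> real n" using real_arch_simple by blast
   have nn: "0 \<le> (\<Sum>p\<leftarrow>ps. \<bar>p x\<bar>)" for ps :: "('h \<Rightarrow> real) list" by (induction ps) auto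
   have "\<forall>p\<in>set ps. \<bar>p x\<bar> \<le> (\<Sum>p\<leftarrow>ps. \<bar>p x\<bar>)" for ps :: "('h \<Rightarrow> real) list"
   proof (induction ps)
    case (Cons a ps)
    show ?case
    proof
     fix p assume "p \<in> set (a # ps)"
     then show "\<bar>p x\<bar> \<le> (\<Sum>p\<leftarrow>a # ps. \<bar>p x\<bar>)" using Cons nn[of ps] by force
    qed
   qed simp
   then have "x \<in> C n" unfolding C_def using n by (auto intro: order_trans)
   then show ?thesis ..
  qed
  then show ?thesis by auto
 qed
 ultimately have "(\<lambda>n. measure ?m (- C n)) \<longlonglongrightarrow> 0" by simp
 then have "eventually (\<lambda>n. measure ?m (- C n) < e) sequentially" using e by (rule order_tendstoD)
 then obtain n where "measure ?m (- C n) < e" by (auto simp: eventually_sequentially)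
 then show "\<exists>C. compact C \<and> measure ?m (- C) < e" using Cc by blast
qed

lemma continuous_AE_zero:
 fixes f :: "'h \<Rightarrow> complex"
 assumes f: "continuous_on UNIV f" and ae: "AE x in M. f x = 0"
 shows "f = (\<lambda>_. 0)"
proof (rule ccontr)
 let ?U = "{x. f x \<noteq> 0}"
 assume "f \<noteq> (\<lambda>_. 0)"
 then have "?U \<noteq> {}" by auto
 moreover have U: "open ?U" using f by (intro open_Collect_neq) auto
 ultimately have "emeasure M ?U > 0" by (intro nonempty_open)
 moreover have "emeasure M ?U = 0"
  using ae U by (subst AE_iff_measurable[symmetric, of _ M "\<lambda>x. f x = 0"]) auto
 ultimately show False by simp
qed

end

section \<open>Square-integrable functions\<close>

lemma borel_measurable_cnj [measurable (raw)]:
 "f \<in> borel_measurable M \<Longrightarrow> (\<lambda>x. cnj (f x)) \<in> borel_measurable M"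
 by (rule measurable_compose[OF _ borel_measurable_continuous_onI[OF continuous_on_cnj[OF continuous_on_id]]])

lemma sq_integrableD:
 assumes "f \<in> sq_integrable M"
 shows "f \<in> borel_measurable M" "integrable M (\<lambda>x. (norm (f x))\<^sup>2)"
 using assms by (auto simp: sq_integrable_def)

lemma sq_integrable_mult:
 assumes f: "f \<in> sq_integrable M" and g: "g \<in> sq_integrable M"
 shows "integrable M (\<lambda>x. f x * g x)"
proof (rule Bochner_Integration.integrable_bound)
 show "integrable M (\<lambda>x. (norm (f x))\<^sup>2 + (norm (g x))\<^sup>2)"
  using f g by (intro Bochner_Integration.integrable_add) (auto simp: sq_integrable_def)
 show "(\<lambda>x. f x * g x) \<in> borel_measurable M" using f g by (auto simp: sq_integrable_def)
 show "AE x in M. norm (f x * g x) \<le> norm ((norm (f x))\<^sup>2 + (norm (g x))\<^sup>2)"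
 proof (rule AE_I2)
  fix x
  have "2 * norm (f x) * norm (g x) \<le> (norm (f x))\<^sup>2 + (norm (g x))\<^sup>2"
   using sum_squares_bound[of "norm (f x)" "norm (g x)"] by simp
  moreover have "norm (f x) * norm (g x) \<ge> 0" by simp
  ultimately have "norm (f x) * norm (g x) \<le> (norm (f x))\<^sup>2 + (norm (g x))\<^sup>2" by linarith
  then show "norm (f x * g x) \<le> norm ((norm (f x))\<^sup>2 + (norm (g x))\<^sup>2)" by (simp add: norm_mult)
 qed
qed

lemma sq_integrable_cnj: "f \<in> sq_integrable M \<Longrightarrow> (\<lambda>x. cnj (f x)) \<in> sq_integrable M"
 by (auto simp: sq_integrable_def)

lemma sq_integrable_scale: "f \<in> sq_integrable M \<Longrightarrow> (\<lambda>x. z * f x) \<in> sq_integrable M"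
 by (auto simp: sq_integrable_def norm_mult power_mult_distrib)

lemma sq_integrable_zero: "(\<lambda>_. 0) \<in> sq_integrable M"
 by (simp add: sq_integrable_def)

lemma norm_sq_add_cnj:
 "complex_of_real ((norm (a + b))\<^sup>2) = a * cnj a + b * cnj b + a * cnj b + b * cnj a"
 unfolding complex_norm_square by (simp add: algebra_simps)

lemma sq_integrable_add:
 assumes f: "f \<in> sq_integrable M" and g: "g \<in> sq_integrable M"
 shows "(\<lambda>x. f x + g x) \<in> sq_integrable M"
proof -
 have "integrable M (\<lambda>x. 2 * ((norm (f x))\<^sup>2 + (norm (g x))\<^sup>2))"
  using f g by (intro integrable_mult_right Bochner_Integration.integrable_add) (auto simp: sq_integrable_def)
 then have "integrable M (\<lambda>x. (norm (f x + g x))\<^sup>2)"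
 proof (rule Bochner_Integration.integrable_bound)
  show "(\<lambda>x. (norm (f x + g x))\<^sup>2) \<in> borel_measurable M" using f g by (auto simp: sq_integrable_def)
  show "AE x in M. norm ((norm (f x + g x))\<^sup>2) \<le> norm (2 * ((norm (f x))\<^sup>2 + (norm (g x))\<^sup>2))"
  proof (rule AE_I2)
   fix x
   have "(norm (f x + g x))\<^sup>2 \<le> (norm (f x) + norm (g x))\<^sup>2" by (intro power_mono norm_triangle_ineq) auto
   also have "\<dots> \<le> 2 * ((norm (f x))\<^sup>2 + (norm (g x))\<^sup>2)"
    using sum_squares_bound[of "norm (f x)" "norm (g x)"] by (simp add: power2_sum)
   finally show "norm ((norm (f x + g x))\<^sup>2) \<le> norm (2 * ((norm (f x))\<^sup>2 + (norm (g x))\<^sup>2))" by simp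
  qed
 qed
 then show ?thesis using f g by (auto simp: sq_integrable_def)
qed

text \<open>Plancherel's theorem is assumed for norms; the norms of a + z b with z = 1, -1, \<i>,
  -\<i> return the scalar product.\<close>

lemma polarization_integral:
 assumes a: "a \<in> sq_integrable M" and b: "b \<in> sq_integrable M"
 shows "(\<integral>x. a x * cnj (b x) \<partial>M) = (1/4) * (of_real (\<integral>x. (norm (a x + 1 * b x))\<^sup>2 \<partial>M)
   - of_real (\<integral>x. (norm (a x + (-1) * b x))\<^sup>2 \<partial>M)
   + \<i> * of_real (\<integral>x. (norm (a x + \<i> * b x))\<^sup>2 \<partial>M) - \<i> * of_real (\<integral>x. (norm (a x + (-\<i>) * b x))\<^sup>2 \<partial>M))"
proof -
 have int: "integrable M (\<lambda>x. complex_of_real ((norm (a x + z * b x))\<^sup>2))" for z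
  using sq_integrable_add[OF a sq_integrable_scale[OF b, of z]]
  by (intro integrable_of_real) (auto simp: sq_integrable_def)
 have "a x * cnj (b x) = (1/4) * (of_real ((norm (a x + 1 * b x))\<^sup>2) - of_real ((norm (a x + (-1) * b x))\<^sup>2)
   + \<i> * of_real ((norm (a x + \<i> * b x))\<^sup>2) - \<i> * of_real ((norm (a x + (-\<i>) * b x))\<^sup>2))" for x
  unfolding norm_sq_add_cnj by (simp add: algebra_simps)
 then have "(\<integral>x. a x * cnj (b x) \<partial>M) = (\<integral>x. (1/4) * (of_real ((norm (a x + 1 * b x))\<^sup>2) - of_real ((norm (a x + (-1) * b x))\<^sup>2)
   + \<i> * of_real ((norm (a x + \<i> * b x))\<^sup>2) - \<i> * of_real ((norm (a x + (-\<i>) * b x))\<^sup>2)) \<partial>M)" by (simp only:)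
 also have "\<dots> = (1/4) * ((\<integral>x. of_real ((norm (a x + 1 * b x))\<^sup>2) \<partial>M) - (\<integral>x. of_real ((norm (a x + (-1) * b x))\<^sup>2) \<partial>M)
   + \<i> * (\<integral>x. of_real ((norm (a x + \<i> * b x))\<^sup>2) \<partial>M) - \<i> * (\<integral>x. of_real ((norm (a x + (-\<i>) * b x))\<^sup>2) \<partial>M))"
  by (simp only: integral_mult_right_zero Bochner_Integration.integral_add Bochner_Integration.integral_diff
   Bochner_Integration.integrable_add Bochner_Integration.integrable_diff integrable_mult_right int)
 finally show ?thesis by (simp only: integral_complex_of_real)
qed

lemma integrable_mult_bounded:
 fixes f g :: "'a \<Rightarrow> complex"
 assumes f: "integrable M f" and g: "g \<in> borel_measurable M" "\<And>x. norm (g x) \<le> B"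
 shows "integrable M (\<lambda>x. f x * g x)"
proof (rule Bochner_Integration.integrable_bound)
 show "integrable M (\<lambda>x. B * norm (f x))" using f by (intro integrable_mult_right integrable_norm)
 show "AE x in M. norm (f x * g x) \<le> norm (B * norm (f x))"
 proof (rule AE_I2)
  fix x
  have "norm (f x * g x) \<le> B * norm (f x)"
   using mult_left_mono[OF g(2)[of x] norm_ge_zero[of "f x"]] by (simp add: norm_mult mult.commute)
  then show "norm (f x * g x) \<le> norm (B * norm (f x))" by simp
 qed
qed (use f g in auto)

text \<open>The integrability behind every exchange of a Fourier integral with a second integration:
  a phase of modulus at most 1 does not disturb a tensor product of integrable functions.\<close>

lemma integrable_tensor_phase:
 fixes a :: "'a \<Rightarrow> complex" and b :: "'b \<Rightarrow> complex"
 assumes "sigma_finite_measure M" "sigma_finite_measure N"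
  and a: "integrable M a" and b: "integrable N b"
  and c: "(\<lambda>z. c (fst z) (snd z)) \<in> borel_measurable (M \<Otimes>\<^sub>M N)" "\<And>x y. norm (c x y) \<le> 1"
 shows "integrable (M \<Otimes>\<^sub>M N) (\<lambda>(x, y). a x * b y * c x y)"
proof -
 interpret M: sigma_finite_measure M by fact
 interpret N: sigma_finite_measure N by fact
 interpret P: pair_sigma_finite M N ..
 have am [measurable]: "a \<in> borel_measurable M" and bm [measurable]: "b \<in> borel_measurable N" using a b by auto
 have "integrable (M \<Otimes>\<^sub>M N) (\<lambda>z. a (fst z) * b (snd z))"
 proof (rule P.Fubini_integrable)
  show "integrable M (\<lambda>x. \<integral>y. norm (a (fst (x, y)) * b (snd (x, y))) \<partial>N)"
   using a by (simp add: norm_mult)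
  show "AE x in M. integrable N (\<lambda>y. a (fst (x, y)) * b (snd (x, y)))"
   using b by simp
 qed measurable
 from integrable_mult_bounded[OF this c(1), of 1] c(2) show ?thesis by (simp add: case_prod_unfold)
qed

section \<open>Fourier inversion\<close>

lemma cis_has_vector_derivative:
 "((\<lambda>s. cis (s * r)) has_vector_derivative (\<i> * of_real r * cis (s * r))) (at s)"
 unfolding cis_conv_exp
 using exp_scaleR_has_vector_derivative_left[of "\<i> * of_real r" s]
 by (simp add: scaleR_conv_of_real mult_ac)

locale phase_space =
 M: schwartz_group \<mu> Ps + N: schwartz_group \<nu> Qs
 for \<mu> :: "'g::{topological_ab_group_add, t2_space, second_countable_topology} measure" and Ps
  and \<nu> :: "'g pontryagin_dual measure" and Qs +
 assumes lc: "locally compact (UNIV :: 'g set)" and planch: "plancherel \<mu> \<nu>"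
begin

lemma continuous_on_char [continuous_intros]:
 fixes f :: "'a::topological_space \<Rightarrow> 'g pontryagin_dual"
 assumes "continuous_on S f" "continuous_on S g"
 shows "continuous_on S (\<lambda>x. char_fun (f x) (g x))"
 using continuous_on_compose2[OF continuous_eval_dual_joint[OF lc] continuous_on_Pair[OF assms]] by simp

lemma schwartz_mult_char:
 assumes v: "v \<in> schwartz_space"
 shows "(\<lambda>\<epsilon>. char_fun \<epsilon> t * v \<epsilon>) \<in> (schwartz_space :: ('g pontryagin_dual \<Rightarrow> complex) set)"
proof (rule schwartz_phase[OF v])
 show "continuous_on UNIV (\<lambda>\<epsilon>. char_fun \<epsilon> t)" by (rule continuous_eval_dual)
 show "bounded (range (\<lambda>\<epsilon>. char_fun \<epsilon> t))" by (auto simp: bounded_iff)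
 fix X :: "real \<Rightarrow> 'g pontryagin_dual" assume "one_param X"
 then obtain p where p: "\<And>t s. char_fun (X s) t = cis (s * p t)"
  using one_param_dual_frequency[OF lc] by blast
 have "((\<lambda>s. char_fun (x + X s) t) has_vector_derivative \<i> * of_real (p t) * char_fun x t) (at 0)" for x
  using has_vector_derivative_mult_left[OF cis_has_vector_derivative[of "p t" 0], of "char_fun x t"]
  by (simp add: char_fun_add p mult.commute)
 then show "\<exists>q r. real_hom q \<and> (\<forall>x. ((\<lambda>s. char_fun (x + X s) t) has_vector_derivative
   \<i> * of_real (q x + r) * char_fun x t) (at 0))"
  by (intro exI[of _ "\<lambda>_. 0"] exI[of _ "p t"]) (simp add: real_hom_const_0)
qed

text \<open>
 The matrix coefficient \<open>V\<close> with the second argument already conjugated. Polynomials in \<open>t\<close> are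
 absorbed by integration by parts along the one-parameter subgroup of the dual that they define.
\<close>

definition wigner ::
 "('g pontryagin_dual \<Rightarrow> complex) \<Rightarrow> ('g pontryagin_dual \<Rightarrow> complex) \<Rightarrow> 'g pontryagin_dual \<times> 'g \<Rightarrow> complex"
 where "wigner \<xi> \<eta> z = (\<integral>\<epsilon>. \<xi> (\<epsilon> + fst z) * \<eta> \<epsilon> * char_fun \<epsilon> (snd z) \<partial>\<nu>)"

lemma wigner_schwartz:
 assumes "\<xi> \<in> schwartz_space" "\<eta> \<in> schwartz_space"
 shows "wigner \<xi> \<eta> \<in> schwartz_space"
proof (rule schwartz_coinduct_span)
 define W where "W = {wigner \<xi> \<eta> | \<xi> \<eta>. \<xi> \<in> schwartz_space \<and> \<eta> \<in> schwartz_space}"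
 have VW: "wigner \<xi> \<eta> \<in> fspan W" if "\<xi> \<in> schwartz_space" "\<eta> \<in> schwartz_space" for \<xi> \<eta>
  using that unfolding W_def by (intro fspan.base) blast
 show "wigner \<xi> \<eta> \<in> fspan W" using assms by (rule VW)
 fix g assume "g \<in> W"
 then obtain \<xi> \<eta> where xe: "\<xi> \<in> schwartz_space" "\<eta> \<in> schwartz_space" and g: "g = wigner \<xi> \<eta>"
  unfolding W_def by blast
 have bnd: "\<exists>B. \<forall>x. norm (f x) \<le> B" if "f \<in> schwartz_space" for f :: "'g pontryagin_dual \<Rightarrow> complex"
  using schwartz_bounded[OF that] by (auto simp: bounded_iff)
 have meas: "(\<lambda>\<epsilon>. \<xi> (\<epsilon> + \<gamma>) * \<eta> \<epsilon> * char_fun \<epsilon> t) \<in> borel_measurable \<nu>"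
  if "\<xi> \<in> schwartz_space" "\<eta> \<in> schwartz_space" for \<xi> \<eta> \<gamma> t
  by (intro N.cont_meas continuous_intros schwartz_continuous schwartz_translate that)
 have int: "integrable \<nu> (\<lambda>\<epsilon>. \<xi> (\<epsilon> + \<gamma>) * \<eta> \<epsilon> * char_fun \<epsilon> t)"
  if "\<xi> \<in> schwartz_space" "\<eta> \<in> schwartz_space" for \<xi> \<eta> \<gamma> t
  by (rule integrable_mult_bounded[where B = 1])
   (auto intro!: N.schwartz_integrable schwartz_mult schwartz_translate that N.cont_meas continuous_eval_dual)
 obtain B where B: "\<And>x. norm (\<xi> x) \<le> B" using bnd[OF xe(1)] by blast
 have nb: "norm (\<xi> x * \<eta> y * char_fun y t) \<le> B * norm (\<eta> y)" for x y t
  using mult_right_mono[OF B[of x] norm_ge_zero[of "\<eta> y"]] by (simp add: norm_mult)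
 have iB: "integrable \<nu> (\<lambda>y. B * norm (\<eta> y))"
  by (intro integrable_mult_right integrable_norm N.schwartz_integrable xe)
 show "continuous_on UNIV g" unfolding g wigner_def
 proof (rule continuous_on_integral_param[OF _ _ _ iB nb])
  show "countably_based TYPE('g pontryagin_dual \<times> 'g)"
   by (intro countably_based_prod countably_based_dual lc countably_based_class)
  show "continuous_on UNIV (\<lambda>z. \<xi> (\<epsilon> + fst z) * \<eta> \<epsilon> * char_fun \<epsilon> (snd z))" for \<epsilon>
   by (intro continuous_intros continuous_on_compose2[OF schwartz_continuous[OF xe(1)]]) auto
 qed (rule meas[OF xe])
 show "bounded (range g)"
 proof -
  have "norm (wigner \<xi> \<eta> z) \<le> (\<integral>y. B * norm (\<eta> y) \<partial>\<nu>)" for z unfolding wigner_def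
   by (rule order_trans[OF integral_norm_bound Bochner_Integration.integral_mono[OF integrable_norm[OF int[OF xe]] iB nb]])
  then show ?thesis by (auto simp: bounded_iff g)
 qed
 show "\<exists>g'\<in>fspan W. \<forall>x. ((\<lambda>t. g (x + X t)) has_vector_derivative g' x) (at 0)" if X: "one_param X" for X
 proof -
  define X1 X2 where "X1 = (\<lambda>s. fst (X s))" and "X2 = (\<lambda>s. snd (X s))"
  have X1: "one_param X1" and X2: "one_param X2" unfolding X1_def X2_def
   using X by (auto intro: one_param_fst one_param_snd)
  obtain P where P: "real_hom P" "\<And>\<gamma> s. char_fun \<gamma> (X2 s) = cis (s * P \<gamma>)"
   using one_param_frequency[OF X2] by blast
  \<comment> \<open>Moving in the dual differentiates the first function; moving in the group brings
    down the frequency P \<epsilon>, a polynomial factor that the second function absorbs.\<close>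
  let ?\<xi>' = "dir_deriv X1 \<xi>" and ?\<eta>' = "\<lambda>\<epsilon>. \<i> * (of_real (P \<epsilon>) * \<eta> \<epsilon>)"
  have d: "?\<xi>' \<in> schwartz_space" "?\<eta>' \<in> schwartz_space"
   by (intro schwartz_dir_deriv schwartz_scale schwartz_mult_real_hom xe X1 P)+
  obtain B' where B': "\<And>x. norm (?\<xi>' x) \<le> B'" using bnd[OF d(1)] by blast
  have "((\<lambda>s. wigner \<xi> \<eta> (z + X s)) has_vector_derivative wigner ?\<xi>' \<eta> z + wigner \<xi> ?\<eta>' z) (at 0)" for z
  proof -
   let ?D = "\<lambda>\<epsilon> s. ?\<xi>' (\<epsilon> + fst z + X1 s) * \<eta> \<epsilon> * char_fun \<epsilon> (snd z + X2 s)
     + \<xi> (\<epsilon> + fst z + X1 s) * ?\<eta>' \<epsilon> * char_fun \<epsilon> (snd z + X2 s)"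
   have "((\<lambda>s. \<integral>\<epsilon>. \<xi> (\<epsilon> + fst z + X1 s) * \<eta> \<epsilon> * char_fun \<epsilon> (snd z + X2 s) \<partial>\<nu>)
     has_vector_derivative (\<integral>\<epsilon>. ?D \<epsilon> 0 \<partial>\<nu>)) (at 0)"
   proof (rule integral_has_vector_derivative_param)
    show "integrable \<nu> (\<lambda>\<epsilon>. \<xi> (\<epsilon> + fst z + X1 s) * \<eta> \<epsilon> * char_fun \<epsilon> (snd z + X2 s))" for s
     using int[OF xe, of "fst z + X1 s"] by (simp add: add.assoc)
    show "((\<lambda>s. \<xi> (\<epsilon> + fst z + X1 s) * \<eta> \<epsilon> * char_fun \<epsilon> (snd z + X2 s)) has_vector_derivative ?D \<epsilon> s) (at s)" for \<epsilon> s
    proof -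
     have 1: "((\<lambda>s. \<xi> (\<epsilon> + fst z + X1 s) * \<eta> \<epsilon>) has_vector_derivative ?\<xi>' (\<epsilon> + fst z + X1 s) * \<eta> \<epsilon>) (at s)"
      by (intro has_vector_derivative_mult_left schwartz_has_deriv_at xe X1)
     have 2: "((\<lambda>s. char_fun \<epsilon> (snd z + X2 s)) has_vector_derivative \<i> * of_real (P \<epsilon>) * char_fun \<epsilon> (snd z + X2 s)) (at s)"
      using has_vector_derivative_mult_right[OF cis_has_vector_derivative[of "P \<epsilon>" s], of "char_fun \<epsilon> (snd z)"]
      by (simp add: char_fun_add_arg P mult_ac)
     show ?thesis using has_vector_derivative_mult[OF 1 2] by (simp add: algebra_simps)
    qed
    show "integrable \<nu> (\<lambda>\<epsilon>. B' * norm (\<eta> \<epsilon>) + B * norm (?\<eta>' \<epsilon>))"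
     by (intro Bochner_Integration.integrable_add integrable_mult_right integrable_norm N.schwartz_integrable xe d)
    show "norm (?D \<epsilon> s) \<le> B' * norm (\<eta> \<epsilon>) + B * norm (?\<eta>' \<epsilon>)" for \<epsilon> s
    proof (rule norm_triangle_le, rule add_mono)
     show "norm (?\<xi>' (\<epsilon> + fst z + X1 s) * \<eta> \<epsilon> * char_fun \<epsilon> (snd z + X2 s)) \<le> B' * norm (\<eta> \<epsilon>)"
      using mult_right_mono[OF B'[of "\<epsilon> + fst z + X1 s"] norm_ge_zero[of "\<eta> \<epsilon>"]] by (simp add: norm_mult)
     show "norm (\<xi> (\<epsilon> + fst z + X1 s) * ?\<eta>' \<epsilon> * char_fun \<epsilon> (snd z + X2 s)) \<le> B * norm (?\<eta>' \<epsilon>)"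
      using mult_right_mono[OF B[of "\<epsilon> + fst z + X1 s"] norm_ge_zero[of "?\<eta>' \<epsilon>"]] by (simp add: norm_mult)
    qed
    show "(\<lambda>\<epsilon>. ?D \<epsilon> 0) \<in> borel_measurable \<nu>"
     using meas[OF d(1) xe(2), of "fst z" "snd z"] meas[OF xe(1) d(2), of "fst z" "snd z"]
     by (simp add: one_param_0[OF X1] one_param_0[OF X2])
   qed
   then show ?thesis unfolding wigner_def X1_def[symmetric] X2_def[symmetric]
    using int[OF d(1) xe(2), of "fst z" "snd z"] int[OF xe(1) d(2), of "fst z" "snd z"]
    by (simp add: one_param_0[OF X1] one_param_0[OF X2] X1_def[symmetric] X2_def[symmetric] fun_cong[OF X1_def, symmetric] fun_cong[OF X2_def, symmetric] add.assoc)
  qed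
  moreover have "(\<lambda>z. wigner ?\<xi>' \<eta> z + wigner \<xi> ?\<eta>' z) \<in> fspan W" by (intro fspan.add VW d xe)
  ultimately show ?thesis unfolding g by (intro bexI[of _ "\<lambda>z. wigner ?\<xi>' \<eta> z + wigner \<xi> ?\<eta>' z"] allI)
 qed
 show "(\<lambda>x. of_real (p x) * g x) \<in> fspan W" if p: "real_hom p" for p
 proof -
  define p1 p2 where "p1 = (\<lambda>\<gamma>. p (\<gamma>, 0))" and "p2 = (\<lambda>t. p (0, t))"
  have p1: "real_hom p1" and p2: "real_hom p2" unfolding p1_def p2_def
   using p by (auto intro: real_hom_slice_fst real_hom_slice_snd)
  have pz: "p z = p1 (fst z) + p2 (snd z)" for z unfolding p1_def p2_def by (rule real_hom_Pair[OF p])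
  obtain X where X: "one_param X" "\<And>s t. char_fun (X s) t = cis (s * p2 t)"
   using real_hom_frequency[OF p2] by blast
  let ?a = "\<lambda>\<epsilon>. of_real (p1 \<epsilon>) * \<xi> \<epsilon>" and ?b = "\<lambda>\<epsilon>. of_real (p1 \<epsilon>) * \<eta> \<epsilon>"
  let ?c = "dir_deriv X \<xi>" and ?d = "dir_deriv X \<eta>"
  have s: "?a \<in> schwartz_space" "?b \<in> schwartz_space" "?c \<in> schwartz_space" "?d \<in> schwartz_space"
   by (intro schwartz_dir_deriv schwartz_mult_real_hom xe X p1)+
  \<comment> \<open>The identity p1 (fst z) = p1 (\<epsilon> + fst z) - p1 \<epsilon> distributes
    the factor over the two functions.\<close>
  have 1: "of_real (p1 (fst z)) * wigner \<xi> \<eta> z = wigner ?a \<eta> z - wigner \<xi> ?b z" for z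
  proof -
   have "of_real (p1 (fst z)) * wigner \<xi> \<eta> z =
     (\<integral>\<epsilon>. of_real (p1 (fst z)) * (\<xi> (\<epsilon> + fst z) * \<eta> \<epsilon> * char_fun \<epsilon> (snd z)) \<partial>\<nu>)"
    unfolding wigner_def by simp
   also have "\<dots> = (\<integral>\<epsilon>. ?a (\<epsilon> + fst z) * \<eta> \<epsilon> * char_fun \<epsilon> (snd z) - \<xi> (\<epsilon> + fst z) * ?b \<epsilon> * char_fun \<epsilon> (snd z) \<partial>\<nu>)"
    by (intro Bochner_Integration.integral_cong refl) (simp add: real_hom_add[OF p1] algebra_simps)
   also have "\<dots> = wigner ?a \<eta> z - wigner \<xi> ?b z" unfolding wigner_def
    by (rule Bochner_Integration.integral_diff[OF int[OF s(1) xe(2)] int[OF xe(1) s(2)]])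
   finally show ?thesis .
  qed
  have 2: "of_real (p2 (snd z)) * wigner \<xi> \<eta> z = \<i> * (wigner ?c \<eta> z + wigner \<xi> ?d z)" for z
  proof -
   \<comment> \<open>The derivative of the character along X is \<i> p2 (snd z) times itself. As the
     derivative of u integrates to 0, the factor p2 (snd z) is traded for derivatives of \<xi> and
     \<eta>.\<close>
   let ?u = "\<lambda>\<epsilon>. char_fun \<epsilon> (snd z) * (\<xi> (\<epsilon> + fst z) * \<eta> \<epsilon>)"
   have u: "?u \<in> schwartz_space" by (intro schwartz_mult_char schwartz_mult schwartz_translate xe)
   have "dir_deriv X ?u \<epsilon> = ?c (\<epsilon> + fst z) * \<eta> \<epsilon> * char_fun \<epsilon> (snd z) + \<xi> (\<epsilon> + fst z) * ?d \<epsilon> * char_fun \<epsilon> (snd z)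
     + \<i> * of_real (p2 (snd z)) * (\<xi> (\<epsilon> + fst z) * \<eta> \<epsilon> * char_fun \<epsilon> (snd z))" for \<epsilon>
   proof (rule dir_derivI)
    have a: "((\<lambda>s. \<xi> (\<epsilon> + X s + fst z)) has_vector_derivative ?c (\<epsilon> + fst z)) (at 0)"
     using schwartz_has_deriv[OF xe(1) X(1), of "\<epsilon> + fst z"] by (simp add: ac_simps)
    have b: "((\<lambda>s. \<eta> (\<epsilon> + X s)) has_vector_derivative ?d \<epsilon>) (at 0)"
     by (rule schwartz_has_deriv[OF xe(2) X(1)])
    have c: "((\<lambda>s. char_fun (\<epsilon> + X s) (snd z)) has_vector_derivative \<i> * of_real (p2 (snd z)) * char_fun \<epsilon> (snd z)) (at 0)"
     using has_vector_derivative_mult_right[OF cis_has_vector_derivative[of "p2 (snd z)" 0], of "char_fun \<epsilon> (snd z)"]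
     by (simp add: char_fun_add X mult_ac)
    show "((\<lambda>s. ?u (\<epsilon> + X s)) has_vector_derivative
      ?c (\<epsilon> + fst z) * \<eta> \<epsilon> * char_fun \<epsilon> (snd z) + \<xi> (\<epsilon> + fst z) * ?d \<epsilon> * char_fun \<epsilon> (snd z)
     + \<i> * of_real (p2 (snd z)) * (\<xi> (\<epsilon> + fst z) * \<eta> \<epsilon> * char_fun \<epsilon> (snd z))) (at 0)"
     using has_vector_derivative_mult[OF c has_vector_derivative_mult[OF a b]]
     by (simp add: one_param_0[OF X(1)] algebra_simps)
   qed
   then have "(\<integral>\<epsilon>. ?c (\<epsilon> + fst z) * \<eta> \<epsilon> * char_fun \<epsilon> (snd z) + \<xi> (\<epsilon> + fst z) * ?d \<epsilon> * char_fun \<epsilon> (snd z)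
     + \<i> * of_real (p2 (snd z)) * (\<xi> (\<epsilon> + fst z) * \<eta> \<epsilon> * char_fun \<epsilon> (snd z)) \<partial>\<nu>) = 0"
    using N.schwartz_integral_dir_deriv[OF u X(1)] by simp
   then have "wigner ?c \<eta> z + wigner \<xi> ?d z + \<i> * of_real (p2 (snd z)) * wigner \<xi> \<eta> z = 0"
    unfolding wigner_def using int[OF s(3) xe(2), of "fst z" "snd z"] int[OF xe(1) s(4), of "fst z" "snd z"] int[OF xe, of "fst z" "snd z"]
    by simp
   then have "wigner ?c \<eta> z + wigner \<xi> ?d z = - (\<i> * of_real (p2 (snd z)) * wigner \<xi> \<eta> z)"
    by (simp only: eq_neg_iff_add_eq_0)
   then show ?thesis by (simp flip: mult.assoc)
  qed
  have "of_real (p z) * g z = (wigner ?a \<eta> z - wigner \<xi> ?b z) + \<i> * (wigner ?c \<eta> z + wigner \<xi> ?d z)" for z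
   unfolding g using 1[of z] 2[of z] by (simp add: pz distrib_right)
  moreover have "(\<lambda>z. (wigner ?a \<eta> z - wigner \<xi> ?b z) + \<i> * (wigner ?c \<eta> z + wigner \<xi> ?d z)) \<in> fspan W"
   by (intro fspan.add fspan_diff fspan.scale VW s xe)
  ultimately show ?thesis by (simp only:)
 qed
qed

section \<open>Uniqueness and inversion for the Fourier transform\<close>

lemma bounded_integrable_sq_integrable:
 assumes "integrable M f" "\<And>x. norm (f x) \<le> B"
 shows "f \<in> sq_integrable M"
proof -
 have "integrable M (\<lambda>x. f x * cnj (f x))"
  using assms by (intro integrable_mult_bounded[where B = B]) auto
 from integrable_norm[OF this] show ?thesis
  using assms(1) by (auto simp: sq_integrable_def norm_mult power2_eq_square)
qed

text \<open>w annihilates every character, hence every trigonometric polynomial. These are dense in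
  the L^2 space of the finite measure with density |w|, so the conjugate of w can be replaced by
  such a polynomial, and the integral of |w|^2 is arbitrarily small.\<close>

lemma transform_injective:
 assumes w: "continuous_on UNIV w" "\<And>\<epsilon>. norm (w \<epsilon>) \<le> B" "integrable \<nu> w"
  and zero: "\<And>t. (\<integral>\<epsilon>. w \<epsilon> * char_fun \<epsilon> t \<partial>\<nu>) = 0"
 shows "w = (\<lambda>_. 0)"
proof -
 let ?m = "density \<nu> (\<lambda>x. ennreal (norm (w x)))"
 define W where "W = range (\<lambda>t (\<epsilon> :: 'g pontryagin_dual). char_fun \<epsilon> t)"
 have wm: "w \<in> borel_measurable \<nu>" using w(3) by simp
 have Wf: "continuous_on UNIV r \<and> bounded (range r) \<and> (\<integral>\<epsilon>. w \<epsilon> * r \<epsilon> \<partial>\<nu>) = 0" if "r \<in> fspan W" for r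
  using that
 proof induction
  case (base f)
  then show ?case using zero by (auto simp: W_def continuous_eval_dual bounded_iff)
 next
  case (add f g)
  then have "integrable \<nu> (\<lambda>\<epsilon>. w \<epsilon> * f \<epsilon>)" "integrable \<nu> (\<lambda>\<epsilon>. w \<epsilon> * g \<epsilon>)"
   using w(3) by (auto simp: bounded_iff intro!: integrable_mult_bounded N.cont_meas)
  then show ?case using add by (simp add: distrib_left continuous_on_add bounded_range_add)
 next
  case (scale f z)
  then show ?case by (simp add: continuous_on_mult_left bounded_range_mult mult.left_commute)
 qed auto
 define T where "T = (\<integral>\<epsilon>. norm (w \<epsilon>) \<partial>\<nu>)"
 have T0: "T \<ge> 0" by (simp add: T_def)
 have bound: "norm (\<integral>\<epsilon>. w \<epsilon> * cnj (w \<epsilon>) \<partial>\<nu>) \<le> \<delta> * ((T + 1) / 2)" if d: "\<delta> > 0" for \<delta>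
 proof -
  obtain r where r: "r \<in> fspan W" "(\<integral>x. (norm (cnj (w x) - r x))\<^sup>2 \<partial>?m) < \<delta>\<^sup>2"
  proof -
   have "\<exists>r\<in>fspan W. (\<integral>x. (norm (cnj (w x) - r x))\<^sup>2 \<partial>?m) < \<delta>\<^sup>2"
   proof (rule bounded_complex_algebra_dense_L2)
    show "finite_measure ?m" by (rule N.tight_density(2)[of _ 1]) (use w in auto)
    show "\<exists>C. compact C \<and> measure ?m (- C) < e" if "e > 0" for e
     by (rule N.tight_density(1)) (use w that in auto)
    show "(\<lambda>x. f x * g x) \<in> W" if fg: "f \<in> W" "g \<in> W" for f g
    proof -
     obtain s t where "f = (\<lambda>\<epsilon>. char_fun \<epsilon> s)" "g = (\<lambda>\<epsilon>. char_fun \<epsilon> t)" using fg by (auto simp: W_def)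
     then have "(\<lambda>x. f x * g x) = (\<lambda>\<epsilon>. char_fun \<epsilon> (s + t))" by (simp add: char_fun_add_arg)
     then show ?thesis unfolding W_def by blast
    qed
    have "(\<lambda>_. 1) = (\<lambda>\<epsilon> :: 'g pontryagin_dual. char_fun \<epsilon> 0)" by simp
    then show "(\<lambda>_. 1) \<in> W" unfolding W_def by blast
    show "(\<lambda>x. cnj (f x)) \<in> W" if f: "f \<in> W" for f
    proof -
     obtain s where "f = (\<lambda>\<epsilon>. char_fun \<epsilon> s)" using f by (auto simp: W_def)
     then have "(\<lambda>x. cnj (f x)) = (\<lambda>\<epsilon>. char_fun \<epsilon> (- s))" by (simp add: char_fun_minus_arg)
     then show ?thesis unfolding W_def by blast
    qed
    show "\<exists>w\<in>W. w x \<noteq> w y" if "x \<noteq> y" for x y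
    proof -
     obtain t where "char_fun x t \<noteq> char_fun y t" using \<open>x \<noteq> y\<close> by (metis char_fun_inject ext)
     then show ?thesis by (intro bexI[of _ "\<lambda>\<epsilon>. char_fun \<epsilon> t"]) (auto simp: W_def)
    qed
    show "bounded (range (\<lambda>x. cnj (w x)))" using w(2) by (auto simp: bounded_iff)
    show "continuous_on UNIV (\<lambda>x. cnj (w x))" by (intro continuous_intros w)
   qed (use d in \<open>auto simp: W_def continuous_eval_dual bounded_iff\<close>)
   then show thesis using that by blast
  qed
  have rc: "continuous_on UNIV r" "bounded (range r)" "(\<integral>\<epsilon>. w \<epsilon> * r \<epsilon> \<partial>\<nu>) = 0" using Wf[OF r(1)] by auto
  then obtain D where D: "\<And>x. norm (r x) \<le> D" by (auto simp: bounded_iff)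
  have hm: "(\<lambda>x. cnj (w x) - r x) \<in> borel_measurable \<nu>" using w rc by (intro N.cont_meas continuous_intros)
  have hb: "norm (cnj (w x) - r x) \<le> B + D" for x
   using norm_triangle_ineq4[of "cnj (w x)" "r x"] w(2)[of x] D[of x] by simp
  have i1: "integrable \<nu> (\<lambda>x. w x * cnj (w x))" "integrable \<nu> (\<lambda>x. w x * r x)"
   using w D rc by (auto intro!: integrable_mult_bounded N.cont_meas continuous_intros)
  have i2: "integrable \<nu> (\<lambda>x. w x * (cnj (w x) - r x))"
   by (rule integrable_mult_bounded[OF w(3) hm hb])
  have i3: "integrable \<nu> (\<lambda>x. norm (w x) * (norm (cnj (w x) - r x))\<^sup>2)"
  proof -
   have "integrable \<nu> (\<lambda>x. w x * ((cnj (w x) - r x) * cnj (cnj (w x) - r x)))"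
   proof (rule integrable_mult_bounded[OF w(3), where B = "(B + D) * (B + D)"])
    show "norm ((cnj (w x) - r x) * cnj (cnj (w x) - r x)) \<le> (B + D) * (B + D)" for x
     using mult_mono[OF hb[of x] hb[of x] order_trans[OF norm_ge_zero hb[of x]] norm_ge_zero]
     by (simp only: norm_mult complex_mod_cnj)
   qed (intro borel_measurable_times borel_measurable_cnj hm)
   from integrable_norm[OF this] show ?thesis by (simp only: norm_mult complex_mod_cnj power2_eq_square)
  qed
  have "norm (\<integral>\<epsilon>. w \<epsilon> * cnj (w \<epsilon>) \<partial>\<nu>) = norm (\<integral>\<epsilon>. w \<epsilon> * (cnj (w \<epsilon>) - r \<epsilon>) \<partial>\<nu>)"
   using i1 rc(3) by (simp add: right_diff_distrib)
  also have "\<dots> \<le> (\<integral>\<epsilon>. norm (w \<epsilon> * (cnj (w \<epsilon>) - r \<epsilon>)) \<partial>\<nu>)" by (rule integral_norm_bound)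
  \<comment> \<open>The pointwise inequality h \<le> \<delta>/2 + h^2/(2 \<delta>) trades the error
    for its square in the weighted space, which is below \<delta>^2; this is where (T + 1)/2 comes
    from.\<close>
  also have "\<dots> \<le> (\<integral>\<epsilon>. (\<delta> / 2) * norm (w \<epsilon>) + (1 / (2 * \<delta>)) * (norm (w \<epsilon>) * (norm (cnj (w \<epsilon>) - r \<epsilon>))\<^sup>2) \<partial>\<nu>)"
  proof (rule Bochner_Integration.integral_mono)
   show "norm (w \<epsilon> * (cnj (w \<epsilon>) - r \<epsilon>)) \<le> (\<delta> / 2) * norm (w \<epsilon>) + (1 / (2 * \<delta>)) * (norm (w \<epsilon>) * (norm (cnj (w \<epsilon>) - r \<epsilon>))\<^sup>2)" for \<epsilon>
   proof -
    let ?h = "norm (cnj (w \<epsilon>) - r \<epsilon>)"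
    have "2 * \<delta> * ?h \<le> \<delta>\<^sup>2 + ?h\<^sup>2" using sum_squares_bound[of \<delta> ?h] by simp
    then have "?h \<le> \<delta> / 2 + (1 / (2 * \<delta>)) * ?h\<^sup>2" using d by (simp add: field_simps power2_eq_square)
    from mult_left_mono[OF this norm_ge_zero[of "w \<epsilon>"]] show ?thesis
     unfolding norm_mult by (simp add: distrib_left mult_ac)
   qed
  qed (use i2 i3 w(3) in \<open>auto intro!: Bochner_Integration.integrable_add\<close>)
  also have "\<dots> = (\<delta> / 2) * T + (1 / (2 * \<delta>)) * (\<integral>\<epsilon>. norm (w \<epsilon>) * (norm (cnj (w \<epsilon>) - r \<epsilon>))\<^sup>2 \<partial>\<nu>)"
   using i3 w(3) by (simp add: T_def)
  also have "(\<integral>\<epsilon>. norm (w \<epsilon>) * (norm (cnj (w \<epsilon>) - r \<epsilon>))\<^sup>2 \<partial>\<nu>) = (\<integral>x. (norm (cnj (w x) - r x))\<^sup>2 \<partial>?m)"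
   using wm hm by (subst integral_density) auto
  also have "(\<delta> / 2) * T + (1 / (2 * \<delta>)) * \<dots> \<le> (\<delta> / 2) * T + (1 / (2 * \<delta>)) * \<delta>\<^sup>2"
   using r(2) d by (intro add_left_mono mult_left_mono) auto
  also have "\<dots> = \<delta> * ((T + 1) / 2)" using d by (simp add: field_simps power2_eq_square)
  finally show ?thesis .
 qed
 have "norm (\<integral>\<epsilon>. w \<epsilon> * cnj (w \<epsilon>) \<partial>\<nu>) \<le> 0"
 proof (rule field_le_epsilon)
  fix e :: real assume "e > 0"
  moreover have "e * 2 / (T + 1) * ((T + 1) / 2) = e" using T0 by (simp add: field_simps)
  ultimately show "norm (\<integral>\<epsilon>. w \<epsilon> * cnj (w \<epsilon>) \<partial>\<nu>) \<le> 0 + e"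
   using bound[of "e * 2 / (T + 1)"] T0 by simp
 qed
 then have "(\<integral>\<epsilon>. complex_of_real ((norm (w \<epsilon>))\<^sup>2) \<partial>\<nu>) = 0"
  unfolding complex_norm_square by simp
 then have "(\<integral>\<epsilon>. (norm (w \<epsilon>))\<^sup>2 \<partial>\<nu>) = 0"
  unfolding integral_complex_of_real by (simp only: of_real_eq_0_iff)
 moreover have "integrable \<nu> (\<lambda>\<epsilon>. (norm (w \<epsilon>))\<^sup>2)"
  using bounded_integrable_sq_integrable[OF w(3,2)] by (simp add: sq_integrable_def)
 ultimately have "AE \<epsilon> in \<nu>. (norm (w \<epsilon>))\<^sup>2 = 0"
  by (subst (asm) integral_nonneg_eq_0_iff_AE) auto
 then have "AE \<epsilon> in \<nu>. w \<epsilon> = 0" by simp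
 then show ?thesis by (rule N.continuous_AE_zero[OF w(1)])
qed

lemma char_meas: "(\<lambda>x. char_fun \<gamma> x) \<in> borel_measurable \<mu>"
 by (intro M.cont_meas continuous_char_fun)

lemma fourier_add_scale:
 assumes "integrable \<mu> f" "integrable \<mu> g"
 shows "fourier \<mu> (\<lambda>x. f x + z * g x) \<gamma> = fourier \<mu> f \<gamma> + z * fourier \<mu> g \<gamma>"
proof -
 have "integrable \<mu> (\<lambda>x. f x * cnj (char_fun \<gamma> x))" "integrable \<mu> (\<lambda>x. g x * cnj (char_fun \<gamma> x))"
  using assms char_meas[of \<gamma>] by (auto intro!: integrable_mult_bounded[where B = 1])
 then show ?thesis by (simp add: fourier_def distrib_right mult.assoc)
qed

text \<open>By linearity the norm identity holds for f + z g with every z, and polarization of both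
  sides gives the claim.\<close>

lemma fourier_parseval:
 assumes f: "integrable \<mu> f" "f \<in> sq_integrable \<mu>" and g: "integrable \<mu> g" "g \<in> sq_integrable \<mu>"
 shows "(\<integral>\<gamma>. fourier \<mu> f \<gamma> * cnj (fourier \<mu> g \<gamma>) \<partial>\<nu>) = (\<integral>x. f x * cnj (g x) \<partial>\<mu>)"
proof -
 have "(\<integral>\<gamma>. (norm (fourier \<mu> f \<gamma> + z * fourier \<mu> g \<gamma>))\<^sup>2 \<partial>\<nu>) = (\<integral>x. (norm (f x + z * g x))\<^sup>2 \<partial>\<mu>)" for z
 proof -
  have "integrable \<mu> (\<lambda>x. f x + z * g x)" using f g by simp
  moreover have "(\<lambda>x. f x + z * g x) \<in> sq_integrable \<mu>"
   by (intro sq_integrable_add sq_integrable_scale f g)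
  ultimately have "(\<integral>\<gamma>. (norm (fourier \<mu> (\<lambda>x. f x + z * g x) \<gamma>))\<^sup>2 \<partial>\<nu>) = (\<integral>x. (norm (f x + z * g x))\<^sup>2 \<partial>\<mu>)"
   using planch unfolding plancherel_def by blast
  then show ?thesis by (simp only: fourier_add_scale[OF f(1) g(1)])
 qed
 note eq = this
 have "fourier \<mu> f \<in> sq_integrable \<nu>" "fourier \<mu> g \<in> sq_integrable \<nu>"
  using planch f g unfolding plancherel_def by blast+
 then show ?thesis
  by (simp only: polarization_integral[OF f(2) g(2)] polarization_integral[of "fourier \<mu> f" \<nu> "fourier \<mu> g"] eq)
qed

lemma fourier_continuous:
 assumes "integrable \<mu> f"
 shows "continuous_on UNIV (fourier \<mu> f)" "norm (fourier \<mu> f \<gamma>) \<le> (\<integral>x. norm (f x) \<partial>\<mu>)"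
proof -
 have m: "(\<lambda>x. f x * cnj (char_fun \<gamma> x)) \<in> borel_measurable \<mu>" for \<gamma>
  using assms char_meas[of \<gamma>] by measurable
 show "continuous_on UNIV (fourier \<mu> f)" unfolding fourier_def[abs_def]
  by (rule continuous_on_integral_param[OF N.basis, where b = "\<lambda>x. norm (f x)"])
   (use assms m in \<open>auto simp: norm_mult intro!: continuous_intros continuous_eval_dual\<close>)
 have "norm (fourier \<mu> f \<gamma>) \<le> (\<integral>x. norm (f x * cnj (char_fun \<gamma> x)) \<partial>\<mu>)"
  unfolding fourier_def by (rule integral_norm_bound)
 then show "norm (fourier \<mu> f \<gamma>) \<le> (\<integral>x. norm (f x) \<partial>\<mu>)" by (simp add: norm_mult)
qed

lemma char_pair_meas: "(\<lambda>z. char_fun (fst z) (snd z)) \<in> borel_measurable (\<nu> \<Otimes>\<^sub>M \<mu>)"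
 by (rule N.measurable_pair_cont[OF M.sets_M]) (intro continuous_intros)

lemma fourier_translate:
 assumes g: "integrable \<mu> g"
 shows "fourier \<mu> (\<lambda>x. g (x + s)) \<epsilon> = char_fun \<epsilon> s * fourier \<mu> g \<epsilon>"
proof -
 have "fourier \<mu> (\<lambda>x. g (x + s)) \<epsilon> = (\<integral>x. (\<lambda>x. g x * cnj (char_fun \<epsilon> (x - s))) (x + s) \<partial>\<mu>)"
  unfolding fourier_def by simp
 also have "\<dots> = (\<integral>x. g x * cnj (char_fun \<epsilon> (x - s)) \<partial>\<mu>)"
  using g char_meas[of \<epsilon>] unfolding char_fun_diff_arg
  by (intro M.integral_translate borel_measurable_times borel_measurable_cnj) auto
 also have "\<dots> = char_fun \<epsilon> s * fourier \<mu> g \<epsilon>"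
  unfolding fourier_def by (subst integral_mult_right_zero[symmetric]) (simp add: char_fun_diff_arg mult_ac)
 finally show ?thesis .
qed

text \<open>
 With \<open>f\<close> the inverse transform of \<open>u\<close>, the difference \<open>w = u - fourier f\<close> is orthogonal to every
 Fourier transform, hence to its products with characters; so all \<open>w \<cdot> cnj (fourier g)\<close> have
 vanishing inverse transform.
\<close>

lemma fourier_inversion:
 assumes u: "u \<in> schwartz_space" and f: "f \<in> schwartz_space"
  and fu: "\<And>t. f t = (\<integral>\<epsilon>. u \<epsilon> * char_fun \<epsilon> t \<partial>\<nu>)"
 shows "fourier \<mu> f = u"
proof -
 have f2: "integrable \<mu> f" "f \<in> sq_integrable \<mu>" using f by (auto intro: M.schwartz_integrable M.schwartz_sq_integrable)
 have u2: "integrable \<nu> u" "u \<in> sq_integrable \<nu>" using u by (auto intro: N.schwartz_integrable N.schwartz_sq_integrable)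
 have F2: "fourier \<mu> f \<in> sq_integrable \<nu>" using planch f2 unfolding plancherel_def by blast
 define w where "w \<epsilon> = u \<epsilon> - fourier \<mu> f \<epsilon>" for \<epsilon>
 have wc: "continuous_on UNIV w" unfolding w_def[abs_def]
  by (intro continuous_intros schwartz_continuous u fourier_continuous f2)
 obtain B where "\<And>x. norm (u x) \<le> B" using schwartz_bounded[OF u] by (auto simp: bounded_iff)
 then have wb: "norm (w x) \<le> B + (\<integral>x. norm (f x) \<partial>\<mu>)" for x
  unfolding w_def using norm_triangle_ineq4[of "u x" "fourier \<mu> f x"] fourier_continuous(2)[OF f2(1), of x]
  by (meson add_mono order_trans)
 have w2: "w \<in> sq_integrable \<nu>"
  using sq_integrable_add[OF u2(2) sq_integrable_scale[OF F2, of "-1"]] by (simp add: w_def[abs_def])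
 have orth: "(\<integral>\<epsilon>. w \<epsilon> * cnj (fourier \<mu> g \<epsilon>) \<partial>\<nu>) = 0" if g: "integrable \<mu> g" "g \<in> sq_integrable \<mu>" for g
 proof -
  have G2: "fourier \<mu> g \<in> sq_integrable \<nu>" using planch g unfolding plancherel_def by blast
  interpret P: pair_sigma_finite \<nu> \<mu> ..
  \<comment> \<open>Fubini moves the transform from g to u, where it becomes f by hypothesis;
    Parseval then gives the same value for \<open>fourier \<mu> f\<close>.\<close>
  have "(\<integral>\<epsilon>. u \<epsilon> * cnj (fourier \<mu> g \<epsilon>) \<partial>\<nu>) = (\<integral>\<epsilon>. (\<integral>s. u \<epsilon> * cnj (g s) * char_fun \<epsilon> s \<partial>\<mu>) \<partial>\<nu>)"
  proof (rule Bochner_Integration.integral_cong[OF refl])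
   fix \<epsilon>
   have "cnj (fourier \<mu> g \<epsilon>) = (\<integral>s. cnj (g s) * char_fun \<epsilon> s \<partial>\<mu>)"
    unfolding fourier_def by (subst Bochner_Integration.integral_cnj[symmetric]) simp
   then show "u \<epsilon> * cnj (fourier \<mu> g \<epsilon>) = (\<integral>s. u \<epsilon> * cnj (g s) * char_fun \<epsilon> s \<partial>\<mu>)"
    by (simp add: mult.assoc)
  qed
  also have "\<dots> = (\<integral>s. (\<integral>\<epsilon>. u \<epsilon> * cnj (g s) * char_fun \<epsilon> s \<partial>\<nu>) \<partial>\<mu>)"
  proof (rule P.Fubini_integral[symmetric])
   show "integrable (\<nu> \<Otimes>\<^sub>M \<mu>) (\<lambda>(\<epsilon>, s). u \<epsilon> * cnj (g s) * char_fun \<epsilon> s)"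
    by (rule integrable_tensor_phase) (use u2 g char_pair_meas N.sigma_finite_measure_axioms M.sigma_finite_measure_axioms in auto)
  qed
  also have "\<dots> = (\<integral>s. f s * cnj (g s) \<partial>\<mu>)"
  proof (rule Bochner_Integration.integral_cong[OF refl])
   fix s
   have "(\<integral>\<epsilon>. u \<epsilon> * cnj (g s) * char_fun \<epsilon> s \<partial>\<nu>) = (\<integral>\<epsilon>. cnj (g s) * (u \<epsilon> * char_fun \<epsilon> s) \<partial>\<nu>)"
    by (simp add: mult_ac)
   then show "(\<integral>\<epsilon>. u \<epsilon> * cnj (g s) * char_fun \<epsilon> s \<partial>\<nu>) = f s * cnj (g s)"
    by (simp add: fu)
  qed
  also have "\<dots> = (\<integral>\<epsilon>. fourier \<mu> f \<epsilon> * cnj (fourier \<mu> g \<epsilon>) \<partial>\<nu>)"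
   by (rule fourier_parseval[OF f2 g, symmetric])
  finally have eq: "(\<integral>\<epsilon>. u \<epsilon> * cnj (fourier \<mu> g \<epsilon>) \<partial>\<nu>) = (\<integral>\<epsilon>. fourier \<mu> f \<epsilon> * cnj (fourier \<mu> g \<epsilon>) \<partial>\<nu>)" .
  have "integrable \<nu> (\<lambda>\<epsilon>. u \<epsilon> * cnj (fourier \<mu> g \<epsilon>))" "integrable \<nu> (\<lambda>\<epsilon>. fourier \<mu> f \<epsilon> * cnj (fourier \<mu> g \<epsilon>))"
   by (intro sq_integrable_mult sq_integrable_cnj u2 F2 G2)+
  then show ?thesis using eq by (simp add: w_def left_diff_distrib)
 qed
 have key: "(\<lambda>\<epsilon>. w \<epsilon> * cnj (fourier \<mu> g \<epsilon>)) = (\<lambda>_. 0)" if g: "integrable \<mu> g" "g \<in> sq_integrable \<mu>" for g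
 proof (rule transform_injective)
  have G2: "fourier \<mu> g \<in> sq_integrable \<nu>" using planch g unfolding plancherel_def by blast
  show "continuous_on UNIV (\<lambda>\<epsilon>. w \<epsilon> * cnj (fourier \<mu> g \<epsilon>))"
   by (intro continuous_intros wc fourier_continuous g)
  show "norm (w \<epsilon> * cnj (fourier \<mu> g \<epsilon>)) \<le> (B + (\<integral>x. norm (f x) \<partial>\<mu>)) * (\<integral>x. norm (g x) \<partial>\<mu>)" for \<epsilon>
   unfolding norm_mult complex_mod_cnj
   by (rule mult_mono[OF wb fourier_continuous(2)[OF g(1)] order_trans[OF norm_ge_zero wb] norm_ge_zero])
  show "integrable \<nu> (\<lambda>\<epsilon>. w \<epsilon> * cnj (fourier \<mu> g \<epsilon>))"
   by (intro sq_integrable_mult sq_integrable_cnj w2 G2)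
  fix t
  let ?h = "\<lambda>x. g (x + - t)"
  have "integrable \<mu> ?h" "?h \<in> sq_integrable \<mu>"
   using M.integrable_translate[OF g(1), of "-t"] M.integrable_translate[OF sq_integrableD(2)[OF g(2)], of "-t"]
   by (auto simp: sq_integrable_def)
  from orth[OF this] show "(\<integral>\<epsilon>. w \<epsilon> * cnj (fourier \<mu> g \<epsilon>) * char_fun \<epsilon> t \<partial>\<nu>) = 0"
   unfolding fourier_translate[OF g(1)] by (simp add: char_fun_minus_arg mult_ac)
 qed
 have "w \<epsilon>0 = 0" for \<epsilon>0
 proof -
  \<comment> \<open>The weight exceeds half its value at 0 on an open set around 0, and
    integrability of the weight makes this set of finite measure.\<close>
  define U where "U = {x. M.wt x > M.wt 0 / 2}"
  have U: "open U" "U \<noteq> {}" using M.wt_pos[of 0]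
   by (auto simp: U_def intro!: open_Collect_less continuous_intros M.wt_continuous exI[of _ 0])
  have Ufin: "emeasure \<mu> U < \<infinity>"
  proof -
   have "emeasure \<mu> U = (\<integral>\<^sup>+x. indicator U x \<partial>\<mu>)" using U by simp
   also have "\<dots> \<le> (\<integral>\<^sup>+x. ennreal (2 / M.wt 0 * M.wt x) \<partial>\<mu>)"
    using M.wt_pos[of 0] by (intro nn_integral_mono) (auto simp: U_def indicator_def field_simps intro!: ennreal_leI simp flip: ennreal_1)
   also have "\<dots> < \<infinity>"
    using integrable_mult_right[OF M.wt_integrable, of "2 / M.wt 0"] M.wt_pos less_imp_le[OF M.wt_pos]
    by (subst nn_integral_eq_integral) auto
   finally show ?thesis .
  qed
  \<comment> \<open>The character \<epsilon>0 cut off to U has transform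
    \<open>measure \<mu> U\<close> at \<epsilon>0, which is nonzero, so the vanishing product forces
    w \<epsilon>0 = 0.\<close>
  define g where "g x = char_fun \<epsilon>0 x * of_real (indicator U x)" for x
  have gi: "integrable \<mu> g"
  proof -
   have "integrable \<mu> (\<lambda>x. complex_of_real (indicator U x))" using U Ufin by simp
   from integrable_mult_bounded[OF this char_meas[of \<epsilon>0], of 1] show ?thesis by (simp add: g_def[abs_def] mult.commute)
  qed
  have g2: "g \<in> sq_integrable \<mu>"
   by (rule bounded_integrable_sq_integrable[OF gi, of 1]) (auto simp: g_def norm_mult indicator_def)
  have "fourier \<mu> g \<epsilon>0 = (\<integral>x. complex_of_real (indicator U x) \<partial>\<mu>)"
   unfolding fourier_def g_def
   by (intro Bochner_Integration.integral_cong refl) (metis (no_types, lifting) char_fun_cnj_mult(2) mult.assoc mult.commute mult_1)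
  also have "\<dots> = of_real (measure \<mu> U)" using U by simp
  finally have "fourier \<mu> g \<epsilon>0 \<noteq> 0" using M.nonempty_open[OF U] Ufin
   by (auto simp: measure_def enn2real_eq_0_iff)
  moreover have "w \<epsilon>0 * cnj (fourier \<mu> g \<epsilon>0) = 0" using fun_cong[OF key[OF gi g2], of \<epsilon>0] .
  ultimately show ?thesis by simp
 qed
 then show ?thesis by (auto simp: w_def fun_eq_iff)
qed

end

section \<open>Algebras of operators on an inner product space\<close>

lemma complex_ring_simps [simp]:
 "carrier complex_ring = UNIV" "monoid.mult complex_ring = (*)" "one complex_ring = 1"
 "zero complex_ring = 0" "add complex_ring = (+)"
 by (simp_all add: complex_ring_def)

lemma cring_complex_ring: "cring complex_ring"
proof (rule cringI)
 show "abelian_group complex_ring"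
 proof (rule abelian_groupI)
  show "\<exists>y\<in>carrier complex_ring. y \<oplus>\<^bsub>complex_ring\<^esub> x = \<zero>\<^bsub>complex_ring\<^esub>" for x
   by (intro bexI[of _ "- x"]) auto
 qed auto
 show "comm_monoid complex_ring" by (rule comm_monoidI) auto
qed (auto simp: distrib_right)

lemma complex_star_algebra_simps [simp]:
 "carrier complex_star_algebra = UNIV" "monoid.mult complex_star_algebra = (*)" "one complex_star_algebra = 1"
 "zero complex_star_algebra = 0" "add complex_star_algebra = (+)" "smult complex_star_algebra = (*)"
 "star complex_star_algebra = cnj" "nrm complex_star_algebra = norm"
 by (simp_all add: complex_star_algebra_def)

lemma abelian_group_complex_star_algebra: "abelian_group complex_star_algebra"
proof (rule abelian_groupI)
 show "\<exists>y\<in>carrier complex_star_algebra. y \<oplus>\<^bsub>complex_star_algebra\<^esub> x = \<zero>\<^bsub>complex_star_algebra\<^esub>" for x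
  by (intro bexI[of _ "- x"]) auto
qed auto

lemma module_complex_star_algebra: "Module.module complex_ring complex_star_algebra"
 by (rule module.intro[OF cring_complex_ring abelian_group_complex_star_algebra], unfold_locales)
  (auto simp: algebra_simps)

lemma pre_cstar_algebra_complex: "pre_cstar_algebra complex_star_algebra"
 by (rule pre_cstar_algebra.intro)
  (simp_all add: module_complex_star_algebra distrib_left distrib_right mult_ac norm_mult power2_eq_square
   norm_triangle_ineq)

lemma minus_complex_star_algebra [simp]: "x \<ominus>\<^bsub>complex_star_algebra\<^esub> y = x - y"
proof -
 have "\<ominus>\<^bsub>complex_star_algebra\<^esub> y = - y"
  using abelian_group.minus_equality[OF abelian_group_complex_star_algebra, of "-y" y] by simp
 then show ?thesis by (simp add: a_minus_def)
qed

lemma pos_elem_complex: "x \<ge> 0 \<Longrightarrow> pos_elem complex_star_algebra (of_real x)"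
 unfolding pos_elem_def
 by (auto intro!: exI[of _ "of_real (sqrt x)"] simp flip: of_real_mult)

section \<open>Inner product spaces and bounded operators\<close>

locale prehilbert =
 fixes H :: "('v, 'm) inner_space_scheme" (structure)
 assumes vs: "Module.module complex_ring H"
  and ip_add: "\<lbrakk>x \<in> carrier H; y \<in> carrier H; z \<in> carrier H\<rbrakk> \<Longrightarrow> ip H (x \<oplus> y) z = ip H x z + ip H y z"
  and ip_smult: "\<lbrakk>x \<in> carrier H; y \<in> carrier H\<rbrakk> \<Longrightarrow> ip H (c \<odot> x) y = c * ip H x y"
  and ip_cnj: "\<lbrakk>x \<in> carrier H; y \<in> carrier H\<rbrakk> \<Longrightarrow> ip H y x = cnj (ip H x y)"
  and ip_nonneg: "x \<in> carrier H \<Longrightarrow> Re (ip H x x) \<ge> 0"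
  and ip_definite: "\<lbrakk>x \<in> carrier H; ip H x x = 0\<rbrakk> \<Longrightarrow> x = \<zero>"
begin

lemma abelian_group_H: "abelian_group H" using vs by (rule module.axioms(2))

lemma abelian_monoid_H: "abelian_monoid H" using abelian_group_H by (rule abelian_group.axioms(1))

lemmas H_add_closed [simp, intro] = abelian_monoid.a_closed[OF abelian_monoid_H]
 and H_zero_closed [simp, intro] = abelian_monoid.zero_closed[OF abelian_monoid_H]
 and H_add_assoc = abelian_monoid.a_assoc[OF abelian_monoid_H]
 and H_add_comm = abelian_monoid.a_comm[OF abelian_monoid_H]
 and H_l_zero [simp] = abelian_monoid.l_zero[OF abelian_monoid_H]
 and H_r_zero [simp] = abelian_monoid.r_zero[OF abelian_monoid_H]

lemma H_smult_closed [simp, intro]: "x \<in> carrier H \<Longrightarrow> z \<odot> x \<in> carrier H"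
 using module.smult_closed[OF vs] by simp

lemma H_smult_add: "x \<in> carrier H \<Longrightarrow> y \<in> carrier H \<Longrightarrow> z \<odot> (x \<oplus> y) = z \<odot> x \<oplus> z \<odot> y"
 using module.smult_r_distr[OF vs] by simp

lemma H_add_smult: "x \<in> carrier H \<Longrightarrow> (a + b) \<odot> x = a \<odot> x \<oplus> b \<odot> x"
 using module.smult_l_distr[OF vs] by simp

lemma H_smult_smult: "x \<in> carrier H \<Longrightarrow> a \<odot> (b \<odot> x) = (a * b) \<odot> x"
 using module.smult_assoc1[OF vs] by simp

lemma H_smult_one [simp]: "x \<in> carrier H \<Longrightarrow> 1 \<odot> x = x"
 using module.smult_one[OF vs] by simp

lemma H_smult_zero_left [simp]: "x \<in> carrier H \<Longrightarrow> 0 \<odot> x = \<zero>"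
 using module.smult_l_null[OF vs] by simp

lemma H_smult_zero_right [simp]: "z \<odot> \<zero> = \<zero>"
 using module.smult_r_null[OF vs] by simp

lemma H_neg: "x \<in> carrier H \<Longrightarrow> (-1) \<odot> x \<oplus> x = \<zero>"
 using H_add_smult[of x "-1" 1] by simp

lemma ip_zero_left [simp]: "y \<in> carrier H \<Longrightarrow> ip H \<zero> y = 0"
 using ip_smult[of y y 0] by simp

lemma ip_add_right: "\<lbrakk>x \<in> carrier H; y \<in> carrier H; z \<in> carrier H\<rbrakk> \<Longrightarrow> ip H z (x \<oplus> y) = ip H z x + ip H z y"
 using ip_cnj[of "x \<oplus> y" z] ip_add[of x y z] ip_cnj[of x z] ip_cnj[of y z] by simp

lemma ip_smult_right: "\<lbrakk>x \<in> carrier H; y \<in> carrier H\<rbrakk> \<Longrightarrow> ip H y (z \<odot> x) = cnj z * ip H y x"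
 using ip_cnj[of "z \<odot> x" y] ip_smult[of x y z] ip_cnj[of x y] by simp

lemma ip_zero_right [simp]: "y \<in> carrier H \<Longrightarrow> ip H y \<zero> = 0"
 using ip_cnj[of \<zero> y] by simp

lemma ip_self: "x \<in> carrier H \<Longrightarrow> ip H x x = of_real ((vnorm H x)\<^sup>2)"
 using ip_cnj[of x x] ip_nonneg[of x] by (simp add: vnorm_def complex_eq_iff)

lemma vnorm_nonneg [simp]: "x \<in> carrier H \<Longrightarrow> vnorm H x \<ge> 0"
 using ip_nonneg[of x] by (simp add: vnorm_def)

lemma vnorm_zero [simp]: "vnorm H \<zero> = 0"
 by (simp add: vnorm_def)

lemma vnorm_eq_0: "x \<in> carrier H \<Longrightarrow> vnorm H x = 0 \<Longrightarrow> x = \<zero>"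
 using ip_self[of x] ip_definite[of x] by simp

lemma vnorm_smult: "x \<in> carrier H \<Longrightarrow> vnorm H (z \<odot> x) = norm z * vnorm H x"
proof -
 assume x: "x \<in> carrier H"
 have "complex_of_real ((vnorm H (z \<odot> x))\<^sup>2) = ip H (z \<odot> x) (z \<odot> x)"
  by (simp only: ip_self H_smult_closed x)
 also have "\<dots> = (z * cnj z) * ip H x x" using x by (simp add: ip_smult ip_smult_right)
 also have "\<dots> = of_real ((norm z)\<^sup>2) * of_real ((vnorm H x)\<^sup>2)" by (simp only: complex_norm_square ip_self x)
 also have "\<dots> = of_real ((norm z * vnorm H x)\<^sup>2)" by (simp add: power_mult_distrib)
 finally have "complex_of_real ((vnorm H (z \<odot> x))\<^sup>2) = of_real ((norm z * vnorm H x)\<^sup>2)" .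
 then have "(vnorm H (z \<odot> x))\<^sup>2 = (norm z * vnorm H x)\<^sup>2" by (simp only: of_real_eq_iff)
 then show ?thesis using x by (simp add: power2_eq_iff_nonneg)
qed

lemma ip_ext:
 assumes "x \<in> carrier H" "y \<in> carrier H" "\<And>z. z \<in> carrier H \<Longrightarrow> ip H x z = ip H y z"
 shows "x = y"
proof -
 have "ip H (x \<oplus> (-1) \<odot> y) z = 0" if "z \<in> carrier H" for z
  using assms that by (simp add: ip_add ip_smult)
 then have "x \<oplus> (-1) \<odot> y = \<zero>" using assms by (intro ip_definite) auto
 then have "(x \<oplus> (-1) \<odot> y) \<oplus> y = y" using assms by simp
 then show ?thesis using assms by (simp add: H_add_assoc H_neg)
qed

lemma cauchy_schwarz:
 assumes x: "x \<in> carrier H" and y: "y \<in> carrier H"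
 shows "norm (ip H x y) \<le> vnorm H x * vnorm H y"
proof (cases "vnorm H y = 0")
 case True
 then show ?thesis using vnorm_eq_0[OF y] x by simp
next
 case False
 define n where "n = (vnorm H y)\<^sup>2"
 have n: "n > 0" using False by (simp add: n_def)
 \<comment> \<open>The coefficient of the projection of x onto y; the square of the remainder is
   nonnegative.\<close>
 define a where "a = ip H x y / of_real n"
 let ?w = "x \<oplus> (- a) \<odot> y"
 have "ip H ?w ?w = ip H x x + cnj (- a) * ip H x y + (- a) * (ip H y x + cnj (- a) * ip H y y)"
  using x y by (simp add: ip_add ip_add_right ip_smult ip_smult_right algebra_simps)
 also have "\<dots> = of_real ((vnorm H x)\<^sup>2 - (norm (ip H x y))\<^sup>2 / n)"
 proof -
  have "ip H x x = of_real ((vnorm H x)\<^sup>2)" "ip H y y = of_real n" using x y by (simp_all add: ip_self n_def)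
  moreover have "ip H y x = cnj (ip H x y)" using x y by (rule ip_cnj)
  moreover have "complex_of_real ((norm (ip H x y))\<^sup>2) = ip H x y * cnj (ip H x y)" by (rule complex_norm_square)
  ultimately show ?thesis using n by (simp add: a_def field_simps del: of_real_power)
 qed
 finally have "Re (ip H ?w ?w) = (vnorm H x)\<^sup>2 - (norm (ip H x y))\<^sup>2 / n" by simp
 moreover have "Re (ip H ?w ?w) \<ge> 0" using x y by (intro ip_nonneg) auto
 ultimately have "(norm (ip H x y))\<^sup>2 / n \<le> (vnorm H x)\<^sup>2" by simp
 then have "(norm (ip H x y))\<^sup>2 \<le> (vnorm H x * vnorm H y)\<^sup>2"
  using n by (simp add: n_def power_mult_distrib divide_le_eq)
 then show ?thesis using x y by (simp add: power2_le_iff_abs_le)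
qed

lemma vnorm_triangle:
 assumes x: "x \<in> carrier H" and y: "y \<in> carrier H"
 shows "vnorm H (x \<oplus> y) \<le> vnorm H x + vnorm H y"
proof -
 have "complex_of_real ((vnorm H (x \<oplus> y))\<^sup>2) = ip H (x \<oplus> y) (x \<oplus> y)" using x y by (simp add: ip_self)
 also have "\<dots> = ip H x x + ip H x y + cnj (ip H x y) + ip H y y"
  using x y by (simp add: ip_add ip_add_right ip_cnj[of x y])
 also have "\<dots> = of_real ((vnorm H x)\<^sup>2 + 2 * Re (ip H x y) + (vnorm H y)\<^sup>2)"
  using x y by (simp add: ip_self complex_eq_iff)
 finally have "(vnorm H (x \<oplus> y))\<^sup>2 = (vnorm H x)\<^sup>2 + 2 * Re (ip H x y) + (vnorm H y)\<^sup>2"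
  by (simp only: of_real_eq_iff)
 also have "\<dots> \<le> (vnorm H x + vnorm H y)\<^sup>2"
  using cauchy_schwarz[OF x y] complex_Re_le_cmod[of "ip H x y"] by (simp add: power2_sum)
 finally show ?thesis using x y by (simp add: power2_le_iff_abs_le)
qed

lemma bounded_opD:
 assumes "bounded_op H T"
 shows "T \<in> carrier H \<rightarrow>\<^sub>E carrier H" "\<And>x. x \<in> carrier H \<Longrightarrow> T x \<in> carrier H"
  "\<And>x y. x \<in> carrier H \<Longrightarrow> y \<in> carrier H \<Longrightarrow> T (x \<oplus> y) = T x \<oplus> T y"
  "\<And>x z. x \<in> carrier H \<Longrightarrow> T (z \<odot> x) = z \<odot> T x"
  "\<exists>C. \<forall>x\<in>carrier H. vnorm H (T x) \<le> C * vnorm H x"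
 using assms by (auto simp: bounded_op_def)

lemma bounded_op_zero_arg: "bounded_op H T \<Longrightarrow> T \<zero> = \<zero>"
 using bounded_opD(4)[of T \<zero> 0] bounded_opD(2)[of T \<zero>] by simp

lemma op_ext:
 assumes "T \<in> carrier H \<rightarrow>\<^sub>E carrier H" "S \<in> carrier H \<rightarrow>\<^sub>E carrier H"
  "\<And>x y. x \<in> carrier H \<Longrightarrow> y \<in> carrier H \<Longrightarrow> ip H (T x) y = ip H (S x) y"
 shows "T = S"
 using assms by (intro PiE_ext[OF assms(1,2)] ip_ext) auto

abbreviation opnorm :: "('v \<Rightarrow> 'v) \<Rightarrow> real" where "opnorm \<equiv> nrm (bounded_ops H)"

lemma opnorm_eq: "opnorm T = (SUP x\<in>{x \<in> carrier H. vnorm H x \<le> 1}. vnorm H (T x))"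
 by (simp add: bounded_ops_def)

lemma opnorm_bdd:
 assumes T: "bounded_op H T"
 shows "bdd_above ((\<lambda>x. vnorm H (T x)) ` {x \<in> carrier H. vnorm H x \<le> 1})"
proof -
 obtain C where C: "\<And>x. x \<in> carrier H \<Longrightarrow> vnorm H (T x) \<le> C * vnorm H x" using bounded_opD(5)[OF T] by blast
 have "vnorm H (T x) \<le> \<bar>C\<bar>" if "x \<in> carrier H" "vnorm H x \<le> 1" for x
 proof -
  have "C * vnorm H x \<le> \<bar>C\<bar> * 1" using that by (intro mult_mono) auto
  then show ?thesis using C[OF that(1)] by simp
 qed
 then show ?thesis by (intro bdd_aboveI2[of _ _ "\<bar>C\<bar>"]) auto
qed

lemma opnorm_nonneg: "bounded_op H T \<Longrightarrow> opnorm T \<ge> 0"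
 unfolding opnorm_eq
 by (rule order_trans[OF _ cSUP_upper[OF _ opnorm_bdd, of \<zero>]]) (simp_all add: bounded_op_zero_arg)

lemma opnorm_bound:
 assumes T: "bounded_op H T" and x: "x \<in> carrier H"
 shows "vnorm H (T x) \<le> opnorm T * vnorm H x"
proof (cases "vnorm H x = 0")
 case True
 then show ?thesis using vnorm_eq_0[OF x] bounded_op_zero_arg[OF T] by simp
next
 case False
 then have v: "vnorm H x > 0" using vnorm_nonneg[OF x] by simp
 let ?u = "of_real (1 / vnorm H x) \<odot> x"
 have "vnorm H ?u = 1" using x v by (simp add: vnorm_smult norm_divide)
 then have "vnorm H (T ?u) \<le> opnorm T" unfolding opnorm_eq
  using x by (intro cSUP_upper opnorm_bdd[OF T]) auto
 moreover have "vnorm H (T ?u) = vnorm H (T x) / vnorm H x"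
  using x v T by (simp add: bounded_opD vnorm_smult norm_divide)
 ultimately show ?thesis using v by (simp add: divide_le_eq)
qed

lemma opnorm_least:
 assumes "C \<ge> 0" "\<And>x. x \<in> carrier H \<Longrightarrow> vnorm H (T x) \<le> C * vnorm H x"
 shows "opnorm T \<le> C"
 unfolding opnorm_eq
proof (rule cSUP_least)
 fix x assume x: "x \<in> {x \<in> carrier H. vnorm H x \<le> 1}"
 then have "C * vnorm H x \<le> C * 1" using assms(1) by (intro mult_left_mono) auto
 then show "vnorm H (T x) \<le> C" using assms(2)[of x] x by simp
next
 have "\<zero> \<in> {x \<in> carrier H. vnorm H x \<le> 1}" by simp
 then show "{x \<in> carrier H. vnorm H x \<le> 1} \<noteq> {}" by blast
qed

text \<open>Two adjoints of T have equal inner products with all vectors, so exhibiting one of them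
  resolves the \<open>THE\<close> in \<open>star\<close>.\<close>

lemma star_bounded_ops:
 assumes S: "bounded_op H S"
  and adj: "\<And>x y. x \<in> carrier H \<Longrightarrow> y \<in> carrier H \<Longrightarrow> ip H (T x) y = ip H x (S y)"
 shows "star (bounded_ops H) T = S"
proof -
 have "(THE S. bounded_op H S \<and> (\<forall>x\<in>carrier H. \<forall>y\<in>carrier H. ip H (T x) y = ip H x (S y))) = S"
 proof (rule the_equality)
  fix S' assume S': "bounded_op H S' \<and> (\<forall>x\<in>carrier H. \<forall>y\<in>carrier H. ip H (T x) y = ip H x (S' y))"
  show "S' = S"
  proof (rule op_ext)
   fix x y assume xy: "x \<in> carrier H" "y \<in> carrier H"
   have "ip H y (S' x) = ip H y (S x)" using adj[OF xy(2,1)] S' xy by simp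
   then show "ip H (S' x) y = ip H (S x) y"
    using ip_cnj[of y "S' x"] ip_cnj[of y "S x"] xy bounded_opD(2)[of S' x] S' bounded_opD(2)[OF S, of x] by simp
  qed (use S S' in \<open>auto simp: bounded_op_def\<close>)
 qed (use S adj in auto)
 then show ?thesis by (simp add: bounded_ops_def)
qed

end

section \<open>Self-adjoint algebras of bounded operators\<close>

text \<open>\<open>adj_mem\<close> supplies adjoints as members of the algebra; in the application
  they are given by an explicit symbol.\<close>

locale operator_algebra = prehilbert +
 fixes \<A> :: "('a \<Rightarrow> 'a) set"
 assumes bounded: "T \<in> \<A> \<Longrightarrow> bounded_op H T"
  and zero_mem: "(\<lambda>x\<in>carrier H. \<zero>\<^bsub>H\<^esub>) \<in> \<A>"
  and add_mem: "S \<in> \<A> \<Longrightarrow> T \<in> \<A> \<Longrightarrow> (\<lambda>x\<in>carrier H. S x \<oplus>\<^bsub>H\<^esub> T x) \<in> \<A>"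
  and smult_mem: "T \<in> \<A> \<Longrightarrow> (\<lambda>x\<in>carrier H. z \<odot>\<^bsub>H\<^esub> T x) \<in> \<A>"
  and mult_mem: "S \<in> \<A> \<Longrightarrow> T \<in> \<A> \<Longrightarrow> compose (carrier H) S T \<in> \<A>"
  and adj_mem: "T \<in> \<A> \<Longrightarrow> \<exists>S\<in>\<A>. \<forall>x\<in>carrier H. \<forall>y\<in>carrier H. ip H (T x) y = ip H x (S y)"
begin

definition A :: "('a \<Rightarrow> 'a) star_algebra" where "A = (bounded_ops H)\<lparr>carrier := \<A>\<rparr>"

lemma A_simps [simp]:
 "carrier A = \<A>" "monoid.mult A = compose (carrier H)" "zero A = (\<lambda>x\<in>carrier H. \<zero>\<^bsub>H\<^esub>)"
 "add A = (\<lambda>S T. \<lambda>x\<in>carrier H. S x \<oplus>\<^bsub>H\<^esub> T x)" "smult A = (\<lambda>z T. \<lambda>x\<in>carrier H. z \<odot>\<^bsub>H\<^esub> T x)"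
 "star A = star (bounded_ops H)" "nrm A = opnorm"
 by (simp_all add: A_def bounded_ops_def)

lemma mem_PiE: "T \<in> \<A> \<Longrightarrow> T \<in> carrier H \<rightarrow>\<^sub>E carrier H"
 using bounded by (auto simp: bounded_op_def)

lemma mem_closed [simp, intro]: "T \<in> \<A> \<Longrightarrow> x \<in> carrier H \<Longrightarrow> T x \<in> carrier H"
 using mem_PiE by blast

lemma mem_ext: "S \<in> \<A> \<Longrightarrow> T \<in> \<A> \<Longrightarrow> (\<And>x. x \<in> carrier H \<Longrightarrow> S x = T x) \<Longrightarrow> S = T"
 using mem_PiE by (metis PiE_ext)

lemma module_A: "Module.module complex_ring A"
proof (rule module.intro[OF cring_complex_ring])
 show "abelian_group A"
 proof (rule abelian_groupI)
  fix S T U assume "S \<in> carrier A" "T \<in> carrier A" "U \<in> carrier A"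
  then show "S \<oplus>\<^bsub>A\<^esub> T \<oplus>\<^bsub>A\<^esub> U = S \<oplus>\<^bsub>A\<^esub> (T \<oplus>\<^bsub>A\<^esub> U)"
   by (auto simp: H_add_assoc fun_eq_iff restrict_def)
 next
  fix S T assume "S \<in> carrier A" "T \<in> carrier A"
  then show "S \<oplus>\<^bsub>A\<^esub> T \<in> carrier A" "S \<oplus>\<^bsub>A\<^esub> T = T \<oplus>\<^bsub>A\<^esub> S"
   using add_mem[of S T] by (simp, auto simp: H_add_comm fun_eq_iff restrict_def)
 next
  show "\<zero>\<^bsub>A\<^esub> \<in> carrier A" using zero_mem by simp
 next
  fix S assume S: "S \<in> carrier A"
  show "\<exists>T\<in>carrier A. T \<oplus>\<^bsub>A\<^esub> S = \<zero>\<^bsub>A\<^esub>"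
   using S smult_mem[of S "-1"] by (intro bexI[of _ "\<lambda>x\<in>carrier H. (-1) \<odot>\<^bsub>H\<^esub> S x"]) (auto simp: fun_eq_iff H_neg restrict_def)
  show "\<zero>\<^bsub>A\<^esub> \<oplus>\<^bsub>A\<^esub> S = S"
   using S zero_mem add_mem[OF zero_mem, of S] by (intro mem_ext) auto
 qed
 show "module_axioms complex_ring A"
  by unfold_locales
   (auto simp: H_add_smult H_smult_add H_smult_smult restrict_def fun_eq_iff intro: mem_ext
    intro!: smult_mem[unfolded restrict_def] dest: mem_PiE[THEN PiE_arb])
qed

lemma abelian_group_A: "abelian_group A" using module_A by (rule module.axioms(2))

lemma minus_A:
 assumes "S \<in> \<A>" "T \<in> \<A>"
 shows "S \<ominus>\<^bsub>A\<^esub> T = (\<lambda>x\<in>carrier H. S x \<oplus>\<^bsub>H\<^esub> (-1) \<odot>\<^bsub>H\<^esub> T x)"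
proof -
 have "\<ominus>\<^bsub>A\<^esub> T = (\<lambda>x\<in>carrier H. (-1) \<odot>\<^bsub>H\<^esub> T x)"
  using assms smult_mem[of T "-1"]
  by (intro abelian_group.minus_equality[OF abelian_group_A]) (auto simp: fun_eq_iff H_neg restrict_def)
 then show ?thesis by (simp add: a_minus_def fun_eq_iff restrict_def)
qed

lemma star_mem:
 assumes "T \<in> \<A>"
 shows "star A T \<in> \<A>" "\<And>x y. x \<in> carrier H \<Longrightarrow> y \<in> carrier H \<Longrightarrow> ip H (T x) y = ip H x (star A T y)"
  "\<And>x y. x \<in> carrier H \<Longrightarrow> y \<in> carrier H \<Longrightarrow> ip H (star A T x) y = ip H x (T y)"
proof -
 obtain S where S: "S \<in> \<A>" "\<And>x y. x \<in> carrier H \<Longrightarrow> y \<in> carrier H \<Longrightarrow> ip H (T x) y = ip H x (S y)"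
  using adj_mem[OF assms] by blast
 have e: "star A T = S" using star_bounded_ops[OF bounded[OF S(1)] S(2)] by simp
 show "star A T \<in> \<A>" "\<And>x y. x \<in> carrier H \<Longrightarrow> y \<in> carrier H \<Longrightarrow> ip H (T x) y = ip H x (star A T y)"
  using S by (simp_all only: e)
 show "ip H (star A T x) y = ip H x (T y)" if "x \<in> carrier H" "y \<in> carrier H" for x y
  using S(2)[OF that(2,1)] ip_cnj[of y "S x"] ip_cnj[of "T y" x] that S(1) assms by (simp only: e mem_closed)
qed

lemma star_eqI:
 assumes "S \<in> \<A>" "\<And>x y. x \<in> carrier H \<Longrightarrow> y \<in> carrier H \<Longrightarrow> ip H (T x) y = ip H x (S y)"
 shows "star A T = S"
 using star_bounded_ops[OF bounded[OF assms(1)] assms(2)] by simp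

lemma opnorm_mult:
 assumes "S \<in> \<A>" "T \<in> \<A>"
 shows "opnorm (compose (carrier H) S T) \<le> opnorm S * opnorm T"
proof (rule opnorm_least)
 show "opnorm S * opnorm T \<ge> 0" using assms by (simp add: opnorm_nonneg bounded)
 fix x assume x: "x \<in> carrier H"
 have "vnorm H (S (T x)) \<le> opnorm S * vnorm H (T x)" using assms x by (intro opnorm_bound bounded) auto
 also have "\<dots> \<le> opnorm S * (opnorm T * vnorm H x)"
  using assms x by (intro mult_left_mono opnorm_bound bounded opnorm_nonneg)
 finally show "vnorm H (compose (carrier H) S T x) \<le> opnorm S * opnorm T * vnorm H x"
  using x by (simp add: compose_def mult.assoc)
qed

text \<open>The squared norm of T x is the inner product of its image under \<open>star A T\<close>
  with x. Cauchy-Schwarz turns this into the half of the C*-identity that does not follow from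
  submultiplicativity.\<close>

lemma opnorm_sq_le:
 assumes T: "T \<in> \<A>"
 shows "(opnorm T)\<^sup>2 \<le> opnorm (compose (carrier H) (star A T) T)"
proof -
 let ?P = "compose (carrier H) (star A T) T"
 have P: "?P \<in> \<A>" using T star_mem(1)[OF T] by (rule mult_mem[rotated])
 have "opnorm T \<le> sqrt (opnorm ?P)"
 proof (rule opnorm_least)
  show "sqrt (opnorm ?P) \<ge> 0" using opnorm_nonneg[OF bounded[OF P]] by simp
  fix x assume x: "x \<in> carrier H"
  have "complex_of_real ((vnorm H (T x))\<^sup>2) = ip H (T x) (T x)" using x T by (simp add: ip_self)
  also have "\<dots> = ip H (?P x) x" using star_mem(3)[OF T, of "T x" x] x T by (simp add: compose_def)
  finally have "(vnorm H (T x))\<^sup>2 = norm (ip H (?P x) x)" by (metis norm_of_real abs_power2)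
  also have "\<dots> \<le> vnorm H (?P x) * vnorm H x" using x P by (intro cauchy_schwarz) auto
  also have "\<dots> \<le> (opnorm ?P * vnorm H x) * vnorm H x"
   using x P by (intro mult_right_mono opnorm_bound bounded) auto
  finally have "(vnorm H (T x))\<^sup>2 \<le> opnorm ?P * (vnorm H x)\<^sup>2"
   by (simp add: power2_eq_square mult.assoc)
  then have "vnorm H (T x) \<le> sqrt (opnorm ?P * (vnorm H x)\<^sup>2)" by (rule real_le_rsqrt)
  then show "vnorm H (T x) \<le> sqrt (opnorm ?P) * vnorm H x"
   using x T by (simp add: real_sqrt_mult)
 qed
 then have "(opnorm T)\<^sup>2 \<le> (sqrt (opnorm ?P))\<^sup>2" using opnorm_nonneg[OF bounded[OF T]] by (intro power_mono)
 then show ?thesis using opnorm_nonneg[OF bounded[OF P]] by simp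
qed

text \<open>The squared norm of T is at most the norm of its adjoint times the norm of T, and one
  factor cancels. Applied to the adjoint as well, it makes \<open>star\<close> isometric.\<close>

lemma opnorm_le_star:
 assumes T: "T \<in> \<A>"
 shows "opnorm T \<le> opnorm (star A T)"
proof -
 have "(opnorm T)\<^sup>2 \<le> opnorm (star A T) * opnorm T"
  using opnorm_sq_le[OF T] opnorm_mult[OF star_mem(1)[OF T] T] by simp
 then show ?thesis using opnorm_nonneg[OF bounded[OF T]] opnorm_nonneg[OF bounded[OF star_mem(1)[OF T]]]
  by (cases "opnorm T = 0") (auto simp: power2_eq_square)
qed

lemma star_star_A: "T \<in> \<A> \<Longrightarrow> star A (star A T) = T"
 using star_mem(3)[of T] by (intro star_eqI) auto

lemma pre_cstar_algebra_A: "pre_cstar_algebra A"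
proof (rule pre_cstar_algebra.intro, goal_cases)
 case 1
 show ?case by (rule module_A)
next
 case (2 a b)
 then show ?case by (simp add: mult_mem)
next
 case (3 a b c)
 then show ?case by (auto simp: compose_def fun_eq_iff restrict_def)
next
 case (4 a b c)
 then show ?case by (auto simp: compose_def fun_eq_iff restrict_def)
next
 case (5 a b c)
 then show ?case by (auto simp: compose_def fun_eq_iff restrict_def bounded_opD(3)[OF bounded])
next
 case (6 a b z)
 then show ?case by (auto simp: compose_def fun_eq_iff restrict_def)
next
 case (7 a b z)
 then show ?case by (auto simp: compose_def fun_eq_iff restrict_def bounded_opD(4)[OF bounded])
next
 case (8 a)
 then show ?case using star_mem(1) by simp
next
 case (9 a)
 then show ?case using star_star_A by simp
next
 case (10 a b)
 then have m: "a \<in> \<A>" "b \<in> \<A>" "star A a \<in> \<A>" "star A b \<in> \<A>" using star_mem(1) by auto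
 have "star A (\<lambda>x\<in>carrier H. a x \<oplus>\<^bsub>H\<^esub> b x) = (\<lambda>x\<in>carrier H. star A a x \<oplus>\<^bsub>H\<^esub> star A b x)"
  using m star_mem(2)[OF m(1)] star_mem(2)[OF m(2)]
  by (intro star_eqI add_mem) (simp_all add: ip_add ip_add_right del: A_simps(6))
 then show ?case by simp
next
 case (11 a z)
 then have m: "a \<in> \<A>" "star A a \<in> \<A>" using star_mem(1) by auto
 have "star A (\<lambda>x\<in>carrier H. z \<odot>\<^bsub>H\<^esub> a x) = (\<lambda>x\<in>carrier H. cnj z \<odot>\<^bsub>H\<^esub> star A a x)"
  using m star_mem(2)[OF m(1)]
  by (intro star_eqI smult_mem) (simp_all add: ip_smult ip_smult_right del: A_simps(6))
 then show ?case by simp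
next
 case (12 a b)
 then have m: "a \<in> \<A>" "b \<in> \<A>" "star A a \<in> \<A>" "star A b \<in> \<A>" using star_mem(1) by auto
 have "star A (compose (carrier H) a b) = compose (carrier H) (star A b) (star A a)"
  using m star_mem(2)[OF m(1)] star_mem(2)[OF m(2)]
  by (intro star_eqI mult_mem) (simp_all add: compose_def del: A_simps(6))
 then show ?case by simp
next
 case (13 a)
 then have a: "a \<in> \<A>" by simp
 show ?case
 proof
  assume n: "nrm A a = 0"
  have "a x = \<zero>\<^bsub>H\<^esub>" if "x \<in> carrier H" for x
   using opnorm_bound[OF bounded[OF a] that] n vnorm_nonneg[OF mem_closed[OF a that]] mem_closed[OF a that]
   by (intro vnorm_eq_0 antisym) auto
  then show "a = \<zero>\<^bsub>A\<^esub>" using a zero_mem by (intro mem_ext) auto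
 next
  assume "a = \<zero>\<^bsub>A\<^esub>"
  then have "opnorm a \<le> 0" by (intro opnorm_least) auto
  then show "nrm A a = 0" using opnorm_nonneg[OF bounded[OF a]] by simp
 qed
next
 case (14 a b)
 then have ab: "a \<in> \<A>" "b \<in> \<A>" by auto
 have "opnorm (\<lambda>x\<in>carrier H. a x \<oplus>\<^bsub>H\<^esub> b x) \<le> opnorm a + opnorm b"
 proof (rule opnorm_least)
  show "0 \<le> opnorm a + opnorm b" using ab by (simp add: opnorm_nonneg bounded)
  fix x assume x: "x \<in> carrier H"
  have "vnorm H (a x \<oplus>\<^bsub>H\<^esub> b x) \<le> vnorm H (a x) + vnorm H (b x)" using ab x by (intro vnorm_triangle) auto
  also have "\<dots> \<le> opnorm a * vnorm H x + opnorm b * vnorm H x"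
   using ab x by (intro add_mono opnorm_bound bounded)
  finally show "vnorm H ((\<lambda>x\<in>carrier H. a x \<oplus>\<^bsub>H\<^esub> b x) x) \<le> (opnorm a + opnorm b) * vnorm H x"
   using x by (simp add: distrib_right)
 qed
 then show ?case by simp
next
 case (15 a z)
 then have a: "a \<in> \<A>" by simp
 have le: "opnorm (\<lambda>x\<in>carrier H. z \<odot>\<^bsub>H\<^esub> b x) \<le> norm z * opnorm b" if b: "b \<in> \<A>" for b z
 proof (rule opnorm_least)
  show "0 \<le> norm z * opnorm b" using b by (simp add: opnorm_nonneg bounded)
  fix x assume x: "x \<in> carrier H"
  show "vnorm H ((\<lambda>x\<in>carrier H. z \<odot>\<^bsub>H\<^esub> b x) x) \<le> norm z * opnorm b * vnorm H x"
   using x b opnorm_bound[OF bounded[OF b] x] by (simp add: vnorm_smult mult.assoc mult_left_mono)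
 qed
 show ?case
 proof (cases "z = 0")
  case True
  then show ?thesis using le[OF a, of 0] opnorm_nonneg[OF bounded[OF smult_mem[OF a, of 0]]] by simp
 next
  case False
  \<comment> \<open>The reverse inequality is the upper bound already shown, applied to the scalar
    1/z.\<close>
  have "(\<lambda>x\<in>carrier H. (1/z) \<odot>\<^bsub>H\<^esub> (\<lambda>x\<in>carrier H. z \<odot>\<^bsub>H\<^esub> a x) x) = a"
   using a False by (intro mem_ext smult_mem a) (auto simp: H_smult_smult)
  then have "opnorm a \<le> norm (1/z) * opnorm (\<lambda>x\<in>carrier H. z \<odot>\<^bsub>H\<^esub> a x)"
   using le[OF smult_mem[OF a, of z], of "1/z"] by simp
  then have "norm z * opnorm a \<le> opnorm (\<lambda>x\<in>carrier H. z \<odot>\<^bsub>H\<^esub> a x)"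
   using False by (simp add: norm_divide field_simps)
  then show ?thesis using le[OF a, of z] by simp
 qed
next
 case (16 a b)
 then show ?case by (simp add: opnorm_mult)
next
 case (17 a)
 then have a: "a \<in> \<A>" "star A a \<in> \<A>" using star_mem(1) by auto
 have "opnorm (star A a) \<le> opnorm a" using opnorm_le_star[OF a(2)] star_star_A[OF a(1)] by simp
 then have "opnorm (star A a) * opnorm a \<le> opnorm a * opnorm a"
  using opnorm_nonneg[OF bounded[OF a(1)]] by (intro mult_right_mono)
 then have "opnorm (compose (carrier H) (star A a) a) \<le> (opnorm a)\<^sup>2"
  using opnorm_mult[OF a(2,1)] by (simp add: power2_eq_square)
 then show ?case using opnorm_sq_le[OF a(1)] by simp
qed

end

section \<open>Equivalence bimodules from rank-one operators\<close>

text \<open>Sums suffice: a scalar multiple of a rank-one operator is again one, with the scalar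
  absorbed by its range vector.\<close>

inductive_set rank_one_span :: "('v, 'm) inner_space_scheme \<Rightarrow> ('v \<Rightarrow> 'v) set \<Rightarrow> ('v \<Rightarrow> 'v) set" for H \<Theta> where
 zero: "(\<lambda>x\<in>carrier H. \<zero>\<^bsub>H\<^esub>) \<in> rank_one_span H \<Theta>"
| base: "\<theta> \<in> \<Theta> \<Longrightarrow> \<theta> \<in> rank_one_span H \<Theta>"
| add: "S \<in> rank_one_span H \<Theta> \<Longrightarrow> T \<in> rank_one_span H \<Theta> \<Longrightarrow>
  (\<lambda>x\<in>carrier H. S x \<oplus>\<^bsub>H\<^esub> T x) \<in> rank_one_span H \<Theta>"

text \<open>E is a space of concrete vectors that \<open>j\<close> maps injectively into H. Density
  is required as a bound on vectors, the form in which an integral kernel delivers it;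
  \<open>nontrivial\<close> provides a nonzero scalar product, hence fullness over the complex
  numbers.\<close>

locale rank_one_module = operator_algebra +
 fixes E :: "(complex, 'e) module" and j :: "'e \<Rightarrow> 'a"
 assumes module_E: "Module.module complex_ring E"
  and j_closed [simp, intro]: "\<xi> \<in> carrier E \<Longrightarrow> j \<xi> \<in> carrier H"
  and j_add: "\<lbrakk>\<xi> \<in> carrier E; \<eta> \<in> carrier E\<rbrakk> \<Longrightarrow> j (\<xi> \<oplus>\<^bsub>E\<^esub> \<eta>) = j \<xi> \<oplus>\<^bsub>H\<^esub> j \<eta>"
  and j_smult: "\<xi> \<in> carrier E \<Longrightarrow> j (z \<odot>\<^bsub>E\<^esub> \<xi>) = z \<odot>\<^bsub>H\<^esub> j \<xi>"
  and j_inj: "inj_on j (carrier E)"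
  and invariant: "T \<in> \<A> \<Longrightarrow> \<xi> \<in> carrier E \<Longrightarrow> T (j \<xi>) \<in> j ` carrier E"
  and rank_one_mem: "\<lbrakk>\<xi> \<in> carrier E; \<eta> \<in> carrier E\<rbrakk> \<Longrightarrow> (\<lambda>x\<in>carrier H. ip H x (j \<eta>) \<odot>\<^bsub>H\<^esub> j \<xi>) \<in> \<A>"
  and rank_one_dense: "\<lbrakk>T \<in> \<A>; \<epsilon> > 0\<rbrakk> \<Longrightarrow>
   \<exists>R\<in>rank_one_span H {\<lambda>x\<in>carrier H. ip H x (j \<eta>) \<odot>\<^bsub>H\<^esub> j \<xi> | \<xi> \<eta>. \<xi> \<in> carrier E \<and> \<eta> \<in> carrier E}.
    \<forall>x\<in>carrier H. vnorm H (T x \<oplus>\<^bsub>H\<^esub> (-1) \<odot>\<^bsub>H\<^esub> R x) \<le> \<epsilon> * vnorm H x"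
  and nontrivial: "\<exists>\<xi>\<in>carrier E. j \<xi> \<noteq> \<zero>\<^bsub>H\<^esub>"
begin

definition \<theta> :: "'e \<Rightarrow> 'e \<Rightarrow> 'a \<Rightarrow> 'a" where
 "\<theta> \<xi> \<eta> = (\<lambda>x\<in>carrier H. ip H x (j \<eta>) \<odot>\<^bsub>H\<^esub> j \<xi>)"

text \<open>The algebra acts on H and preserves the image of \<open>j\<close>, so the action can be
  pulled back to E, where the module elements are functions and not classes.\<close>

definition act :: "('a \<Rightarrow> 'a) \<Rightarrow> 'e \<Rightarrow> 'e" where
 "act T \<xi> = inv_into (carrier E) j (T (j \<xi>))"

lemma act: "T \<in> \<A> \<Longrightarrow> \<xi> \<in> carrier E \<Longrightarrow> act T \<xi> \<in> carrier E" "T \<in> \<A> \<Longrightarrow> \<xi> \<in> carrier E \<Longrightarrow> j (act T \<xi>) = T (j \<xi>)"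
 unfolding act_def by (simp_all add: inv_into_into f_inv_into_f invariant)

lemma act_eqI: "\<zeta> \<in> carrier E \<Longrightarrow> j \<zeta> = T (j \<xi>) \<Longrightarrow> act T \<xi> = \<zeta>"
 unfolding act_def by (metis inv_into_f_f j_inj)

lemma E_closed [simp, intro]:
 "\<xi> \<in> carrier E \<Longrightarrow> \<eta> \<in> carrier E \<Longrightarrow> \<xi> \<oplus>\<^bsub>E\<^esub> \<eta> \<in> carrier E" "\<xi> \<in> carrier E \<Longrightarrow> z \<odot>\<^bsub>E\<^esub> \<xi> \<in> carrier E"
 "\<zero>\<^bsub>E\<^esub> \<in> carrier E"
 using module.smult_closed[OF module_E] abelian_monoid.a_closed[OF abelian_group.axioms(1)[OF module.axioms(2)[OF module_E]]]
  abelian_monoid.zero_closed[OF abelian_group.axioms(1)[OF module.axioms(2)[OF module_E]]]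
 by auto

lemma j_eqI: "\<xi> \<in> carrier E \<Longrightarrow> \<eta> \<in> carrier E \<Longrightarrow> j \<xi> = j \<eta> \<Longrightarrow> \<xi> = \<eta>"
 using j_inj by (simp add: inj_on_def)

lemma j_zero: "j \<zero>\<^bsub>E\<^esub> = \<zero>\<^bsub>H\<^esub>"
proof -
 have "0 \<odot>\<^bsub>E\<^esub> \<zero>\<^bsub>E\<^esub> = \<zero>\<^bsub>E\<^esub>" using module.smult_l_null[OF module_E, of "\<zero>\<^bsub>E\<^esub>"] by simp
 then show ?thesis using j_smult[of "\<zero>\<^bsub>E\<^esub>" 0] by simp
qed

lemma \<theta>_mem [simp, intro]: "\<xi> \<in> carrier E \<Longrightarrow> \<eta> \<in> carrier E \<Longrightarrow> \<theta> \<xi> \<eta> \<in> \<A>"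
 unfolding \<theta>_def by (rule rank_one_mem)

lemma \<theta>_apply [simp]: "x \<in> carrier H \<Longrightarrow> \<theta> \<xi> \<eta> x = ip H x (j \<eta>) \<odot>\<^bsub>H\<^esub> j \<xi>"
 by (simp add: \<theta>_def)

lemma \<theta>_star: "\<xi> \<in> carrier E \<Longrightarrow> \<eta> \<in> carrier E \<Longrightarrow> star A (\<theta> \<xi> \<eta>) = \<theta> \<eta> \<xi>"
 by (rule star_eqI) (auto simp: ip_smult ip_smult_right ip_cnj[of _ "j \<xi>"] mult.commute)

lemma minus_self_A: "T \<in> \<A> \<Longrightarrow> T \<ominus>\<^bsub>A\<^esub> T = \<zero>\<^bsub>A\<^esub>"
 by (auto simp: minus_A fun_eq_iff restrict_def H_neg H_add_comm[of "T _"])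

lemma nrm_A_minus_self: "T \<in> \<A> \<Longrightarrow> nrm A (T \<ominus>\<^bsub>A\<^esub> T) = 0"
proof -
 assume T: "T \<in> \<A>"
 show ?thesis
  using minus_self_A[OF T] pre_cstar_algebra.nrm_definite[OF pre_cstar_algebra_A, of "T \<ominus>\<^bsub>A\<^esub> T"] zero_mem by simp
qed

lemma pos_elem_A_I: "T \<in> \<A> \<Longrightarrow> b \<in> \<A> \<Longrightarrow> T = star A b \<otimes>\<^bsub>A\<^esub> b \<Longrightarrow> pos_elem A T"
 unfolding pos_elem_def using nrm_A_minus_self[of T] by (metis A_simps(1))

text \<open>Dividing \<theta> \<xi> \<xi> by the norm of \<open>j \<xi>\<close> gives a self-adjoint
  b whose square is \<theta> \<xi> \<xi>, so the approximation in \<open>pos_elem\<close> is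
  attained exactly.\<close>

lemma \<theta>_pos: assumes "\<xi> \<in> carrier E" shows "pos_elem A (\<theta> \<xi> \<xi>)"
proof -
 \<comment> \<open>For a vector of norm 0 the operator itself vanishes, and c = 0 avoids the
   division.\<close>
 define c where "c = (if vnorm H (j \<xi>) = 0 then 0 else complex_of_real (1 / vnorm H (j \<xi>)))"
 let ?b = "\<lambda>x\<in>carrier H. c \<odot>\<^bsub>H\<^esub> \<theta> \<xi> \<xi> x"
 have b: "?b \<in> \<A>" using assms by (intro smult_mem) auto
 have sb: "star A ?b = ?b"
  by (rule star_eqI[OF b])
   (use assms in \<open>auto simp: ip_smult ip_smult_right ip_cnj[of _ "j \<xi>"] mult.commute c_def\<close>)
 have "\<theta> \<xi> \<xi> = star A ?b \<otimes>\<^bsub>A\<^esub> ?b"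
 proof (rule mem_ext)
  show "star A ?b \<otimes>\<^bsub>A\<^esub> ?b \<in> \<A>" using mult_mem[OF b b] by (simp only: sb A_simps(2))
  fix x assume x: "x \<in> carrier H"
  show "\<theta> \<xi> \<xi> x = (star A ?b \<otimes>\<^bsub>A\<^esub> ?b) x"
  proof (cases "vnorm H (j \<xi>) = 0")
   case True
   then show ?thesis unfolding sb using vnorm_eq_0[of "j \<xi>"] assms x by (simp add: compose_def)
  next
   case False
   have key: "c * (c * ip H x (j \<xi>) * ip H (j \<xi>) (j \<xi>)) = ip H x (j \<xi>)"
    using False assms by (simp add: c_def ip_self power2_eq_square)
   have "(?b \<otimes>\<^bsub>A\<^esub> ?b) x = (c * (c * ip H x (j \<xi>) * ip H (j \<xi>) (j \<xi>))) \<odot>\<^bsub>H\<^esub> j \<xi>"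
    using assms x by (simp add: compose_def H_smult_smult ip_smult)
   then show ?thesis unfolding sb key using x by simp
  qed
 qed (use assms in auto)
 then show ?thesis using assms b by (intro pos_elem_A_I) auto
qed

lemma rank_one_span_mem:
 assumes "R \<in> rank_one_span H {\<lambda>x\<in>carrier H. ip H x (j \<eta>) \<odot>\<^bsub>H\<^esub> j \<xi> | \<xi> \<eta>. \<xi> \<in> carrier E \<and> \<eta> \<in> carrier E}"
 shows "R \<in> \<A> \<and> R \<in> lin_span A {\<theta> \<xi> \<eta> | \<xi> \<eta>. \<xi> \<in> carrier E \<and> \<eta> \<in> carrier E}"
 using assms
proof induction
 case zero
 have "\<zero>\<^bsub>A\<^esub> \<in> N" if "submodule N complex_ring A" for N
  using subgroup.one_closed[OF submodule.axioms(1)[OF that]] by simp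
 then show ?case using zero_mem unfolding lin_span_def A_simps by blast
next
 case (base \<theta>')
 then show ?case unfolding lin_span_def by (auto simp: \<theta>_def[symmetric])
next
 case (add S T)
 have "(\<lambda>x\<in>carrier H. S x \<oplus>\<^bsub>H\<^esub> T x) \<in> N" if "submodule N complex_ring A" "S \<in> N" "T \<in> N" for N
  using subgroup.m_closed[OF submodule.axioms(1)[OF that(1)] that(2,3)] by simp
 moreover have "(\<lambda>x\<in>carrier H. S x \<oplus>\<^bsub>H\<^esub> T x) \<in> \<A>" using add by (intro add_mem) simp_all
 ultimately show ?case using add.IH unfolding lin_span_def by blast
qed

text \<open>In the compatibility relation both sides send \<zeta> to the inner product of \<zeta>
  with \<eta>, times \<xi>. The module axioms are identities in H that injectivity of
  \<open>j\<close> carries back to E, and the left action is bounded by the definition of the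
  operator norm.\<close>

lemma equivalence_bimodule_rank_one:
 "equivalence_bimodule A complex_star_algebra E act (\<lambda>\<xi> z. z \<odot>\<^bsub>E\<^esub> \<xi>) \<theta> (\<lambda>\<xi> \<eta>. ip H (j \<eta>) (j \<xi>))"
proof (rule equivalence_bimodule.intro[OF pre_cstar_algebra_A pre_cstar_algebra_complex equivalence_bimodule_axioms.intro], goal_cases)
 case 1
 show ?case by (rule module_E)
next
 case (2 a \<xi>)
 then show ?case by (simp add: act)
next
 case (3 a a' \<xi>)
 then show ?case by (intro act_eqI) (auto simp: act j_add)
next
 case (4 a \<xi> \<eta>)
 then show ?case by (intro act_eqI) (auto simp: act j_add bounded_opD(3)[OF bounded])
next
 case (5 a \<xi> z)
 then show ?case by (intro act_eqI) (auto simp: act j_smult)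
next
 case (6 a \<xi> z)
 then show ?case by (intro act_eqI) (auto simp: act j_smult bounded_opD(4)[OF bounded])
next
 case (7 a a' \<xi>)
 then show ?case by (intro act_eqI) (auto simp: act compose_def)
next
 case (8 \<xi> b)
 then show ?case by simp
next
 case (9 \<xi> \<eta> b)
 then show ?case by (intro j_eqI) (auto simp: j_add j_smult H_smult_add)
next
 case (10 \<xi> b b')
 then show ?case by (intro j_eqI) (auto simp: j_add j_smult H_add_smult)
next
 case (11 \<xi> b z)
 then show ?case by (intro j_eqI) (auto simp: j_smult H_smult_smult mult.commute)
next
 case (12 \<xi> b z)
 then show ?case by (intro j_eqI) (auto simp: j_smult H_smult_smult)
next
 case (13 \<xi> b b')
 then show ?case by (intro j_eqI) (auto simp: j_smult H_smult_smult mult.commute)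
next
 case (14 a \<xi> b)
 then show ?case by (intro j_eqI) (auto simp: act j_smult bounded_opD(4)[OF bounded])
next
 case (15 \<xi> \<eta>)
 then show ?case by simp
next
 case (16 \<xi> \<xi>' \<eta>)
 then show ?case by (intro mem_ext) (auto simp: j_add H_smult_add intro: add_mem)
next
 case (17 \<xi> \<eta> z)
 then show ?case by (intro mem_ext) (auto simp: j_smult H_smult_smult mult.commute intro: smult_mem)
next
 case (18 a \<xi> \<eta>)
 then have m: "compose (carrier H) a (\<theta> \<xi> \<eta>) \<in> \<A>" by (intro mult_mem) auto
 show ?case using 18 m by (intro mem_ext) (auto simp: act compose_def bounded_opD(4)[OF bounded])
next
 case (19 \<xi> \<eta>)
 then show ?case by (rule \<theta>_star)
next
 case (20 \<xi>)
 then show ?case by (rule \<theta>_pos)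
next
 case (21 \<xi>)
 have "\<theta> \<xi> \<xi> (j \<xi>) = (\<lambda>x\<in>carrier H. \<zero>\<^bsub>H\<^esub>) (j \<xi>)" using 21 by (simp only: A_simps)
 then have "ip H (j \<xi>) (j \<xi>) \<odot>\<^bsub>H\<^esub> j \<xi> = \<zero>\<^bsub>H\<^esub>" using 21(1) by simp
 then have "norm (ip H (j \<xi>) (j \<xi>)) * vnorm H (j \<xi>) = 0" using vnorm_smult[of "j \<xi>"] 21 by (metis j_closed vnorm_zero)
 then have "vnorm H (j \<xi>) = 0" using 21 by (auto simp: ip_self)
 then show ?case using 21 vnorm_eq_0[of "j \<xi>"] by (intro j_eqI) (auto simp: j_zero)
next
 case (22 \<xi> \<eta>)
 then show ?case by simp
next
 case (23 \<xi> \<eta> \<eta>')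
 then show ?case by (simp add: j_add ip_add)
next
 case (24 \<xi> \<eta> z)
 then show ?case by (simp add: j_smult ip_smult)
next
 case (25 \<xi> \<eta> b)
 then show ?case by (simp add: j_smult ip_smult)
next
 case (26 \<xi> \<eta>)
 then show ?case using ip_cnj[of "j \<eta>" "j \<xi>"] by simp
next
 case (27 \<xi>)
 then show ?case using pos_elem_complex[of "(vnorm H (j \<xi>))\<^sup>2"] by (simp add: ip_self)
next
 case (28 \<xi>)
 then show ?case using ip_definite[of "j \<xi>"] by (intro j_eqI) (auto simp: j_zero)
next
 case 29
 show ?case unfolding norm_dense_def
 proof (intro ballI allI impI)
  fix T and \<epsilon> :: real assume T: "T \<in> carrier A" and e: "\<epsilon> > 0"
  obtain R where R: "R \<in> rank_one_span H {\<lambda>x\<in>carrier H. ip H x (j \<eta>) \<odot>\<^bsub>H\<^esub> j \<xi> | \<xi> \<eta>. \<xi> \<in> carrier E \<and> \<eta> \<in> carrier E}"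
   and Rx: "\<And>x. x \<in> carrier H \<Longrightarrow> vnorm H (T x \<oplus>\<^bsub>H\<^esub> (-1) \<odot>\<^bsub>H\<^esub> R x) \<le> (\<epsilon>/2) * vnorm H x"
   using rank_one_dense[of T "\<epsilon>/2"] T e by auto
  have RA: "R \<in> \<A>" "R \<in> lin_span A {\<theta> \<xi> \<eta> | \<xi> \<eta>. \<xi> \<in> carrier E \<and> \<eta> \<in> carrier E}"
   using rank_one_span_mem[OF R] by auto
  have TA: "T \<in> \<A>" using T by simp
  \<comment> \<open>A pointwise bound gives only a weak inequality for the supremum; \<epsilon>/2
    makes the final one strict.\<close>
  have "opnorm (T \<ominus>\<^bsub>A\<^esub> R) \<le> \<epsilon> / 2"
   unfolding minus_A[OF TA RA(1)] by (rule opnorm_least) (use e Rx in auto)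
  then show "\<exists>s\<in>lin_span A {\<theta> \<xi> \<eta> | \<xi> \<eta>. \<xi> \<in> carrier E \<and> \<eta> \<in> carrier E}. nrm A (T \<ominus>\<^bsub>A\<^esub> s) < \<epsilon>"
   using RA e by (intro bexI[of _ R]) auto
 qed
next
 case 30
 show ?case unfolding norm_dense_def
 proof (intro ballI allI impI)
  fix z :: complex and \<epsilon> :: real assume e: "\<epsilon> > 0"
  obtain \<xi> where x: "\<xi> \<in> carrier E" "j \<xi> \<noteq> \<zero>\<^bsub>H\<^esub>" using nontrivial by blast
  let ?c = "ip H (j \<xi>) (j \<xi>)"
  have c: "?c \<noteq> 0" using ip_definite[of "j \<xi>"] x by auto
  have "z \<in> N" if N: "submodule N complex_ring complex_star_algebra" "?c \<in> N" for N
   using submodule.smult_closed[OF N(1), of "z / ?c" ?c] N(2) c by simp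
  then have "z \<in> lin_span complex_star_algebra {ip H (j \<eta>) (j \<xi>) | \<xi> \<eta>. \<xi> \<in> carrier E \<and> \<eta> \<in> carrier E}"
   unfolding lin_span_def using x by blast
  then show "\<exists>s\<in>lin_span complex_star_algebra {ip H (j \<eta>) (j \<xi>) | \<xi> \<eta>. \<xi> \<in> carrier E \<and> \<eta> \<in> carrier E}.
    nrm complex_star_algebra (z \<ominus>\<^bsub>complex_star_algebra\<^esub> s) < \<epsilon>"
   using e by (intro bexI[of _ z]) auto
 qed
next
 case (31 \<xi> \<eta> \<zeta>)
 then show ?case by (intro act_eqI) (auto simp: j_smult)
next
 case (32 a \<xi>)
 then have a: "a \<in> \<A>" by simp
 have "vnorm H (a (j \<xi>)) \<le> opnorm a * vnorm H (j \<xi>)" using 32 by (intro opnorm_bound bounded) auto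
 then have "(vnorm H (a (j \<xi>)))\<^sup>2 \<le> (opnorm a * vnorm H (j \<xi>))\<^sup>2" using 32 by (intro power_mono) auto
 then have "pos_elem complex_star_algebra (of_real ((opnorm a)\<^sup>2 * (vnorm H (j \<xi>))\<^sup>2 - (vnorm H (a (j \<xi>)))\<^sup>2))"
  by (intro pos_elem_complex) (simp add: power_mult_distrib)
 then show ?case using 32 by (simp add: cstar_le_def act ip_self)
next
 case (33 \<xi> b)
 let ?T = "\<lambda>x\<in>carrier H. of_real ((norm b)\<^sup>2) \<odot>\<^bsub>H\<^esub> \<theta> \<xi> \<xi> x"
 have T: "?T \<in> \<A>" using 33 by (intro smult_mem) auto
 \<comment> \<open>Scalars act on the right, so the boundedness inequality holds with equality and
   the element to be shown positive is 0.\<close>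
 have eq: "\<theta> (b \<odot>\<^bsub>E\<^esub> \<xi>) (b \<odot>\<^bsub>E\<^esub> \<xi>) = ?T"
 proof (rule mem_ext)
  fix x assume x: "x \<in> carrier H"
  show "\<theta> (b \<odot>\<^bsub>E\<^esub> \<xi>) (b \<odot>\<^bsub>E\<^esub> \<xi>) x = ?T x"
   unfolding complex_norm_square using x 33 by (simp add: j_smult ip_smult_right H_smult_smult mult_ac)
 qed (use 33 T in auto)
 have "pos_elem A (?T \<ominus>\<^bsub>A\<^esub> ?T)"
 proof -
  have z: "?T \<ominus>\<^bsub>A\<^esub> ?T = \<zero>\<^bsub>A\<^esub>" using T by (rule minus_self_A)
  have "\<zero>\<^bsub>A\<^esub> = star A \<zero>\<^bsub>A\<^esub> \<otimes>\<^bsub>A\<^esub> \<zero>\<^bsub>A\<^esub>"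
  proof -
   have "star A \<zero>\<^bsub>A\<^esub> = \<zero>\<^bsub>A\<^esub>" by (rule star_eqI) (use zero_mem in auto)
   then show ?thesis by (auto simp: compose_def fun_eq_iff restrict_def)
  qed
  then show ?thesis unfolding z using zero_mem by (intro pos_elem_A_I[of _ "\<zero>\<^bsub>A\<^esub>"]) auto
 qed
 then show ?case unfolding cstar_le_def eq by simp
qed

end

section \<open>The Hilbert space of square-integrable functions\<close>

lemma equiv_ae_eq: "equiv (sq_integrable M) (ae_eq M)"
proof (rule equivI)
 show "ae_eq M \<subseteq> sq_integrable M \<times> sq_integrable M" by (auto simp: ae_eq_def)
 show "refl_on (sq_integrable M) (ae_eq M)" by (auto simp: refl_on_def ae_eq_def)
 show "sym (ae_eq M)" by (auto simp: sym_def ae_eq_def elim: AE_mp)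
 show "trans (ae_eq M)" unfolding trans_def ae_eq_def by (auto elim: AE_mp)
qed

lemma L2_class_eq_iff:
 "f \<in> sq_integrable M \<Longrightarrow> g \<in> sq_integrable M \<Longrightarrow> L2_class M f = L2_class M g \<longleftrightarrow> (AE x in M. f x = g x)"
 using eq_equiv_class_iff[OF equiv_ae_eq, of f M g] by (simp add: L2_class_def ae_eq_def)

lemma carrier_L2: "carrier (L2 M) = L2_class M ` sq_integrable M"
 by (auto simp: L2_def L2_class_def quotient_def)

lemma L2_class_closed [simp, intro]: "f \<in> sq_integrable M \<Longrightarrow> L2_class M f \<in> carrier (L2 M)"
 by (simp add: carrier_L2)

lemma L2_rep_class:
 assumes "f \<in> sq_integrable M"
 shows "L2_rep (L2_class M f) \<in> sq_integrable M" "AE x in M. L2_rep (L2_class M f) x = f x"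
proof -
 have "f \<in> L2_class M f" using assms by (simp add: L2_class_def ae_eq_def)
 then have "L2_rep (L2_class M f) \<in> L2_class M f" unfolding L2_rep_def by (rule someI[of "\<lambda>h. h \<in> L2_class M f"])
 then show "L2_rep (L2_class M f) \<in> sq_integrable M" "AE x in M. L2_rep (L2_class M f) x = f x"
  by (auto simp: L2_class_def ae_eq_def elim: AE_mp)
qed

lemma L2_cases:
 assumes "c \<in> carrier (L2 M)"
 obtains f where "f \<in> sq_integrable M" "c = L2_class M f"
 using assms by (auto simp: carrier_L2)

lemma L2_rep:
 assumes "c \<in> carrier (L2 M)"
 shows "L2_rep c \<in> sq_integrable M" "L2_class M (L2_rep c) = c"
proof -
 obtain f where f: "f \<in> sq_integrable M" "c = L2_class M f" using assms by (rule L2_cases)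
 then show "L2_rep c \<in> sq_integrable M" using L2_rep_class by blast
 then show "L2_class M (L2_rep c) = c" using f L2_rep_class[OF f(1)] by (simp add: L2_class_eq_iff)
qed

lemma L2_add:
 assumes "f \<in> sq_integrable M" "g \<in> sq_integrable M"
 shows "L2_class M f \<oplus>\<^bsub>L2 M\<^esub> L2_class M g = L2_class M (\<lambda>x. f x + g x)"
proof -
 have "AE x in M. L2_rep (L2_class M f) x + L2_rep (L2_class M g) x = f x + g x"
  using L2_rep_class(2)[OF assms(1)] L2_rep_class(2)[OF assms(2)] by eventually_elim simp
 then show ?thesis using assms by (simp add: L2_def L2_class_eq_iff sq_integrable_add L2_rep_class)
qed

lemma L2_smult:
 assumes "f \<in> sq_integrable M"
 shows "z \<odot>\<^bsub>L2 M\<^esub> L2_class M f = L2_class M (\<lambda>x. z * f x)"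
proof -
 have "AE x in M. z * L2_rep (L2_class M f) x = z * f x"
  using L2_rep_class(2)[OF assms(1)] by eventually_elim simp
 then show ?thesis using assms by (simp add: L2_def L2_class_eq_iff sq_integrable_scale L2_rep_class)
qed

lemma L2_zero: "\<zero>\<^bsub>L2 M\<^esub> = L2_class M (\<lambda>_. 0)"
 by (simp add: L2_def)

lemma L2_ip:
 assumes "f \<in> sq_integrable M" "g \<in> sq_integrable M"
 shows "ip (L2 M) (L2_class M f) (L2_class M g) = (\<integral>x. f x * cnj (g x) \<partial>M)"
proof -
 have "AE x in M. L2_rep (L2_class M f) x * cnj (L2_rep (L2_class M g) x) = f x * cnj (g x)"
  using L2_rep_class(2)[OF assms(1)] L2_rep_class(2)[OF assms(2)] by eventually_elim simp
 then show ?thesis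
  using assms L2_rep_class(1)[OF assms(1)] L2_rep_class(1)[OF assms(2)]
  by (auto simp: L2_def intro!: integral_cong_AE dest!: sq_integrableD(1))
qed

lemma module_L2: "Module.module complex_ring (L2 M)"
proof (rule module.intro[OF cring_complex_ring])
 show "abelian_group (L2 M)"
 proof (rule abelian_groupI)
  show "\<zero>\<^bsub>L2 M\<^esub> \<in> carrier (L2 M)" by (auto simp: L2_zero sq_integrable_zero)
  fix c assume c: "c \<in> carrier (L2 M)"
  then obtain f where f: "f \<in> sq_integrable M" "c = L2_class M f" by (rule L2_cases)
  show "\<zero>\<^bsub>L2 M\<^esub> \<oplus>\<^bsub>L2 M\<^esub> c = c" by (simp add: f L2_zero L2_add sq_integrable_zero)
  show "\<exists>y\<in>carrier (L2 M). y \<oplus>\<^bsub>L2 M\<^esub> c = \<zero>\<^bsub>L2 M\<^esub>"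
   using f sq_integrable_scale[OF f(1), of "-1"]
   by (intro bexI[of _ "L2_class M (\<lambda>x. (-1) * f x)"]) (auto simp: L2_add L2_zero)
  fix d assume "d \<in> carrier (L2 M)"
  then obtain g where g: "g \<in> sq_integrable M" "d = L2_class M g" by (rule L2_cases)
  show "c \<oplus>\<^bsub>L2 M\<^esub> d \<in> carrier (L2 M)" using f g by (auto simp: L2_add sq_integrable_add)
  show "c \<oplus>\<^bsub>L2 M\<^esub> d = d \<oplus>\<^bsub>L2 M\<^esub> c" using f g by (simp add: L2_add add.commute)
  fix e assume "e \<in> carrier (L2 M)"
  then obtain h where h: "h \<in> sq_integrable M" "e = L2_class M h" by (rule L2_cases)
  show "c \<oplus>\<^bsub>L2 M\<^esub> d \<oplus>\<^bsub>L2 M\<^esub> e = c \<oplus>\<^bsub>L2 M\<^esub> (d \<oplus>\<^bsub>L2 M\<^esub> e)"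
   using f g h by (simp add: L2_add sq_integrable_add add.assoc)
 qed
 show "module_axioms complex_ring (L2 M)"
 proof
  fix a b :: complex and c d assume cd: "c \<in> carrier (L2 M)" "d \<in> carrier (L2 M)"
  obtain f where f: "f \<in> sq_integrable M" "c = L2_class M f" using cd(1) by (rule L2_cases)
  obtain g where g: "g \<in> sq_integrable M" "d = L2_class M g" using cd(2) by (rule L2_cases)
  show "(a \<oplus>\<^bsub>complex_ring\<^esub> b) \<odot>\<^bsub>L2 M\<^esub> c = a \<odot>\<^bsub>L2 M\<^esub> c \<oplus>\<^bsub>L2 M\<^esub> b \<odot>\<^bsub>L2 M\<^esub> c"
   using f by (simp add: L2_add L2_smult sq_integrable_scale distrib_right)
  show "a \<odot>\<^bsub>L2 M\<^esub> (c \<oplus>\<^bsub>L2 M\<^esub> d) = a \<odot>\<^bsub>L2 M\<^esub> c \<oplus>\<^bsub>L2 M\<^esub> a \<odot>\<^bsub>L2 M\<^esub> d"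
   using f g by (simp add: L2_add L2_smult sq_integrable_scale sq_integrable_add distrib_left)
  show "(a \<otimes>\<^bsub>complex_ring\<^esub> b) \<odot>\<^bsub>L2 M\<^esub> c = a \<odot>\<^bsub>L2 M\<^esub> (b \<odot>\<^bsub>L2 M\<^esub> c)"
   using f by (simp add: L2_smult sq_integrable_scale mult.assoc)
 next
  fix c and a :: complex assume "c \<in> carrier (L2 M)"
  then obtain f where f: "f \<in> sq_integrable M" "c = L2_class M f" by (rule L2_cases)
  show "a \<odot>\<^bsub>L2 M\<^esub> c \<in> carrier (L2 M)" using f by (auto simp: L2_smult sq_integrable_scale)
  show "\<one>\<^bsub>complex_ring\<^esub> \<odot>\<^bsub>L2 M\<^esub> c = c" using f by (simp add: L2_smult)
 qed
qed

lemma ip_self_L2: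
 assumes "f \<in> sq_integrable M"
 shows "ip (L2 M) (L2_class M f) (L2_class M f) = of_real (\<integral>x. (norm (f x))\<^sup>2 \<partial>M)"
proof -
 have "ip (L2 M) (L2_class M f) (L2_class M f) = (\<integral>x. of_real ((norm (f x))\<^sup>2) \<partial>M)"
  unfolding complex_norm_square by (rule L2_ip[OF assms assms])
 then show ?thesis by (simp only: integral_complex_of_real)
qed

lemma prehilbert_L2: "prehilbert (L2 M)"
proof (rule prehilbert.intro)
 show "Module.module complex_ring (L2 M)" by (rule module_L2)
 fix c assume "c \<in> carrier (L2 M)"
 then obtain f where f: "f \<in> sq_integrable M" "c = L2_class M f" by (rule L2_cases)
 show "Re (ip (L2 M) c c) \<ge> 0" using f by (simp add: ip_self_L2)
 show "c = \<zero>\<^bsub>L2 M\<^esub>" if z: "ip (L2 M) c c = 0"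
 proof -
  have "(\<integral>x. (norm (f x))\<^sup>2 \<partial>M) = 0" using z f by (simp add: ip_self_L2)
  then have "AE x in M. (norm (f x))\<^sup>2 = 0"
   using sq_integrableD(2)[OF f(1)] by (subst (asm) integral_nonneg_eq_0_iff_AE) auto
  then have "AE x in M. f x = 0" by simp
  then show ?thesis using f by (simp add: L2_zero L2_class_eq_iff sq_integrable_zero)
 qed
 fix d assume "d \<in> carrier (L2 M)"
 then obtain g where g: "g \<in> sq_integrable M" "d = L2_class M g" by (rule L2_cases)
 show "ip (L2 M) d c = cnj (ip (L2 M) c d)"
  using f g by (simp add: L2_ip mult.commute flip: Bochner_Integration.integral_cnj)
 show "ip (L2 M) (z \<odot>\<^bsub>L2 M\<^esub> c) d = z * ip (L2 M) c d" for z
  using f g by (simp add: L2_ip L2_smult sq_integrable_scale mult.assoc)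
 fix e assume "e \<in> carrier (L2 M)"
 then obtain h where h: "h \<in> sq_integrable M" "e = L2_class M h" by (rule L2_cases)
 show "ip (L2 M) (c \<oplus>\<^bsub>L2 M\<^esub> d) e = ip (L2 M) c e + ip (L2 M) d e"
  using f g h by (simp add: L2_ip L2_add sq_integrable_add distrib_right sq_integrable_mult sq_integrable_cnj)
qed

definition l2 :: "'x measure \<Rightarrow> ('x \<Rightarrow> complex) \<Rightarrow> real" where
 "l2 M f = sqrt (\<integral>x. (norm (f x))\<^sup>2 \<partial>M)"

lemma l2_nonneg [simp]: "l2 M f \<ge> 0"
 by (simp add: l2_def)

lemma vnorm_L2: "f \<in> sq_integrable M \<Longrightarrow> vnorm (L2 M) (L2_class M f) = l2 M f"
 by (simp add: vnorm_def ip_self_L2 l2_def)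

text \<open>Cauchy-Schwarz is applied to the absolute values, because integrability on product
  spaces needs a bound on the integral of the norm.\<close>

lemma integral_norm_mult_le:
 assumes f: "f \<in> sq_integrable M" and g: "g \<in> sq_integrable M"
 shows "(\<integral>x. norm (f x) * norm (g x) \<partial>M) \<le> l2 M f * l2 M g"
proof -
 interpret prehilbert "L2 M" by (rule prehilbert_L2)
 let ?f = "\<lambda>x. complex_of_real (norm (f x))" and ?g = "\<lambda>x. complex_of_real (norm (g x))"
 have s: "?f \<in> sq_integrable M" "?g \<in> sq_integrable M" using f g by (auto simp: sq_integrable_def)
 have "(\<integral>x. ?f x * cnj (?g x) \<partial>M) = of_real (\<integral>x. norm (f x) * norm (g x) \<partial>M)"
  by (simp flip: integral_complex_of_real)
 then have "norm (of_real (\<integral>x. norm (f x) * norm (g x) \<partial>M) :: complex) \<le> l2 M ?f * l2 M ?g"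
  using cauchy_schwarz[of "L2_class M ?f" "L2_class M ?g"] s by (simp add: L2_ip vnorm_L2)
 then show ?thesis by (simp add: l2_def)
qed

lemma norm_integral_mult_le:
 assumes f: "f \<in> sq_integrable M" and g: "g \<in> sq_integrable M"
 shows "norm (\<integral>x. f x * cnj (g x) \<partial>M) \<le> l2 M f * l2 M g"
 using integral_norm_bound[of M "\<lambda>x. f x * cnj (g x)"] integral_norm_mult_le[OF f g] by (simp add: norm_mult)

section \<open>The projective representation\<close>

context phase_space
begin

sublocale G: schwartz_group "\<nu> \<Otimes>\<^sub>M \<mu>" "map (\<lambda>p z. p (fst z)) Qs @ map (\<lambda>q z. q (snd z)) Ps"
 by (rule schwartz_group_prod) unfold_locales

sublocale NM: pair_sigma_finite \<nu> \<mu> ..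

sublocale GN: pair_sigma_finite "\<nu> \<Otimes>\<^sub>M \<mu>" \<nu> ..

sublocale GG: pair_sigma_finite "\<nu> \<Otimes>\<^sub>M \<mu>" "\<nu> \<Otimes>\<^sub>M \<mu>" ..

sublocale NN: pair_sigma_finite \<nu> \<nu> ..

sublocale H: prehilbert "L2 \<nu>" by (rule prehilbert_L2)

lemma pi_fun_eq: "pi_fun g \<xi> \<delta> = cnj (char_fun (\<delta> - fst g) (snd g)) * \<xi> (\<delta> - fst g)"
 by (simp add: pi_fun_def translation_def modulation_def char_fun_minus_arg split: prod.splits)

lemma norm_pi_fun [simp]: "norm (pi_fun g \<xi> \<delta>) = norm (\<xi> (\<delta> - fst g))"
 by (simp add: pi_fun_eq norm_mult)

text \<open>Fubini needs measurability in g and \<delta> together. The phase is continuous, and a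
  merely measurable x is composed with the continuous subtraction.\<close>

lemma pi_fun_measurable:
 assumes x: "x \<in> borel_measurable \<nu>"
 shows "(\<lambda>z. pi_fun (fst z) x (snd z)) \<in> borel_measurable ((\<nu> \<Otimes>\<^sub>M \<mu>) \<Otimes>\<^sub>M \<nu>)"
proof -
 have 1: "(\<lambda>z. cnj (char_fun (snd z - fst (fst z)) (snd (fst z)))) \<in> borel_measurable ((\<nu> \<Otimes>\<^sub>M \<mu>) \<Otimes>\<^sub>M \<nu>)"
  by (rule G.measurable_pair_cont[OF N.sets_M]) (intro continuous_intros)
 have "(\<lambda>z. snd z - fst (fst z)) \<in> borel_measurable ((\<nu> \<Otimes>\<^sub>M \<mu>) \<Otimes>\<^sub>M \<nu>)"
  by (rule G.measurable_pair_cont[OF N.sets_M]) (intro continuous_intros)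
 then have "(\<lambda>z. snd z - fst (fst z)) \<in> (\<nu> \<Otimes>\<^sub>M \<mu>) \<Otimes>\<^sub>M \<nu> \<rightarrow>\<^sub>M \<nu>"
  by (simp add: measurable_cong_sets[OF refl N.sets_M])
 from measurable_compose[OF this x]
 have "(\<lambda>z. x (snd z - fst (fst z))) \<in> borel_measurable ((\<nu> \<Otimes>\<^sub>M \<mu>) \<Otimes>\<^sub>M \<nu>)" .
 with 1 show ?thesis unfolding pi_fun_eq by (rule borel_measurable_times)
qed

lemma pi_fun_sq_integrable:
 assumes x: "x \<in> sq_integrable \<nu>"
 shows "pi_fun g x \<in> sq_integrable \<nu>"
proof -
 have "pi_fun g x \<in> borel_measurable \<nu>"
  using measurable_Pair2[OF pi_fun_measurable[OF sq_integrableD(1)[OF x]], of g]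
  by (simp add: space_pair_measure)
 moreover have "integrable \<nu> (\<lambda>\<delta>. (norm (x (\<delta> + - fst g)))\<^sup>2)"
  by (rule N.integrable_translate[OF sq_integrableD(2)[OF x]])
 ultimately show ?thesis by (simp add: sq_integrable_def)
qed

lemma pi_fun_isometry:
 assumes x: "x \<in> sq_integrable \<nu>"
 shows "(\<integral>\<delta>. (norm (pi_fun g x \<delta>))\<^sup>2 \<partial>\<nu>) = (\<integral>\<delta>. (norm (x \<delta>))\<^sup>2 \<partial>\<nu>)"
proof -
 have "complex_of_real (\<integral>\<delta>. (norm (pi_fun g x \<delta>))\<^sup>2 \<partial>\<nu>) = (\<integral>\<delta>. (\<lambda>\<delta>. complex_of_real ((norm (x \<delta>))\<^sup>2)) (\<delta> + - fst g) \<partial>\<nu>)"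
  unfolding integral_complex_of_real[symmetric] by simp
 also have "\<dots> = (\<integral>\<delta>. complex_of_real ((norm (x \<delta>))\<^sup>2) \<partial>\<nu>)"
  by (rule N.integral_translate[OF borel_measurable_integrable[OF integrable_of_real[OF sq_integrableD(2)[OF x]]]])
 finally show ?thesis by (simp only: integral_complex_of_real of_real_eq_iff)
qed

lemma pi_op_class:
 assumes x: "x \<in> sq_integrable \<nu>"
 shows "pi_op \<nu> g (L2_class \<nu> x) = L2_class \<nu> (pi_fun g x)"
proof -
 have "AE \<delta> in \<nu>. L2_rep (L2_class \<nu> x) \<delta> = x \<delta>" by (rule L2_rep_class(2)[OF x])
 from N.AE_translate[OF this, of "- fst g"]
 have "AE \<delta> in \<nu>. pi_fun g (L2_rep (L2_class \<nu> x)) \<delta> = pi_fun g x \<delta>"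
  by eventually_elim (simp add: pi_fun_eq)
 then show ?thesis using x
  by (simp add: pi_op_def L2_class_eq_iff pi_fun_sq_integrable L2_rep_class)
qed

lemma pi_op_closed [simp, intro]: "c \<in> carrier (L2 \<nu>) \<Longrightarrow> pi_op \<nu> g c \<in> carrier (L2 \<nu>)"
 by (erule L2_cases) (auto simp: pi_op_class pi_fun_sq_integrable)

lemma pi_op_add:
 assumes "c \<in> carrier (L2 \<nu>)" "d \<in> carrier (L2 \<nu>)"
 shows "pi_op \<nu> g (c \<oplus>\<^bsub>L2 \<nu>\<^esub> d) = pi_op \<nu> g c \<oplus>\<^bsub>L2 \<nu>\<^esub> pi_op \<nu> g d"
proof -
 obtain x y where "x \<in> sq_integrable \<nu>" "c = L2_class \<nu> x" "y \<in> sq_integrable \<nu>" "d = L2_class \<nu> y"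
  using assms by (auto elim!: L2_cases)
 then show ?thesis by (simp add: L2_add pi_op_class sq_integrable_add pi_fun_sq_integrable)
  (simp add: pi_fun_eq[abs_def] distrib_left)
qed

lemma pi_op_smult:
 assumes "c \<in> carrier (L2 \<nu>)"
 shows "pi_op \<nu> g (z \<odot>\<^bsub>L2 \<nu>\<^esub> c) = z \<odot>\<^bsub>L2 \<nu>\<^esub> pi_op \<nu> g c"
proof -
 obtain x where "x \<in> sq_integrable \<nu>" "c = L2_class \<nu> x" using assms by (auto elim!: L2_cases)
 then show ?thesis by (simp add: L2_smult pi_op_class sq_integrable_scale pi_fun_sq_integrable)
  (simp add: pi_fun_eq[abs_def] mult_ac)
qed

lemma vnorm_pi_op: "c \<in> carrier (L2 \<nu>) \<Longrightarrow> vnorm (L2 \<nu>) (pi_op \<nu> g c) = vnorm (L2 \<nu>) c"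
 by (erule L2_cases) (simp add: pi_op_class vnorm_L2 pi_fun_sq_integrable l2_def pi_fun_isometry del: norm_pi_fun)

text \<open>The scalar is the cocycle \<sigma>(g, h). It arises because the character variable seen
  by g differs from the one seen by the combined operator by the translation
  \<open>fst h\<close>.\<close>

lemma pi_op_mult:
 assumes "c \<in> carrier (L2 \<nu>)"
 shows "pi_op \<nu> g (pi_op \<nu> h c) = cnj (char_fun (fst h) (snd g)) \<odot>\<^bsub>L2 \<nu>\<^esub> pi_op \<nu> (g + h) c"
proof -
 obtain x where x: "x \<in> sq_integrable \<nu>" "c = L2_class \<nu> x" using assms by (auto elim!: L2_cases)
 have "pi_fun g (pi_fun h x) \<delta> = cnj (char_fun (fst h) (snd g)) * pi_fun (g + h) x \<delta>" for \<delta>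
 proof -
  have "char_fun (\<delta> - fst g) (snd g) = char_fun (fst h) (snd g) * char_fun (\<delta> - (fst g + fst h)) (snd g)"
   unfolding char_fun_add[symmetric] by simp
  then show ?thesis by (simp add: pi_fun_eq char_fun_add_arg diff_diff_eq mult_ac)
 qed
 then have "pi_fun g (pi_fun h x) = (\<lambda>\<delta>. cnj (char_fun (fst h) (snd g)) * pi_fun (g + h) x \<delta>)" by auto
 then show ?thesis using x by (simp add: pi_op_class L2_smult pi_fun_sq_integrable)
qed

text \<open>Substituting \<epsilon> = \<delta> - \<gamma> removes the translation from the
  character, so the group variable occurs only as \<epsilon>(t); later the integral over t becomes a
  Fourier transform.\<close>

lemma ip_pi_op_shift:
 assumes x: "x \<in> sq_integrable \<nu>" and y: "y \<in> sq_integrable \<nu>"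
 shows "ip (L2 \<nu>) (pi_op \<nu> g (L2_class \<nu> x)) (L2_class \<nu> y) =
  (\<integral>\<epsilon>. cnj (char_fun \<epsilon> (snd g)) * x \<epsilon> * cnj (y (\<epsilon> + fst g)) \<partial>\<nu>)"
proof -
 have "ip (L2 \<nu>) (pi_op \<nu> g (L2_class \<nu> x)) (L2_class \<nu> y) = (\<integral>\<delta>. pi_fun g x \<delta> * cnj (y \<delta>) \<partial>\<nu>)"
  using x y by (simp add: pi_op_class L2_ip pi_fun_sq_integrable)
 also have "\<dots> = (\<integral>\<epsilon>. pi_fun g x (\<epsilon> + fst g) * cnj (y (\<epsilon> + fst g)) \<partial>\<nu>)"
  by (rule N.integral_translate[OF borel_measurable_integrable[OF
    sq_integrable_mult[OF pi_fun_sq_integrable[OF x] sq_integrable_cnj[OF y]]], symmetric])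
 finally show ?thesis by (simp add: pi_fun_eq)
qed

text \<open>\<pi>(g) is unitary, and \<pi>(g) \<pi>(-g) is the scalar \<sigma>(g, -g) = \<gamma>(t)
  for g = (\<gamma>, t). Hence the adjoint is the conjugate of \<gamma>(t) times \<pi>(-g).\<close>

lemma ip_pi_op_adjoint:
 assumes "c \<in> carrier (L2 \<nu>)" "d \<in> carrier (L2 \<nu>)"
 shows "ip (L2 \<nu>) (pi_op \<nu> g c) d = char_fun (fst g) (snd g) * ip (L2 \<nu>) c (pi_op \<nu> (- g) d)"
proof -
 obtain x y where xy: "x \<in> sq_integrable \<nu>" "c = L2_class \<nu> x" "y \<in> sq_integrable \<nu>" "d = L2_class \<nu> y"
  using assms by (auto elim!: L2_cases)
 have "ip (L2 \<nu>) c (pi_op \<nu> (- g) d) = (\<integral>\<epsilon>. x \<epsilon> * cnj (pi_fun (- g) y \<epsilon>) \<partial>\<nu>)"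
  using xy by (simp add: pi_op_class L2_ip pi_fun_sq_integrable)
 then have "char_fun (fst g) (snd g) * ip (L2 \<nu>) c (pi_op \<nu> (- g) d) =
   (\<integral>\<epsilon>. char_fun (fst g) (snd g) * (x \<epsilon> * cnj (pi_fun (- g) y \<epsilon>)) \<partial>\<nu>)" by simp
 also have "\<dots> = (\<integral>\<epsilon>. cnj (char_fun \<epsilon> (snd g)) * x \<epsilon> * cnj (y (\<epsilon> + fst g)) \<partial>\<nu>)"
 proof (rule Bochner_Integration.integral_cong[OF refl])
  fix \<epsilon>
  have "cnj (pi_fun (- g) y \<epsilon>) = cnj (char_fun \<epsilon> (snd g)) * cnj (char_fun (fst g) (snd g)) * cnj (y (\<epsilon> + fst g))"
   by (simp add: pi_fun_eq char_fun_minus_arg char_fun_add)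
  moreover have "char_fun (fst g) (snd g) * (a * (b * cnj (char_fun (fst g) (snd g)) * c)) = b * a * c" for a b c
  proof -
   have "char_fun (fst g) (snd g) * (a * (b * cnj (char_fun (fst g) (snd g)) * c)) =
    (char_fun (fst g) (snd g) * cnj (char_fun (fst g) (snd g))) * (b * a * c)" by (simp only: mult_ac)
   then show ?thesis by simp
  qed
  ultimately show "char_fun (fst g) (snd g) * (x \<epsilon> * cnj (pi_fun (- g) y \<epsilon>)) =
    cnj (char_fun \<epsilon> (snd g)) * x \<epsilon> * cnj (y (\<epsilon> + fst g))" by simp
 qed
 finally show ?thesis using xy by (simp add: ip_pi_op_shift)
qed

lemma coefficient_bound:
 assumes "c \<in> carrier (L2 \<nu>)" "d \<in> carrier (L2 \<nu>)"
 shows "norm (ip (L2 \<nu>) (pi_op \<nu> g c) d) \<le> vnorm (L2 \<nu>) c * vnorm (L2 \<nu>) d"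
 using H.cauchy_schwarz[OF pi_op_closed[OF assms(1)] assms(2)] by (simp add: vnorm_pi_op assms)

lemma coefficient_measurable:
 assumes "c \<in> carrier (L2 \<nu>)" "d \<in> carrier (L2 \<nu>)"
 shows "(\<lambda>g. ip (L2 \<nu>) (pi_op \<nu> g c) d) \<in> borel_measurable (\<nu> \<Otimes>\<^sub>M \<mu>)"
proof -
 obtain x y where xy: "x \<in> sq_integrable \<nu>" "c = L2_class \<nu> x" "y \<in> sq_integrable \<nu>" "d = L2_class \<nu> y"
  using assms by (auto elim!: L2_cases)
 have [measurable]: "(\<lambda>z. pi_fun (fst z) x (snd z)) \<in> borel_measurable ((\<nu> \<Otimes>\<^sub>M \<mu>) \<Otimes>\<^sub>M \<nu>)" "y \<in> borel_measurable \<nu>"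
  using xy by (auto intro: pi_fun_measurable dest: sq_integrableD)
 have "(\<lambda>z. pi_fun (fst z) x (snd z) * cnj (y (snd z))) \<in> borel_measurable ((\<nu> \<Otimes>\<^sub>M \<mu>) \<Otimes>\<^sub>M \<nu>)"
  by measurable
 then have "(\<lambda>g. \<integral>\<delta>. pi_fun g x \<delta> * cnj (y \<delta>) \<partial>\<nu>) \<in> borel_measurable (\<nu> \<Otimes>\<^sub>M \<mu>)"
  by (intro N.borel_measurable_lebesgue_integral) (simp add: case_prod_unfold)
 then show ?thesis using xy by (simp add: pi_op_class L2_ip pi_fun_sq_integrable)
qed

section \<open>The integrated representation\<close>

text \<open>The action on functions, integrated pointwise. For integrable a and square-integrable x
  the integrand may fail to be integrable on a null set of \<delta>, where the integral takes the
  default value 0.\<close>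

definition pi_conv :: "('g pontryagin_dual \<times> 'g \<Rightarrow> complex) \<Rightarrow> ('g pontryagin_dual \<Rightarrow> complex) \<Rightarrow> 'g pontryagin_dual \<Rightarrow> complex"
 where "pi_conv a x = (\<lambda>\<delta>. \<integral>g. a g * pi_fun g x \<delta> \<partial>(\<nu> \<Otimes>\<^sub>M \<mu>))"

text \<open>A Young inequality: Cauchy-Schwarz in g with respect to |a| bounds the squared value at
  \<delta> by A u(\<delta>), and u integrates to A times the squared norm of x because every
  \<open>pi_fun g\<close> is isometric.\<close>

lemma pi_conv_sq_integrable:
 assumes a: "integrable (\<nu> \<Otimes>\<^sub>M \<mu>) a" and x: "x \<in> sq_integrable \<nu>"
 shows "pi_conv a x \<in> sq_integrable \<nu>" "l2 \<nu> (pi_conv a x) \<le> (\<integral>g. norm (a g) \<partial>(\<nu> \<Otimes>\<^sub>M \<mu>)) * l2 \<nu> x"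
proof -
 let ?G = "\<nu> \<Otimes>\<^sub>M \<mu>"
 define A where "A = (\<integral>g. norm (a g) \<partial>?G)"
 have A0: "A \<ge> 0" by (simp add: A_def)
 have am [measurable]: "a \<in> borel_measurable ?G" using a by simp
 have pm [measurable]: "(\<lambda>z. pi_fun (fst z) x (snd z)) \<in> borel_measurable (?G \<Otimes>\<^sub>M \<nu>)"
  using x by (intro pi_fun_measurable) (rule sq_integrableD)
 have i2: "integrable \<nu> (\<lambda>\<delta>. (norm (pi_fun g x \<delta>))\<^sup>2)" for g
  using pi_fun_sq_integrable[OF x] by (rule sq_integrableD)
 have I: "integrable (?G \<Otimes>\<^sub>M \<nu>) (\<lambda>z. norm (a (fst z)) * (norm (pi_fun (fst z) x (snd z)))\<^sup>2)"
 proof (rule GN.Fubini_integrable)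
  show "integrable ?G (\<lambda>g. \<integral>\<delta>. norm (norm (a (fst (g, \<delta>))) * (norm (pi_fun (fst (g, \<delta>)) x (snd (g, \<delta>))))\<^sup>2) \<partial>\<nu>)"
   using a x by (simp add: pi_fun_isometry del: norm_pi_fun)
  show "AE g in ?G. integrable \<nu> (\<lambda>\<delta>. norm (a (fst (g, \<delta>))) * (norm (pi_fun (fst (g, \<delta>)) x (snd (g, \<delta>))))\<^sup>2)"
   using i2 by simp
 qed measurable
 define u where "u \<delta> = (\<integral>g. norm (a g) * (norm (pi_fun g x \<delta>))\<^sup>2 \<partial>?G)" for \<delta>
 have u: "integrable \<nu> u" "(\<integral>\<delta>. u \<delta> \<partial>\<nu>) = A * (l2 \<nu> x)\<^sup>2"
 proof -
  show "integrable \<nu> u" unfolding u_def[abs_def] using GN.integrable_snd[of "\<lambda>g \<delta>. norm (a g) * (norm (pi_fun g x \<delta>))\<^sup>2"] I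
   by (simp add: case_prod_unfold del: norm_pi_fun)
  have "(\<integral>\<delta>. u \<delta> \<partial>\<nu>) = (\<integral>g. (\<integral>\<delta>. norm (a g) * (norm (pi_fun g x \<delta>))\<^sup>2 \<partial>\<nu>) \<partial>?G)"
   unfolding u_def using I by (intro GN.Fubini_integral) (simp add: case_prod_unfold)
  also have "\<dots> = A * (l2 \<nu> x)\<^sup>2"
   using x by (simp add: pi_fun_isometry A_def l2_def del: norm_pi_fun)
  finally show "(\<integral>\<delta>. u \<delta> \<partial>\<nu>) = A * (l2 \<nu> x)\<^sup>2" .
 qed
 have ae: "AE \<delta> in \<nu>. (norm (pi_conv a x \<delta>))\<^sup>2 \<le> A * u \<delta>"
 proof -
  have "AE \<delta> in \<nu>. integrable ?G (\<lambda>g. norm (a g) * (norm (pi_fun g x \<delta>))\<^sup>2)"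
   using GN.AE_integrable_snd[of "\<lambda>g \<delta>. norm (a g) * (norm (pi_fun g x \<delta>))\<^sup>2"] I
   by (simp add: case_prod_unfold del: norm_pi_fun)
  then show ?thesis
  proof eventually_elim
   case (elim \<delta>)
   have pd [measurable]: "(\<lambda>g. pi_fun g x \<delta>) \<in> borel_measurable ?G"
    using measurable_Pair1[OF pm, of \<delta>] by simp
   \<comment> \<open>|a| is split into two square roots, one of which carries x.\<close>
   let ?f = "\<lambda>g. complex_of_real (sqrt (norm (a g)))" and ?h = "\<lambda>g. complex_of_real (sqrt (norm (a g))) * pi_fun g x \<delta>"
   have nf: "(norm (?f g))\<^sup>2 = norm (a g)" for g by (simp add: real_sqrt_pow2)
   have nh: "(norm (?h g))\<^sup>2 = norm (a g) * (norm (pi_fun g x \<delta>))\<^sup>2" for g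
    by (simp add: norm_mult power_mult_distrib real_sqrt_pow2 del: norm_pi_fun)
   have sf: "?f \<in> sq_integrable ?G" using a unfolding sq_integrable_def nf by auto
   have "integrable ?G (\<lambda>g. (norm (?h g))\<^sup>2)" unfolding nh by (rule elim)
   then have sh: "?h \<in> sq_integrable ?G" unfolding sq_integrable_def by simp
   have "norm (pi_conv a x \<delta>) \<le> (\<integral>g. norm (a g * pi_fun g x \<delta>) \<partial>?G)" unfolding pi_conv_def by (rule integral_norm_bound)
   also have "\<dots> = (\<integral>g. norm (?f g) * norm (?h g) \<partial>?G)"
    by (intro Bochner_Integration.integral_cong refl) (simp add: norm_mult mult.assoc[symmetric] del: norm_pi_fun)
   also have "\<dots> \<le> l2 ?G ?f * l2 ?G ?h" by (rule integral_norm_mult_le[OF sf sh])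
   also have "\<dots> = sqrt A * sqrt (u \<delta>)" unfolding l2_def nf nh A_def u_def ..
   finally have "(norm (pi_conv a x \<delta>))\<^sup>2 \<le> (sqrt A * sqrt (u \<delta>))\<^sup>2" by (intro power_mono) auto
   moreover have "u \<delta> \<ge> 0" unfolding u_def by (intro Bochner_Integration.integral_nonneg) auto
   ultimately show ?case using A0 by (simp add: power_mult_distrib)
  qed
 qed
 have cm: "pi_conv a x \<in> borel_measurable \<nu>"
 proof -
  have "(\<lambda>(\<delta>, g). a g * pi_fun g x \<delta>) \<in> borel_measurable (\<nu> \<Otimes>\<^sub>M ?G)"
   using measurable_pair_swap[of "\<lambda>z. a (fst z) * pi_fun (fst z) x (snd z)" ?G \<nu> borel]
   by (simp add: case_prod_unfold)
  then show ?thesis unfolding pi_conv_def by (rule G.borel_measurable_lebesgue_integral)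
 qed
 have Au: "integrable \<nu> (\<lambda>\<delta>. A * u \<delta>)" using u by simp
 have i: "integrable \<nu> (\<lambda>\<delta>. (norm (pi_conv a x \<delta>))\<^sup>2)"
 proof (rule Bochner_Integration.integrable_bound[OF Au])
  show "AE \<delta> in \<nu>. norm ((norm (pi_conv a x \<delta>))\<^sup>2) \<le> norm (A * u \<delta>)"
   using ae by eventually_elim simp
 qed (use cm in measurable)
 then show "pi_conv a x \<in> sq_integrable \<nu>" using cm by (simp add: sq_integrable_def)
 have "(\<integral>\<delta>. (norm (pi_conv a x \<delta>))\<^sup>2 \<partial>\<nu>) \<le> (\<integral>\<delta>. A * u \<delta> \<partial>\<nu>)" by (rule integral_mono_AE[OF i Au ae])
 also have "\<dots> = (A * l2 \<nu> x)\<^sup>2" using u(2) by (simp add: power_mult_distrib power2_eq_square)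
 finally show "l2 \<nu> (pi_conv a x) \<le> A * l2 \<nu> x"
  using A0 by (simp add: l2_def[of _ "pi_conv a x"] real_le_lsqrt)
qed

text \<open>Fubini, justified by a bound on the coefficients that does not depend on g, shows that
  the pointwise integral satisfies the weak definition of the operator.\<close>

lemma pi_conv_weak:
 assumes a: "integrable (\<nu> \<Otimes>\<^sub>M \<mu>) a" and x: "x \<in> sq_integrable \<nu>" and y: "y \<in> sq_integrable \<nu>"
 shows "(\<integral>\<delta>. pi_conv a x \<delta> * cnj (y \<delta>) \<partial>\<nu>) =
  (\<integral>g. a g * ip (L2 \<nu>) (pi_op \<nu> g (L2_class \<nu> x)) (L2_class \<nu> y) \<partial>(\<nu> \<Otimes>\<^sub>M \<mu>))"
proof -
 let ?G = "\<nu> \<Otimes>\<^sub>M \<mu>"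
 have am [measurable]: "a \<in> borel_measurable ?G" and ym [measurable]: "y \<in> borel_measurable \<nu>"
  using a y by (auto dest: sq_integrableD)
 have pm [measurable]: "(\<lambda>z. pi_fun (fst z) x (snd z)) \<in> borel_measurable (?G \<Otimes>\<^sub>M \<nu>)"
  using x by (intro pi_fun_measurable) (rule sq_integrableD)
 have py: "integrable \<nu> (\<lambda>\<delta>. pi_fun g x \<delta> * cnj (y \<delta>))" for g
  by (intro sq_integrable_mult pi_fun_sq_integrable sq_integrable_cnj x y)
 have I: "integrable (?G \<Otimes>\<^sub>M \<nu>) (\<lambda>z. a (fst z) * (pi_fun (fst z) x (snd z) * cnj (y (snd z))))"
 proof (rule GN.Fubini_integrable)
  show "integrable ?G (\<lambda>g. \<integral>\<delta>. norm (a (fst (g, \<delta>)) * (pi_fun (fst (g, \<delta>)) x (snd (g, \<delta>)) * cnj (y (snd (g, \<delta>))))) \<partial>\<nu>)"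
  proof (rule Bochner_Integration.integrable_bound)
   show "integrable ?G (\<lambda>g. norm (a g) * (l2 \<nu> x * l2 \<nu> y))" using a by (intro integrable_mult_left integrable_norm)
   show "AE g in ?G. norm (\<integral>\<delta>. norm (a (fst (g, \<delta>)) * (pi_fun (fst (g, \<delta>)) x (snd (g, \<delta>)) * cnj (y (snd (g, \<delta>))))) \<partial>\<nu>)
     \<le> norm (norm (a g) * (l2 \<nu> x * l2 \<nu> y))"
   proof (rule AE_I2)
    fix g
    have "(\<integral>\<delta>. norm (pi_fun g x \<delta>) * norm (y \<delta>) \<partial>\<nu>) \<le> l2 \<nu> (pi_fun g x) * l2 \<nu> y"
     by (intro integral_norm_mult_le pi_fun_sq_integrable x y)
    also have "l2 \<nu> (pi_fun g x) = l2 \<nu> x" using x by (simp add: l2_def pi_fun_isometry del: norm_pi_fun)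
    finally have *: "(\<integral>\<delta>. norm (pi_fun g x \<delta>) * norm (y \<delta>) \<partial>\<nu>) \<le> l2 \<nu> x * l2 \<nu> y" .
    have "(\<integral>\<delta>. norm (pi_fun g x \<delta>) * norm (y \<delta>) \<partial>\<nu>) \<ge> 0" by (intro Bochner_Integration.integral_nonneg) auto
    then show "norm (\<integral>\<delta>. norm (a (fst (g, \<delta>)) * (pi_fun (fst (g, \<delta>)) x (snd (g, \<delta>)) * cnj (y (snd (g, \<delta>))))) \<partial>\<nu>)
     \<le> norm (norm (a g) * (l2 \<nu> x * l2 \<nu> y))"
     using mult_left_mono[OF * norm_ge_zero[of "a g"]] by (simp add: norm_mult abs_mult del: norm_pi_fun)
   qed
  qed measurable
  show "AE g in ?G. integrable \<nu> (\<lambda>\<delta>. a (fst (g, \<delta>)) * (pi_fun (fst (g, \<delta>)) x (snd (g, \<delta>)) * cnj (y (snd (g, \<delta>)))))"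
   using py by simp
 qed measurable
 have "(\<integral>\<delta>. pi_conv a x \<delta> * cnj (y \<delta>) \<partial>\<nu>) = (\<integral>\<delta>. (\<integral>g. a g * (pi_fun g x \<delta> * cnj (y \<delta>)) \<partial>?G) \<partial>\<nu>)"
  unfolding pi_conv_def by (simp flip: integral_mult_left_zero add: mult.assoc)
 also have "\<dots> = (\<integral>g. (\<integral>\<delta>. a g * (pi_fun g x \<delta> * cnj (y \<delta>)) \<partial>\<nu>) \<partial>?G)"
  using I by (intro GN.Fubini_integral) (simp add: case_prod_unfold)
 finally show ?thesis using x y by (simp add: pi_op_class L2_ip pi_fun_sq_integrable)
qed

lemma coefficient_integrable:
 assumes "integrable (\<nu> \<Otimes>\<^sub>M \<mu>) a" "c \<in> carrier (L2 \<nu>)" "d \<in> carrier (L2 \<nu>)"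
 shows "integrable (\<nu> \<Otimes>\<^sub>M \<mu>) (\<lambda>g. a g * ip (L2 \<nu>) (pi_op \<nu> g c) d)"
 by (rule integrable_mult_bounded[OF assms(1) coefficient_measurable[OF assms(2,3)] coefficient_bound[OF assms(2,3)]])

text \<open>The operator induced by \<open>pi_conv\<close> meets the description under the
  \<open>THE\<close>, and inner products determine an operator. The third claim makes the formula
  valid for every representative x, in particular for a Schwartz function in its own class.\<close>

lemma pi_int:
 assumes a: "integrable (\<nu> \<Otimes>\<^sub>M \<mu>) a"
 shows "bounded_op (L2 \<nu>) (pi_int \<mu> \<nu> a)"
  and "\<And>c d. c \<in> carrier (L2 \<nu>) \<Longrightarrow> d \<in> carrier (L2 \<nu>) \<Longrightarrow>
   ip (L2 \<nu>) (pi_int \<mu> \<nu> a c) d = (\<integral>g. a g * ip (L2 \<nu>) (pi_op \<nu> g c) d \<partial>(\<nu> \<Otimes>\<^sub>M \<mu>))"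
  and "\<And>x. x \<in> sq_integrable \<nu> \<Longrightarrow> pi_int \<mu> \<nu> a (L2_class \<nu> x) = L2_class \<nu> (pi_conv a x)"
proof -
 let ?G = "\<nu> \<Otimes>\<^sub>M \<mu>"
 define T where "T = (\<lambda>c\<in>carrier (L2 \<nu>). L2_class \<nu> (pi_conv a (L2_rep c)))"
 have Tc: "T c \<in> carrier (L2 \<nu>)" if "c \<in> carrier (L2 \<nu>)" for c
  using that by (auto simp: T_def intro!: pi_conv_sq_integrable(1)[OF a] L2_rep)
 have Tw: "ip (L2 \<nu>) (T c) d = (\<integral>g. a g * ip (L2 \<nu>) (pi_op \<nu> g c) d \<partial>?G)"
  if c: "c \<in> carrier (L2 \<nu>)" and d: "d \<in> carrier (L2 \<nu>)" for c d
  using pi_conv_weak[OF a L2_rep(1)[OF c] L2_rep(1)[OF d]] pi_conv_sq_integrable(1)[OF a L2_rep(1)[OF c]] c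
   L2_ip[OF pi_conv_sq_integrable(1)[OF a L2_rep(1)[OF c]] L2_rep(1)[OF d]]
  by (simp add: T_def L2_rep(2) c d)
 have bT: "bounded_op (L2 \<nu>) T"
  unfolding bounded_op_def
 proof (intro conjI ballI allI)
  show "T \<in> carrier (L2 \<nu>) \<rightarrow>\<^sub>E carrier (L2 \<nu>)" using Tc by (auto simp: T_def)
  fix c assume c: "c \<in> carrier (L2 \<nu>)"
  show "T (c \<oplus>\<^bsub>L2 \<nu>\<^esub> d) = T c \<oplus>\<^bsub>L2 \<nu>\<^esub> T d" if d: "d \<in> carrier (L2 \<nu>)" for d
  proof (rule H.ip_ext)
   fix e assume e: "e \<in> carrier (L2 \<nu>)"
   show "ip (L2 \<nu>) (T (c \<oplus>\<^bsub>L2 \<nu>\<^esub> d)) e = ip (L2 \<nu>) (T c \<oplus>\<^bsub>L2 \<nu>\<^esub> T d) e"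
    using c d e coefficient_integrable[OF a] by (simp add: Tw Tc pi_op_add H.ip_add distrib_left)
  qed (use c d Tc in auto)
  show "T (z \<odot>\<^bsub>L2 \<nu>\<^esub> c) = z \<odot>\<^bsub>L2 \<nu>\<^esub> T c" for z
  proof (rule H.ip_ext)
   fix e assume e: "e \<in> carrier (L2 \<nu>)"
   show "ip (L2 \<nu>) (T (z \<odot>\<^bsub>L2 \<nu>\<^esub> c)) e = ip (L2 \<nu>) (z \<odot>\<^bsub>L2 \<nu>\<^esub> T c) e"
    using c e by (simp add: Tw Tc pi_op_smult H.ip_smult mult.left_commute)
  qed (use c Tc in auto)
 next
  show "\<exists>C. \<forall>c\<in>carrier (L2 \<nu>). vnorm (L2 \<nu>) (T c) \<le> C * vnorm (L2 \<nu>) c"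
  proof (intro exI ballI)
   fix c assume c: "c \<in> carrier (L2 \<nu>)"
   show "vnorm (L2 \<nu>) (T c) \<le> (\<integral>g. norm (a g) \<partial>?G) * vnorm (L2 \<nu>) c"
    using pi_conv_sq_integrable[OF a L2_rep(1)[OF c]] vnorm_L2[OF L2_rep(1)[OF c]] c
    by (simp add: T_def vnorm_L2 L2_rep(2))
  qed
 qed
 have sm: "ip (L2 \<nu>) ((a g \<odot>\<^bsub>bounded_ops (L2 \<nu>)\<^esub> pi_op \<nu> g) c) d = a g * ip (L2 \<nu>) (pi_op \<nu> g c) d"
  if "c \<in> carrier (L2 \<nu>)" "d \<in> carrier (L2 \<nu>)" for c d g
  using that by (simp add: bounded_ops_def H.ip_smult)
 have TT: "pi_int \<mu> \<nu> a = T"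
  unfolding pi_int_def op_integral_def
 proof (rule the_equality)
  show "bounded_op (L2 \<nu>) T \<and> (\<forall>c\<in>carrier (L2 \<nu>). \<forall>d\<in>carrier (L2 \<nu>).
    integrable ?G (\<lambda>g. ip (L2 \<nu>) ((a g \<odot>\<^bsub>bounded_ops (L2 \<nu>)\<^esub> pi_op \<nu> g) c) d) \<and>
    ip (L2 \<nu>) (T c) d = (\<integral>g. ip (L2 \<nu>) ((a g \<odot>\<^bsub>bounded_ops (L2 \<nu>)\<^esub> pi_op \<nu> g) c) d \<partial>?G))"
   using bT coefficient_integrable[OF a] by (simp add: sm Tw)
  fix S assume S: "bounded_op (L2 \<nu>) S \<and> (\<forall>c\<in>carrier (L2 \<nu>). \<forall>d\<in>carrier (L2 \<nu>).
    integrable ?G (\<lambda>g. ip (L2 \<nu>) ((a g \<odot>\<^bsub>bounded_ops (L2 \<nu>)\<^esub> pi_op \<nu> g) c) d) \<and>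
    ip (L2 \<nu>) (S c) d = (\<integral>g. ip (L2 \<nu>) ((a g \<odot>\<^bsub>bounded_ops (L2 \<nu>)\<^esub> pi_op \<nu> g) c) d \<partial>?G))"
  show "S = T"
  proof (rule H.op_ext)
   show "S \<in> carrier (L2 \<nu>) \<rightarrow>\<^sub>E carrier (L2 \<nu>)" "T \<in> carrier (L2 \<nu>) \<rightarrow>\<^sub>E carrier (L2 \<nu>)"
    using S bT by (auto simp: bounded_op_def)
   show "ip (L2 \<nu>) (S c) d = ip (L2 \<nu>) (T c) d" if "c \<in> carrier (L2 \<nu>)" "d \<in> carrier (L2 \<nu>)" for c d
    using S that by (simp add: sm Tw)
  qed
 qed
 show "bounded_op (L2 \<nu>) (pi_int \<mu> \<nu> a)" unfolding TT by (rule bT)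
 show w: "ip (L2 \<nu>) (pi_int \<mu> \<nu> a c) d = (\<integral>g. a g * ip (L2 \<nu>) (pi_op \<nu> g c) d \<partial>?G)"
  if "c \<in> carrier (L2 \<nu>)" "d \<in> carrier (L2 \<nu>)" for c d
  unfolding TT by (rule Tw[OF that])
 show "pi_int \<mu> \<nu> a (L2_class \<nu> x) = L2_class \<nu> (pi_conv a x)" if x: "x \<in> sq_integrable \<nu>" for x
 proof (rule H.ip_ext)
  fix e assume "e \<in> carrier (L2 \<nu>)"
  then obtain y where y: "y \<in> sq_integrable \<nu>" "e = L2_class \<nu> y" by (rule L2_cases)
  show "ip (L2 \<nu>) (pi_int \<mu> \<nu> a (L2_class \<nu> x)) e = ip (L2 \<nu>) (L2_class \<nu> (pi_conv a x)) e"
   using x y pi_conv_sq_integrable(1)[OF a x] by (simp add: w L2_ip pi_conv_weak[OF a x y(1)])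
 qed (use x Tc pi_conv_sq_integrable(1)[OF a x] in \<open>auto simp: TT\<close>)
qed

lemma pi_int_eqI:
 assumes a: "integrable (\<nu> \<Otimes>\<^sub>M \<mu>) a" and S: "S \<in> carrier (L2 \<nu>) \<rightarrow>\<^sub>E carrier (L2 \<nu>)"
  and w: "\<And>c d. c \<in> carrier (L2 \<nu>) \<Longrightarrow> d \<in> carrier (L2 \<nu>) \<Longrightarrow>
   ip (L2 \<nu>) (S c) d = (\<integral>g. a g * ip (L2 \<nu>) (pi_op \<nu> g c) d \<partial>(\<nu> \<Otimes>\<^sub>M \<mu>))"
 shows "pi_int \<mu> \<nu> a = S"
proof (rule H.op_ext)
 show "pi_int \<mu> \<nu> a \<in> carrier (L2 \<nu>) \<rightarrow>\<^sub>E carrier (L2 \<nu>)" using pi_int(1)[OF a] by (simp add: bounded_op_def)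
qed (use S w pi_int(2)[OF a] in auto)

end

section \<open>The operator algebra\<close>

context phase_space
begin

lemma schwartz_G_integrable: "a \<in> schwartz_space \<Longrightarrow> integrable (\<nu> \<Otimes>\<^sub>M \<mu>) a"
 by (rule G.schwartz_integrable)

lemma pi_int_add:
 assumes a: "a \<in> schwartz_space" and b: "b \<in> schwartz_space"
 shows "pi_int \<mu> \<nu> (\<lambda>g. a g + b g) = (\<lambda>c\<in>carrier (L2 \<nu>). pi_int \<mu> \<nu> a c \<oplus>\<^bsub>L2 \<nu>\<^esub> pi_int \<mu> \<nu> b c)"
proof (rule pi_int_eqI)
 have ab: "integrable (\<nu> \<Otimes>\<^sub>M \<mu>) a" "integrable (\<nu> \<Otimes>\<^sub>M \<mu>) b" using a b by (auto intro: schwartz_G_integrable)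
 show "integrable (\<nu> \<Otimes>\<^sub>M \<mu>) (\<lambda>g. a g + b g)" using ab by simp
 note cl = H.bounded_opD(2)[OF pi_int(1)[OF ab(1)]] H.bounded_opD(2)[OF pi_int(1)[OF ab(2)]]
 show "(\<lambda>c\<in>carrier (L2 \<nu>). pi_int \<mu> \<nu> a c \<oplus>\<^bsub>L2 \<nu>\<^esub> pi_int \<mu> \<nu> b c) \<in> carrier (L2 \<nu>) \<rightarrow>\<^sub>E carrier (L2 \<nu>)"
  using cl by auto
 show "ip (L2 \<nu>) ((\<lambda>c\<in>carrier (L2 \<nu>). pi_int \<mu> \<nu> a c \<oplus>\<^bsub>L2 \<nu>\<^esub> pi_int \<mu> \<nu> b c) c) d =
   (\<integral>g. (a g + b g) * ip (L2 \<nu>) (pi_op \<nu> g c) d \<partial>(\<nu> \<Otimes>\<^sub>M \<mu>))"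
  if "c \<in> carrier (L2 \<nu>)" "d \<in> carrier (L2 \<nu>)" for c d
  using that cl ab by (simp add: H.ip_add pi_int(2) distrib_right coefficient_integrable)
qed

lemma pi_int_scale:
 assumes a: "a \<in> schwartz_space"
 shows "pi_int \<mu> \<nu> (\<lambda>g. z * a g) = (\<lambda>c\<in>carrier (L2 \<nu>). z \<odot>\<^bsub>L2 \<nu>\<^esub> pi_int \<mu> \<nu> a c)"
proof (rule pi_int_eqI)
 have a': "integrable (\<nu> \<Otimes>\<^sub>M \<mu>) a" using a by (auto intro: schwartz_G_integrable)
 show "integrable (\<nu> \<Otimes>\<^sub>M \<mu>) (\<lambda>g. z * a g)" using a' by simp
 note cl = H.bounded_opD(2)[OF pi_int(1)[OF a']]
 show "(\<lambda>c\<in>carrier (L2 \<nu>). z \<odot>\<^bsub>L2 \<nu>\<^esub> pi_int \<mu> \<nu> a c) \<in> carrier (L2 \<nu>) \<rightarrow>\<^sub>E carrier (L2 \<nu>)"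
  using cl by auto
 show "ip (L2 \<nu>) ((\<lambda>c\<in>carrier (L2 \<nu>). z \<odot>\<^bsub>L2 \<nu>\<^esub> pi_int \<mu> \<nu> a c) c) d =
   (\<integral>g. z * a g * ip (L2 \<nu>) (pi_op \<nu> g c) d \<partial>(\<nu> \<Otimes>\<^sub>M \<mu>))"
  if "c \<in> carrier (L2 \<nu>)" "d \<in> carrier (L2 \<nu>)" for c d
  using that cl by (simp add: H.ip_smult pi_int(2)[OF a'] mult.assoc)
qed

section \<open>Symbols of products and adjoints\<close>

text \<open>The phase is the cocycle \<sigma>(h, k - h), from \<pi>(h) \<pi>(k - h) = \<sigma>(h, k
  - h) \<pi>(k).\<close>

definition twisted_conv ::
 "('g pontryagin_dual \<times> 'g \<Rightarrow> complex) \<Rightarrow> ('g pontryagin_dual \<times> 'g \<Rightarrow> complex) \<Rightarrow> 'g pontryagin_dual \<times> 'g \<Rightarrow> complex"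
 where "twisted_conv a b k = (\<integral>h. a h * cnj (char_fun (fst k - fst h) (snd h)) * b (k - h) \<partial>(\<nu> \<Otimes>\<^sub>M \<mu>))"

text \<open>Along a one-parameter subgroup in k the phase oscillates with frequency -p (snd h), a
  real homomorphism of the integration variable, as \<open>G.schwartz_twisted_integral\<close>
  demands.\<close>

lemma twisted_conv_schwartz:
 assumes "a \<in> schwartz_space" "b \<in> schwartz_space"
 shows "twisted_conv a b \<in> schwartz_space"
 unfolding twisted_conv_def[abs_def]
proof (rule G.schwartz_twisted_integral[OF assms G.basis, where \<rho> = "\<lambda>h. h"])
 show "continuous_on UNIV (\<lambda>(h :: 'g pontryagin_dual \<times> 'g, k :: 'g pontryagin_dual \<times> 'g). cnj (char_fun (fst k - fst h) (snd h)))"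
  unfolding case_prod_unfold by (intro continuous_intros)
 fix X :: "real \<Rightarrow> 'g pontryagin_dual \<times> 'g" assume X: "one_param X"
 obtain p where p: "real_hom p" "\<And>t s. char_fun (fst (X s)) t = cis (s * p t)"
  using one_param_dual_frequency[OF lc one_param_fst[OF X]] by metis
 have q: "real_hom (\<lambda>h :: 'g pontryagin_dual \<times> 'g. - p (snd h))"
  using real_hom_compose_snd[OF p(1)] by (auto simp: real_hom_def intro!: continuous_intros)
 have "cnj (char_fun (fst (x + X s) - fst h) (snd h)) = cis (s * - p (snd h)) * cnj (char_fun (fst x - fst h) (snd h))"
  for x h :: "'g pontryagin_dual \<times> 'g" and s
  by (simp add: char_fun_diff char_fun_add p(2) cis_cnj mult_ac)
 then show "\<exists>q. real_hom q \<and> (\<forall>(h :: 'g pontryagin_dual \<times> 'g) (x :: 'g pontryagin_dual \<times> 'g) s.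
   cnj (char_fun (fst (x + X s) - fst h) (snd h)) = cis (s * q h) * cnj (char_fun (fst x - fst h) (snd h)))"
  using q by (intro exI[of _ "\<lambda>h. - p (snd h)"]) simp
qed (auto intro: continuous_intros)

text \<open>Expanding both operators weakly gives a double integral of cocycles against the
  coefficients of \<pi>(g + h). Substituting k = g + h and exchanging the integrals collects the
  symbol of the product in front of \<pi>(k).\<close>

lemma pi_int_mult:
 assumes a: "a \<in> schwartz_space" and b: "b \<in> schwartz_space"
 shows "pi_int \<mu> \<nu> (twisted_conv a b) = compose (carrier (L2 \<nu>)) (pi_int \<mu> \<nu> a) (pi_int \<mu> \<nu> b)"
proof (rule pi_int_eqI)
 let ?G = "\<nu> \<Otimes>\<^sub>M \<mu>"
 have ab: "integrable ?G a" "integrable ?G b" using a b by (auto intro: schwartz_G_integrable)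
 show "integrable ?G (twisted_conv a b)" by (intro schwartz_G_integrable twisted_conv_schwartz a b)
 note cl = H.bounded_opD(2)[OF pi_int(1)[OF ab(1)]] H.bounded_opD(2)[OF pi_int(1)[OF ab(2)]]
 show "compose (carrier (L2 \<nu>)) (pi_int \<mu> \<nu> a) (pi_int \<mu> \<nu> b) \<in> carrier (L2 \<nu>) \<rightarrow>\<^sub>E carrier (L2 \<nu>)"
  using cl by (auto simp: compose_def)
 fix c d assume c: "c \<in> carrier (L2 \<nu>)" and d: "d \<in> carrier (L2 \<nu>)"
 define m where "m k = ip (L2 \<nu>) (pi_op \<nu> k c) d" for k
 have mm: "m \<in> borel_measurable ?G" unfolding m_def[abs_def] by (rule coefficient_measurable[OF c d])
 have mb: "norm (m k) \<le> vnorm (L2 \<nu>) c * vnorm (L2 \<nu>) d" for k unfolding m_def by (rule coefficient_bound[OF c d])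
 let ?s = "\<lambda>g k. cnj (char_fun (fst k - fst g) (snd g))"
 \<comment> \<open>\<pi>(g) is moved to the other argument, where the weak formula for b applies,
   and then moved back under the integral.\<close>
 have inner: "ip (L2 \<nu>) (pi_op \<nu> g (pi_int \<mu> \<nu> b c)) d = (\<integral>k. ?s g k * b (k - g) * m k \<partial>?G)" for g
 proof -
  have bmeas: "(\<lambda>h. b h * (cnj (char_fun (fst h) (snd g)) * m (h + g))) \<in> borel_measurable ?G"
   by (intro borel_measurable_times borel_measurable_cnj G.schwartz_meas b
     measurable_compose[OF G.measurable_ops(1) mm] G.cont_meas continuous_intros)
  have "ip (L2 \<nu>) (pi_op \<nu> g (pi_int \<mu> \<nu> b c)) d = char_fun (fst g) (snd g) * ip (L2 \<nu>) (pi_int \<mu> \<nu> b c) (pi_op \<nu> (- g) d)"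
   using c d cl by (intro ip_pi_op_adjoint) auto
  also have "\<dots> = (\<integral>h. char_fun (fst g) (snd g) * (b h * ip (L2 \<nu>) (pi_op \<nu> h c) (pi_op \<nu> (- g) d)) \<partial>?G)"
   using c d by (simp add: pi_int(2)[OF ab(2)])
  also have "\<dots> = (\<integral>h. b h * (cnj (char_fun (fst h) (snd g)) * m (h + g)) \<partial>?G)"
  proof (rule Bochner_Integration.integral_cong[OF refl])
   fix h
   have "char_fun (fst g) (snd g) * ip (L2 \<nu>) (pi_op \<nu> h c) (pi_op \<nu> (- g) d) = ip (L2 \<nu>) (pi_op \<nu> g (pi_op \<nu> h c)) d"
    using c d by (subst ip_pi_op_adjoint[of "pi_op \<nu> h c" d g]) auto
   also have "\<dots> = cnj (char_fun (fst h) (snd g)) * m (h + g)"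
    using c d by (simp add: pi_op_mult H.ip_smult m_def add.commute)
   finally show "char_fun (fst g) (snd g) * (b h * ip (L2 \<nu>) (pi_op \<nu> h c) (pi_op \<nu> (- g) d)) = b h * (cnj (char_fun (fst h) (snd g)) * m (h + g))"
    by (simp only: mult.left_commute)
  qed
  also have "\<dots> = (\<integral>h. (\<lambda>h. b h * (cnj (char_fun (fst h) (snd g)) * m (h + g))) (h + - g) \<partial>?G)"
   by (rule G.integral_translate[OF bmeas, symmetric])
  also have "\<dots> = (\<integral>k. ?s g k * b (k - g) * m k \<partial>?G)"
   by (intro Bochner_Integration.integral_cong refl) (simp add: mult_ac)
  finally show ?thesis .
 qed
 have I: "integrable (?G \<Otimes>\<^sub>M ?G) (\<lambda>z. a (fst z) * (?s (fst z) (snd z) * b (snd z - fst z) * m (snd z)))"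
 proof (rule GG.Fubini_integrable)
  have 1: "(\<lambda>z. a (fst z) * (?s (fst z) (snd z) * b (snd z - fst z))) \<in> borel_measurable (?G \<Otimes>\<^sub>M ?G)"
   by (rule G.measurable_pair_cont[OF G.sets_M])
    (intro continuous_intros continuous_on_compose2[OF schwartz_continuous[OF a]] continuous_on_compose2[OF schwartz_continuous[OF b]]; simp)
  have 2: "(\<lambda>z. m (snd z)) \<in> borel_measurable (?G \<Otimes>\<^sub>M ?G)" by (rule measurable_compose[OF measurable_snd mm])
  show "(\<lambda>z. a (fst z) * (?s (fst z) (snd z) * b (snd z - fst z) * m (snd z))) \<in> borel_measurable (?G \<Otimes>\<^sub>M ?G)"
   using borel_measurable_times[OF 1 2] by (simp add: mult.assoc)
  have bi: "integrable ?G (\<lambda>k. b (k - g))" for g using G.integrable_translate[OF ab(2), of "- g"] by simp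
  have ik: "integrable ?G (\<lambda>k. ?s g k * b (k - g) * m k)" for g
  proof -
   have "integrable ?G (\<lambda>k. b (k - g) * ?s g k)"
    by (rule integrable_mult_bounded[OF bi, of _ 1])
     (auto intro!: borel_measurable_cnj G.cont_meas continuous_intros)
   from integrable_mult_bounded[OF this mm mb] show ?thesis by (simp add: mult.commute)
  qed
  show "AE g in ?G. integrable ?G (\<lambda>k. a (fst (g, k)) * (?s (fst (g, k)) (snd (g, k)) * b (snd (g, k) - fst (g, k)) * m (snd (g, k))))"
   using ik by simp
  \<comment> \<open>Translation invariance makes this bound on the inner integral independent of
    g.\<close>
  define B where "B = (\<integral>k. norm (b k) \<partial>?G) * (vnorm (L2 \<nu>) c * vnorm (L2 \<nu>) d)"
  have Bb: "(\<integral>k. norm (?s g k * b (k - g) * m k) \<partial>?G) \<le> B" for g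
  proof -
   have "(\<integral>k. norm (?s g k * b (k - g) * m k) \<partial>?G) \<le> (\<integral>k. norm (b (k - g)) * (vnorm (L2 \<nu>) c * vnorm (L2 \<nu>) d) \<partial>?G)"
   proof (rule Bochner_Integration.integral_mono)
    show "integrable ?G (\<lambda>k. norm (?s g k * b (k - g) * m k))" by (rule integrable_norm[OF ik])
    show "integrable ?G (\<lambda>k. norm (b (k - g)) * (vnorm (L2 \<nu>) c * vnorm (L2 \<nu>) d))"
     by (intro integrable_mult_left integrable_norm bi)
    show "norm (?s g k * b (k - g) * m k) \<le> norm (b (k - g)) * (vnorm (L2 \<nu>) c * vnorm (L2 \<nu>) d)" for k
     using mult_left_mono[OF mb[of k] norm_ge_zero[of "b (k - g)"]] by (simp add: norm_mult)
   qed
   moreover have "(\<integral>k. norm (b (k - g)) \<partial>?G) = (\<integral>k. norm (b k) \<partial>?G)"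
   proof -
    have "complex_of_real (\<integral>k. norm (b (k - g)) \<partial>?G) = (\<integral>k. (\<lambda>k. complex_of_real (norm (b k))) (k + - g) \<partial>?G)"
     by (simp flip: integral_complex_of_real)
    also have "\<dots> = (\<integral>k. complex_of_real (norm (b k)) \<partial>?G)"
     by (rule G.integral_translate[OF borel_measurable_integrable[OF integrable_of_real[OF integrable_norm[OF ab(2)]]]])
    finally show ?thesis by (simp only: integral_complex_of_real of_real_eq_iff)
   qed
   ultimately show ?thesis unfolding B_def by (simp only: integral_mult_left_zero)
  qed
  have B0: "B \<ge> 0" using c d by (simp add: B_def)
  show "integrable ?G (\<lambda>g. \<integral>k. norm (a (fst (g, k)) * (?s (fst (g, k)) (snd (g, k)) * b (snd (g, k) - fst (g, k)) * m (snd (g, k)))) \<partial>?G)"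
  proof (rule Bochner_Integration.integrable_bound)
   show "integrable ?G (\<lambda>g. norm (a g) * B)" using ab by (intro integrable_mult_left integrable_norm)
   show "(\<lambda>g. \<integral>k. norm (a (fst (g, k)) * (?s (fst (g, k)) (snd (g, k)) * b (snd (g, k) - fst (g, k)) * m (snd (g, k)))) \<partial>?G) \<in> borel_measurable ?G"
    using borel_measurable_times[OF 1 2]
    by (intro G.borel_measurable_lebesgue_integral) (simp add: case_prod_unfold mult.assoc)
   show "AE g in ?G. norm (\<integral>k. norm (a (fst (g, k)) * (?s (fst (g, k)) (snd (g, k)) * b (snd (g, k) - fst (g, k)) * m (snd (g, k)))) \<partial>?G) \<le> norm (norm (a g) * B)"
   proof (rule AE_I2)
    fix g
    have "(\<integral>k. norm (?s g k * b (k - g) * m k) \<partial>?G) \<ge> 0" by (intro Bochner_Integration.integral_nonneg) simp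
    then show "norm (\<integral>k. norm (a (fst (g, k)) * (?s (fst (g, k)) (snd (g, k)) * b (snd (g, k) - fst (g, k)) * m (snd (g, k)))) \<partial>?G) \<le> norm (norm (a g) * B)"
     using mult_left_mono[OF Bb[of g] norm_ge_zero[of "a g"]] B0 by (simp add: norm_mult[of "a g"] abs_mult)
   qed
  qed
 qed
 have "ip (L2 \<nu>) (compose (carrier (L2 \<nu>)) (pi_int \<mu> \<nu> a) (pi_int \<mu> \<nu> b) c) d =
   (\<integral>g. a g * ip (L2 \<nu>) (pi_op \<nu> g (pi_int \<mu> \<nu> b c)) d \<partial>?G)"
  using c d cl by (simp add: compose_def pi_int(2)[OF ab(1)])
 also have "\<dots> = (\<integral>g. (\<integral>k. a g * (?s g k * b (k - g) * m k) \<partial>?G) \<partial>?G)"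
  unfolding inner by simp
 also have "\<dots> = (\<integral>k. (\<integral>g. a g * (?s g k * b (k - g) * m k) \<partial>?G) \<partial>?G)"
  using I by (intro GG.Fubini_integral[symmetric]) (simp add: case_prod_unfold)
 also have "\<dots> = (\<integral>k. twisted_conv a b k * m k \<partial>?G)"
  unfolding twisted_conv_def by (simp flip: integral_mult_left_zero add: mult.assoc)
 finally show "ip (L2 \<nu>) (compose (carrier (L2 \<nu>)) (pi_int \<mu> \<nu> a) (pi_int \<mu> \<nu> b) c) d =
   (\<integral>g. twisted_conv a b g * ip (L2 \<nu>) (pi_op \<nu> g c) d \<partial>?G)" unfolding m_def .
qed


text \<open>The adjoint of \<pi>(g) is the conjugate of \<gamma>(t) times \<pi>(-g). Reflecting the
  integration variable moves the sign to the symbol, and \<gamma>(t) is unchanged by it.\<close>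

definition twisted_adj :: "('g pontryagin_dual \<times> 'g \<Rightarrow> complex) \<Rightarrow> 'g pontryagin_dual \<times> 'g \<Rightarrow> complex"
 where "twisted_adj a g = cnj (char_fun (fst g) (snd g)) * cnj (a (- g))"

text \<open>The pairing is a second-degree character: its logarithmic derivative along a
  one-parameter subgroup is \<i> times a real homomorphism, the case covered by
  \<open>schwartz_phase\<close>.\<close>

lemma twisted_adj_schwartz:
 assumes a: "a \<in> schwartz_space"
 shows "twisted_adj a \<in> schwartz_space"
 unfolding twisted_adj_def[abs_def]
proof (rule schwartz_phase[OF schwartz_cnj[OF schwartz_reflect[OF a]]])
 let ?c = "\<lambda>g :: 'g pontryagin_dual \<times> 'g. cnj (char_fun (fst g) (snd g))"
 show "continuous_on UNIV ?c" by (intro continuous_intros)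
 show "bounded (range ?c)" by (auto simp: bounded_iff intro!: exI[of _ 1])
 fix X :: "real \<Rightarrow> 'g pontryagin_dual \<times> 'g" assume X: "one_param X"
 obtain p where p: "real_hom p" "\<And>t s. char_fun (fst (X s)) t = cis (s * p t)"
  using one_param_dual_frequency[OF lc one_param_fst[OF X]] by metis
 obtain q where q: "real_hom q" "\<And>\<gamma> s. char_fun \<gamma> (snd (X s)) = cis (s * q \<gamma>)"
  using one_param_frequency[OF one_param_snd[OF X]] by metis
 have "((\<lambda>s. ?c (g + X s)) has_vector_derivative \<i> * of_real (- (p (snd g) + q (fst g)) + 0) * ?c g) (at 0)" for g
 proof -
  have ps: "p (snd (X s)) = s * p (snd (X 1))" for s by (rule real_hom_one_param[OF one_param_snd[OF X] p(1)])
  \<comment> \<open>The two moving arguments pair with each other in a term quadratic in s, which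
    drops out of the derivative at 0.\<close>
  have eq: "char_fun (fst g + fst (X s)) (snd g + snd (X s)) =
    char_fun (fst g) (snd g) * cis (s * (p (snd g) + q (fst g)) + s * s * p (snd (X 1)))" for s
  proof -
   have "char_fun (fst g + fst (X s)) (snd g + snd (X s)) =
     char_fun (fst g) (snd g) * (cis (s * q (fst g)) * (cis (s * p (snd g)) * cis (s * p (snd (X s)))))"
    unfolding char_fun_add char_fun_add_arg p(2) by (simp add: q(2))
   also have "\<dots> = char_fun (fst g) (snd g) * cis (s * q (fst g) + (s * p (snd g) + s * (s * p (snd (X 1)))))"
    by (simp only: cis_mult ps[of s])
   finally show ?thesis by (simp add: algebra_simps)
  qed
  have d1: "((\<lambda>s. - (s * (p (snd g) + q (fst g)) + s * s * p (snd (X 1)))) has_real_derivative - (p (snd g) + q (fst g))) (at 0)"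
   by (auto intro!: derivative_eq_intros)
  have "((\<lambda>s. cis (- (s * (p (snd g) + q (fst g)) + s * s * p (snd (X 1))))) has_vector_derivative
    (- (p (snd g) + q (fst g))) *\<^sub>R (\<i> * cis 0)) (at 0)"
  proof -
   have c0: "(cis has_vector_derivative \<i> * cis 0) (at 0)"
    using cis_has_vector_derivative[of 1 0] by simp
   show ?thesis
    using vector_diff_chain_at[OF d1[unfolded has_real_derivative_iff_has_vector_derivative], of cis "\<i> * cis 0"] c0
    by (simp add: o_def)
  qed
  from has_vector_derivative_mult_right[OF this, of "?c g"] show ?thesis
   by (simp add: eq cis_cnj scaleR_conv_of_real mult.commute mult.left_commute)
 qed
 moreover have "real_hom (\<lambda>g :: 'g pontryagin_dual \<times> 'g. - (p (snd g) + q (fst g)))"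
  using real_hom_compose_snd[OF p(1)] real_hom_compose_fst[OF q(1)] unfolding real_hom_def
  by (auto intro!: continuous_intros)
 ultimately show "\<exists>q r. real_hom q \<and> (\<forall>g. ((\<lambda>s. ?c (g + X s)) has_vector_derivative \<i> * of_real (q g + r) * ?c g) (at 0))"
  by (intro exI[of _ "\<lambda>g. - (p (snd g) + q (fst g))"] exI[of _ 0]) simp
qed

lemma pi_int_adjoint:
 assumes a: "a \<in> schwartz_space" and c: "c \<in> carrier (L2 \<nu>)" and d: "d \<in> carrier (L2 \<nu>)"
 shows "ip (L2 \<nu>) (pi_int \<mu> \<nu> a c) d = ip (L2 \<nu>) c (pi_int \<mu> \<nu> (twisted_adj a) d)"
proof -
 let ?G = "\<nu> \<Otimes>\<^sub>M \<mu>"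
 have a': "integrable ?G (twisted_adj a)" and ai: "integrable ?G a"
  by (intro schwartz_G_integrable twisted_adj_schwartz a)+
 have "ip (L2 \<nu>) c (pi_int \<mu> \<nu> (twisted_adj a) d) = cnj (ip (L2 \<nu>) (pi_int \<mu> \<nu> (twisted_adj a) d) c)"
  using H.bounded_opD(2)[OF pi_int(1)[OF a']] c d by (intro H.ip_cnj) auto
 also have "\<dots> = (\<integral>g. cnj (twisted_adj a g * ip (L2 \<nu>) (pi_op \<nu> g d) c) \<partial>?G)"
  using c d by (simp add: pi_int(2)[OF a'] del: complex_cnj_mult)
 also have "\<dots> = (\<integral>g. (\<lambda>g. a g * ip (L2 \<nu>) (pi_op \<nu> g c) d) (- g) \<partial>?G)"
 proof (rule Bochner_Integration.integral_cong[OF refl])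
  fix g
  have "ip (L2 \<nu>) (pi_op \<nu> (- g) c) d = char_fun (fst g) (snd g) * cnj (ip (L2 \<nu>) (pi_op \<nu> g d) c)"
   using c d ip_pi_op_adjoint[OF c d, of "- g"] H.ip_cnj[of "pi_op \<nu> g d" c]
   by (simp add: char_fun_uminus char_fun_minus_arg)
  then show "cnj (twisted_adj a g * ip (L2 \<nu>) (pi_op \<nu> g d) c) = (\<lambda>g. a g * ip (L2 \<nu>) (pi_op \<nu> g c) d) (- g)"
   by (simp add: twisted_adj_def)
 qed
 also have "\<dots> = (\<integral>g. a g * ip (L2 \<nu>) (pi_op \<nu> g c) d \<partial>?G)"
  by (rule G.integral_reflect[OF borel_measurable_integrable[OF coefficient_integrable[OF ai c d]]])
 also have "\<dots> = ip (L2 \<nu>) (pi_int \<mu> \<nu> a c) d" by (rule pi_int(2)[OF ai c d, symmetric])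
 finally show ?thesis ..
qed

text \<open>Only the dual component of g translates, hence the choice \<open>\<rho> = fst\<close>;
  the group component enters through the phase. This makes the Schwartz space invariant under the
  algebra.\<close>

lemma pi_conv_schwartz:
 assumes a: "a \<in> schwartz_space" and x: "x \<in> schwartz_space"
 shows "pi_conv a x \<in> schwartz_space"
proof -
 have "(\<lambda>\<delta>. \<integral>g. a g * cnj (char_fun (\<delta> - fst g) (snd g)) * x (\<delta> - fst g) \<partial>(\<nu> \<Otimes>\<^sub>M \<mu>)) \<in> schwartz_space"
 proof (rule G.schwartz_twisted_integral[OF a x N.basis, where \<rho> = fst])
  show "continuous_on UNIV (\<lambda>(h :: 'g pontryagin_dual \<times> 'g, k). cnj (char_fun (k - fst h) (snd h)))"
   unfolding case_prod_unfold by (intro continuous_intros)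
  fix X :: "real \<Rightarrow> 'g pontryagin_dual" assume X: "one_param X"
  obtain p where p: "real_hom p" "\<And>t s. char_fun (X s) t = cis (s * p t)"
   using one_param_dual_frequency[OF lc X] by metis
  have q: "real_hom (\<lambda>h :: 'g pontryagin_dual \<times> 'g. - p (snd h))"
   using real_hom_compose_snd[OF p(1)] by (auto simp: real_hom_def intro!: continuous_intros)
  have "cnj (char_fun (x + X s - fst h) (snd h)) = cis (s * - p (snd h)) * cnj (char_fun (x - fst h) (snd h))"
   for x and h :: "'g pontryagin_dual \<times> 'g" and s
   by (simp add: char_fun_diff char_fun_add p(2) cis_cnj mult_ac)
  then show "\<exists>q. real_hom q \<and> (\<forall>(h :: 'g pontryagin_dual \<times> 'g) x s.
    cnj (char_fun (x + X s - fst h) (snd h)) = cis (s * q h) * cnj (char_fun (x - fst h) (snd h)))"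
   using q by (intro exI[of _ "\<lambda>h. - p (snd h)"]) simp
 qed (auto intro: continuous_intros)
 then show ?thesis unfolding pi_conv_def pi_fun_eq by (simp add: mult.assoc)
qed

lemma L2_class_inj: "inj_on (L2_class \<nu>) (schwartz_space :: ('g pontryagin_dual \<Rightarrow> complex) set)"
proof
 fix x y :: "'g pontryagin_dual \<Rightarrow> complex"
 assume x: "x \<in> schwartz_space" and y: "y \<in> schwartz_space" and eq: "L2_class \<nu> x = L2_class \<nu> y"
 have "AE \<delta> in \<nu>. x \<delta> = y \<delta>" using eq L2_class_eq_iff[OF N.schwartz_sq_integrable[OF x] N.schwartz_sq_integrable[OF y]] by simp
 then have ae: "AE \<delta> in \<nu>. x \<delta> - y \<delta> = 0" by eventually_elim simp
 have "(\<lambda>\<delta>. x \<delta> - y \<delta>) = (\<lambda>_. 0)"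
  by (rule N.continuous_AE_zero[OF _ ae]) (intro continuous_intros schwartz_continuous x y)
 then show "x = y" by (simp add: fun_eq_iff)
qed

lemma operator_algebra_A: "operator_algebra (L2 \<nu>) (pi_int \<mu> \<nu> ` schwartz_space)"
proof (intro operator_algebra.intro H.prehilbert_axioms operator_algebra_axioms.intro)
 let ?A = "pi_int \<mu> \<nu> ` schwartz_space"
 show "bounded_op (L2 \<nu>) T" if "T \<in> ?A" for T
  using that by (auto intro: pi_int(1) schwartz_G_integrable)
 show "(\<lambda>x\<in>carrier (L2 \<nu>). \<zero>\<^bsub>L2 \<nu>\<^esub>) \<in> ?A"
 proof -
  have "pi_int \<mu> \<nu> (\<lambda>_. 0) = (\<lambda>x\<in>carrier (L2 \<nu>). \<zero>\<^bsub>L2 \<nu>\<^esub>)"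
   by (rule pi_int_eqI) auto
  then show ?thesis using imageI[OF schwartz_zero, of "pi_int \<mu> \<nu>"] by simp
 qed
 show "(\<lambda>x\<in>carrier (L2 \<nu>). S x \<oplus>\<^bsub>L2 \<nu>\<^esub> T x) \<in> ?A" if "S \<in> ?A" "T \<in> ?A" for S T
  using that by (auto simp flip: pi_int_add intro!: imageI schwartz_add)
 show "(\<lambda>x\<in>carrier (L2 \<nu>). z \<odot>\<^bsub>L2 \<nu>\<^esub> T x) \<in> ?A" if "T \<in> ?A" for T z
  using that by (auto simp flip: pi_int_scale intro!: imageI schwartz_scale)
 show "compose (carrier (L2 \<nu>)) S T \<in> ?A" if "S \<in> ?A" "T \<in> ?A" for S T
  using that by (auto simp flip: pi_int_mult intro!: imageI twisted_conv_schwartz)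
 show "\<exists>S\<in>?A. \<forall>x\<in>carrier (L2 \<nu>). \<forall>y\<in>carrier (L2 \<nu>). ip (L2 \<nu>) (T x) y = ip (L2 \<nu>) x (S y)" if "T \<in> ?A" for T
  using that pi_int_adjoint twisted_adj_schwartz by auto
qed

end

section \<open>Gaussians\<close>

context schwartz_group
begin

text \<open>A Schwartz function without zeros, so it can serve as a denominator. When
  \<open>Ps\<close> is empty the group is compact and this is the constant 1.\<close>

definition gauss :: "'h \<Rightarrow> real" where "gauss x = exp (- (\<Sum>p\<leftarrow>Ps. (p x)\<^sup>2))"

lemma gauss_pos: "gauss x > 0" by (simp add: gauss_def)

lemma gauss_continuous: "continuous_on UNIV gauss"
proof -
 have "continuous_on UNIV (\<lambda>x. \<Sum>p\<leftarrow>ps. (p x)\<^sup>2)" if "list_all real_hom ps" for ps :: "('h \<Rightarrow> real) list"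
  using that by (induction ps) (simp_all add: real_hom_continuous continuous_on_add continuous_on_power)
 then show ?thesis using homs unfolding gauss_def[abs_def] by (auto intro!: continuous_intros)
qed

lemma gauss_deriv:
 assumes X: "one_param X"
 shows "((\<lambda>t. complex_of_real (gauss (x + X t))) has_vector_derivative
  (\<Sum>p\<leftarrow>Ps. of_real (- 2 * p (X 1)) * (of_real (p x) * of_real (gauss x)))) (at 0)"
proof -
 have 1: "((\<lambda>t. \<Sum>p\<leftarrow>ps. (p (x + X t))\<^sup>2) has_real_derivative (\<Sum>p\<leftarrow>ps. 2 * p (X 1) * p x)) (at 0)"
  if "list_all real_hom ps" for ps :: "('h \<Rightarrow> real) list"
  using that
 proof (induction ps)
  case (Cons p ps)
  then have p: "real_hom p" by simp
  have "((\<lambda>t. (p x + t * p (X 1))\<^sup>2) has_real_derivative 2 * p (X 1) * p x) (at 0)"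
   by (rule derivative_eq_intros refl | simp)+
  moreover have "p (x + X t) = p x + t * p (X 1)" for t
   unfolding real_hom_add[OF p] by (subst real_hom_one_param[OF X p, of t]) (rule refl)
  ultimately have "((\<lambda>t. (p (x + X t))\<^sup>2) has_real_derivative 2 * p (X 1) * p x) (at 0)" by simp
  from DERIV_add[OF this Cons.IH] Cons.prems show ?case by simp
 qed simp
 have "((\<lambda>t. gauss (x + X t)) has_real_derivative gauss x * - (\<Sum>p\<leftarrow>Ps. 2 * p (X 1) * p x)) (at 0)"
 proof -
  have X0: "X 0 = 0" by (rule one_param_0[OF X])
  show ?thesis unfolding gauss_def
   by (rule DERIV_fun_exp[OF DERIV_minus[OF 1[OF homs]], THEN DERIV_cong]) (simp add: X0)
 qed
 then have "((\<lambda>t. complex_of_real (gauss (x + X t))) has_vector_derivative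
   of_real (gauss x * - (\<Sum>p\<leftarrow>Ps. 2 * p (X 1) * p x))) (at 0)"
  by (rule has_vector_derivative_of_real)
 moreover have "of_real (gauss x * - (\<Sum>p\<leftarrow>ps. 2 * p (X 1) * p x)) =
   (\<Sum>p\<leftarrow>ps. of_real (- 2 * p (X 1)) * (of_real (p x) * complex_of_real (gauss x)))" for ps :: "('h \<Rightarrow> real) list"
  by (induction ps) (simp_all add: algebra_simps)
 ultimately show ?thesis by simp
qed

text \<open>A derivative multiplies the Gaussian by a combination of the homomorphisms in
  \<open>Ps\<close>, so monomials times the Gaussian span a stable set. Boundedness uses
  \<open>growth\<close> to compare an arbitrary monomial with a power of 1 + Q, where Q is the sum
  of squares in the exponent.\<close>

lemma gauss_schwartz: "(\<lambda>x. complex_of_real (gauss x)) \<in> schwartz_space"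
proof (rule schwartz_coinduct_span)
 define m where "m qs x = complex_of_real (\<Prod>q\<leftarrow>qs. q x) * of_real (gauss x)" for qs x
 define W where "W = {m qs | qs. list_all real_hom qs}"
 have W: "m qs \<in> fspan W" if "list_all real_hom qs" for qs using that by (auto simp: W_def intro: fspan.base)
 have mW: "(\<lambda>x. of_real (p x) * g x) \<in> fspan W" if "real_hom p" "g \<in> fspan W" for p g
  using that(2)
 proof induction
  case (base f)
  then obtain qs where "list_all real_hom qs" "f = m qs" by (auto simp: W_def)
  then show ?case using W[of "p # qs"] that(1) by (simp add: m_def[abs_def] mult.assoc)
 next
  case (add f g)
  from fspan.add[OF add.IH] show ?case by (simp add: distrib_left)
 next
  case (scale f z)
  from fspan.scale[OF scale.IH, of z] show ?case by (simp add: mult.left_commute)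
 qed (simp add: fspan.zero)
 show "(\<lambda>x. complex_of_real (gauss x)) \<in> fspan W" using W[of "[]"] by (simp add: m_def[abs_def])
 show "(\<lambda>x. of_real (p x) * g x) \<in> fspan W" if "g \<in> W" "real_hom p" for g p
  using mW[OF that(2) fspan.base[OF that(1)]] .
 show "continuous_on UNIV g" if g: "g \<in> W" for g
 proof -
  have "continuous_on UNIV (\<lambda>x. \<Prod>q\<leftarrow>qs. q x)" if "list_all real_hom qs" for qs :: "('h \<Rightarrow> real) list"
   using that by (induction qs) (simp_all add: real_hom_continuous continuous_on_mult)
  then have "continuous_on UNIV (m qs)" if "list_all real_hom qs" for qs
   using that gauss_continuous unfolding m_def[abs_def] by (intro continuous_on_mult continuous_on_of_real) auto
  then show ?thesis using g by (auto simp: W_def)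
 qed
 show "bounded (range g)" if g: "g \<in> W" for g
 proof -
  obtain qs where qs: "list_all real_hom qs" "g = m qs" using g by (auto simp: W_def)
  define Q where "Q x = (\<Sum>p\<leftarrow>Ps. (p x)\<^sup>2)" for x
  have Q0: "Q x \<ge> 0" for x unfolding Q_def by (rule sum_list_nonneg) auto
  have SQ: "(\<Sum>p\<leftarrow>Ps. \<bar>p x\<bar>) \<le> real (length Ps) + Q x" for x
  proof -
   have "(\<Sum>p\<leftarrow>ps. \<bar>p x\<bar>) \<le> real (length ps) + (\<Sum>p\<leftarrow>ps. (p x)\<^sup>2)" for ps :: "('h \<Rightarrow> real) list"
   proof (induction ps)
    case (Cons p ps)
    have "\<bar>p x\<bar> \<le> 1 + (p x)\<^sup>2"
     using sum_squares_bound[of "\<bar>p x\<bar>" 1] by (simp add: power2_eq_square)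
    with Cons show ?case by simp
   qed simp
   then show ?thesis by (simp add: Q_def)
  qed
  have "\<exists>C\<ge>0. \<forall>x. \<bar>\<Prod>q\<leftarrow>qs. q x\<bar> \<le> C * (1 + Q x) ^ length qs" using qs(1)
  proof (induction qs)
   case Nil
   show ?case by (intro exI[of _ 1]) simp
  next
   case (Cons q qs)
   then obtain C where C: "C \<ge> 0" "\<And>x. \<bar>\<Prod>q\<leftarrow>qs. q x\<bar> \<le> C * (1 + Q x) ^ length qs" by auto
   obtain D where D: "\<And>x. \<bar>q x\<bar> \<le> D * (1 + (\<Sum>p\<leftarrow>Ps. \<bar>p x\<bar>))" using growth[of q] Cons.prems by auto
   have S0: "(\<Sum>p\<leftarrow>Ps. \<bar>p x\<bar>) \<ge> 0" for x by (rule sum_list_nonneg) auto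
   have D': "\<bar>q x\<bar> \<le> \<bar>D\<bar> * (1 + real (length Ps)) * (1 + Q x)" for x
   proof -
    have "\<bar>q x\<bar> \<le> \<bar>D\<bar> * (1 + (\<Sum>p\<leftarrow>Ps. \<bar>p x\<bar>))"
     using D[of x] mult_right_mono[of D "\<bar>D\<bar>" "1 + (\<Sum>p\<leftarrow>Ps. \<bar>p x\<bar>)"] S0[of x] by linarith
    also have "\<dots> \<le> \<bar>D\<bar> * ((1 + real (length Ps)) * (1 + Q x))"
    proof (rule mult_left_mono)
     have "real (length Ps) * Q x \<ge> 0" using Q0 by simp
     then show "1 + (\<Sum>p\<leftarrow>Ps. \<bar>p x\<bar>) \<le> (1 + real (length Ps)) * (1 + Q x)"
      using SQ[of x] by (simp add: algebra_simps)
    qed simp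
    finally show ?thesis by (simp add: mult.assoc)
   qed
   have "\<bar>\<Prod>q\<leftarrow>q # qs. q x\<bar> \<le> (\<bar>D\<bar> * (1 + real (length Ps)) * C) * (1 + Q x) ^ length (q # qs)" for x
    using mult_mono[OF D'[of x] C(2)[of x]] Q0[of x] by (simp add: abs_mult mult_ac)
   then show ?case using C(1) by (intro exI[of _ "\<bar>D\<bar> * (1 + real (length Ps)) * C"]) simp
  qed
  then obtain C where C: "C \<ge> 0" "\<And>x. \<bar>\<Prod>q\<leftarrow>qs. q x\<bar> \<le> C * (1 + Q x) ^ length qs" by blast
  have "norm (m qs x) \<le> C * (fact (length qs) * exp 1)" for x
  proof -
   let ?k = "length qs"
   \<comment> \<open>A single term of the exponential series at 1 + Q; it yields the constant k! e
     for degree k.\<close>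
   have "(1 + Q x) ^ ?k / fact ?k \<le> exp (1 + Q x)"
    using Q0[of x] sum_le_suminf[OF summable_exp_generic, of "{?k}" "1 + Q x"]
    by (simp add: exp_def divide_inverse mult.commute)
   then have e: "(1 + Q x) ^ ?k * exp (- Q x) \<le> fact ?k * exp 1"
    by (simp add: exp_add exp_minus field_simps)
   have "norm (m qs x) = \<bar>\<Prod>q\<leftarrow>qs. q x\<bar> * exp (- Q x)"
    unfolding m_def gauss_def Q_def norm_mult norm_of_real by simp
   also have "\<dots> \<le> C * (1 + Q x) ^ ?k * exp (- Q x)" by (intro mult_right_mono C) simp
   also have "\<dots> \<le> C * (fact ?k * exp 1)" using mult_left_mono[OF e C(1)] by (simp add: mult.assoc)
   finally show ?thesis .
  qed
  then show ?thesis unfolding qs(2) bounded_iff by blast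
 qed
 fix g and X :: "real \<Rightarrow> 'h" assume g: "g \<in> W" and X: "one_param X"
 obtain qs where qs: "list_all real_hom qs" "g = m qs" using g by (auto simp: W_def)
 have "\<exists>g'\<in>fspan W. \<forall>x. ((\<lambda>t. m qs (x + X t)) has_vector_derivative g' x) (at 0)" using qs(1)
 proof (induction qs)
  case Nil
  have "(\<lambda>x. \<Sum>p\<leftarrow>ps. of_real (- 2 * p (X 1)) * (of_real (p x) * of_real (gauss x))) \<in> fspan W"
   if "list_all real_hom ps" for ps
   using that
  proof (induction ps)
   case (Cons p ps)
   have "(\<lambda>x. of_real (- 2 * p (X 1)) * (of_real (p x) * complex_of_real (gauss x))) \<in> fspan W"
    using fspan.scale[OF mW[OF _ W[of "[]"]], of p "of_real (- 2 * p (X 1))"] Cons.prems by (simp add: m_def)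
   from fspan.add[OF this Cons.IH] Cons.prems show ?case by simp
  qed (simp add: fspan.zero)
  from bexI[OF _ this[OF homs]] show ?case using gauss_deriv[OF X] by (simp add: m_def)
 next
  case (Cons q qs)
  then obtain g' where g': "g' \<in> fspan W" "\<And>x. ((\<lambda>t. m qs (x + X t)) has_vector_derivative g' x) (at 0)" by auto
  have q: "real_hom q" "list_all real_hom qs" using Cons.prems by auto
  have mq: "m (q # qs) x = of_real (q x) * m qs x" for x by (simp add: m_def mult.assoc)
  show ?case
  proof (intro bexI[of _ "\<lambda>x. of_real (q x) * g' x + of_real (q (X 1)) * m qs x"] allI)
   show "(\<lambda>x. of_real (q x) * g' x + of_real (q (X 1)) * m qs x) \<in> fspan W"
    by (intro fspan.add fspan.scale mW q g' W)
   fix x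
   have "((\<lambda>t. complex_of_real (q x + t * q (X 1))) has_vector_derivative of_real (q (X 1))) (at 0)"
    by (rule has_vector_derivative_of_real) (auto intro!: derivative_eq_intros)
   from has_vector_derivative_mult[OF this g'(2)[of x]]
   show "((\<lambda>t. m (q # qs) (x + X t)) has_vector_derivative of_real (q x) * g' x + of_real (q (X 1)) * m qs x) (at 0)"
    using one_param_0[OF X]
    by (simp add: mq real_hom_add[OF q(1)] real_hom_0[OF q(1)] flip: real_hom_one_param[OF X q(1)])
  qed
 qed
 then show "\<exists>g'\<in>fspan W. \<forall>x. ((\<lambda>t. g (x + X t)) has_vector_derivative g' x) (at 0)" by (simp add: qs)
qed

end

section \<open>Integral kernels\<close>

lemma sq_integrable_bounded_mult:
 fixes f g :: "'a \<Rightarrow> complex"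
 assumes f: "f \<in> sq_integrable M" and g: "g \<in> borel_measurable M" "\<And>x. norm (g x) \<le> B"
 shows "(\<lambda>x. g x * f x) \<in> sq_integrable M"
proof -
 have "integrable M (\<lambda>x. B\<^sup>2 * (norm (f x))\<^sup>2)" using sq_integrableD[OF f] by simp
 then have "integrable M (\<lambda>x. (norm (g x * f x))\<^sup>2)"
 proof (rule Bochner_Integration.integrable_bound)
  show "AE x in M. norm ((norm (g x * f x))\<^sup>2) \<le> norm (B\<^sup>2 * (norm (f x))\<^sup>2)"
  proof (rule AE_I2)
   fix x
   have "(norm (g x))\<^sup>2 \<le> B\<^sup>2" using g(2)[of x] by (intro power_mono) auto
   then show "norm ((norm (g x * f x))\<^sup>2) \<le> norm (B\<^sup>2 * (norm (f x))\<^sup>2)"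
    by (simp add: norm_mult power_mult_distrib mult_right_mono)
  qed
 qed (use sq_integrableD[OF f] g in simp)
 then show ?thesis using sq_integrableD[OF f] g by (simp add: sq_integrable_def)
qed

lemma sq_integrable_diff:
 "f \<in> sq_integrable M \<Longrightarrow> g \<in> sq_integrable M \<Longrightarrow> (\<lambda>x. f x - g x) \<in> sq_integrable M"
 using sq_integrable_add[OF _ sq_integrable_scale[of g M "-1"], of f] by simp

lemma (in schwartz_group) wt_le_1: "wt x \<le> 1"
proof -
 have "(\<Prod>p\<leftarrow>ps. 1 / (1 + (p x)\<^sup>2)) \<le> 1 \<and> (\<Prod>p\<leftarrow>ps. 1 / (1 + (p x)\<^sup>2)) \<ge> 0" for ps :: "('h \<Rightarrow> real) list"
 proof (induction ps)
  case (Cons p ps)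
  have "0 \<le> 1 / (1 + (p x)\<^sup>2)" "1 / (1 + (p x)\<^sup>2) \<le> 1" by (simp_all add: add_nonneg_pos divide_le_eq_1 add_pos_nonneg)
  with Cons show ?case by (simp only: list.map prod_list.Cons) (intro conjI mult_le_one mult_nonneg_nonneg; simp)
 qed simp
 then show ?thesis by (simp add: wt_def)
qed

context phase_space
begin

sublocale NNg: schwartz_group "\<nu> \<Otimes>\<^sub>M \<nu>" "map (\<lambda>p z. p (fst z)) Qs @ map (\<lambda>q z. q (snd z)) Qs"
 by (rule schwartz_group_prod) unfold_locales

text \<open>The coordinates are (shift, source): the operator carries the value at \<epsilon> to
  \<epsilon> + \<gamma> with factor \<open>kern a (\<gamma>, \<epsilon>)\<close>. In these
  coordinates the partial Fourier transform of the symbol is the kernel itself.\<close>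

definition kern :: "('g pontryagin_dual \<times> 'g \<Rightarrow> complex) \<Rightarrow> 'g pontryagin_dual \<times> 'g pontryagin_dual \<Rightarrow> complex"
 where "kern a z = fourier \<mu> (\<lambda>t. a (fst z, t)) (snd z)"

definition kform ::
 "('g pontryagin_dual \<times> 'g pontryagin_dual \<Rightarrow> complex) \<Rightarrow> ('g pontryagin_dual \<Rightarrow> complex) \<Rightarrow>
   ('g pontryagin_dual \<Rightarrow> complex) \<Rightarrow> complex"
 where "kform k x y = (\<integral>z. k z * (x (snd z) * cnj (y (snd z + fst z))) \<partial>(\<nu> \<Otimes>\<^sub>M \<nu>))"

text \<open>The weight of the phase space is a product and its dual factor is at most 1, so all
  slices share one integrable majorant in t.\<close>

lemma slice_bound:
 fixes a :: "'g pontryagin_dual \<times> 'g \<Rightarrow> complex"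
 assumes a: "a \<in> schwartz_space"
 shows "\<exists>C\<ge>0. \<forall>\<gamma> t. norm (a (\<gamma>, t)) \<le> C * M.wt t"
proof -
 obtain C where C: "C \<ge> 0" "\<And>g. norm (a g) \<le> C * G.wt g" using G.schwartz_wt_bound[OF a] by blast
 have "norm (a (\<gamma>, t)) \<le> C * M.wt t" for \<gamma> t
 proof -
  have "G.wt (\<gamma>, t) = N.wt \<gamma> * M.wt t"
   by (simp add: G.wt_def N.wt_def M.wt_def o_def)
  then have "G.wt (\<gamma>, t) \<le> M.wt t"
   using mult_right_mono[OF N.wt_le_1[of \<gamma>], of "M.wt t"] M.wt_pos[of t] by simp
  then show ?thesis using C(2)[of "(\<gamma>, t)"] mult_left_mono[of "G.wt (\<gamma>, t)" "M.wt t" C] C(1) by simp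
 qed
 then show ?thesis using C(1) by blast
qed

lemma kern_continuous_bounded:
 assumes a: "a \<in> schwartz_space"
 shows "continuous_on UNIV (kern a)" "bounded (range (kern a))"
proof -
 obtain C where C: "C \<ge> 0" "\<And>\<gamma> t. norm (a (\<gamma>, t)) \<le> C * M.wt t" using slice_bound[OF a] by blast
 have b: "norm (a (fst z, t) * cnj (char_fun (snd z) t)) \<le> C * M.wt t" for t and z :: "'g pontryagin_dual \<times> 'g pontryagin_dual"
  using C(2) by (simp add: norm_mult)
 have i: "integrable \<mu> (\<lambda>t. C * M.wt t)" by (intro integrable_mult_right M.wt_integrable)
 have m: "(\<lambda>t. a (fst z, t) * cnj (char_fun (snd z) t)) \<in> borel_measurable \<mu>" for z :: "'g pontryagin_dual \<times> 'g pontryagin_dual"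
  by (intro M.cont_meas continuous_intros continuous_on_compose2[OF schwartz_continuous[OF a]]) auto
 show "continuous_on UNIV (kern a)" unfolding kern_def[abs_def] fourier_def
 proof (rule continuous_on_integral_param[OF NNg.basis _ m i b])
  show "continuous_on UNIV (\<lambda>z :: 'g pontryagin_dual \<times> 'g pontryagin_dual. a (fst z, t) * cnj (char_fun (snd z) t))" for t
   by (intro continuous_intros continuous_on_compose2[OF schwartz_continuous[OF a]]) auto
 qed
 have "norm (kern a z) \<le> (\<integral>t. C * M.wt t \<partial>\<mu>)" for z
  unfolding kern_def fourier_def
  by (rule order_trans[OF integral_norm_bound Bochner_Integration.integral_mono])
   (use b[of z] i m[of z] in \<open>auto intro!: integrable_norm Bochner_Integration.integrable_bound[OF i] AE_I2 order_trans[OF b abs_ge_self]\<close>)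
 then show "bounded (range (kern a))" by (auto simp: bounded_iff)
qed

text \<open>Plancherel on each slice replaces the inner integral over the dual by one over the
  group, which reduces the claim to square integrability of the symbol.\<close>

lemma kern_sq_integrable:
 assumes a: "a \<in> schwartz_space"
 shows "kern a \<in> sq_integrable (\<nu> \<Otimes>\<^sub>M \<nu>)"
proof -
 have meas: "kern a \<in> borel_measurable (\<nu> \<Otimes>\<^sub>M \<nu>)" by (intro NNg.cont_meas kern_continuous_bounded a)
 have pl: "fourier \<mu> (\<lambda>t. a (\<gamma>, t)) \<in> sq_integrable \<nu>"
   "(\<integral>\<epsilon>. (norm (fourier \<mu> (\<lambda>t. a (\<gamma>, t)) \<epsilon>))\<^sup>2 \<partial>\<nu>) = (\<integral>t. (norm (a (\<gamma>, t)))\<^sup>2 \<partial>\<mu>)" for \<gamma>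
  using planch M.schwartz_integrable[OF schwartz_slice_snd[OF a, of \<gamma>]] M.schwartz_sq_integrable[OF schwartz_slice_snd[OF a, of \<gamma>]]
  unfolding plancherel_def by blast+
 have "integrable (\<nu> \<Otimes>\<^sub>M \<nu>) (\<lambda>z. (norm (kern a z))\<^sup>2)"
 proof (rule NN.Fubini_integrable)
  show "(\<lambda>z. (norm (kern a z))\<^sup>2) \<in> borel_measurable (\<nu> \<Otimes>\<^sub>M \<nu>)" using meas by simp
  show "AE \<gamma> in \<nu>. integrable \<nu> (\<lambda>\<epsilon>. (norm (kern a (\<gamma>, \<epsilon>)))\<^sup>2)"
   using sq_integrableD(2)[OF pl(1)] by (simp add: kern_def)
  have "integrable \<nu> (\<lambda>\<gamma>. \<integral>t. (norm (a (\<gamma>, t)))\<^sup>2 \<partial>\<mu>)"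
   by (rule NM.integrable_fst'[OF sq_integrableD(2)[OF G.schwartz_sq_integrable[OF a]]])
  then show "integrable \<nu> (\<lambda>\<gamma>. \<integral>\<epsilon>. norm ((norm (kern a (\<gamma>, \<epsilon>)))\<^sup>2) \<partial>\<nu>)" by (simp add: kern_def pl(2))
 qed
 then show ?thesis using meas by (simp add: sq_integrable_def)
qed

text \<open>For fixed \<epsilon> the substitution \<gamma> + \<epsilon> in the other variable
  preserves the measure, so Tonelli factorises the norm as for an unshifted tensor product.\<close>

lemma tensor_shift:
 assumes x: "x \<in> sq_integrable \<nu>" and y: "y \<in> sq_integrable \<nu>"
 shows "(\<lambda>z. x (snd z) * cnj (y (snd z + fst z))) \<in> sq_integrable (\<nu> \<Otimes>\<^sub>M \<nu>)"
  and "l2 (\<nu> \<Otimes>\<^sub>M \<nu>) (\<lambda>z. x (snd z) * cnj (y (snd z + fst z))) = l2 \<nu> x * l2 \<nu> y"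
proof -
 let ?A = "\<integral>\<epsilon>. (norm (x \<epsilon>))\<^sup>2 \<partial>\<nu>" and ?B = "\<integral>\<epsilon>. (norm (y \<epsilon>))\<^sup>2 \<partial>\<nu>"
 have xm: "(\<lambda>z. x (snd z)) \<in> borel_measurable (\<nu> \<Otimes>\<^sub>M \<nu>)"
  by (rule measurable_compose[OF measurable_snd sq_integrableD(1)[OF x]])
 have ym: "(\<lambda>z. y (snd z + fst z)) \<in> borel_measurable (\<nu> \<Otimes>\<^sub>M \<nu>)"
  by (rule measurable_compose[OF N.measurable_pair_ops(3) sq_integrableD(1)[OF y]])
 have m: "(\<lambda>z. x (snd z) * cnj (y (snd z + fst z))) \<in> borel_measurable (\<nu> \<Otimes>\<^sub>M \<nu>)" using xm borel_measurable_cnj[OF ym] by simp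
 have y1: "(\<lambda>\<gamma>. ennreal ((norm (y \<gamma>))\<^sup>2)) \<in> borel_measurable \<nu>" "(\<lambda>\<gamma>. ennreal ((norm (x \<gamma>))\<^sup>2)) \<in> borel_measurable \<nu>"
  using sq_integrableD(1)[OF x] sq_integrableD(1)[OF y] by simp_all
 have "(\<integral>\<^sup>+z. ennreal ((norm (x (snd z) * cnj (y (snd z + fst z))))\<^sup>2) \<partial>(\<nu> \<Otimes>\<^sub>M \<nu>)) =
   (\<integral>\<^sup>+\<epsilon>. (\<integral>\<^sup>+\<gamma>. ennreal ((norm (x \<epsilon> * cnj (y (\<epsilon> + \<gamma>))))\<^sup>2) \<partial>\<nu>) \<partial>\<nu>)"
  using m by (subst NN.nn_integral_snd[symmetric]) auto
 also have "\<dots> = (\<integral>\<^sup>+\<epsilon>. ennreal ((norm (x \<epsilon>))\<^sup>2) * (\<integral>\<^sup>+\<gamma>. ennreal ((norm (y \<gamma>))\<^sup>2) \<partial>\<nu>) \<partial>\<nu>)"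
 proof (rule nn_integral_cong)
  fix \<epsilon>
  have "(\<integral>\<^sup>+\<gamma>. ennreal ((norm (x \<epsilon> * cnj (y (\<epsilon> + \<gamma>))))\<^sup>2) \<partial>\<nu>) =
    (\<integral>\<^sup>+\<gamma>. ennreal ((norm (x \<epsilon>))\<^sup>2) * (\<lambda>\<gamma>. ennreal ((norm (y \<gamma>))\<^sup>2)) (\<gamma> + \<epsilon>) \<partial>\<nu>)"
   by (simp add: norm_mult power_mult_distrib ennreal_mult add.commute)
  also have "\<dots> = ennreal ((norm (x \<epsilon>))\<^sup>2) * (\<integral>\<^sup>+\<gamma>. (\<lambda>\<gamma>. ennreal ((norm (y \<gamma>))\<^sup>2)) (\<gamma> + \<epsilon>) \<partial>\<nu>)"
   by (rule nn_integral_cmult) (rule measurable_compose[OF N.measurable_ops(1) y1(1)])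
  also have "(\<integral>\<^sup>+\<gamma>. (\<lambda>\<gamma>. ennreal ((norm (y \<gamma>))\<^sup>2)) (\<gamma> + \<epsilon>) \<partial>\<nu>) = (\<integral>\<^sup>+\<gamma>. ennreal ((norm (y \<gamma>))\<^sup>2) \<partial>\<nu>)"
   by (rule N.nn_integral_translate[OF y1(1)])
  finally show "(\<integral>\<^sup>+\<gamma>. ennreal ((norm (x \<epsilon> * cnj (y (\<epsilon> + \<gamma>))))\<^sup>2) \<partial>\<nu>) =
    ennreal ((norm (x \<epsilon>))\<^sup>2) * (\<integral>\<^sup>+\<gamma>. ennreal ((norm (y \<gamma>))\<^sup>2) \<partial>\<nu>)" .
 qed
 also have "\<dots> = (\<integral>\<^sup>+\<epsilon>. ennreal ((norm (x \<epsilon>))\<^sup>2) \<partial>\<nu>) * (\<integral>\<^sup>+\<gamma>. ennreal ((norm (y \<gamma>))\<^sup>2) \<partial>\<nu>)"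
  by (rule nn_integral_multc[OF y1(2)])
 also have "\<dots> = ennreal (?A * ?B)"
  using sq_integrableD(2)[OF x] sq_integrableD(2)[OF y] by (simp add: nn_integral_eq_integral ennreal_mult)
 finally have eq: "(\<integral>\<^sup>+z. ennreal ((norm (x (snd z) * cnj (y (snd z + fst z))))\<^sup>2) \<partial>(\<nu> \<Otimes>\<^sub>M \<nu>)) = ennreal (?A * ?B)" .
 have AB: "integrable (\<nu> \<Otimes>\<^sub>M \<nu>) (\<lambda>z. (norm (x (snd z) * cnj (y (snd z + fst z))))\<^sup>2) \<and>
   (\<integral>z. (norm (x (snd z) * cnj (y (snd z + fst z))))\<^sup>2 \<partial>(\<nu> \<Otimes>\<^sub>M \<nu>)) = ?A * ?B"
 proof (rule nn_integral_eq_integrable[THEN iffD1, OF _ _ _ eq])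
  show "(\<lambda>z. (norm (x (snd z) * cnj (y (snd z + fst z))))\<^sup>2) \<in> borel_measurable (\<nu> \<Otimes>\<^sub>M \<nu>)" using m by simp
 qed simp_all
 then show "(\<lambda>z. x (snd z) * cnj (y (snd z + fst z))) \<in> sq_integrable (\<nu> \<Otimes>\<^sub>M \<nu>)"
  using m by (simp add: sq_integrable_def)
 show "l2 (\<nu> \<Otimes>\<^sub>M \<nu>) (\<lambda>z. x (snd z) * cnj (y (snd z + fst z))) = l2 \<nu> x * l2 \<nu> y"
  unfolding l2_def using AB by (simp only: real_sqrt_mult)
qed

lemma kform_integrable:
 assumes "k \<in> sq_integrable (\<nu> \<Otimes>\<^sub>M \<nu>)" "x \<in> sq_integrable \<nu>" "y \<in> sq_integrable \<nu>"
 shows "integrable (\<nu> \<Otimes>\<^sub>M \<nu>) (\<lambda>z. k z * (x (snd z) * cnj (y (snd z + fst z))))"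
 by (rule sq_integrable_mult[OF assms(1) tensor_shift(1)[OF assms(2,3)]])

text \<open>The L^2 norm of the kernel is the Hilbert-Schmidt norm, and Cauchy-Schwarz on the
  product space bounds the form by it.\<close>

lemma kform_bound:
 assumes k: "k \<in> sq_integrable (\<nu> \<Otimes>\<^sub>M \<nu>)" and xy: "x \<in> sq_integrable \<nu>" "y \<in> sq_integrable \<nu>"
 shows "norm (kform k x y) \<le> l2 (\<nu> \<Otimes>\<^sub>M \<nu>) k * (l2 \<nu> x * l2 \<nu> y)"
proof -
 have "norm (kform k x y) \<le> l2 (\<nu> \<Otimes>\<^sub>M \<nu>) k * l2 (\<nu> \<Otimes>\<^sub>M \<nu>) (\<lambda>z. cnj (x (snd z) * cnj (y (snd z + fst z))))"
  using norm_integral_mult_le[OF k sq_integrable_cnj[OF tensor_shift(1)[OF xy]]] unfolding kform_def complex_cnj_cnj .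
 also have "l2 (\<nu> \<Otimes>\<^sub>M \<nu>) (\<lambda>z. cnj (x (snd z) * cnj (y (snd z + fst z)))) = l2 \<nu> x * l2 \<nu> y"
  unfolding tensor_shift(2)[OF xy, symmetric] by (simp only: l2_def complex_mod_cnj)
 finally show ?thesis .
qed

lemma kform_diff:
 assumes k: "k \<in> sq_integrable (\<nu> \<Otimes>\<^sub>M \<nu>)" "l \<in> sq_integrable (\<nu> \<Otimes>\<^sub>M \<nu>)" and xy: "x \<in> sq_integrable \<nu>" "y \<in> sq_integrable \<nu>"
 shows "kform (\<lambda>z. k z - l z) x y = kform k x y - kform l x y"
 unfolding kform_def left_diff_distrib by (rule Bochner_Integration.integral_diff) (intro kform_integrable assms)+

lemma kform_add:
 assumes k: "k \<in> sq_integrable (\<nu> \<Otimes>\<^sub>M \<nu>)" "l \<in> sq_integrable (\<nu> \<Otimes>\<^sub>M \<nu>)" and xy: "x \<in> sq_integrable \<nu>" "y \<in> sq_integrable \<nu>"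
 shows "kform (\<lambda>z. k z + l z) x y = kform k x y + kform l x y"
 unfolding kform_def distrib_right by (rule Bochner_Integration.integral_add) (intro kform_integrable assms)+

lemma kform_scale: "kform (\<lambda>z. c * k z) x y = c * kform k x y"
 unfolding kform_def mult.assoc by simp

text \<open>A function of the target \<epsilon> + \<gamma> times a function of the source \<epsilon>
  is the kernel of a rank-one operator.\<close>

lemma kform_tensor:
 assumes xi: "\<xi> \<in> sq_integrable \<nu>" and eta: "\<eta> \<in> sq_integrable \<nu>" and x: "x \<in> sq_integrable \<nu>" and y: "y \<in> sq_integrable \<nu>"
 shows "kform (\<lambda>z. \<xi> (snd z + fst z) * cnj (\<eta> (snd z))) x y =
  (\<integral>\<epsilon>. x \<epsilon> * cnj (\<eta> \<epsilon>) \<partial>\<nu>) * (\<integral>\<epsilon>. \<xi> \<epsilon> * cnj (y \<epsilon>) \<partial>\<nu>)"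
proof -
 let ?F = "\<lambda>\<gamma> \<epsilon>. \<xi> (\<epsilon> + \<gamma>) * cnj (\<eta> \<epsilon>) * (x \<epsilon> * cnj (y (\<epsilon> + \<gamma>)))"
 have s: "(\<lambda>z. \<xi> (snd z + fst z) * cnj (\<eta> (snd z))) \<in> sq_integrable (\<nu> \<Otimes>\<^sub>M \<nu>)"
  using sq_integrable_cnj[OF tensor_shift(1)[OF eta xi]] by (simp add: mult.commute)
 have "kform (\<lambda>z. \<xi> (snd z + fst z) * cnj (\<eta> (snd z))) x y = (\<integral>\<epsilon>. (\<integral>\<gamma>. ?F \<gamma> \<epsilon> \<partial>\<nu>) \<partial>\<nu>)"
  unfolding kform_def using kform_integrable[OF s x y]
  by (subst NN.integral_snd) (simp_all add: case_prod_unfold)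
 also have "\<dots> = (\<integral>\<epsilon>. x \<epsilon> * cnj (\<eta> \<epsilon>) * (\<integral>\<delta>. \<xi> \<delta> * cnj (y \<delta>) \<partial>\<nu>) \<partial>\<nu>)"
 proof (rule Bochner_Integration.integral_cong[OF refl])
  fix \<epsilon>
  have "(\<integral>\<gamma>. ?F \<gamma> \<epsilon> \<partial>\<nu>) = (\<integral>\<gamma>. x \<epsilon> * cnj (\<eta> \<epsilon>) * (\<lambda>\<delta>. \<xi> \<delta> * cnj (y \<delta>)) (\<gamma> + \<epsilon>) \<partial>\<nu>)"
   by (intro Bochner_Integration.integral_cong refl) (simp add: mult_ac add.commute)
  also have "\<dots> = x \<epsilon> * cnj (\<eta> \<epsilon>) * (\<integral>\<gamma>. (\<lambda>\<delta>. \<xi> \<delta> * cnj (y \<delta>)) (\<gamma> + \<epsilon>) \<partial>\<nu>)" by simp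
  also have "(\<integral>\<gamma>. (\<lambda>\<delta>. \<xi> \<delta> * cnj (y \<delta>)) (\<gamma> + \<epsilon>) \<partial>\<nu>) = (\<integral>\<delta>. \<xi> \<delta> * cnj (y \<delta>) \<partial>\<nu>)"
   by (rule N.integral_translate[OF borel_measurable_integrable[OF sq_integrable_mult[OF xi sq_integrable_cnj[OF y]]]])
  finally show "(\<integral>\<gamma>. ?F \<gamma> \<epsilon> \<partial>\<nu>) = x \<epsilon> * cnj (\<eta> \<epsilon>) * (\<integral>\<delta>. \<xi> \<delta> * cnj (y \<delta>) \<partial>\<nu>)" .
 qed
 finally show ?thesis by simp
qed

text \<open>In the weak formula the group variable appears only through the symbol and a character
  of \<epsilon>, so integrating over it first produces the partial Fourier transform.\<close>

lemma pi_int_kern: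
 assumes a: "a \<in> schwartz_space" and x: "x \<in> sq_integrable \<nu>" and y: "y \<in> sq_integrable \<nu>"
 shows "ip (L2 \<nu>) (pi_int \<mu> \<nu> a (L2_class \<nu> x)) (L2_class \<nu> y) = kform (kern a) x y"
proof -
 interpret MN: pair_sigma_finite \<mu> \<nu> ..
 let ?c = "\<lambda>g. a g * ip (L2 \<nu>) (pi_op \<nu> g (L2_class \<nu> x)) (L2_class \<nu> y)"
 have inner: "(\<integral>t. ?c (\<gamma>, t) \<partial>\<mu>) = (\<integral>\<epsilon>. kern a (\<gamma>, \<epsilon>) * (x \<epsilon> * cnj (y (\<epsilon> + \<gamma>))) \<partial>\<nu>)" for \<gamma>
 proof -
  let ?b = "\<lambda>\<epsilon>. x \<epsilon> * cnj (y (\<epsilon> + \<gamma>))"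
  have y': "(\<lambda>\<epsilon>. y (\<epsilon> + \<gamma>)) \<in> sq_integrable \<nu>"
   using measurable_compose[OF N.measurable_ops(1) sq_integrableD(1)[OF y]] N.integrable_translate[OF sq_integrableD(2)[OF y]]
   by (simp add: sq_integrable_def)
  have b: "integrable \<nu> ?b" by (rule sq_integrable_mult[OF x sq_integrable_cnj[OF y']])
  have sl: "integrable \<mu> (\<lambda>t. a (\<gamma>, t))" by (intro M.schwartz_integrable schwartz_slice_snd a)
  have cm: "(\<lambda>z. cnj (char_fun (snd z) (fst z))) \<in> borel_measurable (\<mu> \<Otimes>\<^sub>M \<nu>)"
   by (rule M.measurable_pair_cont[OF N.sets_M]) (intro continuous_intros)
  have I: "integrable (\<mu> \<Otimes>\<^sub>M \<nu>) (\<lambda>(t, \<epsilon>). a (\<gamma>, t) * ?b \<epsilon> * cnj (char_fun \<epsilon> t))"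
   by (rule integrable_tensor_phase[where c = "\<lambda>t \<epsilon>. cnj (char_fun \<epsilon> t)", OF M.sigma_finite_measure_axioms N.sigma_finite_measure_axioms sl b cm])
    simp
  have "(\<integral>t. ?c (\<gamma>, t) \<partial>\<mu>) = (\<integral>t. (\<integral>\<epsilon>. a (\<gamma>, t) * ?b \<epsilon> * cnj (char_fun \<epsilon> t) \<partial>\<nu>) \<partial>\<mu>)"
   unfolding ip_pi_op_shift[OF x y] by (simp flip: integral_mult_right_zero add: mult_ac)
  also have "\<dots> = (\<integral>\<epsilon>. (\<integral>t. a (\<gamma>, t) * ?b \<epsilon> * cnj (char_fun \<epsilon> t) \<partial>\<mu>) \<partial>\<nu>)"
   by (rule MN.Fubini_integral[OF I, symmetric])
  also have "\<dots> = (\<integral>\<epsilon>. kern a (\<gamma>, \<epsilon>) * ?b \<epsilon> \<partial>\<nu>)"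
  proof (rule Bochner_Integration.integral_cong[OF refl])
   fix \<epsilon>
   have "(\<integral>t. a (\<gamma>, t) * ?b \<epsilon> * cnj (char_fun \<epsilon> t) \<partial>\<mu>) = (\<integral>t. a (\<gamma>, t) * cnj (char_fun \<epsilon> t) * ?b \<epsilon> \<partial>\<mu>)"
    by (intro Bochner_Integration.integral_cong refl) (simp add: mult_ac)
   then show "(\<integral>t. a (\<gamma>, t) * ?b \<epsilon> * cnj (char_fun \<epsilon> t) \<partial>\<mu>) = kern a (\<gamma>, \<epsilon>) * ?b \<epsilon>"
    by (simp only: kern_def fourier_def integral_mult_left_zero fst_conv snd_conv)
  qed
  finally show ?thesis .
 qed
 have ai: "integrable (\<nu> \<Otimes>\<^sub>M \<mu>) a" by (rule schwartz_G_integrable[OF a])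
 have "ip (L2 \<nu>) (pi_int \<mu> \<nu> a (L2_class \<nu> x)) (L2_class \<nu> y) = (\<integral>g. ?c g \<partial>(\<nu> \<Otimes>\<^sub>M \<mu>))"
  by (rule pi_int(2)[OF ai L2_class_closed[OF x] L2_class_closed[OF y]])
 also have "\<dots> = (\<integral>\<gamma>. (\<integral>t. ?c (\<gamma>, t) \<partial>\<mu>) \<partial>\<nu>)"
  by (rule NM.integral_fst'[OF coefficient_integrable[OF ai L2_class_closed[OF x] L2_class_closed[OF y]], symmetric])
 also have "\<dots> = kform (kern a) x y"
  unfolding inner kform_def
  using NM.integral_fst' NN.integral_fst'[OF kform_integrable[OF kern_sq_integrable[OF a] x y]] by simp
 finally show ?thesis .
qed

text \<open>For fixed \<gamma> the coefficient function is, in the group variable, the inverse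
  transform of \<xi>(\<epsilon> + \<gamma>) times the conjugate of \<eta>(\<epsilon>). Fourier
  inversion gives this product back as the kernel.\<close>

lemma coeff_fun_schwartz:
 assumes xi: "\<xi> \<in> schwartz_space" and eta: "\<eta> \<in> schwartz_space"
 shows "coeff_fun \<nu> \<eta> \<xi> \<in> schwartz_space" "kern (coeff_fun \<nu> \<eta> \<xi>) = (\<lambda>z. \<xi> (snd z + fst z) * cnj (\<eta> (snd z)))"
proof -
 have sq: "\<xi> \<in> sq_integrable \<nu>" "\<eta> \<in> sq_integrable \<nu>" by (intro N.schwartz_sq_integrable assms)+
 have eq: "coeff_fun \<nu> \<eta> \<xi> = wigner \<xi> (\<lambda>\<epsilon>. cnj (\<eta> \<epsilon>))"
 proof
  fix g
  have "coeff_fun \<nu> \<eta> \<xi> g = cnj (ip (L2 \<nu>) (pi_op \<nu> g (L2_class \<nu> \<eta>)) (L2_class \<nu> \<xi>))"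
   unfolding coeff_fun_def using sq by (intro H.ip_cnj) auto
  also have "\<dots> = (\<integral>\<epsilon>. cnj (cnj (char_fun \<epsilon> (snd g)) * \<eta> \<epsilon> * cnj (\<xi> (\<epsilon> + fst g))) \<partial>\<nu>)"
   unfolding ip_pi_op_shift[OF sq(2,1)] by (simp del: complex_cnj_mult)
  also have "\<dots> = wigner \<xi> (\<lambda>\<epsilon>. cnj (\<eta> \<epsilon>)) g"
   unfolding wigner_def by (intro Bochner_Integration.integral_cong refl) (simp add: mult_ac)
  finally show "coeff_fun \<nu> \<eta> \<xi> g = wigner \<xi> (\<lambda>\<epsilon>. cnj (\<eta> \<epsilon>)) g" .
 qed
 have w: "wigner \<xi> (\<lambda>\<epsilon>. cnj (\<eta> \<epsilon>)) \<in> schwartz_space" by (intro wigner_schwartz schwartz_cnj assms)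
 then show "coeff_fun \<nu> \<eta> \<xi> \<in> schwartz_space" by (simp add: eq)
 have "fourier \<mu> (\<lambda>t. wigner \<xi> (\<lambda>\<epsilon>. cnj (\<eta> \<epsilon>)) (\<gamma>, t)) = (\<lambda>\<epsilon>. \<xi> (\<epsilon> + \<gamma>) * cnj (\<eta> \<epsilon>))" for \<gamma>
 proof (rule fourier_inversion)
  show "(\<lambda>\<epsilon>. \<xi> (\<epsilon> + \<gamma>) * cnj (\<eta> \<epsilon>)) \<in> schwartz_space" by (intro schwartz_mult schwartz_cnj schwartz_translate assms)
  show "(\<lambda>t. wigner \<xi> (\<lambda>\<epsilon>. cnj (\<eta> \<epsilon>)) (\<gamma>, t)) \<in> schwartz_space" by (rule schwartz_slice_snd[OF w])
 qed (simp add: wigner_def)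
 then show "kern (coeff_fun \<nu> \<eta> \<xi>) = (\<lambda>z. \<xi> (snd z + fst z) * cnj (\<eta> (snd z)))"
  by (simp add: eq kern_def fun_eq_iff)
qed

lemma pi_int_rank_one:
 assumes xi: "\<xi> \<in> schwartz_space" and eta: "\<eta> \<in> schwartz_space"
 shows "pi_int \<mu> \<nu> (coeff_fun \<nu> \<eta> \<xi>) =
  (\<lambda>c\<in>carrier (L2 \<nu>). ip (L2 \<nu>) c (L2_class \<nu> \<eta>) \<odot>\<^bsub>L2 \<nu>\<^esub> L2_class \<nu> \<xi>)"
proof (rule pi_int_eqI)
 have sq: "\<xi> \<in> sq_integrable \<nu>" "\<eta> \<in> sq_integrable \<nu>" by (intro N.schwartz_sq_integrable assms)+
 note cs = coeff_fun_schwartz[OF assms]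
 show ci: "integrable (\<nu> \<Otimes>\<^sub>M \<mu>) (coeff_fun \<nu> \<eta> \<xi>)" by (rule schwartz_G_integrable[OF cs(1)])
 show "(\<lambda>c\<in>carrier (L2 \<nu>). ip (L2 \<nu>) c (L2_class \<nu> \<eta>) \<odot>\<^bsub>L2 \<nu>\<^esub> L2_class \<nu> \<xi>) \<in> carrier (L2 \<nu>) \<rightarrow>\<^sub>E carrier (L2 \<nu>)"
  using sq by (auto simp: L2_smult intro!: L2_class_closed sq_integrable_scale)
 fix c d assume c: "c \<in> carrier (L2 \<nu>)" and d: "d \<in> carrier (L2 \<nu>)"
 obtain x where x: "x \<in> sq_integrable \<nu>" "c = L2_class \<nu> x" using c by (rule L2_cases)
 obtain y where y: "y \<in> sq_integrable \<nu>" "d = L2_class \<nu> y" using d by (rule L2_cases)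
 have "(\<integral>g. coeff_fun \<nu> \<eta> \<xi> g * ip (L2 \<nu>) (pi_op \<nu> g c) d \<partial>(\<nu> \<Otimes>\<^sub>M \<mu>)) = kform (kern (coeff_fun \<nu> \<eta> \<xi>)) x y"
  using pi_int(2)[OF ci c d] pi_int_kern[OF cs(1) x(1) y(1)] by (simp add: x y)
 also have "\<dots> = (\<integral>\<epsilon>. x \<epsilon> * cnj (\<eta> \<epsilon>) \<partial>\<nu>) * (\<integral>\<epsilon>. \<xi> \<epsilon> * cnj (y \<epsilon>) \<partial>\<nu>)"
  unfolding cs(2) by (rule kform_tensor[OF sq x(1) y(1)])
 also have "\<dots> = ip (L2 \<nu>) ((\<lambda>c\<in>carrier (L2 \<nu>). ip (L2 \<nu>) c (L2_class \<nu> \<eta>) \<odot>\<^bsub>L2 \<nu>\<^esub> L2_class \<nu> \<xi>) c) d"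
  using c d sq by (simp add: H.ip_smult) (simp add: x y L2_ip)
 finally show "ip (L2 \<nu>) ((\<lambda>c\<in>carrier (L2 \<nu>). ip (L2 \<nu>) c (L2_class \<nu> \<eta>) \<odot>\<^bsub>L2 \<nu>\<^esub> L2_class \<nu> \<xi>) c) d =
   (\<integral>g. coeff_fun \<nu> \<eta> \<xi> g * ip (L2 \<nu>) (pi_op \<nu> g c) d \<partial>(\<nu> \<Otimes>\<^sub>M \<mu>))" ..
qed


section \<open>Approximation of kernels by Gaussian-weighted trigonometric polynomials\<close>

text \<open>A Gaussian in the source times one in the target, in place of one in the two
  coordinates: with this weight every product of characters becomes a rank-one kernel with Schwartz
  factors.\<close>

definition gauss2 :: "'g pontryagin_dual \<times> 'g pontryagin_dual \<Rightarrow> real"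
 where "gauss2 z = N.gauss (snd z) * N.gauss (snd z + fst z)"

definition pair_chars :: "('g pontryagin_dual \<times> 'g pontryagin_dual \<Rightarrow> complex) set"
 where "pair_chars = {\<lambda>z. char_fun (fst z) s * char_fun (snd z) t | s t. True}"

lemma gauss2_pos: "gauss2 z > 0" by (simp add: gauss2_def N.gauss_pos)

lemma gauss2_continuous: "continuous_on UNIV gauss2"
 unfolding gauss2_def[abs_def]
 by (intro continuous_intros continuous_on_compose2[OF N.gauss_continuous]) auto

lemma gauss2_sq_integrable: "(\<lambda>z. complex_of_real (gauss2 z)) \<in> sq_integrable (\<nu> \<Otimes>\<^sub>M \<nu>)"
 using tensor_shift(1)[OF N.schwartz_sq_integrable[OF N.gauss_schwartz] N.schwartz_sq_integrable[OF N.gauss_schwartz]]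
 by (simp add: gauss2_def)

lemma pair_chars_span:
 assumes "r \<in> fspan pair_chars"
 shows "continuous_on UNIV r" "bounded (range r)" "(\<lambda>z. r z * complex_of_real (gauss2 z)) \<in> sq_integrable (\<nu> \<Otimes>\<^sub>M \<nu>)"
proof -
 show c: "continuous_on UNIV r" using assms
  by induction (auto simp: pair_chars_def intro!: continuous_intros)
 show b: "bounded (range r)" using assms
 proof induction
  case (base f)
  then show ?case by (auto simp: pair_chars_def bounded_iff norm_mult intro!: exI[of _ 1])
 next
  case (scale f z)
  then show ?case using bounded_range_mult[of "\<lambda>_. z" f] by simp
 qed (simp_all add: bounded_range_add)
 then obtain B where "\<And>z. norm (r z) \<le> B" by (auto simp: bounded_iff)
 then show "(\<lambda>z. r z * complex_of_real (gauss2 z)) \<in> sq_integrable (\<nu> \<Otimes>\<^sub>M \<nu>)"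
  by (rule sq_integrable_bounded_mult[OF gauss2_sq_integrable NNg.cont_meas[OF c]])
qed

text \<open>
 Dividing by \<open>gauss2 + 1/n\<close> instead of \<open>gauss2\<close> makes the quotient bounded, at a cost in
 \<open>L\<^sup>2\<close> that vanishes as \<open>n\<close> grows.
\<close>

lemma kernel_approximation:
 fixes k :: "'g pontryagin_dual \<times> 'g pontryagin_dual \<Rightarrow> complex"
 assumes k: "continuous_on UNIV k" "bounded (range k)" "k \<in> sq_integrable (\<nu> \<Otimes>\<^sub>M \<nu>)" and d: "d > 0"
 shows "\<exists>r\<in>fspan pair_chars. l2 (\<nu> \<Otimes>\<^sub>M \<nu>) (\<lambda>z. k z - r z * of_real (gauss2 z)) \<le> d"
proof -
 let ?N = "\<nu> \<Otimes>\<^sub>M \<nu>"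
 obtain B where B: "\<And>z. norm (k z) \<le> B" using k(2) by (auto simp: bounded_iff)
 have gm: "gauss2 \<in> borel_measurable ?N" by (rule NNg.cont_meas[OF gauss2_continuous])
 define e where "e n = 1 / real (Suc n)" for n
 have e0: "e n > 0" for n by (simp add: e_def)
 have ge: "gauss2 z + e n > 0" for z n using gauss2_pos[of z] e0[of n] by simp
 define f where "f n z = k z / of_real (gauss2 z + e n)" for n z
 have fk: "f n z * of_real (gauss2 z) = of_real (gauss2 z / (gauss2 z + e n)) * k z" for n z by (simp add: f_def)
 have fd: "k z - f n z * of_real (gauss2 z) = of_real (e n / (gauss2 z + e n)) * k z" for n z
 proof -
  have "e n / (gauss2 z + e n) = 1 - gauss2 z / (gauss2 z + e n)" using ge[of z n] by (simp add: field_simps)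
  then show ?thesis unfolding fk by (simp add: left_diff_distrib)
 qed
 have q1: "0 \<le> e n / (gauss2 z + e n)" "e n / (gauss2 z + e n) \<le> 1"
   "0 \<le> gauss2 z / (gauss2 z + e n)" "gauss2 z / (gauss2 z + e n) \<le> 1" for n z
  using ge[of z n] e0[of n] gauss2_pos[of z] by (simp_all add: divide_le_eq_1)
 have fc: "continuous_on UNIV (f n)" for n
  unfolding f_def
  by (intro continuous_on_divide continuous_on_of_real continuous_on_add k gauss2_continuous continuous_on_const)
    (auto simp flip: of_real_add simp del: of_real_add dest: less_imp_neq[OF ge, THEN not_sym, THEN notE])
 have fb: "bounded (range (f n))" for n
 proof -
  have "norm (f n z) \<le> B / e n" for z
   unfolding f_def norm_divide norm_of_real
   using B[of z] e0[of n] gauss2_pos[of z] order_trans[OF norm_ge_zero[of "k z"] B[of z]] by (intro frac_le) auto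
  then show ?thesis by (auto simp: bounded_iff)
 qed
 have lim: "(\<lambda>n. \<integral>z. (norm (k z - f n z * of_real (gauss2 z)))\<^sup>2 \<partial>?N) \<longlonglongrightarrow> (\<integral>z. 0 \<partial>?N)"
 proof (rule integral_dominated_convergence[where w = "\<lambda>z. (norm (k z))\<^sup>2"])
  show "integrable ?N (\<lambda>z. (norm (k z))\<^sup>2)" by (rule sq_integrableD(2)[OF k(3)])
  show "(\<lambda>z. (norm (k z - f n z * of_real (gauss2 z)))\<^sup>2) \<in> borel_measurable ?N" for n
   by (intro NNg.cont_meas continuous_intros k fc gauss2_continuous)
  show "AE z in ?N. norm ((norm (k z - f n z * of_real (gauss2 z)))\<^sup>2) \<le> (norm (k z))\<^sup>2" for n
  proof (rule AE_I2)
   fix z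
   have "norm (k z - f n z * of_real (gauss2 z)) \<le> norm (k z)"
    unfolding fd norm_mult norm_of_real abs_of_nonneg[OF q1(1)[of n z]]
    by (rule mult_left_le_one_le[OF norm_ge_zero q1(1,2)])
   then show "norm ((norm (k z - f n z * of_real (gauss2 z)))\<^sup>2) \<le> (norm (k z))\<^sup>2" by (simp add: power_mono)
  qed
  show "AE z in ?N. (\<lambda>n. (norm (k z - f n z * of_real (gauss2 z)))\<^sup>2) \<longlonglongrightarrow> 0"
  proof (rule AE_I2)
   fix z
   have e0: "e \<longlonglongrightarrow> 0" unfolding e_def using LIMSEQ_Suc[OF lim_1_over_n] by simp
   then have "(\<lambda>n. e n / (gauss2 z + e n)) \<longlonglongrightarrow> 0 / (gauss2 z + 0)"
    using gauss2_pos[of z] by (intro tendsto_divide tendsto_add tendsto_const e0) auto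
   then have "(\<lambda>n. of_real (e n / (gauss2 z + e n)) * k z) \<longlonglongrightarrow> of_real (0 / (gauss2 z + 0)) * k z"
    by (rule tendsto_mult[OF tendsto_of_real tendsto_const])
   then have "(\<lambda>n. k z - f n z * of_real (gauss2 z)) \<longlonglongrightarrow> 0" by (simp add: fd)
   then show "(\<lambda>n. (norm (k z - f n z * of_real (gauss2 z)))\<^sup>2) \<longlonglongrightarrow> 0"
    using tendsto_power[OF tendsto_norm_zero, of _ _ 2] by (simp add: zero_power2)
  qed
 qed simp
 \<comment> \<open>Two errors u and v with squared norm below d^2/4 enter through 2 |u|^2 + 2 |v|^2,
   which adds up to d^2.\<close>
 have d4: "d\<^sup>2 / 4 > 0" using d by simp
 from lim have "eventually (\<lambda>n. (\<integral>z. (norm (k z - f n z * of_real (gauss2 z)))\<^sup>2 \<partial>?N) < d\<^sup>2 / 4) sequentially"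
  using d4 by (intro order_tendstoD(2)) (simp_all only: Bochner_Integration.integral_zero)
 then obtain n where n: "(\<integral>z. (norm (k z - f n z * of_real (gauss2 z)))\<^sup>2 \<partial>?N) < d\<^sup>2 / 4"
  by (auto simp: eventually_sequentially)
 \<comment> \<open>The distance of f n and r in this space is the unweighted distance of their
   products with \<open>gauss2\<close>.\<close>
 let ?m = "density ?N (\<lambda>z. ennreal ((gauss2 z)\<^sup>2))"
 have gi: "integrable ?N (\<lambda>z. (gauss2 z)\<^sup>2)"
  using sq_integrableD(2)[OF gauss2_sq_integrable] by simp
 have "\<exists>r\<in>fspan pair_chars. (\<integral>z. (norm (f n z - r z))\<^sup>2 \<partial>?m) < d\<^sup>2 / 4"
 proof (rule bounded_complex_algebra_dense_L2)
  show "sets ?m = sets borel" unfolding sets_density by (rule NNg.sets_M)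
  show "finite_measure ?m" by (rule NNg.tight_density(2)[OF gi, of 1]) simp_all
  show "\<exists>C. compact C \<and> measure ?m (- C) < e" if "e > 0" for e
   by (rule NNg.tight_density(1)[OF gi _ that]) simp
  show "continuous_on UNIV w" "bounded (range w)" if "w \<in> pair_chars" for w
   using pair_chars_span[OF fspan.base[OF that]] by simp_all
  show "(\<lambda>z. g z * h z) \<in> pair_chars" if gh: "g \<in> pair_chars" "h \<in> pair_chars" for g h
  proof -
   obtain s t s' t' where "g = (\<lambda>z. char_fun (fst z) s * char_fun (snd z) t)" "h = (\<lambda>z. char_fun (fst z) s' * char_fun (snd z) t')"
    using gh by (auto simp: pair_chars_def)
   then have "(\<lambda>z. g z * h z) = (\<lambda>z. char_fun (fst z) (s + s') * char_fun (snd z) (t + t'))"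
    by (simp add: char_fun_add_arg mult_ac)
   then show ?thesis unfolding pair_chars_def by blast
  qed
  have "(\<lambda>_. 1) = (\<lambda>z :: 'g pontryagin_dual \<times> 'g pontryagin_dual. char_fun (fst z) 0 * char_fun (snd z) 0)"
   by (simp add: char_fun_zero_arg)
  then show "(\<lambda>_. 1) \<in> pair_chars" unfolding pair_chars_def by blast
  show "(\<lambda>z. cnj (w z)) \<in> pair_chars" if w: "w \<in> pair_chars" for w
  proof -
   obtain s t where "w = (\<lambda>z. char_fun (fst z) s * char_fun (snd z) t)" using w by (auto simp: pair_chars_def)
   then have "(\<lambda>z. cnj (w z)) = (\<lambda>z. char_fun (fst z) (- s) * char_fun (snd z) (- t))" by (simp add: char_fun_minus_arg)
   then show ?thesis unfolding pair_chars_def by blast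
  qed
  show "\<exists>w\<in>pair_chars. w x \<noteq> w y" if xy: "x \<noteq> y" for x y
  proof -
   have pc: "(\<lambda>z. char_fun (fst z) s * char_fun (snd z) t) \<in> pair_chars" for s t unfolding pair_chars_def by blast
   have "fst x \<noteq> fst y \<or> snd x \<noteq> snd y" using xy by (simp add: prod_eq_iff)
   then have "(\<exists>s. char_fun (fst x) s \<noteq> char_fun (fst y) s) \<or> (\<exists>t. char_fun (snd x) t \<noteq> char_fun (snd y) t)"
    by (auto simp: char_fun_inject[symmetric] fun_eq_iff)
   then show ?thesis
   proof
    assume "\<exists>s. char_fun (fst x) s \<noteq> char_fun (fst y) s"
    then obtain s where "char_fun (fst x) s \<noteq> char_fun (fst y) s" ..
    then show ?thesis
     by (intro bexI[of _ "\<lambda>z. char_fun (fst z) s * char_fun (snd z) 0"]) (simp add: char_fun_zero_arg, rule pc)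
   next
    assume "\<exists>t. char_fun (snd x) t \<noteq> char_fun (snd y) t"
    then obtain t where "char_fun (snd x) t \<noteq> char_fun (snd y) t" ..
    then show ?thesis
     by (intro bexI[of _ "\<lambda>z. char_fun (fst z) 0 * char_fun (snd z) t"]) (simp add: char_fun_zero_arg, rule pc)
   qed
  qed
 qed (use fc fb d4 in auto)
 then obtain r where r: "r \<in> fspan pair_chars" "(\<integral>z. (norm (f n z - r z))\<^sup>2 \<partial>?m) < d\<^sup>2 / 4" by blast
 note rp = pair_chars_span[OF r(1)]
 have "(\<integral>z. (norm (f n z - r z))\<^sup>2 \<partial>?m) = (\<integral>z. (gauss2 z)\<^sup>2 *\<^sub>R (norm (f n z - r z))\<^sup>2 \<partial>?N)"
  by (rule integral_density) (auto intro!: NNg.cont_meas continuous_intros fc rp gauss2_continuous AE_I2)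
 also have "\<dots> = (\<integral>z. (norm (f n z * of_real (gauss2 z) - r z * of_real (gauss2 z)))\<^sup>2 \<partial>?N)"
  by (intro Bochner_Integration.integral_cong refl)
   (simp flip: left_diff_distrib add: norm_mult power_mult_distrib mult.commute)
 finally have rn: "(\<integral>z. (norm (f n z * of_real (gauss2 z) - r z * of_real (gauss2 z)))\<^sup>2 \<partial>?N) < d\<^sup>2 / 4" using r(2) by simp
 have sf: "(\<lambda>z. f n z * of_real (gauss2 z)) \<in> sq_integrable ?N"
  unfolding fk
 proof (rule sq_integrable_bounded_mult[OF k(3)])
  show "(\<lambda>z. complex_of_real (gauss2 z / (gauss2 z + e n))) \<in> borel_measurable ?N"
   using gm by simp
  show "norm (complex_of_real (gauss2 z / (gauss2 z + e n))) \<le> 1" for z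
   unfolding norm_of_real abs_of_nonneg[OF q1(3)] by (rule q1(4))
 qed
 note s1 = sq_integrableD(2)[OF sq_integrable_diff[OF k(3) sf]] and s2 = sq_integrableD(2)[OF sq_integrable_diff[OF sf rp(3)]]
 have "(\<integral>z. (norm (k z - r z * of_real (gauss2 z)))\<^sup>2 \<partial>?N) \<le>
   (\<integral>z. 2 * (norm (k z - f n z * of_real (gauss2 z)))\<^sup>2 + 2 * (norm (f n z * of_real (gauss2 z) - r z * of_real (gauss2 z)))\<^sup>2 \<partial>?N)"
 proof (rule Bochner_Integration.integral_mono)
  show "integrable ?N (\<lambda>z. (norm (k z - r z * of_real (gauss2 z)))\<^sup>2)"
   by (rule sq_integrableD(2)[OF sq_integrable_diff[OF k(3) rp(3)]])
  show "integrable ?N (\<lambda>z. 2 * (norm (k z - f n z * of_real (gauss2 z)))\<^sup>2 + 2 * (norm (f n z * of_real (gauss2 z) - r z * of_real (gauss2 z)))\<^sup>2)"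
   using s1 s2 by (intro Bochner_Integration.integrable_add integrable_mult_right)
  fix z
  let ?u = "k z - f n z * of_real (gauss2 z)" and ?v = "f n z * of_real (gauss2 z) - r z * of_real (gauss2 z)"
  have "norm (k z - r z * of_real (gauss2 z)) \<le> norm ?u + norm ?v" using norm_triangle_ineq[of ?u ?v] by simp
  then have "(norm (k z - r z * of_real (gauss2 z)))\<^sup>2 \<le> (norm ?u + norm ?v)\<^sup>2" by (rule power_mono) simp
  also have "\<dots> \<le> 2 * (norm ?u)\<^sup>2 + 2 * (norm ?v)\<^sup>2"
   using sum_squares_bound[of "norm ?u" "norm ?v"] by (simp add: power2_sum)
  finally show "(norm (k z - r z * of_real (gauss2 z)))\<^sup>2 \<le> 2 * (norm ?u)\<^sup>2 + 2 * (norm ?v)\<^sup>2" .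
 qed
 also have "\<dots> = 2 * (\<integral>z. (norm (k z - f n z * of_real (gauss2 z)))\<^sup>2 \<partial>?N) +
   2 * (\<integral>z. (norm (f n z * of_real (gauss2 z) - r z * of_real (gauss2 z)))\<^sup>2 \<partial>?N)"
  using s1 s2 by (subst Bochner_Integration.integral_add) auto
 also have "\<dots> \<le> d\<^sup>2" using n rn by simp
 finally have "l2 ?N (\<lambda>z. k z - r z * of_real (gauss2 z)) \<le> d"
  unfolding l2_def using d real_sqrt_le_mono by fastforce
 then show ?thesis using r(1) by blast
qed

abbreviation rank_one_ops :: "(('g pontryagin_dual \<Rightarrow> complex) set \<Rightarrow> ('g pontryagin_dual \<Rightarrow> complex) set) set"
 where "rank_one_ops \<equiv> {\<lambda>c\<in>carrier (L2 \<nu>). ip (L2 \<nu>) c (L2_class \<nu> \<eta>) \<odot>\<^bsub>L2 \<nu>\<^esub> L2_class \<nu> \<xi> | \<xi> \<eta>.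
  \<xi> \<in> schwartz_space \<and> \<eta> \<in> schwartz_space}"

text \<open>The scalar c is arbitrary so that the scaling case of the induction can absorb its
  factor; \<open>rank_one_span\<close> has no clause for scalars.\<close>

lemma pair_chars_rank_one:
 assumes "r \<in> fspan pair_chars"
 shows "\<exists>R\<in>rank_one_span (L2 \<nu>) rank_one_ops. R \<in> carrier (L2 \<nu>) \<rightarrow> carrier (L2 \<nu>) \<and>
  (\<forall>x\<in>sq_integrable \<nu>. \<forall>y\<in>sq_integrable \<nu>.
   ip (L2 \<nu>) (R (L2_class \<nu> x)) (L2_class \<nu> y) = c * kform (\<lambda>z. r z * of_real (gauss2 z)) x y)"
 using assms
proof (induction arbitrary: c)
 case zero
 have "(\<lambda>c\<in>carrier (L2 \<nu>). \<zero>\<^bsub>L2 \<nu>\<^esub>) \<in> rank_one_span (L2 \<nu>) rank_one_ops" by (rule rank_one_span.zero)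
 then show ?case
  by (rule bexI[rotated]) (auto simp: kform_def L2_zero L2_ip sq_integrable_zero)
next
 case (base r)
 then obtain s t where r: "r = (\<lambda>z. char_fun (fst z) s * char_fun (snd z) t)" by (auto simp: pair_chars_def)
 \<comment> \<open>The product \<gamma>(s) \<epsilon>(t) equals (\<epsilon> + \<gamma>)(s) times the
   conjugate of \<epsilon>(s - t), which separates target and source.\<close>
 define \<xi> where "\<xi> \<epsilon> = c * (char_fun \<epsilon> s * complex_of_real (N.gauss \<epsilon>))" for \<epsilon>
 define \<eta> where "\<eta> \<epsilon> = char_fun \<epsilon> (s - t) * complex_of_real (N.gauss \<epsilon>)" for \<epsilon>
 have S: "\<xi> \<in> schwartz_space" "\<eta> \<in> schwartz_space" unfolding \<xi>_def[abs_def] \<eta>_def[abs_def]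
  by (intro schwartz_scale schwartz_mult_char N.gauss_schwartz)+
 have sq: "\<xi> \<in> sq_integrable \<nu>" "\<eta> \<in> sq_integrable \<nu>" by (intro N.schwartz_sq_integrable S)+
 let ?R = "\<lambda>c\<in>carrier (L2 \<nu>). ip (L2 \<nu>) c (L2_class \<nu> \<eta>) \<odot>\<^bsub>L2 \<nu>\<^esub> L2_class \<nu> \<xi>"
 have eq: "c * (r z * of_real (gauss2 z)) = \<xi> (snd z + fst z) * cnj (\<eta> (snd z))" for z
 proof -
  have "char_fun (snd z) s * cnj (char_fun (snd z) s) = 1" by (simp add: complex_norm_square[symmetric])
  moreover have "\<xi> (snd z + fst z) * cnj (\<eta> (snd z)) =
    (char_fun (snd z) s * cnj (char_fun (snd z) s)) * (c * (r z * of_real (gauss2 z)))"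
   by (simp add: \<xi>_def \<eta>_def r gauss2_def char_fun_add char_fun_diff_arg mult_ac)
  ultimately show ?thesis by simp
 qed
 have "?R \<in> rank_one_span (L2 \<nu>) rank_one_ops" using S by (intro rank_one_span.base) blast
 moreover have "?R \<in> carrier (L2 \<nu>) \<rightarrow> carrier (L2 \<nu>)"
  using sq by (auto simp: L2_smult intro!: L2_class_closed sq_integrable_scale)
 moreover have "ip (L2 \<nu>) (?R (L2_class \<nu> x)) (L2_class \<nu> y) = c * kform (\<lambda>z. r z * of_real (gauss2 z)) x y"
  if xy: "x \<in> sq_integrable \<nu>" "y \<in> sq_integrable \<nu>" for x y
  unfolding kform_scale[symmetric] eq kform_tensor[OF sq xy] using xy sq by (simp add: H.ip_smult L2_class_closed) (simp add: L2_ip)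
 ultimately show ?case by blast
next
 case (add f g)
 obtain R where R: "R \<in> rank_one_span (L2 \<nu>) rank_one_ops" "R \<in> carrier (L2 \<nu>) \<rightarrow> carrier (L2 \<nu>)"
  "\<And>x y. x \<in> sq_integrable \<nu> \<Longrightarrow> y \<in> sq_integrable \<nu> \<Longrightarrow>
   ip (L2 \<nu>) (R (L2_class \<nu> x)) (L2_class \<nu> y) = c * kform (\<lambda>z. f z * of_real (gauss2 z)) x y"
  using add.IH(1)[of c] by blast
 obtain S where S: "S \<in> rank_one_span (L2 \<nu>) rank_one_ops" "S \<in> carrier (L2 \<nu>) \<rightarrow> carrier (L2 \<nu>)"
  "\<And>x y. x \<in> sq_integrable \<nu> \<Longrightarrow> y \<in> sq_integrable \<nu> \<Longrightarrow>
   ip (L2 \<nu>) (S (L2_class \<nu> x)) (L2_class \<nu> y) = c * kform (\<lambda>z. g z * of_real (gauss2 z)) x y"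
  using add.IH(2)[of c] by blast
 let ?T = "\<lambda>x\<in>carrier (L2 \<nu>). R x \<oplus>\<^bsub>L2 \<nu>\<^esub> S x"
 have "?T \<in> rank_one_span (L2 \<nu>) rank_one_ops" by (rule rank_one_span.add[OF R(1) S(1)])
 moreover have cl: "R x \<in> carrier (L2 \<nu>)" "S x \<in> carrier (L2 \<nu>)" if "x \<in> carrier (L2 \<nu>)" for x
  using R(2) S(2) that by auto
 then have "?T \<in> carrier (L2 \<nu>) \<rightarrow> carrier (L2 \<nu>)" by auto
 moreover have "ip (L2 \<nu>) (?T (L2_class \<nu> x)) (L2_class \<nu> y) = c * kform (\<lambda>z. (f z + g z) * of_real (gauss2 z)) x y"
  if xy: "x \<in> sq_integrable \<nu>" "y \<in> sq_integrable \<nu>" for x y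
  unfolding distrib_right kform_add[OF pair_chars_span(3)[OF add.hyps(1)] pair_chars_span(3)[OF add.hyps(2)] xy]
  using xy cl by (simp add: H.ip_add R(3) S(3) distrib_left L2_class_closed)
 ultimately show ?case by blast
next
 case (scale f w)
 have "c * kform (\<lambda>z. w * f z * of_real (gauss2 z)) x y = c * w * kform (\<lambda>z. f z * of_real (gauss2 z)) x y" for x y
  by (simp add: mult.assoc kform_scale)
 then show ?case using scale.IH[of "c * w"] by (simp only:)
qed

lemma pi_int_approximation:
 assumes a: "a \<in> schwartz_space" and d: "d > 0"
 shows "\<exists>R\<in>rank_one_span (L2 \<nu>) rank_one_ops.
  \<forall>c\<in>carrier (L2 \<nu>). vnorm (L2 \<nu>) (pi_int \<mu> \<nu> a c \<oplus>\<^bsub>L2 \<nu>\<^esub> (-1) \<odot>\<^bsub>L2 \<nu>\<^esub> R c) \<le> d * vnorm (L2 \<nu>) c"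
proof -
 obtain r where r: "r \<in> fspan pair_chars" "l2 (\<nu> \<Otimes>\<^sub>M \<nu>) (\<lambda>z. kern a z - r z * of_real (gauss2 z)) \<le> d"
  using kernel_approximation[OF kern_continuous_bounded[OF a] kern_sq_integrable[OF a] d] by blast
 note ks = kern_sq_integrable[OF a] and rs = pair_chars_span(3)[OF r(1)]
 obtain R where R: "R \<in> rank_one_span (L2 \<nu>) rank_one_ops" "R \<in> carrier (L2 \<nu>) \<rightarrow> carrier (L2 \<nu>)"
  "\<And>x y. x \<in> sq_integrable \<nu> \<Longrightarrow> y \<in> sq_integrable \<nu> \<Longrightarrow>
   ip (L2 \<nu>) (R (L2_class \<nu> x)) (L2_class \<nu> y) = 1 * kform (\<lambda>z. r z * of_real (gauss2 z)) x y"
  using pair_chars_rank_one[OF r(1), of 1] by blast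
 have "vnorm (L2 \<nu>) (pi_int \<mu> \<nu> a c \<oplus>\<^bsub>L2 \<nu>\<^esub> (-1) \<odot>\<^bsub>L2 \<nu>\<^esub> R c) \<le> d * vnorm (L2 \<nu>) c" if c: "c \<in> carrier (L2 \<nu>)" for c
 proof -
  let ?v = "pi_int \<mu> \<nu> a c \<oplus>\<^bsub>L2 \<nu>\<^esub> (-1) \<odot>\<^bsub>L2 \<nu>\<^esub> R c"
  obtain x where x: "x \<in> sq_integrable \<nu>" "c = L2_class \<nu> x" using c by (rule L2_cases)
  have cl: "pi_int \<mu> \<nu> a c \<in> carrier (L2 \<nu>)" "R c \<in> carrier (L2 \<nu>)"
   using H.bounded_opD(2)[OF pi_int(1)[OF schwartz_G_integrable[OF a]] c] R(2) c by auto
  then have cl': "(-1) \<odot>\<^bsub>L2 \<nu>\<^esub> R c \<in> carrier (L2 \<nu>)" and v: "?v \<in> carrier (L2 \<nu>)" by auto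
  \<comment> \<open>The difference vector is tested against itself: the bound on the form then
    controls its squared norm by d times its norm and that of c, and one factor cancels.\<close>
  obtain y where y: "y \<in> sq_integrable \<nu>" "?v = L2_class \<nu> y" using v by (rule L2_cases)
  have "ip (L2 \<nu>) ?v ?v = ip (L2 \<nu>) (pi_int \<mu> \<nu> a c) ?v + (-1) * ip (L2 \<nu>) (R c) ?v"
   using cl cl' v by (simp add: H.ip_add H.ip_smult)
  also have "\<dots> = kform (\<lambda>z. kern a z - r z * of_real (gauss2 z)) x y"
   using kform_diff[OF ks rs x(1) y(1)] pi_int_kern[OF a x(1) y(1)] R(3)[OF x(1) y(1)] by (simp add: y(2)[symmetric] x(2)[symmetric])
  finally have "Re (ip (L2 \<nu>) ?v ?v) \<le> norm (kform (\<lambda>z. kern a z - r z * of_real (gauss2 z)) x y)"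
   using complex_Re_le_cmod by simp
  also have "\<dots> \<le> l2 (\<nu> \<Otimes>\<^sub>M \<nu>) (\<lambda>z. kern a z - r z * of_real (gauss2 z)) * (l2 \<nu> x * l2 \<nu> y)"
   by (rule kform_bound[OF sq_integrable_diff[OF ks rs] x(1) y(1)])
  also have "\<dots> \<le> d * (l2 \<nu> x * l2 \<nu> y)" by (intro mult_right_mono r) simp
  finally have "Re (ip (L2 \<nu>) ?v ?v) \<le> d * (l2 \<nu> x * l2 \<nu> y)" .
  then have le: "(vnorm (L2 \<nu>) ?v)\<^sup>2 \<le> d * vnorm (L2 \<nu>) c * vnorm (L2 \<nu>) ?v"
  proof -
   have "(vnorm (L2 \<nu>) ?v)\<^sup>2 = Re (ip (L2 \<nu>) ?v ?v)" using H.ip_nonneg[OF v] by (simp add: vnorm_def)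
   moreover have "vnorm (L2 \<nu>) c = l2 \<nu> x" "vnorm (L2 \<nu>) ?v = l2 \<nu> y" using x y vnorm_L2 by metis+
   ultimately show ?thesis
    using \<open>Re (ip (L2 \<nu>) ?v ?v) \<le> d * (l2 \<nu> x * l2 \<nu> y)\<close> by (simp only: mult.assoc)
  qed
  show ?thesis
  proof (cases "vnorm (L2 \<nu>) ?v = 0")
   case True
   then show ?thesis using d x by (simp add: vnorm_L2)
  next
   case False
   then have "vnorm (L2 \<nu>) ?v > 0" using y by (simp add: vnorm_L2 less_le)
   then show ?thesis using le by (simp add: power2_eq_square)
  qed
 qed
 then show ?thesis using R(1) by blast
qed

end

section \<open>Assembly of the bimodule of Schwartz functions\<close>

text \<open>The abstract construction has the rank-one operator as left product, the claim has an
  operator integral. Their agreement is known on Schwartz vectors, and the axioms evaluate the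
  product at no others.\<close>

lemma equivalence_bimodule_lprod_cong:
 assumes "equivalence_bimodule A B E lact ract lprod rprod"
  and eq: "\<And>\<xi> \<eta>. \<xi> \<in> carrier E \<Longrightarrow> \<eta> \<in> carrier E \<Longrightarrow> lprod' \<xi> \<eta> = lprod \<xi> \<eta>"
 shows "equivalence_bimodule A B E lact ract lprod' rprod"
proof -
 interpret equivalence_bimodule A B E lact ract lprod rprod by fact
 have cl: "\<xi> \<in> carrier E \<Longrightarrow> \<eta> \<in> carrier E \<Longrightarrow> \<xi> \<oplus>\<^bsub>E\<^esub> \<eta> \<in> carrier E" "\<xi> \<in> carrier E \<Longrightarrow> z \<odot>\<^bsub>E\<^esub> \<xi> \<in> carrier E" for \<xi> \<eta> z
  using module.smult_closed[OF E_vector_space] abelian_monoid.a_closed[OF abelian_group.axioms(1)[OF module.axioms(2)[OF E_vector_space]]]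
  by (auto simp: complex_ring_def)
 have sets: "{lprod' \<xi> \<eta> | \<xi> \<eta>. \<xi> \<in> carrier E \<and> \<eta> \<in> carrier E} = {lprod \<xi> \<eta> | \<xi> \<eta>. \<xi> \<in> carrier E \<and> \<eta> \<in> carrier E}"
  by (intro Collect_cong) (metis eq)
 show ?thesis
  by (rule equivalence_bimodule.intro[OF A.pre_cstar_algebra_axioms B.pre_cstar_algebra_axioms equivalence_bimodule_axioms.intro];
    (simp only: sets eq cl lact_closed ract_closed)?;
    (rule E_vector_space lact_closed lact_add_left lact_add_right lact_smult_left lact_smult_right lact_mult
     ract_closed ract_add_left ract_add_right ract_smult_left ract_smult_right ract_mult lact_ract
     lprod_closed lprod_add lprod_smult lprod_lact lprod_star lprod_pos lprod_definite
     rprod_closed rprod_add rprod_smult rprod_ract rprod_star rprod_pos rprod_definite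
     lprod_full rprod_full compatible lact_bounded ract_bounded; assumption?))
qed

lemma module_schwartz: "Module.module complex_ring (schwartz_module :: (complex, 'h::{topological_space, ab_group_add} \<Rightarrow> complex) module)"
proof (rule module.intro[OF cring_complex_ring])
 show "abelian_group (schwartz_module :: (complex, 'h \<Rightarrow> complex) module)"
 proof (rule abelian_groupI)
  fix f :: "'h \<Rightarrow> complex" assume "f \<in> carrier schwartz_module"
  then show "\<exists>g\<in>carrier schwartz_module. g \<oplus>\<^bsub>schwartz_module\<^esub> f = \<zero>\<^bsub>schwartz_module\<^esub>"
   using schwartz_scale[of f "-1"] by (intro bexI[of _ "\<lambda>x. -1 * f x"]) (auto simp: schwartz_module_def)
 qed (auto simp: schwartz_module_def schwartz_zero schwartz_add add_ac)
 show "module_axioms complex_ring (schwartz_module :: (complex, 'h \<Rightarrow> complex) module)"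
  by unfold_locales (auto simp: schwartz_module_def complex_ring_def schwartz_scale algebra_simps)
qed

context phase_space
begin

lemma rank_one_module_schwartz:
 "rank_one_module (L2 \<nu>) (pi_int \<mu> \<nu> ` schwartz_space) schwartz_module (L2_class \<nu>)"
proof (rule rank_one_module.intro[OF operator_algebra_A rank_one_module_axioms.intro])
 let ?E = "schwartz_module :: (complex, 'g pontryagin_dual \<Rightarrow> complex) module"
 have E: "carrier ?E = schwartz_space" by (simp add: schwartz_module_def)
 note sq = N.schwartz_sq_integrable
 show "Module.module complex_ring ?E" by (rule module_schwartz)
 show "inj_on (L2_class \<nu>) (carrier ?E)" unfolding E by (rule L2_class_inj)
 show "L2_class \<nu> \<xi> \<in> carrier (L2 \<nu>)" if "\<xi> \<in> carrier ?E" for \<xi>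
  using that by (auto simp: E intro: sq)
 show "L2_class \<nu> (\<xi> \<oplus>\<^bsub>?E\<^esub> \<eta>) = L2_class \<nu> \<xi> \<oplus>\<^bsub>L2 \<nu>\<^esub> L2_class \<nu> \<eta>"
  if "\<xi> \<in> carrier ?E" "\<eta> \<in> carrier ?E" for \<xi> \<eta>
  using that by (simp add: E L2_add sq) (simp add: schwartz_module_def)
 show "L2_class \<nu> (z \<odot>\<^bsub>?E\<^esub> \<xi>) = z \<odot>\<^bsub>L2 \<nu>\<^esub> L2_class \<nu> \<xi>" if "\<xi> \<in> carrier ?E" for \<xi> z
  using that by (simp add: E L2_smult sq) (simp add: schwartz_module_def)
 show "T (L2_class \<nu> \<xi>) \<in> L2_class \<nu> ` carrier ?E"
  if "T \<in> pi_int \<mu> \<nu> ` schwartz_space" "\<xi> \<in> carrier ?E" for T \<xi>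
  using that by (auto simp: E pi_int(3) schwartz_G_integrable sq intro!: imageI pi_conv_schwartz)
 show "(\<lambda>x\<in>carrier (L2 \<nu>). ip (L2 \<nu>) x (L2_class \<nu> \<eta>) \<odot>\<^bsub>L2 \<nu>\<^esub> L2_class \<nu> \<xi>) \<in> pi_int \<mu> \<nu> ` schwartz_space"
  if "\<xi> \<in> carrier ?E" "\<eta> \<in> carrier ?E" for \<xi> \<eta>
  using that coeff_fun_schwartz(1)[of \<xi> \<eta>] by (auto simp: E pi_int_rank_one[symmetric] intro!: imageI)
 show "\<exists>R\<in>rank_one_span (L2 \<nu>) {\<lambda>x\<in>carrier (L2 \<nu>). ip (L2 \<nu>) x (L2_class \<nu> \<eta>) \<odot>\<^bsub>L2 \<nu>\<^esub> L2_class \<nu> \<xi> | \<xi> \<eta>.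
    \<xi> \<in> carrier ?E \<and> \<eta> \<in> carrier ?E}.
   \<forall>x\<in>carrier (L2 \<nu>). vnorm (L2 \<nu>) (T x \<oplus>\<^bsub>L2 \<nu>\<^esub> (-1) \<odot>\<^bsub>L2 \<nu>\<^esub> R x) \<le> \<epsilon> * vnorm (L2 \<nu>) x"
  if T: "T \<in> pi_int \<mu> \<nu> ` schwartz_space" and \<epsilon>: "\<epsilon> > 0" for T \<epsilon>
 proof -
  obtain a where "a \<in> schwartz_space" "T = pi_int \<mu> \<nu> a" using T by blast
  then show ?thesis using pi_int_approximation[OF _ \<epsilon>] unfolding E by blast
 qed
 \<comment> \<open>The Gaussian is a Schwartz function with nonzero class.\<close>
 let ?e = "\<lambda>\<epsilon>. complex_of_real (N.gauss \<epsilon>)"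
 have "L2_class \<nu> ?e \<noteq> L2_class \<nu> (\<lambda>_. 0)"
 proof
  assume "L2_class \<nu> ?e = L2_class \<nu> (\<lambda>_. 0)"
  then have "?e = (\<lambda>_. 0)" using inj_onD[OF L2_class_inj _ N.gauss_schwartz schwartz_zero] by blast
  then show False using N.gauss_pos[of 0] by (auto simp: fun_eq_iff)
 qed
 then show "\<exists>\<xi>\<in>carrier ?E. L2_class \<nu> \<xi> \<noteq> \<zero>\<^bsub>L2 \<nu>\<^esub>"
  using N.gauss_schwartz unfolding E L2_zero by blast
qed

lemma equivalence_bimodule_schwartz:
 "\<exists>act.
   (\<forall>k\<in>schwartz_space. \<forall>\<xi>\<in>schwartz_space.
    act (pi_int \<mu> \<nu> k) \<xi> = (\<lambda>\<delta>. \<integral>g. k g * pi_fun g \<xi> \<delta> \<partial>(\<nu> \<Otimes>\<^sub>M \<mu>))) \<and>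
   equivalence_bimodule (A_circ \<mu> \<nu>) complex_star_algebra schwartz_module
    act (\<lambda>\<xi> z \<delta>. z * \<xi> \<delta>)
    (\<lambda>\<xi> \<eta>. pi_int \<mu> \<nu> (coeff_fun \<nu> \<eta> \<xi>))
    (\<lambda>\<xi> \<eta>. ip (L2 \<nu>) (L2_class \<nu> \<eta>) (L2_class \<nu> \<xi>))"
proof -
 let ?E = "schwartz_module :: (complex, 'g pontryagin_dual \<Rightarrow> complex) module"
 have E: "carrier ?E = schwartz_space" by (simp add: schwartz_module_def)
 interpret R: rank_one_module "L2 \<nu>" "pi_int \<mu> \<nu> ` schwartz_space" ?E "L2_class \<nu>"
  by (rule rank_one_module_schwartz)
 have A: "R.A = A_circ \<mu> \<nu>" by (simp add: R.A_def A_circ_def)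
 have sm: "(\<lambda>\<xi> z. z \<odot>\<^bsub>?E\<^esub> \<xi>) = (\<lambda>\<xi> z \<delta>. z * \<xi> \<delta>)" by (simp add: schwartz_module_def)
 have "equivalence_bimodule (A_circ \<mu> \<nu>) complex_star_algebra ?E R.act (\<lambda>\<xi> z \<delta>. z * \<xi> \<delta>)
    (\<lambda>\<xi> \<eta>. pi_int \<mu> \<nu> (coeff_fun \<nu> \<eta> \<xi>)) (\<lambda>\<xi> \<eta>. ip (L2 \<nu>) (L2_class \<nu> \<eta>) (L2_class \<nu> \<xi>))"
  by (rule equivalence_bimodule_lprod_cong[OF R.equivalence_bimodule_rank_one[unfolded A sm]])
   (simp add: E pi_int_rank_one R.\<theta>_def)
 moreover have "R.act (pi_int \<mu> \<nu> k) \<xi> = (\<lambda>\<delta>. \<integral>g. k g * pi_fun g \<xi> \<delta> \<partial>(\<nu> \<Otimes>\<^sub>M \<mu>))"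
  if "k \<in> schwartz_space" "\<xi> \<in> schwartz_space" for k \<xi>
  unfolding pi_conv_def[symmetric, abs_def]
  by (rule R.act_eqI) (simp_all add: E pi_conv_schwartz that pi_int(3) schwartz_G_integrable N.schwartz_sq_integrable)
 ultimately show ?thesis by blast
qed

end

section \<open>Groups with a lattice\<close>

lemma additive_int:
 fixes f :: "int \<Rightarrow> real"
 assumes "\<And>k l. f (k + l) = f k + f l"
 shows "f k = of_int k * f 1"
proof -
 have f0: "f 0 = 0" using assms[of 0 0] by simp
 show ?thesis
 proof (induction k rule: int_induct[where k = 0])
  case (step1 i)
  then show ?case by (simp add: assms distrib_right)
 next
  case (step2 i)
  then show ?case using assms[of "i - 1" 1] by (simp add: left_diff_distrib)
 qed (simp add: f0)
qed

text \<open>Invariance of integrals is derived directly from the Haar property, since it is used to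
  verify the weight condition of \<open>schwartz_group\<close>.\<close>

lemma haar_translate:
 fixes M :: "'h::topological_ab_group_add measure"
 assumes haar: "haar_measure M" and f: "f \<in> borel_measurable M"
 shows "(\<integral>\<^sup>+x. f (x + a) \<partial>M) = (\<integral>\<^sup>+x. f x \<partial>M)"
proof -
 have S: "sets M = sets borel" using haar by (simp add: haar_measure_def)
 have m: "(\<lambda>x. x + a) \<in> M \<rightarrow>\<^sub>M M"
  using borel_measurable_continuous_onI[of "\<lambda>x :: 'h. x + a"]
  by (simp add: measurable_cong_sets[OF S S] continuous_on_add)
 have "distr M M (\<lambda>x. x + a) = M"
 proof (rule measure_eqI)
  fix A assume "A \<in> sets (distr M M (\<lambda>x. x + a))"
  then have A: "A \<in> sets borel" "A \<in> sets M" by (simp_all add: S)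
  have "(\<lambda>x. x + a) -` A \<inter> space M = (\<lambda>y. - a + y) ` A"
   using sets_eq_imp_space_eq[OF S] by (auto intro!: image_eqI[of _ _ "_ + a"])
  then show "emeasure (distr M M (\<lambda>x. x + a)) A = emeasure M A"
   using haar A(1) emeasure_distr[OF m A(2)] by (simp only: haar_measure_def)
 qed simp
 then show ?thesis using nn_integral_distr[OF m, of f] f by (simp only: measurable_distr_eq1)
qed

lemma closed_cube:
 fixes P :: "nat \<Rightarrow> 'h::{topological_space, ab_group_add} \<Rightarrow> real"
 assumes "\<And>i. i < n \<Longrightarrow> real_hom (P i)"
 shows "closed {x. \<forall>i<n. \<bar>P i x\<bar> \<le> c}"
proof -
 have eq: "{x. \<forall>i<n. \<bar>P i x\<bar> \<le> c} = (\<Inter>i\<in>{..<n}. {x. \<bar>P i x\<bar> \<le> c})" by auto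
 show ?thesis unfolding eq
  by (intro closed_INT ballI closed_Collect_le continuous_on_rabs real_hom_continuous continuous_on_const assms) simp
qed

text \<open>
 The translates by the lattice of the cube \<open>0 \<le> P i < 1\<close> tile the group, which bounds the
 integral of the weight by a convergent product of sums over the integers, one coordinate at a time.
\<close>

lemma lattice_weight_finite:
 fixes M :: "'h::topological_ab_group_add measure" and P :: "nat \<Rightarrow> 'h \<Rightarrow> real" and b :: "nat \<Rightarrow> int \<Rightarrow> 'h"
 assumes haar: "haar_measure M"
  and P: "\<And>i. i < n \<Longrightarrow> real_hom (P i)"
  and Pb: "\<And>i j k. i < n \<Longrightarrow> j < n \<Longrightarrow> P i (b j k) = (if i = j then of_int k else 0)"
  and K: "compact {x. \<forall>i<n. \<bar>P i x\<bar> \<le> 1}"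
 shows "(\<integral>\<^sup>+x. ennreal (\<Prod>i<n. 1 / (1 + (P i x)\<^sup>2)) \<partial>M) < \<infinity>"
proof -
 have S: "sets M = sets borel" using haar by (simp add: haar_measure_def)
 have Pm: "P i \<in> borel_measurable M" if "i < n" for i
  using borel_measurable_continuous_onI[OF real_hom_continuous[OF P[OF that]]] by (simp add: measurable_cong_sets[OF S refl])
 define u :: "nat \<Rightarrow> 'h \<Rightarrow> ennreal" where "u i x = ennreal (1 / (1 + (P i x)\<^sup>2))" for i x
 define v :: "nat \<Rightarrow> 'h \<Rightarrow> ennreal" where "v i x = indicator {0..<1} (P i x)" for i x
 have um: "u i \<in> borel_measurable M" if "i < n" for i unfolding u_def using Pm[OF that] by measurable
 have vm: "v i \<in> borel_measurable M" if "i < n" for i unfolding v_def using Pm[OF that] by measurable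
 \<comment> \<open>The first j coordinates carry the weight and the others are confined to [0, 1).
   So \<open>F 0\<close> is the indicator of the half-open cube and \<open>F n\<close> the full
   weight.\<close>
 define F where "F j x = (\<Prod>i<j. u i x) * (\<Prod>i\<in>{j..<n}. v i x)" for j x
 have Fm: "F j \<in> borel_measurable M" if "j \<le> n" for j
  unfolding F_def using that um vm by (intro borel_measurable_times_ennreal borel_measurable_prod_ennreal) auto
 \<comment> \<open>The factor 3 pays for rounding: m \<le> |P j x| + 1 gives 1 + m^2 \<le> 3 (1 + (P
   j x)^2).\<close>
 define g :: "nat \<Rightarrow> ennreal" where "g m = ennreal (3 / (1 + (real m)\<^sup>2))" for m
 have gfin: "(\<Sum>m. g m) < \<infinity>"
 proof -
  have "summable (\<lambda>m. 3 / (1 + (real m)\<^sup>2))"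
  proof (rule summable_comparison_test'[where N = 0])
   show "summable (\<lambda>m. 6 * inverse ((real (Suc m))\<^sup>2))"
   proof (rule summable_mult)
    have "summable (\<lambda>m. inverse ((real m)\<^sup>2))" by (rule inverse_power_summable) simp
    then show "summable (\<lambda>m. inverse ((real (Suc m))\<^sup>2))"
     by (simp only: summable_Suc_iff[of "\<lambda>m. inverse ((real m)\<^sup>2)"])
   qed
   fix m :: nat
   have "(real m + 1)\<^sup>2 \<le> 2 * (1 + (real m)\<^sup>2)"
    using sum_squares_bound[of "real m" 1] by (simp add: power2_eq_square algebra_simps)
   then have "(2 * 3) / (2 * (1 + (real m)\<^sup>2)) \<le> (2 * 3) / (real m + 1)\<^sup>2" by (intro frac_le) auto
   moreover have "(2 * 3) / (2 * (1 + (real m)\<^sup>2)) = 3 / (1 + (real m)\<^sup>2)"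
    by (rule mult_divide_mult_cancel_left) simp
   ultimately have "3 / (1 + (real m)\<^sup>2) \<le> (2 * 3) / (real m + 1)\<^sup>2" by (simp only:)
   then show "norm (3 / (1 + (real m)\<^sup>2)) \<le> 6 * inverse ((real (Suc m))\<^sup>2)"
    using abs_of_nonneg[of "3 / (1 + (real m)\<^sup>2)"] by (simp add: divide_inverse[symmetric] add.commute)
  qed
  then have "(\<Sum>m. g m) = ennreal (\<Sum>m. 3 / (1 + (real m)\<^sup>2))" unfolding g_def by (intro suminf_ennreal2) simp_all
  then show ?thesis by simp
 qed
 \<comment> \<open>With k the floor of P j x, the lattice element of index -k moves coordinate j
   into [0, 1) and leaves the others fixed. The sum runs over m = |k| and lists both signs.\<close>
 have step: "F (Suc j) x \<le> (\<Sum>m. g m * (F j (x + b j (int m)) + F j (x + b j (- int m))))" if j: "j < n" for j x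
 proof -
  define k where "k = \<lfloor>P j x\<rfloor>"
  define m where "m = nat \<bar>k\<bar>"
  have Pi: "P i (x + b j (- k)) = (if i = j then P j x - of_int k else P i x)" if "i < n" for i
   using Pb[OF that j] by (simp add: real_hom_add[OF P[OF that]])
  have "1 / (1 + (P j x)\<^sup>2) \<le> 3 / (1 + (real m)\<^sup>2)"
  proof -
   have "\<bar>of_int k\<bar> \<le> \<bar>P j x\<bar> + 1" unfolding k_def by linarith
   then have "(real m)\<^sup>2 \<le> (\<bar>P j x\<bar> + 1)\<^sup>2" unfolding m_def by (intro power_mono) auto
   also have "\<dots> \<le> 2 * (P j x)\<^sup>2 + 2"
    using sum_squares_bound[of "\<bar>P j x\<bar>" 1] by (simp add: power2_eq_square algebra_simps)
   finally have "(real m)\<^sup>2 \<le> 2 * (P j x)\<^sup>2 + 2" .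
   moreover have "1 + a \<le> 3 * (1 + b)" if "a \<le> 2 * b + 2" "0 \<le> b" for a b :: real using that by simp
   ultimately have "1 + (real m)\<^sup>2 \<le> 3 * (1 + (P j x)\<^sup>2)" using zero_le_power2 by blast
   then have "(3 * 1) / (3 * (1 + (P j x)\<^sup>2)) \<le> 3 / (1 + (real m)\<^sup>2)"
    unfolding mult_1_right by (intro frac_le) (auto intro: add_pos_nonneg)
   moreover have "(3 * 1) / (3 * (1 + (P j x)\<^sup>2)) = 1 / (1 + (P j x)\<^sup>2)"
    by (rule mult_divide_mult_cancel_left) simp
   ultimately show ?thesis by (simp only:)
  qed
  then have ug: "u j x \<le> g m" unfolding u_def g_def by (rule ennreal_leI)
  have 1: "F (Suc j) x \<le> g m * F j (x + b j (- k))"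
  proof -
   have "(\<Prod>i<j. u i (x + b j (- k))) = (\<Prod>i<j. u i x)" using j by (intro prod.cong) (simp_all add: u_def Pi)
   moreover have "(\<Prod>i\<in>{j..<n}. v i (x + b j (- k))) = (\<Prod>i\<in>{Suc j..<n}. v i x)"
   proof -
    have "P j x - of_int k \<in> {0..<1}" unfolding k_def atLeastLessThan_iff by linarith
    then have "v j (x + b j (- k)) = 1" unfolding v_def Pi[OF j] by simp
    moreover have "(\<Prod>i\<in>{Suc j..<n}. v i (x + b j (- k))) = (\<Prod>i\<in>{Suc j..<n}. v i x)"
     by (intro prod.cong) (simp_all add: v_def Pi)
    ultimately show ?thesis using prod.atLeast_Suc_lessThan[OF j, of "\<lambda>i. v i (x + b j (- k))"] by simp
   qed
   ultimately have "F j (x + b j (- k)) = (\<Prod>i<j. u i x) * (\<Prod>i\<in>{Suc j..<n}. v i x)" by (simp add: F_def)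
   moreover have "F (Suc j) x = u j x * ((\<Prod>i<j. u i x) * (\<Prod>i\<in>{Suc j..<n}. v i x))" by (simp add: F_def mult_ac)
   ultimately show ?thesis using mult_right_mono[OF ug, of "(\<Prod>i<j. u i x) * (\<Prod>i\<in>{Suc j..<n}. v i x)"] by simp
  qed
  also have "\<dots> \<le> g m * (F j (x + b j (int m)) + F j (x + b j (- int m)))"
  proof (rule mult_left_mono)
   show "F j (x + b j (- k)) \<le> F j (x + b j (int m)) + F j (x + b j (- int m))"
    by (cases "k \<ge> 0") (simp_all add: m_def)
  qed simp
  also have "\<dots> \<le> (\<Sum>m. g m * (F j (x + b j (int m)) + F j (x + b j (- int m))))"
   using sum_le_suminf[of "\<lambda>m. g m * (F j (x + b j (int m)) + F j (x + b j (- int m)))" "{m}"] by simp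
  finally show ?thesis .
 qed
 have "(\<integral>\<^sup>+x. F j x \<partial>M) < \<infinity>" if "j \<le> n" for j using that
 proof (induction j)
  case 0
  have F0: "F 0 x \<le> indicator {x. \<forall>i<n. \<bar>P i x\<bar> \<le> 1} x" for x
  proof (cases "\<forall>i<n. P i x \<in> {0..<1}")
   case True
   then have "v i x = 1" if "i < n" for i using that unfolding v_def by (simp only: indicator_simps)
   then have "(\<Prod>i\<in>{0..<n}. v i x) = 1" by (intro prod.neutral) auto
   then have "F 0 x = 1" unfolding F_def lessThan_0 prod.empty mult_1 .
   moreover have "\<bar>P i x\<bar> \<le> 1" if "i < n" for i using True[rule_format, OF that] by auto
   ultimately show ?thesis by simp
  next
   case False
   then obtain i where i: "i < n" "P i x \<notin> {0..<1}" by blast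
   then have "v i x = 0" unfolding v_def by simp
   then have "(\<Prod>i\<in>{0..<n}. v i x) = 0" using i(1) by (intro prod_zero) auto
   then have "F 0 x = 0" unfolding F_def lessThan_0 prod.empty mult_1 .
   then show ?thesis by simp
  qed
  have Km: "{x. \<forall>i<n. \<bar>P i x\<bar> \<le> 1} \<in> sets M" unfolding S by (intro borel_closed closed_cube P)
  have "(\<integral>\<^sup>+x. F 0 x \<partial>M) \<le> (\<integral>\<^sup>+x. indicator {x. \<forall>i<n. \<bar>P i x\<bar> \<le> 1} x \<partial>M)" by (rule nn_integral_mono) (rule F0)
  also have "(\<integral>\<^sup>+x. indicator {x. \<forall>i<n. \<bar>P i x\<bar> \<le> 1} x \<partial>M) = emeasure M {x. \<forall>i<n. \<bar>P i x\<bar> \<le> 1}"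
   by (rule nn_integral_indicator[OF Km])
  also have "\<dots> < \<infinity>" using haar K unfolding haar_measure_def by blast
  finally show ?case .
 next
  case (Suc j)
  then have j: "j < n" "j \<le> n" by auto
  note F = Fm[OF j(2)]
  have Ft: "(\<lambda>x. F j (x + a)) \<in> borel_measurable M" for a
  proof -
   have "(\<lambda>x. x + a) \<in> M \<rightarrow>\<^sub>M M"
    using borel_measurable_continuous_onI[of "\<lambda>x :: 'h. x + a"]
    by (simp add: measurable_cong_sets[OF S S] continuous_on_add)
   from measurable_compose[OF this F] show ?thesis .
  qed
  have "(\<integral>\<^sup>+x. F (Suc j) x \<partial>M) \<le> (\<integral>\<^sup>+x. (\<Sum>m. g m * (F j (x + b j (int m)) + F j (x + b j (- int m)))) \<partial>M)"
   by (intro nn_integral_mono step j)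
  also have "\<dots> = (\<Sum>m. \<integral>\<^sup>+x. g m * (F j (x + b j (int m)) + F j (x + b j (- int m))) \<partial>M)"
   using Ft by (intro nn_integral_suminf) simp
  also have "\<dots> = (\<Sum>m. g m * (2 * (\<integral>\<^sup>+x. F j x \<partial>M)))"
   using Ft by (simp add: nn_integral_cmult nn_integral_add haar_translate[OF haar F] mult_2)
  also have "\<dots> = (\<Sum>m. g m) * (2 * (\<integral>\<^sup>+x. F j x \<partial>M))" by (rule ennreal_suminf_multc)
  also have "\<dots> < \<infinity>" using gfin Suc.IH[OF j(2)] by (simp add: ennreal_mult_less_top)
  finally show ?case .
 qed
 from this[of n] show ?thesis
 proof -
  have "F n x = ennreal (\<Prod>i<n. 1 / (1 + (P i x)\<^sup>2))" for x
   unfolding F_def u_def by (simp add: prod_ennreal add_nonneg_nonneg)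
  then show ?thesis using \<open>n \<le> n \<Longrightarrow> (\<integral>\<^sup>+x. F n x \<partial>M) < \<infinity>\<close> by simp
 qed
qed

text \<open>Subtracting the lattice point formed from the floors of the coordinates moves every x
  into the compact cube. A sublevel set therefore meets only finitely many translates of the cube,
  and a real homomorphism is bounded on the cube and linear on the lattice, which gives the growth
  bound.\<close>

lemma schwartz_group_lattice:
 fixes M :: "'h::topological_ab_group_add measure" and P :: "nat \<Rightarrow> 'h \<Rightarrow> real" and b :: "nat \<Rightarrow> int \<Rightarrow> 'h"
 assumes haar: "haar_measure M" and basis: "countably_based TYPE('h)"
  and P: "\<And>i. i < n \<Longrightarrow> real_hom (P i)"
  and b_add: "\<And>i k l. i < n \<Longrightarrow> b i (k + l) = b i k + b i l"
  and Pb: "\<And>i j k. i < n \<Longrightarrow> j < n \<Longrightarrow> P i (b j k) = (if i = j then of_int k else 0)"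
  and K: "compact {x. \<forall>i<n. \<bar>P i x\<bar> \<le> 1}"
 shows "schwartz_group M (map P [0..<n])"
proof
 let ?K = "{x. \<forall>i<n. \<bar>P i x\<bar> \<le> 1}"
 define \<beta> where "\<beta> \<kappa> = (\<Sum>i<n. b i (\<kappa> i))" for \<kappa>
 have hs: "p (sum f A) = (\<Sum>i\<in>A. p (f i))" if "real_hom p" for p :: "'h \<Rightarrow> real" and f and A :: "nat set"
  by (induction A rule: infinite_finite_induct) (simp_all add: real_hom_0[OF that] real_hom_add[OF that])
 have P\<beta>: "P i (\<beta> \<kappa>) = of_int (\<kappa> i)" if "i < n" for i \<kappa>
 proof -
  have "P i (\<beta> \<kappa>) = (\<Sum>j<n. P i (b j (\<kappa> j)))" unfolding \<beta>_def by (rule hs[OF P[OF that]])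
  also have "\<dots> = (\<Sum>j<n. if i = j then of_int (\<kappa> j) else 0)" using that by (intro sum.cong) (simp_all add: Pb)
  also have "\<dots> = of_int (\<kappa> i)" using that by simp
  finally show ?thesis .
 qed
 define fl where "fl x i = \<lfloor>P i x\<rfloor>" for x i
 have red: "x - \<beta> (fl x) \<in> ?K" for x
 proof -
  have "\<bar>P i (x - \<beta> (fl x))\<bar> \<le> 1" if "i < n" for i
  proof -
   have "P i (x - \<beta> (fl x)) = P i x - of_int \<lfloor>P i x\<rfloor>"
    by (simp add: real_hom_diff[OF P[OF that]] P\<beta>[OF that] fl_def)
   then show ?thesis by linarith
  qed
  then show ?thesis by blast
 qed
 show "sets M = sets borel" "\<And>A x. A \<in> sets borel \<Longrightarrow> emeasure M ((\<lambda>y. x + y) ` A) = emeasure M A"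
  "\<And>U. open U \<Longrightarrow> U \<noteq> {} \<Longrightarrow> 0 < emeasure M U"
  using haar by (auto simp: haar_measure_def)
 show "list_all real_hom (map P [0..<n])" using P by (auto simp: list_all_iff)
 show "countably_based TYPE('h)" by (rule basis)
 have "(\<Prod>p\<leftarrow>map P [0..<n]. 1 / (1 + (p x)\<^sup>2)) = (\<Prod>i<n. 1 / (1 + (P i x)\<^sup>2))" for x
  using prod.distinct_set_conv_list[of "[0..<n]" "\<lambda>i. 1 / (1 + (P i x)\<^sup>2)"] by (simp add: o_def atLeast0LessThan)
 then show "(\<integral>\<^sup>+x. ennreal (\<Prod>p\<leftarrow>map P [0..<n]. 1 / (1 + (p x)\<^sup>2)) \<partial>M) < \<infinity>"
  using lattice_weight_finite[OF haar P Pb K] by simp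
 show "compact {x. \<forall>p\<in>set (map P [0..<n]). \<bar>p x\<bar> \<le> c}" for c
 proof -
  let ?C = "{x. \<forall>p\<in>set (map P [0..<n]). \<bar>p x\<bar> \<le> c}"
  \<comment> \<open>Restricting floor vectors to indices below n makes the set finite; entries
    beyond n do not enter \<beta>.\<close>
  define I where "I = PiE {..<n} (\<lambda>_. {\<lfloor>- c\<rfloor>..\<lfloor>c\<rfloor>})"
  have "?C = {x. \<forall>i<n. \<bar>P i x\<bar> \<le> c}" by auto
  then have cl: "closed ?C" by (simp only: closed_cube[OF P])
  have U: "compact (\<Union>\<kappa>\<in>I. (\<lambda>x. x + \<beta> \<kappa>) ` ?K)"
   unfolding I_def by (intro compact_UN finite_PiE compact_continuous_image continuous_intros K) auto
  have sub: "?C \<subseteq> (\<Union>\<kappa>\<in>I. (\<lambda>x. x + \<beta> \<kappa>) ` ?K)"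
  proof
   fix x assume x: "x \<in> ?C"
   let ?\<kappa> = "restrict (fl x) {..<n}"
   have "\<beta> ?\<kappa> = \<beta> (fl x)" unfolding \<beta>_def by (intro sum.cong) auto
   then have "x \<in> (\<lambda>x. x + \<beta> ?\<kappa>) ` ?K" using red[of x] by (intro image_eqI[of _ _ "x - \<beta> (fl x)"]) auto
   moreover have "?\<kappa> \<in> I"
   proof -
    have "fl x i \<in> {\<lfloor>- c\<rfloor>..\<lfloor>c\<rfloor>}" if "i < n" for i
    proof -
     have "\<bar>P i x\<bar> \<le> c" using x that by simp
     then have "- c \<le> P i x" "P i x \<le> c" by linarith+
     then show ?thesis unfolding fl_def by (simp add: floor_mono)
    qed
    then show ?thesis unfolding I_def by (simp add: PiE_iff)
   qed
   ultimately show "x \<in> (\<Union>\<kappa>\<in>I. (\<lambda>x. x + \<beta> \<kappa>) ` ?K)" by blast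
  qed
  from compact_Int_closed[OF U cl] show ?thesis unfolding Int_absorb1[OF sub] .
 qed
 fix p :: "'h \<Rightarrow> real" assume p: "real_hom p"
 have "bounded (p ` ?K)"
  by (intro compact_imp_bounded compact_continuous_image continuous_on_subset[OF real_hom_continuous[OF p]] K) simp
 then obtain B where B: "\<And>x. x \<in> ?K \<Longrightarrow> \<bar>p x\<bar> \<le> B" by (auto simp: bounded_iff)
 have B0: "B \<ge> 0" using B[OF red[of 0]] by linarith
 define D where "D = (\<Sum>i<n. \<bar>p (b i 1)\<bar>)"
 have D0: "D \<ge> 0" by (simp add: D_def sum_nonneg)
 have "\<bar>p x\<bar> \<le> (B + D) * (1 + (\<Sum>q\<leftarrow>map P [0..<n]. \<bar>q x\<bar>))" for x
 proof -
  let ?S = "\<Sum>i<n. \<bar>P i x\<bar>"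
  have S: "(\<Sum>q\<leftarrow>map P [0..<n]. \<bar>q x\<bar>) = ?S"
   using sum.distinct_set_conv_list[of "[0..<n]" "\<lambda>i. \<bar>P i x\<bar>"] by (simp add: o_def atLeast0LessThan)
  have Si: "\<bar>P i x\<bar> \<le> ?S" if "i < n" for i using member_le_sum[of i "{..<n}" "\<lambda>i. \<bar>P i x\<bar>"] that by simp
  have "p (\<beta> (fl x)) = (\<Sum>i<n. of_int (fl x i) * p (b i 1))" unfolding \<beta>_def hs[OF p]
  proof (intro sum.cong refl)
   fix i assume "i \<in> {..<n}"
   then show "p (b i (fl x i)) = of_int (fl x i) * p (b i 1)"
    by (intro additive_int[of "\<lambda>k. p (b i k)"]) (simp add: b_add real_hom_add[OF p])
  qed
  then have "\<bar>p (\<beta> (fl x))\<bar> \<le> (\<Sum>i<n. \<bar>of_int (fl x i) * p (b i 1)\<bar>)" using sum_abs by simp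
  also have "\<dots> \<le> (\<Sum>i<n. (1 + ?S) * \<bar>p (b i 1)\<bar>)"
  proof (rule sum_mono)
   fix i assume "i \<in> {..<n}"
   then have "\<bar>real_of_int (fl x i)\<bar> \<le> 1 + ?S" using Si[of i] unfolding fl_def by auto linarith
   then show "\<bar>of_int (fl x i) * p (b i 1)\<bar> \<le> (1 + ?S) * \<bar>p (b i 1)\<bar>" by (simp add: abs_mult mult_right_mono)
  qed
  also have "\<dots> = D * (1 + ?S)" unfolding D_def sum_distrib_right by (simp only: mult.commute)
  finally have "\<bar>p (\<beta> (fl x))\<bar> \<le> D * (1 + ?S)" .
  moreover have "p x = p (x - \<beta> (fl x)) + p (\<beta> (fl x))" by (simp flip: real_hom_add[OF p])
  moreover have "\<bar>p (x - \<beta> (fl x))\<bar> \<le> B" by (rule B[OF red])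
  moreover have "B \<le> B * (1 + ?S)" using B0 by (simp add: sum_nonneg algebra_simps)
  ultimately show ?thesis unfolding S distrib_right by linarith
 qed
 then show "\<exists>C. \<forall>x. \<bar>p x\<bar> \<le> C * (1 + (\<Sum>q\<leftarrow>map P [0..<n]. \<bar>q x\<bar>))" by blast
qed

section \<open>Coordinates on an elementary group and its dual\<close>

lemma compact_product_set:
 fixes S :: "'i \<Rightarrow> 'a::topological_space set"
 assumes "\<And>i. compact (S i)"
 shows "compact {f. \<forall>i. f i \<in> S i}"
proof -
 have "compactin (product_topology (\<lambda>i. euclidean) UNIV) (PiE UNIV S)"
  using assms by (subst compactin_PiE) auto
 then show ?thesis by (simp add: euclidean_product_topology PiE_def Pi_def)
qed

lemma norm_mult_diff_one: "norm a = 1 \<Longrightarrow> norm (a * b - 1) \<le> norm (a - 1) + norm (b - (1 :: complex))"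
proof -
 assume a: "norm a = 1"
 have eq: "a * b - 1 = a * (b - 1) + (a - 1)" by (simp add: algebra_simps)
 show ?thesis unfolding eq using norm_triangle_ineq[of "a * (b - 1)" "a - 1"] by (simp add: norm_mult a del: diff_add_cancel add_diff_eq)
qed

text \<open>
 On a family of characters that is Lipschitz along one-parameter subgroups spanning a neighbourhood
 of \<open>0\<close>, pointwise and uniform convergence on compact sets agree, so Tychonoff's theorem applies.
\<close>

lemma compact_equicontinuous_characters:
 fixes X :: "nat \<Rightarrow> real \<Rightarrow> 'g::topological_ab_group_add"
 assumes small: "\<And>\<epsilon>. \<epsilon> > 0 \<Longrightarrow> \<forall>\<^sub>F x in nhds 0. \<exists>s. x = (\<Sum>i<n. X i (s i)) \<and> (\<forall>i<n. \<bar>s i\<bar> < \<epsilon>)"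
 shows "compact {\<gamma>. \<forall>i<n. \<forall>s. norm (char_fun \<gamma> (X i s) - 1) \<le> \<bar>s\<bar>}"
proof -
 \<comment> \<open>Continuity is left out because it is not closed under pointwise limits; the
   Lipschitz bounds restore it afterwards.\<close>
 define T :: "('g \<Rightarrow> complex) set" where "T = {\<phi>. (\<forall>x. norm (\<phi> x) = 1) \<and> (\<forall>x y. \<phi> (x + y) = \<phi> x * \<phi> y) \<and>
  (\<forall>i\<in>{..<n}. \<forall>s. norm (\<phi> (X i s) - 1) \<le> \<bar>s\<bar>)}"
 have T: "norm (\<phi> x) = 1" "\<phi> (x + y) = \<phi> x * \<phi> y" "i < n \<Longrightarrow> norm (\<phi> (X i s) - 1) \<le> \<bar>s\<bar>" if "\<phi> \<in> T" for \<phi> x y i s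
  using that by (auto simp: T_def)
 have "closed T"
 proof -
  have "T = (\<Inter>x. {\<phi>. norm (\<phi> x) = 1}) \<inter> (\<Inter>x. \<Inter>y. {\<phi>. \<phi> (x + y) = \<phi> x * \<phi> y}) \<inter>
    (\<Inter>i\<in>{..<n}. \<Inter>s. {\<phi>. norm (\<phi> (X i s) - 1) \<le> \<bar>s\<bar>})" by (auto simp: T_def)
  moreover have "closed \<dots>"
   by (intro closed_Int closed_INT ballI closed_Collect_eq closed_Collect_le continuous_intros continuous_on_product_coordinates)
  ultimately show ?thesis by simp
 qed
 moreover have "T \<subseteq> {f. \<forall>x. f x \<in> sphere 0 1}" using T(1) by auto
 moreover have "compact {f :: 'g \<Rightarrow> complex. \<forall>x. f x \<in> sphere 0 1}" by (rule compact_product_set) simp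
 ultimately have "compact T" using compact_Int_closed by (metis Int_absorb1)
 \<comment> \<open>Equicontinuity at 0: a point near 0 is a sum of n steps of parameter below
   \<epsilon>/(n + 1), and the deviations from 1 add up along it. Adding 1 to n keeps the bound
   strict and covers n = 0.\<close>
 have nb: "\<forall>\<^sub>F u in nhds 0. \<forall>\<phi>\<in>T. norm (\<phi> u - 1) < \<epsilon>" if \<epsilon>: "\<epsilon> > 0" for \<epsilon>
 proof -
  have "\<epsilon> / (real n + 1) > 0" using \<epsilon> by simp
  from small[OF this] show ?thesis
  proof eventually_elim
   case (elim u)
   then obtain s where s: "u = (\<Sum>i<n. X i (s i))" "\<And>i. i < n \<Longrightarrow> \<bar>s i\<bar> < \<epsilon> / (real n + 1)" by blast
   show ?case
   proof
    fix \<phi> assume \<phi>: "\<phi> \<in> T"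
    have "\<phi> 0 * \<phi> 0 = \<phi> 0" using T(2)[OF \<phi>, of 0 0] by simp
    then have \<phi>0: "\<phi> 0 = 1" using T(1)[OF \<phi>, of 0] by auto
    have "norm (\<phi> (\<Sum>i<m. X i (s i)) - 1) \<le> (\<Sum>i<m. \<bar>s i\<bar>)" if "m \<le> n" for m using that
    proof (induction m)
     case (Suc m)
     have "norm (\<phi> (\<Sum>i<Suc m. X i (s i)) - 1) \<le> norm (\<phi> (\<Sum>i<m. X i (s i)) - 1) + norm (\<phi> (X m (s m)) - 1)"
      using norm_mult_diff_one[OF T(1)[OF \<phi>]] by (simp add: T(2)[OF \<phi>])
     then show ?case using Suc T(3)[OF \<phi>, of m "s m"] by simp
    qed (simp add: \<phi>0)
    from this[of n] have "norm (\<phi> u - 1) \<le> (\<Sum>i<n. \<bar>s i\<bar>)" by (simp add: s(1))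
    also have "\<dots> \<le> (\<Sum>i<n. \<epsilon> / (real n + 1))" using s(2) by (intro sum_mono) (simp add: less_imp_le)
    also have "\<dots> < \<epsilon>" using \<epsilon> by (simp add: divide_simps)
    finally show "norm (\<phi> u - 1) < \<epsilon>" .
   qed
  qed
 qed
 have T_cont: "continuous_on UNIV \<phi>" if \<phi>: "\<phi> \<in> T" for \<phi>
  unfolding continuous_on_UNIV_nhds
 proof (intro allI tendstoI)
  fix x :: 'g and \<epsilon> :: real assume \<epsilon>: "\<epsilon> > 0"
  have "continuous_on UNIV (\<lambda>y. y - x)" by (intro continuous_intros)
  then have "((\<lambda>y. y - x) \<longlongrightarrow> x - x) (nhds x)" unfolding continuous_on_UNIV_nhds by blast
  then have "filterlim (\<lambda>y. y - x) (nhds 0) (nhds x)" by simp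
  from eventually_compose_filterlim[OF nb[OF \<epsilon>] this]
  show "\<forall>\<^sub>F y in nhds x. dist (\<phi> y) (\<phi> x) < \<epsilon>"
  proof eventually_elim
   case (elim y)
   have "\<phi> y = \<phi> x * \<phi> (y - x)" by (simp flip: T(2)[OF \<phi>])
   then have "\<phi> y - \<phi> x = \<phi> x * (\<phi> (y - x) - 1)" by (simp add: right_diff_distrib)
   then show ?case using elim \<phi> by (simp add: dist_norm norm_mult T(1))
  qed
 qed
 have Abs: "char_fun (Abs_char \<phi>) = \<phi>" if "\<phi> \<in> T" for \<phi>
  using T_cont[OF that] T[OF that] by (intro Abs_char_inverse) auto
 have "continuous_on T Abs_char"
  unfolding continuous_on_def tendsto_dual_iff
 proof (intro ballI allI impI)
  fix \<phi> and K :: "'g set" and \<epsilon> :: real assume \<phi>: "\<phi> \<in> T" and K: "compact K" and \<epsilon>: "\<epsilon> > 0"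
  \<comment> \<open>One third for the values at the finitely many centres X0, and one for each of
    the two characters near 0.\<close>
  have "\<epsilon> / 3 > 0" using \<epsilon> by simp
  from nb[OF this] obtain U where U: "open U" "0 \<in> U" "\<And>u \<phi>. u \<in> U \<Longrightarrow> \<phi> \<in> T \<Longrightarrow> norm (\<phi> u - 1) < \<epsilon> / 3"
   unfolding eventually_nhds by blast
  obtain X0 where X0: "X0 \<subseteq> K" "finite X0" "K \<subseteq> (\<Union>x\<in>X0. (\<lambda>y. y - x) -` U)"
  proof (rule compactE_image[OF K])
   show "open ((\<lambda>y. y - x) -` U)" for x by (intro open_vimage U continuous_intros)
   show "K \<subseteq> (\<Union>x\<in>K. (\<lambda>y. y - x) -` U)" using U(2) by auto
  qed blast
  have "\<forall>\<^sub>F \<psi> in at \<phi> within T. dist (\<psi> x) (\<phi> x) < \<epsilon> / 3" for x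
  proof (rule tendstoD)
   show "((\<lambda>\<psi>. \<psi> x) \<longlongrightarrow> \<phi> x) (at \<phi> within T)"
    using continuous_on_subset[OF continuous_on_product_coordinates[of x], of T] \<phi> by (simp add: continuous_on_def)
  qed (use \<epsilon> in simp)
  then have "\<forall>\<^sub>F \<psi> in at \<phi> within T. \<forall>x\<in>X0. dist (\<psi> x) (\<phi> x) < \<epsilon> / 3"
   by (intro eventually_ball_finite X0) blast
  moreover have "\<forall>\<^sub>F \<psi> in at \<phi> within T. \<psi> \<in> T" by (auto simp: eventually_at_topological)
  ultimately show "\<forall>\<^sub>F \<psi> in at \<phi> within T. \<forall>x\<in>K. norm (char_fun (Abs_char \<psi>) x - char_fun (Abs_char \<phi>) x) < \<epsilon>"
  proof eventually_elim
   case (elim \<psi>)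
   show ?case
   proof
    fix x assume "x \<in> K"
    then obtain y where y: "y \<in> X0" "x - y \<in> U" using X0(3) by auto
    have "\<psi> x - \<phi> x = (\<psi> y - \<phi> y) * \<psi> (x - y) + \<phi> y * ((\<psi> (x - y) - 1) - (\<phi> (x - y) - 1))"
    proof -
     have "\<psi> x = \<psi> y * \<psi> (x - y)" "\<phi> x = \<phi> y * \<phi> (x - y)" using T(2)[OF \<open>\<psi> \<in> T\<close>, of y "x - y"] T(2)[OF \<phi>, of y "x - y"] by simp_all
     then show ?thesis by (simp add: algebra_simps)
    qed
    then have "norm (\<psi> x - \<phi> x) \<le> norm (\<psi> y - \<phi> y) + norm ((\<psi> (x - y) - 1) - (\<phi> (x - y) - 1))"
     using norm_triangle_ineq[of "(\<psi> y - \<phi> y) * \<psi> (x - y)" "\<phi> y * ((\<psi> (x - y) - 1) - (\<phi> (x - y) - 1))"]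
     by (simp add: norm_mult T(1)[OF \<phi>] T(1)[OF \<open>\<psi> \<in> T\<close>])
    also have "norm ((\<psi> (x - y) - 1) - (\<phi> (x - y) - 1)) \<le> norm (\<psi> (x - y) - 1) + norm (\<phi> (x - y) - 1)"
     by (rule norm_triangle_ineq4)
    finally have "norm (\<psi> x - \<phi> x) \<le> norm (\<psi> y - \<phi> y) + (norm (\<psi> (x - y) - 1) + norm (\<phi> (x - y) - 1))" by simp
    then show "norm (char_fun (Abs_char \<psi>) x - char_fun (Abs_char \<phi>) x) < \<epsilon>"
     using U(3)[OF y(2) \<phi>] U(3)[OF y(2) \<open>\<psi> \<in> T\<close>] elim(1)[rule_format, OF y(1)]
     unfolding Abs[OF \<phi>] Abs[OF \<open>\<psi> \<in> T\<close>] dist_norm by linarith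
   qed
  qed
 qed
 from compact_continuous_image[OF this \<open>compact T\<close>] have "compact (Abs_char ` T)" .
 moreover have "{\<gamma>. \<forall>i<n. \<forall>s. norm (char_fun \<gamma> (X i s) - 1) \<le> \<bar>s\<bar>} = Abs_char ` T"
 proof (intro equalityI subsetI)
  fix \<gamma> assume "\<gamma> \<in> {\<gamma>. \<forall>i<n. \<forall>s. norm (char_fun \<gamma> (X i s) - 1) \<le> \<bar>s\<bar>}"
  then have "char_fun \<gamma> \<in> T" by (simp add: T_def char_fun_add_arg)
  then show "\<gamma> \<in> Abs_char ` T" by (intro image_eqI[of _ _ "char_fun \<gamma>"]) (simp_all add: char_fun_inverse)
 qed (auto simp: Abs T(3))
 ultimately show ?thesis by simp
qed

section \<open>Coordinates and coordinate one-parameter subgroups\<close>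

locale elementary_coordinates =
 fixes p q r :: nat and F :: "nat monoid"
  and \<Phi> :: "'g::topological_ab_group_add \<Rightarrow> (nat \<Rightarrow> real) \<times> (nat \<Rightarrow> complex) \<times> (nat \<Rightarrow> int) \<times> nat" and \<Psi>
 assumes F: "comm_group F" "finite (carrier F)"
  and homeo: "homeomorphism (UNIV :: 'g set) (carrier (real_grp p \<times>\<times> torus_grp q \<times>\<times> int_grp r \<times>\<times> F)) \<Phi> \<Psi>"
  and \<Phi>_add: "\<Phi> (x + y) = \<Phi> x \<otimes>\<^bsub>real_grp p \<times>\<times> torus_grp q \<times>\<times> int_grp r \<times>\<times> F\<^esub> \<Phi> y"
begin

interpretation F: comm_group F by (rule F)

definition A :: "'g \<Rightarrow> nat \<Rightarrow> real" where "A x = fst (\<Phi> x)"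
definition B :: "'g \<Rightarrow> nat \<Rightarrow> complex" where "B x = fst (snd (\<Phi> x))"
definition C :: "'g \<Rightarrow> nat \<Rightarrow> int" where "C x = fst (snd (snd (\<Phi> x)))"
definition D :: "'g \<Rightarrow> nat" where "D x = snd (snd (snd (\<Phi> x)))"

abbreviation "S \<equiv> carrier (real_grp p \<times>\<times> torus_grp q \<times>\<times> int_grp r \<times>\<times> F)"

lemma S_iff: "(a, z, c, d) \<in> S \<longleftrightarrow> (\<forall>i\<ge>p. a i = 0) \<and> ((\<forall>i<q. norm (z i) = 1) \<and> (\<forall>i\<ge>q. z i = 1)) \<and> (\<forall>i\<ge>r. c i = 0) \<and> d \<in> carrier F"
 by (simp add: DirProd_def real_grp_def torus_grp_def int_grp_def)

lemma homeo_facts: "continuous_on UNIV \<Phi>" "continuous_on S \<Psi>" "\<Phi> x \<in> S" "\<Psi> (\<Phi> x) = x" "y \<in> S \<Longrightarrow> \<Phi> (\<Psi> y) = y"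
proof -
 show "continuous_on UNIV \<Phi>" by (rule homeomorphism_cont1[OF homeo])
 show "continuous_on S \<Psi>" by (rule homeomorphism_cont2[OF homeo])
 show "\<Phi> x \<in> S" unfolding homeomorphism_image1[OF homeo, symmetric] by (rule rangeI)
 show "\<Psi> (\<Phi> x) = x" by (rule homeomorphism_apply1[OF homeo UNIV_I])
 show "y \<in> S \<Longrightarrow> \<Phi> (\<Psi> y) = y" by (rule homeomorphism_apply2[OF homeo])
qed

lemma \<Phi>_eq: "\<Phi> x = (A x, B x, C x, D x)"
 by (simp add: A_def B_def C_def D_def)

lemma coord_add: "A (x + y) i = A x i + A y i" "B (x + y) i = B x i * B y i" "C (x + y) i = C x i + C y i"
 "D (x + y) = D x \<otimes>\<^bsub>F\<^esub> D y"
proof -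
 obtain a z c d where x: "\<Phi> x = (a, z, c, d)" by (cases "\<Phi> x")
 obtain a' z' c' d' where y: "\<Phi> y = (a', z', c', d')" by (cases "\<Phi> y")
 have "\<Phi> (x + y) = (\<lambda>i. a i + a' i, \<lambda>i. z i * z' i, \<lambda>i. c i + c' i, d \<otimes>\<^bsub>F\<^esub> d')"
  unfolding \<Phi>_add x y by (simp add: DirProd_def real_grp_def torus_grp_def int_grp_def)
 then show "A (x + y) i = A x i + A y i" "B (x + y) i = B x i * B y i" "C (x + y) i = C x i + C y i"
  "D (x + y) = D x \<otimes>\<^bsub>F\<^esub> D y"
  by (simp_all add: A_def B_def C_def D_def x y)
qed

lemma coord_mem: "i \<ge> p \<Longrightarrow> A x i = 0" "norm (B x i) = 1" "i \<ge> q \<Longrightarrow> B x i = 1" "i \<ge> r \<Longrightarrow> C x i = 0" "D x \<in> carrier F"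
proof -
 obtain a z c d where x: "\<Phi> x = (a, z, c, d)" by (cases "\<Phi> x")
 have *: "(a, z, c, d) \<in> S" using homeo_facts(3)[of x] unfolding x .
 then show "i \<ge> p \<Longrightarrow> A x i = 0" "i \<ge> q \<Longrightarrow> B x i = 1" "i \<ge> r \<Longrightarrow> C x i = 0" "D x \<in> carrier F"
  unfolding S_iff by (simp_all add: A_def B_def C_def D_def x)
 show "norm (B x i) = 1" using * unfolding S_iff by (cases "i < q") (simp_all add: B_def x)
qed

lemma coord_eqI:
 assumes "\<And>i. A x i = A y i" "\<And>i. B x i = B y i" "\<And>i. C x i = C y i" "D x = D y"
 shows "x = y"
proof -
 have "fst (\<Phi> x) = fst (\<Phi> y)" using assms(1) unfolding A_def by (rule ext)
 moreover have "fst (snd (\<Phi> x)) = fst (snd (\<Phi> y))" using assms(2) unfolding B_def by (rule ext)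
 moreover have "fst (snd (snd (\<Phi> x))) = fst (snd (snd (\<Phi> y)))" using assms(3) unfolding C_def by (rule ext)
 moreover have "snd (snd (snd (\<Phi> x))) = snd (snd (snd (\<Phi> y)))" using assms(4) unfolding D_def .
 ultimately have "\<Phi> x = \<Phi> y" by (simp add: prod_eq_iff)
 then have "\<Psi> (\<Phi> x) = \<Psi> (\<Phi> y)" by (rule arg_cong)
 then show ?thesis unfolding homeo_facts(4) .
qed

lemma coord_zero: "A 0 i = 0" "B 0 i = 1" "C 0 i = 0" "D 0 = \<one>\<^bsub>F\<^esub>"
proof -
 show "A 0 i = 0" "C 0 i = 0" using coord_add(1,3)[of 0 0 i] by simp_all
 have "B 0 i \<noteq> 0" using coord_mem(2)[of 0 i] by (metis norm_zero zero_neq_one)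
 then show "B 0 i = 1" using coord_add(2)[of 0 0 i] by simp
 have "D 0 \<otimes>\<^bsub>F\<^esub> D 0 = D (0 + 0)" by (rule coord_add(4)[symmetric])
 then have "D 0 \<otimes>\<^bsub>F\<^esub> D 0 = D 0" unfolding add_0_left .
 then show "D 0 = \<one>\<^bsub>F\<^esub>" by (rule F.l_cancel_one[THEN iffD1, OF coord_mem(5) coord_mem(5)])
qed

lemma coord_continuous: "continuous_on UNIV (\<lambda>x. A x i)" "continuous_on UNIV (\<lambda>x. B x i)"
 "continuous_on UNIV (\<lambda>x. C x i)" "continuous_on UNIV D"
proof -
 show "continuous_on UNIV (\<lambda>x. A x i)" unfolding A_def
  by (rule continuous_on_product_then_coordinatewise[OF continuous_on_fst[OF homeo_facts(1)]])
 show "continuous_on UNIV (\<lambda>x. B x i)" unfolding B_def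
  by (rule continuous_on_product_then_coordinatewise[OF continuous_on_fst[OF continuous_on_snd[OF homeo_facts(1)]]])
 show "continuous_on UNIV (\<lambda>x. C x i)" unfolding C_def
  by (rule continuous_on_product_then_coordinatewise[OF continuous_on_fst[OF continuous_on_snd[OF continuous_on_snd[OF homeo_facts(1)]]]])
 show "continuous_on UNIV D" unfolding D_def[abs_def]
  by (rule continuous_on_snd[OF continuous_on_snd[OF continuous_on_snd[OF homeo_facts(1)]]])
qed

lemma coord_sum:
 fixes f :: "nat \<Rightarrow> 'g"
 shows "A (\<Sum>i<m. f i) j = (\<Sum>i<m. A (f i) j)" "B (\<Sum>i<m. f i) j = (\<Prod>i<m. B (f i) j)"
 "C (\<Sum>i<m. f i) j = (\<Sum>i<m. C (f i) j)"
 by (induct m) (simp_all add: coord_zero coord_add)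

lemma coord_sum_D:
 fixes f :: "nat \<Rightarrow> 'g"
 assumes "\<And>i. i < m \<Longrightarrow> D (f i) = \<one>\<^bsub>F\<^esub>"
 shows "D (\<Sum>i<m. f i) = \<one>\<^bsub>F\<^esub>"
 using assms by (induction m) (simp_all add: coord_zero coord_add)

text \<open>The element with these coordinates and trivial finite component; it is meaningful for
  coordinates within the ranges required by \<open>pt_coord\<close>.\<close>

definition pt :: "(nat \<Rightarrow> real) \<Rightarrow> (nat \<Rightarrow> complex) \<Rightarrow> (nat \<Rightarrow> int) \<Rightarrow> 'g" where "pt a z c = \<Psi> (a, z, c, \<one>\<^bsub>F\<^esub>)"

lemma pt_coord:
 assumes "\<forall>i\<ge>p. a i = 0" "\<forall>i<q. norm (z i) = 1" "\<forall>i\<ge>q. z i = 1" "\<forall>i\<ge>r. c i = 0"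
 shows "A (pt a z c) = a" "B (pt a z c) = z" "C (pt a z c) = c" "D (pt a z c) = \<one>\<^bsub>F\<^esub>"
proof -
 have "(a, z, c, \<one>\<^bsub>F\<^esub>) \<in> S" using assms unfolding S_iff by simp
 then have "\<Phi> (pt a z c) = (a, z, c, \<one>\<^bsub>F\<^esub>)" unfolding pt_def by (rule homeo_facts(5))
 then show "A (pt a z c) = a" "B (pt a z c) = z" "C (pt a z c) = c" "D (pt a z c) = \<one>\<^bsub>F\<^esub>" by (simp_all add: A_def B_def C_def D_def)
qed

text \<open>Indices below p run along the coordinate lines; index p + j runs around circle j at unit
  speed.\<close>

definition X :: "nat \<Rightarrow> real \<Rightarrow> 'g" where
 "X i s = pt (\<lambda>j. if j = i \<and> i < p then s else 0) (\<lambda>j. if p + j = i then cis s else 1) (\<lambda>_. 0)"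

lemma X_coord:
 assumes "i < p + q"
 shows "A (X i s) j = (if j = i \<and> i < p then s else 0)" "B (X i s) j = (if p + j = i then cis s else 1)"
  "C (X i s) j = 0" "D (X i s) = \<one>\<^bsub>F\<^esub>"
 unfolding X_def using assms by (subst pt_coord; auto)+

lemma one_param_X:
 assumes i: "i < p + q"
 shows "one_param (X i)"
 unfolding one_param_def
proof (intro conjI allI)
 let ?f = "\<lambda>s. (\<lambda>j. if j = i \<and> i < p then s else 0, \<lambda>j. if p + j = i then cis s else 1, \<lambda>_. 0, \<one>\<^bsub>F\<^esub>)"
 note homeo_facts(2)
 moreover have "continuous_on UNIV ?f"
 proof (intro continuous_on_Pair continuous_on_const continuous_on_coordinatewise_then_product)
  show "continuous_on UNIV (\<lambda>s :: real. if j = i \<and> i < p then s else 0)" for j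
   by (cases "j = i \<and> i < p") auto
  show "continuous_on UNIV (\<lambda>s. if p + j = i then cis s else 1)" for j
   by (cases "p + j = i") (auto intro: continuous_intros)
 qed
 moreover have "?f s \<in> S" for s unfolding S_iff using i by auto
 then have "?f ` UNIV \<subseteq> S" by (simp only: image_subset_iff) blast
 ultimately show "continuous_on UNIV (X i)" unfolding X_def[abs_def] pt_def by (rule continuous_on_compose2)
 show "X i (s + t) = X i s + X i t" for s t
  by (rule coord_eqI) (simp_all add: coord_add X_coord[OF i] cis_mult)
qed

text \<open>Close to 0 the integer and finite coordinates are trivial by discreteness, and each
  circle coordinate is close to 1, where the argument is continuous. So the subgroups
  \<open>X i\<close> sweep out a neighbourhood of 0.\<close>

lemma near_zero:
 assumes \<epsilon>: "\<epsilon> > 0"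
 shows "\<forall>\<^sub>F x in nhds 0. \<exists>s. x = (\<Sum>i<p+q. X i (s i)) \<and> (\<forall>i<p+q. \<bar>s i\<bar> < \<epsilon>)"
proof -
 have "\<forall>\<^sub>F x in nhds 0. \<bar>A x i\<bar> < \<epsilon>" for i
 proof -
  have "((\<lambda>x. A x i) \<longlongrightarrow> 0) (nhds 0)"
   using coord_continuous(1)[of i, unfolded continuous_on_UNIV_nhds, rule_format, of 0] by (simp only: coord_zero)
  from tendstoD[OF this \<epsilon>] show ?thesis by (simp add: dist_norm)
 qed
 then have 1: "\<forall>\<^sub>F x in nhds 0. \<forall>i\<in>{..<p}. \<bar>A x i\<bar> < \<epsilon>" by (intro eventually_ball_finite) auto
 have "\<forall>\<^sub>F x in nhds 0. \<bar>Arg (B x i)\<bar> < \<epsilon>" for i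
 proof -
  have "((\<lambda>x. B x i) \<longlongrightarrow> 1) (nhds 0)"
   using coord_continuous(2)[of i, unfolded continuous_on_UNIV_nhds, rule_format, of 0] by (simp only: coord_zero)
  then have "((\<lambda>x. Arg (B x i)) \<longlongrightarrow> Arg 1) (nhds 0)"
   by (rule isCont_tendsto_compose[OF continuous_at_Arg, rotated]) simp
  from tendstoD[OF this \<epsilon>] show ?thesis by (simp add: dist_norm)
 qed
 then have 2: "\<forall>\<^sub>F x in nhds 0. \<forall>i\<in>{..<q}. \<bar>Arg (B x i)\<bar> < \<epsilon>" by (intro eventually_ball_finite) auto
 have "\<forall>\<^sub>F x in nhds 0. C x i = 0" for i
 proof -
  have "((\<lambda>x. C x i) \<longlongrightarrow> 0) (nhds 0)"
   using coord_continuous(3)[of i, unfolded continuous_on_UNIV_nhds, rule_format, of 0] by (simp only: coord_zero)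
  from topological_tendstoD[OF this, of "{0}"] show ?thesis by (simp add: open_discrete)
 qed
 then have 3: "\<forall>\<^sub>F x in nhds 0. \<forall>i\<in>{..<r}. C x i = 0" by (intro eventually_ball_finite) auto
 have 4: "\<forall>\<^sub>F x in nhds 0. D x = \<one>\<^bsub>F\<^esub>"
 proof -
  have "(D \<longlongrightarrow> \<one>\<^bsub>F\<^esub>) (nhds 0)"
   using coord_continuous(4)[unfolded continuous_on_UNIV_nhds, rule_format, of 0] by (simp only: coord_zero)
  from topological_tendstoD[OF this, of "{\<one>\<^bsub>F\<^esub>}"] show ?thesis by (simp add: open_discrete)
 qed
 from 1 2 3 4 show ?thesis
 proof eventually_elim
  case (elim x)
  let ?s = "\<lambda>i. if i < p then A x i else Arg (B x (i - p))"
  have "x = (\<Sum>i<p+q. X i (?s i))"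
  proof (rule coord_eqI)
   show "A x j = A (\<Sum>i<p+q. X i (?s i)) j" for j
   proof -
    have "A (\<Sum>i<p+q. X i (?s i)) j = (\<Sum>i<p+q. if i = j then (if j < p then A x j else 0) else 0)"
     unfolding coord_sum by (intro sum.cong refl) (auto simp: X_coord)
    then show ?thesis using coord_mem(1)[of j x] by auto
   qed
   show "B x j = B (\<Sum>i<p+q. X i (?s i)) j" for j
   proof -
    have "B (\<Sum>i<p+q. X i (?s i)) j = (\<Prod>i<p+q. if i = p + j then cis (Arg (B x j)) else 1)"
     unfolding coord_sum by (intro prod.cong refl) (auto simp: X_coord)
    also have "\<dots> = (if j < q then cis (Arg (B x j)) else 1)" by simp
    also have "cis (Arg (B x j)) = B x j"
    proof -
     have "B x j \<noteq> 0" using coord_mem(2)[of x j] by (metis norm_zero zero_neq_one)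
     from cis_Arg[OF this] show ?thesis by (simp add: sgn_eq coord_mem(2))
    qed
    finally show ?thesis using coord_mem(3)[of j x] by auto
   qed
   show "C x j = C (\<Sum>i<p+q. X i (?s i)) j" for j
    using elim(3) coord_mem(4)[of j x] by (cases "j < r") (simp_all add: coord_sum X_coord)
   show "D x = D (\<Sum>i<p+q. X i (?s i))"
    unfolding elim(4) by (rule coord_sum_D[symmetric]) (rule X_coord(4))
  qed
  moreover have "\<forall>i<p+q. \<bar>?s i\<bar> < \<epsilon>" using elim(1,2) by auto
  ultimately show ?case by (intro exI[of _ ?s]) blast
 qed
qed

section \<open>Proper real homomorphisms on the group and on its dual\<close>

text \<open>The unbounded coordinates are the p real and r integer ones, with the integer points as
  lattice; torus and finite part are compact and belong to the cube.\<close>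

lemma schwartz_group_elementary:
 assumes haar: "haar_measure (\<mu> :: 'g measure)" and cb: "countably_based TYPE('g)"
 shows "\<exists>Ps. schwartz_group \<mu> Ps"
proof -
 define P where "P i x = (if i < p then A x i else of_int (C x (i - p)))" for i x
 define b where "b i k = pt (\<lambda>j. if j = i \<and> i < p then of_int k else 0) (\<lambda>_. 1) (\<lambda>j. if p + j = i then k else 0)" for i k
 have bc: "A (b i k) j = (if j = i \<and> i < p then of_int k else 0)" "B (b i k) j = 1"
  "C (b i k) j = (if p + j = i then k else 0)" "D (b i k) = \<one>\<^bsub>F\<^esub>" if "i < p + r" for i j k
  unfolding b_def using that by (subst pt_coord; auto)+
 have "continuous_on UNIV real_of_int" by (simp add: continuous_on_def at_discrete)
 then have Cc: "continuous_on UNIV (\<lambda>x. real_of_int (C x i))" for i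
  by (rule continuous_on_compose2[OF _ coord_continuous(3)]) simp
 have "schwartz_group \<mu> (map P [0..<p+r])"
 proof (rule schwartz_group_lattice[OF haar cb])
  show "real_hom (P i)" for i
   unfolding real_hom_def P_def using coord_continuous(1)[of i] Cc[of "i - p"]
   by (cases "i < p") (simp_all add: coord_add)
  show "b i (k + l) = b i k + b i l" if "i < p + r" for i k l
   by (rule coord_eqI) (simp_all add: coord_add bc[OF that])
  show "P i (b j k) = (if i = j then of_int k else 0)" if "i < p + r" "j < p + r" for i j k
   unfolding P_def using that by (auto simp: bc)
  \<comment> \<open>Coordinates beyond p, q and r are pinned to their neutral values, so that this
    product of compact sets lies in the image of \<Phi>.\<close>
  let ?Z = "{a. \<forall>i. a i \<in> (if i < p then {-1..1 :: real} else {0})} \<times> {z. \<forall>i. z i \<in> (if i < q then sphere 0 1 else {1 :: complex})} \<times>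
   {c. \<forall>i. c i \<in> (if i < r then {-1..1 :: int} else {0})} \<times> carrier F"
  have Z: "compact ?Z"
  proof (intro compact_Times compact_product_set)
   show "compact (if i < p then {-1..1 :: real} else {0})" for i by simp
   show "compact (if i < q then sphere 0 1 else {1 :: complex})" for i by simp
   show "compact (if i < r then {-1..1 :: int} else {0})" for i by (simp add: finite_imp_compact)
   show "compact (carrier F)" by (rule finite_imp_compact[OF F(2)])
  qed
  have ZS: "?Z \<subseteq> S"
  proof
   fix y assume y: "y \<in> ?Z"
   obtain a z c d where e: "y = (a, z, c, d)" by (cases y)
   have h: "a i \<in> (if i < p then {-1..1} else {0})" "z i \<in> (if i < q then sphere 0 1 else {1})"
    "c i \<in> (if i < r then {-1..1} else {0})" "d \<in> carrier F" for i
    using y unfolding e mem_Sigma_iff mem_Collect_eq by blast+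
   have "a i = 0" if "i \<ge> p" for i using h(1)[of i] that by simp
   moreover have "norm (z i) = 1" if "i < q" for i using h(2)[of i] that by simp
   moreover have "z i = 1" if "i \<ge> q" for i using h(2)[of i] that by simp
   moreover have "c i = 0" if "i \<ge> r" for i using h(3)[of i] that by simp
   ultimately show "y \<in> S" unfolding e S_iff using h(4) by blast
  qed
  have eq: "{x. \<forall>i<p+r. \<bar>P i x\<bar> \<le> 1} = \<Psi> ` ?Z"
  proof (intro equalityI subsetI)
   fix x assume x: "x \<in> {x. \<forall>i<p+r. \<bar>P i x\<bar> \<le> 1}"
   have a: "\<bar>A x i\<bar> \<le> 1" if "i < p" for i
    using x that by (auto simp: P_def dest!: spec[of _ i])
   have c: "\<bar>C x i\<bar> \<le> 1" if "i < r" for i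
   proof -
    have "\<bar>P (p + i) x\<bar> \<le> 1" using x that by simp
    then have "\<bar>real_of_int (C x i)\<bar> \<le> 1" by (simp add: P_def)
    then show ?thesis by (simp only: of_int_abs[symmetric] of_int_le_1_iff)
   qed
   have m: "A x i \<in> (if i < p then {-1..1} else {0})" "B x i \<in> (if i < q then sphere 0 1 else {1})"
    "C x i \<in> (if i < r then {-1..1} else {0})" for i
   proof -
    have "- 1 \<le> A x i \<and> A x i \<le> 1" if "i < p" using a[OF that] by linarith
    then show "A x i \<in> (if i < p then {-1..1} else {0})" using coord_mem(1)[of i x] by simp
    show "B x i \<in> (if i < q then sphere 0 1 else {1})" using coord_mem(2)[of x i] coord_mem(3)[of i x] by simp
    have "- 1 \<le> C x i \<and> C x i \<le> 1" if "i < r" using c[OF that] by linarith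
    then show "C x i \<in> (if i < r then {-1..1} else {0})" using coord_mem(4)[of i x] by simp
   qed
   have "(A x, B x, C x, D x) \<in> ?Z" unfolding mem_Sigma_iff mem_Collect_eq
    by (intro conjI allI m coord_mem(5))
   then have "\<Phi> x \<in> ?Z" by (subst \<Phi>_eq)
   then have "\<Psi> (\<Phi> x) \<in> \<Psi> ` ?Z" by (rule imageI)
   then show "x \<in> \<Psi> ` ?Z" unfolding homeo_facts(4) .
  next
   fix x assume "x \<in> \<Psi> ` ?Z"
   then obtain z where z: "z \<in> ?Z" "x = \<Psi> z" by blast
   then have "\<Phi> x = z" using homeo_facts(5)[OF subsetD[OF ZS z(1)]] by (simp only:)
   then have "z = (A x, B x, C x, D x)" using \<Phi>_eq[of x] by (rule trans[OF sym])
   with z(1) have "(A x, B x, C x, D x) \<in> ?Z" by (rule back_subst)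
   then have a: "A x i \<in> (if i < p then {-1..1} else {0})" and c: "C x i \<in> (if i < r then {-1..1} else {0})" for i
    unfolding mem_Sigma_iff mem_Collect_eq by (simp_all only:)
   have "\<bar>P i x\<bar> \<le> 1" if "i < p + r" for i
   proof (cases "i < p")
    case True
    then have "- 1 \<le> A x i \<and> A x i \<le> 1" using a[of i] by simp
    then have "\<bar>A x i\<bar> \<le> 1" by linarith
    then show ?thesis using True by (simp add: P_def)
   next
    case False
    then have "i - p < r" using that by linarith
    then have "- 1 \<le> C x (i - p) \<and> C x (i - p) \<le> 1" using c[of "i - p"] by simp
    then have "\<bar>C x (i - p)\<bar> \<le> 1" by linarith
    then have "\<bar>real_of_int (C x (i - p))\<bar> \<le> 1" by (simp only: of_int_abs[symmetric] of_int_le_1_iff)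
    then show ?thesis using False by (simp add: P_def)
   qed
   then show "x \<in> {x. \<forall>i<p+r. \<bar>P i x\<bar> \<le> 1}" by blast
  qed
  show "compact {x. \<forall>i<p+r. \<bar>P i x\<bar> \<le> 1}"
   unfolding eq by (rule compact_continuous_image[OF continuous_on_subset[OF homeo_facts(2) ZS] Z])
 qed
 then show ?thesis by blast
qed

text \<open>The unbounded directions of the dual are the frequencies along the p lines and q
  circles, so tori and not integer factors contribute here. Characters in the cube are 1-Lipschitz
  along each \<open>X i\<close>, hence lie in a compact set.\<close>

lemma schwartz_group_dual:
 assumes haar: "haar_measure (\<nu> :: 'g pontryagin_dual measure)" and cb: "countably_based TYPE('g pontryagin_dual)"
 shows "\<exists>Qs. schwartz_group \<nu> Qs"
proof -
 have "\<exists>P. real_hom P \<and> (\<forall>\<gamma> s. char_fun \<gamma> (X i s) = cis (s * P \<gamma>))" if "i < p + q" for i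
  by (rule one_param_frequency[OF one_param_X[OF that]])
 then obtain P where P: "\<And>i. i < p + q \<Longrightarrow> real_hom (P i)" "\<And>i \<gamma> s. i < p + q \<Longrightarrow> char_fun \<gamma> (X i s) = cis (s * P i \<gamma>)"
  by metis
 \<comment> \<open>The lattice: characters of integer frequency on the lines and integer powers on
   the circles, which have the prescribed frequencies along the \<open>X i\<close>.\<close>
 define E where "E j k x = (if j < p then cis (of_int k * A x j) else B x (j - p) powi k)" for j k x
 have B0: "B x i \<noteq> 0" for x i using coord_mem(2)[of x i] by (metis norm_zero zero_neq_one)
 have "\<exists>\<gamma>. char_fun \<gamma> = E j k" for j k
 proof (rule ex_char_fun)
  show "continuous_on UNIV (E j k)"
   unfolding E_def by (cases "j < p") (auto intro!: continuous_intros coord_continuous B0)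
  show "norm (E j k x) = 1" for x by (simp add: E_def norm_power_int coord_mem(2))
  show "E j k (x + y) = E j k x * E j k y" for x y
   by (simp add: E_def coord_add power_int_mult_distrib cis_mult distrib_left)
 qed
 then obtain b where b: "\<And>j k. char_fun (b j k) = E j k" by metis
 have "schwartz_group \<nu> (map P [0..<p+q])"
 proof (rule schwartz_group_lattice[OF haar cb P(1)])
  show "b i (k + l) = b i k + b i l" for i k l
   by (simp add: char_fun_inject[symmetric] fun_eq_iff char_fun_add b E_def power_int_add B0 cis_mult distrib_right)
  show "P i (b j k) = (if i = j then of_int k else 0)" if i: "i < p + q" and j: "j < p + q" for i j k
  proof (rule cis_scaled_inject)
   fix s
   have "cis (s * P i (b j k)) = E j k (X i s)" using P(2)[OF i, of "b j k" s] by (simp add: b)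
   also have "\<dots> = cis (s * (if i = j then of_int k else 0))"
    using j by (auto simp: E_def X_coord[OF i] cis_power_int mult.commute)
   finally show "cis (s * P i (b j k)) = cis (s * (if i = j then of_int k else 0))" .
  qed
  have sub: "{\<gamma>. \<forall>i<p+q. \<bar>P i \<gamma>\<bar> \<le> 1} \<subseteq> {\<gamma>. \<forall>i<p+q. \<forall>s. norm (char_fun \<gamma> (X i s) - 1) \<le> \<bar>s\<bar>}"
  proof (intro subsetI CollectI allI impI)
   fix \<gamma> i s assume \<gamma>: "\<gamma> \<in> {\<gamma>. \<forall>i<p+q. \<bar>P i \<gamma>\<bar> \<le> 1}" and i: "i < p + q"
   \<comment> \<open>The chord of angle \<theta> = s P i \<gamma> has length 2 |sin (\<theta>/2)|,
     at most |\<theta>|.\<close>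
   have "norm (char_fun \<gamma> (X i s) - 1) = 2 * \<bar>sin (s * P i \<gamma> / 2)\<bar>"
    unfolding P(2)[OF i] cis_conv_exp by (rule dist_exp_i_1)
   also have "\<dots> \<le> 2 * \<bar>s * P i \<gamma> / 2\<bar>" using abs_sin_x_le_abs_x[of "s * P i \<gamma> / 2"] by simp
   also have "\<dots> = \<bar>s\<bar> * \<bar>P i \<gamma>\<bar>" by (simp add: abs_mult)
   also have "\<dots> \<le> \<bar>s\<bar> * 1" using \<gamma> i by (intro mult_left_mono) auto
   finally show "norm (char_fun \<gamma> (X i s) - 1) \<le> \<bar>s\<bar>" by simp
  qed
  from compact_Int_closed[OF compact_equicontinuous_characters[where n = "p + q" and X = X, OF near_zero] closed_cube[where n = "p + q" and P = P and c = 1, OF P(1)]]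
  show "compact {\<gamma>. \<forall>i<p+q. \<bar>P i \<gamma>\<bar> \<le> 1}" unfolding Int_absorb1[OF sub] .
 qed
 then show ?thesis by blast
qed

end

theorem theorem2p3:
 fixes \<mu> :: "'g :: {topological_ab_group_add, t2_space, second_countable_topology} measure"
  and \<nu> :: "'g pontryagin_dual measure"
 assumes "locally compact (UNIV :: 'g set)"
  and "elementary TYPE('g)"
  and "haar_measure \<mu>" and "haar_measure \<nu>" and "plancherel \<mu> \<nu>"
 shows "\<exists>act.
   (\<forall>k\<in>schwartz_space. \<forall>\<xi>\<in>schwartz_space.
    act (pi_int \<mu> \<nu> k) \<xi> = (\<lambda>\<delta>. \<integral>g. k g * pi_fun g \<xi> \<delta> \<partial>(\<nu> \<Otimes>\<^sub>M \<mu>))) \<and>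
   equivalence_bimodule (A_circ \<mu> \<nu>) complex_star_algebra schwartz_module
    act (\<lambda>\<xi> z \<delta>. z * \<xi> \<delta>)
    (\<lambda>\<xi> \<eta>. pi_int \<mu> \<nu> (coeff_fun \<nu> \<eta> \<xi>))
    (\<lambda>\<xi> \<eta>. ip (L2 \<nu>) (L2_class \<nu> \<eta>) (L2_class \<nu> \<xi>))"
proof -
 obtain p q r and F :: "nat monoid" and \<Phi> :: "'g \<Rightarrow> (nat \<Rightarrow> real) \<times> (nat \<Rightarrow> complex) \<times> (nat \<Rightarrow> int) \<times> nat" and \<Psi>
  where *: "comm_group F" "finite (carrier F)"
   "homeomorphism (UNIV :: 'g set) (carrier (real_grp p \<times>\<times> torus_grp q \<times>\<times> int_grp r \<times>\<times> F)) \<Phi> \<Psi>"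
   "\<And>x y. \<Phi> (x + y) = \<Phi> x \<otimes>\<^bsub>real_grp p \<times>\<times> torus_grp q \<times>\<times> int_grp r \<times>\<times> F\<^esub> \<Phi> y"
  using assms(2) unfolding elementary_def Let_def by blast
 interpret elementary_coordinates p q r F \<Phi> \<Psi> using * by (rule elementary_coordinates.intro)
 obtain Ps Qs where "schwartz_group \<mu> Ps" "schwartz_group \<nu> Qs"
  using schwartz_group_elementary[OF assms(3) countably_based_class] schwartz_group_dual[OF assms(4) countably_based_dual[OF assms(1)]]
  by blast
 then have "phase_space \<mu> Ps \<nu> Qs" using assms by (intro phase_space.intro phase_space_axioms.intro)
 then show ?thesis by (rule phase_space.equivalence_bimodule_schwartz)
qed

end
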